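(* Let $\Omega\subset\mathbb{R}^n$ be a bounded open set with Lipschitz boundary, let $\mu\in\mathcal M_{\mathcal H}(\Omega)$ be an admissible measure and let $\lambda:\Omega\to[0,1]$ be a Borel function. Assume that there exist $u\in BV(\Omega)$ and $T\in\mathcal{DM}^\infty(\Omega)$ such that $\|T\|_{L^\infty(\Omega;\mathbb{R}^n)}\le1$, $\operatorname{div}T=\mu$ on $\Omega$, and $(T,Du)_\lambda=\sqrt{1+|Du|^2}-\sqrt{1-|T|^2}\,\mathcal L^n$ on $\Omega$. Then $T$ is unique and satisfies $$T=\frac{\nabla u}{\sqrt{1+|\nabla u|^2}}\qquad\mathcal L^n\text{-a.e. in }\Omega,$$ where $\nabla u$ is the density of the absolutely continuous part of $Du$.
   Context: $\mathcal M(\Omega)$: finite signed Radon measures on $\Omega$. $\mathcal M_{\mathcal H}(\Omega)$: those $\mu\in\mathcal M(\Omega)$ with $|\mu|(A)=0$ for every Borel $A\subset\Omega$ with $\mathcal H^{n-1}(A)=0$. For $u\in BV(\Omega)$: $S_u$ is the set of points with no approximate limit; $\tilde u(x)$ is the approximate limit at $x\notin S_u$; $J_u$ is the approximate jump set, with one-sided traces $u^+(x)>u^-(x)$ for $x\in J_u$; $u^+=u^-=\tilde u$ on $\Omega\setminus S_u$; $u^*=(u^++u^-)/2$; $u^\lambda=\lambda u^++(1-\lambda)u^-$, defined $\mathcal H^{n-1}$-a.e. $Du=\nabla u\,\mathcal L^n+D^su$ is the Lebesgue decomposition and $\sqrt{1+|Du|^2}=\sqrt{1+|\nabla u|^2}\,\mathcal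 L^n+|D^su|$ as a measure. $\mu\in\mathcal M_{\mathcal H}(\Omega)$ is admissible if $|\mu|\in BV(\Omega)^*$, i.e. there is a continuous linear functional on $BV(\Omega)$ equal to $u\mapsto\int_\Omega u^*\,d|\mu|$ on $BV(\Omega)\cap L^\infty(\Omega)$ (then $u^\lambda\in L^1(\Omega;|\mu|)$ for all $u\in BV(\Omega)$ and Borel $\lambda:\Omega\to[0,1]$). $\mathcal{DM}^\infty(\Omega)$: fields $F\in L^\infty(\Omega;\mathbb{R}^n)$ with $\operatorname{div}F\in\mathcal M(\Omega)$. For $F\in\mathcal{DM}^\infty(\Omega)$, $u\in BV(\Omega)$ with $u^\lambda\in L^1(\Omega;|\operatorname{div}F|)$, the $\lambda$-pairing is the distribution (in fact a finite measure) $(F,Du)_\lambda:=\operatorname{div}(uF)-u^\lambda\operatorname{div}F$. *)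

theory Defs
  imports "HOL-Analysis.Analysis" "HOL-Probability.Essential_Supremum"
begin

section \<open>Hausdorff measure and Lipschitz domains\<close>

text \<open>Normalised so that the m-dimensional measure on m-dimensional space is Lebesgue
  measure. The empty set needs its own case, as for \<open>m = 0\<close> every
  nonempty set contributes \<open>1\<close>; boundedness is required because the library diameter is
  meaningless on unbounded sets.\<close>

definition hausdorff_content :: "nat \<Rightarrow> real \<Rightarrow> 'a::metric_space set \<Rightarrow> ennreal" where
  "hausdorff_content m \<delta> A =
     (INF C \<in> {C :: nat \<Rightarrow> 'a set. A \<subseteq> (\<Union>i. C i) \<and> (\<forall>i. bounded (C i) \<and> diameter (C i) < \<delta>)}.
        (\<Sum>i. if C i = {} then 0
             else ennreal (unit_ball_vol (real m) * (diameter (C i) / 2) ^ m)))"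

definition hausdorff_outer :: "nat \<Rightarrow> 'a::metric_space set \<Rightarrow> ennreal" where
  "hausdorff_outer m A = (SUP \<delta> \<in> {0<..}. hausdorff_content m \<delta> A)"

text \<open>Near each boundary point, \<open>\<Omega>\<close> is the strict epigraph of a Lipschitz function on the
  hyperplane orthogonal to a unit vector \<open>e\<close>.\<close>

definition lipschitz_boundary :: "'a::euclidean_space set \<Rightarrow> bool" where
  "lipschitz_boundary \<Omega> \<longleftrightarrow>
     (\<forall>x \<in> frontier \<Omega>. \<exists>r > 0. \<exists>e L g. norm e = 1 \<and>
        L-lipschitz_on {y. y \<bullet> e = 0} (g :: 'a \<Rightarrow> real) \<and>
        \<Omega> \<inter> ball x r = {y \<in> ball x r. g (y - (y \<bullet> e) *\<^sub>R e) < y \<bullet> e})"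


section \<open>Finite signed and vector measures\<close>

abbreviation borel_of :: "'a::topological_space set \<Rightarrow> 'a set set" where
  "borel_of \<Omega> \<equiv> sets (restrict_space borel \<Omega>)"

text \<open>A finite signed (for real values) or vector Radon measure on an open set \<open>\<Omega>\<close> is a countably
  additive function on the Borel subsets of \<open>\<Omega>\<close>; its values on other sets carry no meaning.\<close>

definition finite_vmeasure ::
    "'a::topological_space set \<Rightarrow> ('a set \<Rightarrow> 'b::real_normed_vector) \<Rightarrow> bool" where
  "finite_vmeasure \<Omega> \<nu> \<longleftrightarrow>
     (\<forall>A :: nat \<Rightarrow> 'a set. range A \<subseteq> borel_of \<Omega> \<and> disjoint_family A \<longrightarrow>
        (\<lambda>i. \<nu> (A i)) sums \<nu> (\<Union>i. A i))"

definition total_variation ::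
    "'a::topological_space set \<Rightarrow> ('a set \<Rightarrow> 'b::real_normed_vector) \<Rightarrow> 'a measure" where
  "total_variation \<Omega> \<nu> = measure_of \<Omega> (borel_of \<Omega>)
     (\<lambda>A. SUP D \<in> {D :: nat \<Rightarrow> 'a set. range D \<subseteq> borel_of \<Omega> \<and> disjoint_family D \<and> (\<Union>i. D i) = A}.
        (\<Sum>i. ennreal (norm (\<nu> (D i)))))"

definition pos_variation :: "'a::topological_space set \<Rightarrow> ('a set \<Rightarrow> real) \<Rightarrow> 'a measure" where
  "pos_variation \<Omega> \<nu> = measure_of \<Omega> (borel_of \<Omega>)
     (\<lambda>A. ennreal ((measure (total_variation \<Omega> \<nu>) A + \<nu> A) / 2))"

definition neg_variation :: "'a::topological_space set \<Rightarrow> ('a set \<Rightarrow> real) \<Rightarrow> 'a measure" where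
  "neg_variation \<Omega> \<nu> = measure_of \<Omega> (borel_of \<Omega>)
     (\<lambda>A. ennreal ((measure (total_variation \<Omega> \<nu>) A - \<nu> A) / 2))"

definition signed_integral ::
    "'a::topological_space set \<Rightarrow> ('a set \<Rightarrow> real) \<Rightarrow> ('a \<Rightarrow> real) \<Rightarrow> real" where
  "signed_integral \<Omega> \<nu> f =
     (LINT x|pos_variation \<Omega> \<nu>. f x) - (LINT x|neg_variation \<Omega> \<nu>. f x)"

text \<open>The class \<open>M_H\<close>: measures vanishing on Borel sets that are null for the Hausdorff measure of
  codimension one.\<close>

definition MH :: "'a::euclidean_space set \<Rightarrow> ('a set \<Rightarrow> real) set" where
  "MH \<Omega> = {\<mu>. finite_vmeasure \<Omega> \<mu> \<and>
     (\<forall>A \<in> borel_of \<Omega>. hausdorff_outer (DIM('a) - 1) A = 0 \<longrightarrow>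
        emeasure (total_variation \<Omega> \<mu>) A = 0)}"


section \<open>Test functions and distributional divergence\<close>

primrec cont_diff :: "nat \<Rightarrow> ('a::euclidean_space \<Rightarrow> real) \<Rightarrow> bool" where
  "cont_diff 0 f \<longleftrightarrow> continuous_on UNIV f"
| "cont_diff (Suc k) f \<longleftrightarrow> (\<forall>x. f differentiable at x) \<and>
     (\<forall>i\<in>Basis. cont_diff k (\<lambda>x. frechet_derivative f (at x) i))"

definition test_functions :: "'a::euclidean_space set \<Rightarrow> ('a \<Rightarrow> real) set" where
  "test_functions \<Omega> = {\<phi>. (\<forall>k. cont_diff k \<phi>) \<and>
     (\<exists>K. compact K \<and> K \<subseteq> \<Omega> \<and> (\<forall>x. x \<notin> K \<longrightarrow> \<phi> x = 0))}"

definition grad :: "('a::euclidean_space \<Rightarrow> real) \<Rightarrow> 'a \<Rightarrow> 'a" where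
  "grad \<phi> x = (\<Sum>i\<in>Basis. frechet_derivative \<phi> (at x) i *\<^sub>R i)"

definition distr_div ::
    "'a::euclidean_space set \<Rightarrow> ('a \<Rightarrow> 'a) \<Rightarrow> ('a \<Rightarrow> real) \<Rightarrow> real" where
  "distr_div \<Omega> F \<phi> = - (LINT x|lebesgue_on \<Omega>. F x \<bullet> grad \<phi> x)"

definition Linf_norm :: "'a::euclidean_space set \<Rightarrow> ('a \<Rightarrow> 'b::euclidean_space) \<Rightarrow> ereal" where
  "Linf_norm \<Omega> F = esssup (lebesgue_on \<Omega>) (\<lambda>x. ereal (norm (F x)))"

definition Linf :: "'a::euclidean_space set \<Rightarrow> ('a \<Rightarrow> 'b::euclidean_space) set" where
  "Linf \<Omega> = {F. F \<in> borel_measurable (lebesgue_on \<Omega>) \<and> Linf_norm \<Omega> F < \<infinity>}"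

definition is_div_measure ::
    "'a::euclidean_space set \<Rightarrow> ('a \<Rightarrow> 'a) \<Rightarrow> ('a set \<Rightarrow> real) \<Rightarrow> bool" where
  "is_div_measure \<Omega> F \<nu> \<longleftrightarrow> finite_vmeasure \<Omega> \<nu> \<and>
     (\<forall>\<phi> \<in> test_functions \<Omega>. distr_div \<Omega> F \<phi> = signed_integral \<Omega> \<nu> \<phi>)"

definition DM_inf :: "'a::euclidean_space set \<Rightarrow> ('a \<Rightarrow> 'a) set" where
  "DM_inf \<Omega> = {F \<in> Linf \<Omega>. \<exists>\<nu>. is_div_measure \<Omega> F \<nu>}"

text \<open>Measures chosen by \<open>SOME\<close> here and below are determined on the Borel subsets of \<open>\<Omega>\<close>,
  densities up to Lebesgue null sets.\<close>

definition div_measure :: "'a::euclidean_space set \<Rightarrow> ('a \<Rightarrow> 'a) \<Rightarrow> 'a set \<Rightarrow> real" where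
  "div_measure \<Omega> F = (SOME \<nu>. is_div_measure \<Omega> F \<nu>)"


section \<open>Functions of bounded variation\<close>

definition is_deriv_measure ::
    "'a::euclidean_space set \<Rightarrow> ('a \<Rightarrow> real) \<Rightarrow> ('a set \<Rightarrow> 'a) \<Rightarrow> bool" where
  "is_deriv_measure \<Omega> u \<nu> \<longleftrightarrow> finite_vmeasure \<Omega> \<nu> \<and>
     (\<forall>\<phi> \<in> test_functions \<Omega>. \<forall>i\<in>Basis.
        (LINT x|lebesgue_on \<Omega>. u x * frechet_derivative \<phi> (at x) i)
          = - signed_integral \<Omega> (\<lambda>A. \<nu> A \<bullet> i) \<phi>)"

definition BV :: "'a::euclidean_space set \<Rightarrow> ('a \<Rightarrow> real) set" where
  "BV \<Omega> = {u. integrable (lebesgue_on \<Omega>) u \<and> (\<exists>\<nu>. is_deriv_measure \<Omega> u \<nu>)}"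

definition deriv_measure :: "'a::euclidean_space set \<Rightarrow> ('a \<Rightarrow> real) \<Rightarrow> 'a set \<Rightarrow> 'a" where
  "deriv_measure \<Omega> u = (SOME \<nu>. is_deriv_measure \<Omega> u \<nu>)"

definition BV_norm :: "'a::euclidean_space set \<Rightarrow> ('a \<Rightarrow> real) \<Rightarrow> real" where
  "BV_norm \<Omega> u = (LINT x|lebesgue_on \<Omega>. \<bar>u x\<bar>)
     + measure (total_variation \<Omega> (deriv_measure \<Omega> u)) \<Omega>"

text \<open>Lebesgue decomposition: \<open>g\<close> is the density of the absolutely continuous part of \<open>\<nu>\<close> iff
  \<open>\<nu>\<close> minus the measure with density \<open>g\<close> is concentrated on a Lebesgue null set \<open>N\<close>.\<close>

definition is_ac_density ::
    "'a::euclidean_space set \<Rightarrow> ('a set \<Rightarrow> 'a) \<Rightarrow> ('a \<Rightarrow> 'a) \<Rightarrow> bool" where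
  "is_ac_density \<Omega> \<nu> g \<longleftrightarrow> integrable (lebesgue_on \<Omega>) g \<and>
     (\<exists>N \<in> borel_of \<Omega>. emeasure lborel N = 0 \<and>
        (\<forall>A \<in> borel_of \<Omega>. A \<inter> N = {} \<longrightarrow> \<nu> A = (LINT x|lebesgue_on A. g x)))"

definition ac_grad :: "'a::euclidean_space set \<Rightarrow> ('a \<Rightarrow> real) \<Rightarrow> 'a \<Rightarrow> 'a" where
  "ac_grad \<Omega> u = (SOME g. is_ac_density \<Omega> (deriv_measure \<Omega> u) g)"

definition sing_deriv :: "'a::euclidean_space set \<Rightarrow> ('a \<Rightarrow> real) \<Rightarrow> 'a set \<Rightarrow> 'a" where
  "sing_deriv \<Omega> u A = deriv_measure \<Omega> u A - (LINT x|lebesgue_on A. ac_grad \<Omega> u x)"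

text \<open>The area measure \<open>\<surd>(1 + |Du|\<^sup>2)\<close>.\<close>

definition area_measure :: "'a::euclidean_space set \<Rightarrow> ('a \<Rightarrow> real) \<Rightarrow> 'a set \<Rightarrow> real" where
  "area_measure \<Omega> u A = (LINT x|lebesgue_on A. sqrt (1 + (norm (ac_grad \<Omega> u x))\<^sup>2))
     + measure (total_variation \<Omega> (sing_deriv \<Omega> u)) A"


section \<open>Approximate limits, jump points and precise representatives\<close>

definition mean_dev :: "('a::euclidean_space \<Rightarrow> real) \<Rightarrow> 'a set \<Rightarrow> real \<Rightarrow> real" where
  "mean_dev u E z = (LINT y|lebesgue_on E. \<bar>u y - z\<bar>) / measure lebesgue E"

definition half_ball :: "'a::euclidean_space \<Rightarrow> real \<Rightarrow> 'a \<Rightarrow> 'a set" where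
  "half_ball x r e = {y \<in> ball x r. 0 < (y - x) \<bullet> e}"

definition approx_lim :: "('a::euclidean_space \<Rightarrow> real) \<Rightarrow> 'a \<Rightarrow> real \<Rightarrow> bool" where
  "approx_lim u x z \<longleftrightarrow> ((\<lambda>r. mean_dev u (ball x r) z) \<longlongrightarrow> 0) (at_right 0)"

definition approx_jump ::
    "('a::euclidean_space \<Rightarrow> real) \<Rightarrow> 'a \<Rightarrow> real \<Rightarrow> real \<Rightarrow> 'a \<Rightarrow> bool" where
  "approx_jump u x a b e \<longleftrightarrow> b < a \<and> norm e = 1 \<and>
     ((\<lambda>r. mean_dev u (half_ball x r e) a) \<longlongrightarrow> 0) (at_right 0) \<and>
     ((\<lambda>r. mean_dev u (half_ball x r (- e)) b) \<longlongrightarrow> 0) (at_right 0)"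

definition disc_set :: "'a::euclidean_space set \<Rightarrow> ('a \<Rightarrow> real) \<Rightarrow> 'a set" where
  "disc_set \<Omega> u = {x \<in> \<Omega>. \<nexists>z. approx_lim u x z}"

definition jump_set :: "'a::euclidean_space set \<Rightarrow> ('a \<Rightarrow> real) \<Rightarrow> 'a set" where
  "jump_set \<Omega> u = {x \<in> \<Omega>. \<exists>a b e. approx_jump u x a b e}"

text \<open>On the remaining set \<open>disc_set \<Omega> u - jump_set \<Omega> u\<close>, which for BV functions is negligible
  for the Hausdorff measure of codimension one, the traces are undefined; they are given the
  value \<open>0\<close> there.\<close>

definition upper_trace :: "'a::euclidean_space set \<Rightarrow> ('a \<Rightarrow> real) \<Rightarrow> 'a \<Rightarrow> real" where
  "upper_trace \<Omega> u x =
     (if x \<in> \<Omega> - disc_set \<Omega> u then (THE z. approx_lim u x z)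
      else if x \<in> jump_set \<Omega> u then (THE a. \<exists>b e. approx_jump u x a b e)
      else 0)"

definition lower_trace :: "'a::euclidean_space set \<Rightarrow> ('a \<Rightarrow> real) \<Rightarrow> 'a \<Rightarrow> real" where
  "lower_trace \<Omega> u x =
     (if x \<in> \<Omega> - disc_set \<Omega> u then (THE z. approx_lim u x z)
      else if x \<in> jump_set \<Omega> u then (THE b. \<exists>a e. approx_jump u x a b e)
      else 0)"

definition star_rep :: "'a::euclidean_space set \<Rightarrow> ('a \<Rightarrow> real) \<Rightarrow> 'a \<Rightarrow> real" where
  "star_rep \<Omega> u x = (upper_trace \<Omega> u x + lower_trace \<Omega> u x) / 2"

definition lam_rep ::
    "'a::euclidean_space set \<Rightarrow> ('a \<Rightarrow> real) \<Rightarrow> ('a \<Rightarrow> real) \<Rightarrow> 'a \<Rightarrow> real" where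
  "lam_rep \<Omega> lam u x = lam x * upper_trace \<Omega> u x + (1 - lam x) * lower_trace \<Omega> u x"


section \<open>Admissible measures and the pairing\<close>

text \<open>A continuous linear functional on \<open>BV \<Omega>\<close>. Elements of \<open>BV \<Omega>\<close> are representatives; the
  bound forces equal values on representatives that agree almost everywhere.\<close>

definition BV_dual :: "'a::euclidean_space set \<Rightarrow> (('a \<Rightarrow> real) \<Rightarrow> real) set" where
  "BV_dual \<Omega> = {\<Lambda>.
     (\<forall>u \<in> BV \<Omega>. \<forall>v \<in> BV \<Omega>. \<Lambda> (\<lambda>x. u x + v x) = \<Lambda> u + \<Lambda> v) \<and>
     (\<forall>u \<in> BV \<Omega>. \<forall>c. \<Lambda> (\<lambda>x. c * u x) = c * \<Lambda> u) \<and>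
     (\<exists>C. \<forall>u \<in> BV \<Omega>. \<bar>\<Lambda> u\<bar> \<le> C * BV_norm \<Omega> u)}"

definition admissible :: "'a::euclidean_space set \<Rightarrow> ('a set \<Rightarrow> real) \<Rightarrow> bool" where
  "admissible \<Omega> \<mu> \<longleftrightarrow> \<mu> \<in> MH \<Omega> \<and>
     (\<exists>\<Lambda> \<in> BV_dual \<Omega>. \<forall>u \<in> BV \<Omega> \<inter> Linf \<Omega>.
        \<Lambda> u = (LINT x|total_variation \<Omega> \<mu>. star_rep \<Omega> u x))"

text \<open>The pairing as a distribution, \<open>div (u F) - u\<^sup>\<lambda> div F\<close>.\<close>

definition lam_pairing ::
    "'a::euclidean_space set \<Rightarrow> ('a \<Rightarrow> real) \<Rightarrow> ('a \<Rightarrow> 'a) \<Rightarrow> ('a \<Rightarrow> real) \<Rightarrow> ('a \<Rightarrow> real) \<Rightarrow> real"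
  where
  "lam_pairing \<Omega> lam F u \<phi> = distr_div \<Omega> (\<lambda>x. u x *\<^sub>R F x) \<phi>
     - signed_integral \<Omega> (div_measure \<Omega> F) (\<lambda>x. \<phi> x * lam_rep \<Omega> lam u x)"

text \<open>The hypotheses on \<open>T\<close> for given \<open>\<mu>\<close>, \<open>\<lambda>\<close> and \<open>u\<close>; the last one is equality of a
  distribution with a finite signed measure.\<close>

definition solves_pmc ::
    "'a::euclidean_space set \<Rightarrow> ('a set \<Rightarrow> real) \<Rightarrow> ('a \<Rightarrow> real) \<Rightarrow> ('a \<Rightarrow> real) \<Rightarrow> ('a \<Rightarrow> 'a) \<Rightarrow> bool"
  where
  "solves_pmc \<Omega> \<mu> lam u T \<longleftrightarrow>
     T \<in> DM_inf \<Omega> \<and>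
     Linf_norm \<Omega> T \<le> 1 \<and>
     (\<forall>A \<in> borel_of \<Omega>. div_measure \<Omega> T A = \<mu> A) \<and>
     (\<forall>\<phi> \<in> test_functions \<Omega>. lam_pairing \<Omega> lam T u \<phi> =
        signed_integral \<Omega>
          (\<lambda>A. area_measure \<Omega> u A - (LINT x|lebesgue_on A. sqrt (1 - (norm (T x))\<^sup>2))) \<phi>)"

end

theory Submission
  imports Defs
begin

text \<open>The hypothesis on the pairing is tested against the Lebesgue part only. All singular parts (of
  \<open>Du\<close>, of \<open>\<mu>\<close> and of the area measure) live on one Lebesgue null set \<open>N\<close>, so it suffices to show that
  near a compact set \<open>C\<close> disjoint from \<open>N\<close> the pairing is \<open>T \<bullet> \<nabla>u\<close>. Replace a cut-off of \<open>u\<close> by its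
  mollifications \<open>u\<^sub>\<epsilon>\<close>, for which \<open>div (u\<^sub>\<epsilon> T) = u\<^sub>\<epsilon> \<mu> + T \<bullet> \<nabla>u\<^sub>\<epsilon>\<close>. The gradients \<open>\<nabla>u\<^sub>\<epsilon>\<close> differ from \<open>\<nabla>u\<close> by an
  \<open>L\<^sup>1\<close>-small term and a term controlled by the singular part of \<open>Du\<close>. For \<open>u\<^sub>\<epsilon> \<mu>\<close>, cut \<open>u\<close> into layers
  \<open>j \<le> |u| \<le> j + 1\<close>: their variations are summable, mollified layers are test functions, and
  admissibility of \<open>\<mu>\<close> applied to them bounds the part of \<open>u\<^sub>\<epsilon>\<close> above level \<open>m\<close> in \<open>L\<^sup>1(|\<mu>|)\<close>
  uniformly in \<open>\<epsilon>\<close>; below level \<open>m\<close> the singular part of \<open>\<mu>\<close> contributes at most \<open>m |\<mu>\<^sub>s|(C) = 0\<close>.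
  By Fatou the same bound makes the traces of \<open>u\<close> integrable with respect to \<open>|\<mu>|\<close>, and Lebesgue
  almost everywhere \<open>u\<^sup>\<lambda> = u\<close>. Hence \<open>T \<bullet> \<nabla>u = \<surd>(1 + |\<nabla>u|\<^sup>2) - \<surd>(1 - |T|\<^sup>2)\<close> almost everywhere, which is the
  equality case of the Cauchy-Schwarz inequality for \<open>(T, \<surd>(1 - |T|\<^sup>2))\<close> and \<open>(\<nabla>u, 1)\<close>
  and forces \<open>T = \<nabla>u / \<surd>(1 + |\<nabla>u|\<^sup>2)\<close>.\<close>

section \<open>Variation of countably additive set functions\<close>

text \<open>Two obstacles shape the argument. For unbounded \<open>u\<close> the representative in
  the pairing is not known in advance to be integrable against the total variation of
  \<open>\<mu>\<close>, and a non-integrable function has integral 0 by default, so integrability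
  must be proved before the pairing can be split into an absolutely continuous and a singular part.
  Moreover, the functional behind admissibility is an integral only on bounded functions; mollified
  layers are bounded, smooth and compactly supported, and there the precise representative is the
  function itself. The summation over layers takes the place of the coarea formula: all layers are
  nondecreasing in the absolute value, so their increments add up to at most the increment of
  \<open>u\<close>.

  Three limits are taken in a fixed order. The mollification scale tends to 0 with cut-off
  \<open>\<phi>\<close> and level \<open>m\<close> fixed. Then \<open>\<phi>\<close> tends to the
  indicator of \<open>C\<close>, which removes every term concentrated on \<open>N\<close>,
  including one that grows like \<open>m\<close>. Only then does \<open>m\<close> tend to
  infinity.\<close>

lemma space_borel_of [simp]: "space (restrict_space borel \<Omega>) = (\<Omega> :: 'a::topological_space set)"
  by (simp add: space_restrict_space)

lemma sigma_algebra_borel_of: "sigma_algebra \<Omega> (borel_of (\<Omega> :: 'a::topological_space set))"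
  using sets.sigma_algebra_axioms[of "restrict_space borel \<Omega>"] by simp

lemma borel_of_subset: "A \<in> borel_of \<Omega> \<Longrightarrow> A \<subseteq> (\<Omega> :: 'a::topological_space set)"
  using sets.sets_into_space[of A "restrict_space borel \<Omega>"] by simp

lemma borel_of_top [simp]: "\<Omega> \<in> borel_of (\<Omega> :: 'a::topological_space set)"
  using sets.top[of "restrict_space borel \<Omega>"] by simp

text \<open>The set function inside \<open>total_variation\<close>, kept apart from
  \<open>measure_of\<close>, which yields the null measure until countable additivity is known.
  Finite partitions are included by padding with empty sets.\<close>

definition variation ::
    "'a::topological_space set \<Rightarrow> ('a set \<Rightarrow> 'b::real_normed_vector) \<Rightarrow> 'a set \<Rightarrow> ennreal" where
  "variation \<Omega> \<nu> A =
     (SUP D \<in> {D :: nat \<Rightarrow> 'a set. range D \<subseteq> borel_of \<Omega> \<and> disjoint_family D \<and> (\<Union>i. D i) = A}.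
        (\<Sum>i. ennreal (norm (\<nu> (D i)))))"

lemma finite_vmeasure_sums:
  assumes "finite_vmeasure \<Omega> \<nu>" "range A \<subseteq> borel_of \<Omega>" "disjoint_family A"
  shows "(\<lambda>i. \<nu> (A i)) sums \<nu> (\<Union>i. A i)"
  using assms unfolding finite_vmeasure_def by blast

text \<open>The constant family of empty sets is disjoint, and a series with constant terms
  converges only if the term is 0.\<close>

lemma finite_vmeasure_empty:
  assumes "finite_vmeasure \<Omega> \<nu>" shows "\<nu> {} = 0"
proof -
  have "(\<lambda>i::nat. \<nu> {}) sums \<nu> (\<Union>i::nat. {})"
    by (rule finite_vmeasure_sums[OF assms]) (auto simp: disjoint_family_on_def)
  then show ?thesis
    using summable_LIMSEQ_zero[OF sums_summable] LIMSEQ_const_iff by fastforce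
qed

lemma finite_vmeasure_Un:
  assumes "finite_vmeasure \<Omega> \<nu>" "A \<in> borel_of \<Omega>" "B \<in> borel_of \<Omega>" "A \<inter> B = {}"
  shows "\<nu> (A \<union> B) = \<nu> A + \<nu> B"
proof -
  have "(\<lambda>i. \<nu> (binaryset A B i)) sums \<nu> (\<Union>i. binaryset A B i)"
    using assms by (intro finite_vmeasure_sums) (auto simp: disjoint_family_on_def binaryset_def)
  then show ?thesis
    using sums_unique2[OF binaryset_sums[of \<nu> A B, OF finite_vmeasure_empty[OF assms(1)]]]
    by (auto simp: UN_binaryset_eq)
qed

lemma finite_vmeasure_Diff:
  assumes "finite_vmeasure \<Omega> \<nu>" "A \<in> borel_of \<Omega>" "B \<in> borel_of \<Omega>" "B \<subseteq> A"
  shows "\<nu> (A - B) = \<nu> A - \<nu> B"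
proof -
  have "\<nu> (B \<union> (A - B)) = \<nu> B + \<nu> (A - B)"
    using assms by (intro finite_vmeasure_Un) auto
  moreover have "B \<union> (A - B) = A" using assms by auto
  ultimately show ?thesis by simp
qed

lemma variation_upper:
  assumes "range D \<subseteq> borel_of \<Omega>" "disjoint_family D" "(\<Union>i. D i) = A"
  shows "(\<Sum>i. ennreal (norm (\<nu> (D i)))) \<le> variation \<Omega> \<nu> A"
  unfolding variation_def using assms by (intro SUP_upper) auto

lemma norm_le_variation:
  assumes "finite_vmeasure \<Omega> \<nu>" "A \<in> borel_of \<Omega>"
  shows "ennreal (norm (\<nu> A)) \<le> variation \<Omega> \<nu> A"
proof -
  have e: "\<nu> {} = 0" by (rule finite_vmeasure_empty[OF assms(1)])
  have "(\<Sum>i. ennreal (norm (\<nu> (binaryset A {} i)))) = ennreal (norm (\<nu> A))"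
    using e by (subst suminf_finite[of "{0}"]) (auto simp: binaryset_def)
  moreover have "(\<Sum>i. ennreal (norm (\<nu> (binaryset A {} i)))) \<le> variation \<Omega> \<nu> A"
    using assms by (intro variation_upper)
      (auto simp: disjoint_family_on_def binaryset_def split: if_splits)
  ultimately show ?thesis by simp
qed

lemma variation_empty:
  assumes "finite_vmeasure \<Omega> \<nu>" shows "variation \<Omega> \<nu> {} = 0"
proof -
  have "(\<Sum>i. ennreal (norm (\<nu> (D i)))) = 0" if "(\<Union>i::nat. D i) = {}" for D
  proof -
    have "D i = {}" for i using that by auto
    then show ?thesis using finite_vmeasure_empty[OF assms] by simp
  qed
  then show ?thesis unfolding variation_def by (intro antisym SUP_least) auto
qed

lemma norm_suminf_le_ennreal:
  fixes f :: "nat \<Rightarrow> 'b::real_normed_vector"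
  assumes "f sums s"
  shows "ennreal (norm s) \<le> (\<Sum>i. ennreal (norm (f i)))"
proof (rule LIMSEQ_le_const2)
  show "(\<lambda>n. ennreal (norm (\<Sum>i<n. f i))) \<longlonglongrightarrow> ennreal (norm s)"
    using assms unfolding sums_def by (intro tendsto_ennrealI tendsto_norm)
  show "\<exists>N. \<forall>n\<ge>N. ennreal (norm (\<Sum>i<n. f i)) \<le> (\<Sum>i. ennreal (norm (f i)))"
  proof (intro exI allI impI)
    fix n :: nat
    have "ennreal (norm (\<Sum>i<n. f i)) \<le> ennreal (\<Sum>i<n. norm (f i))"
      by (intro ennreal_leI norm_sum)
    also have "\<dots> = (\<Sum>i<n. ennreal (norm (f i)))"
      by (simp add: sum_ennreal)
    also have "\<dots> \<le> (\<Sum>i. ennreal (norm (f i)))"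
      by (rule sum_le_suminf) auto
    finally show "ennreal (norm (\<Sum>i<n. f i)) \<le> (\<Sum>i. ennreal (norm (f i)))" .
  qed
qed

text \<open>A partition of the union is refined by intersecting its members with the
  \<open>A k\<close>. The terms of the resulting double series are nonnegative, so the sum over the
  partition can be taken first, and for each \<open>k\<close> it runs over a partition of
  \<open>A k\<close>.\<close>

lemma variation_subadditive:
  assumes \<nu>: "finite_vmeasure \<Omega> \<nu>" and A: "range A \<subseteq> borel_of \<Omega>" "disjoint_family A"
  shows "variation \<Omega> \<nu> (\<Union>i. A i) \<le> (\<Sum>i. variation \<Omega> \<nu> (A i))"
proof -
  have "(\<Sum>i. ennreal (norm (\<nu> (D i)))) \<le> (\<Sum>i. variation \<Omega> \<nu> (A i))"
    if D: "range D \<subseteq> borel_of \<Omega>" "disjoint_family D" "(\<Union>i. D i) = (\<Union>i. A i)" for D :: "nat \<Rightarrow> 'a set"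
  proof -
    have 1: "ennreal (norm (\<nu> (D i))) \<le> (\<Sum>k. ennreal (norm (\<nu> (D i \<inter> A k))))" for i
    proof -
      have "D i = (\<Union>k. D i \<inter> A k)" using D(3) by auto
      moreover have "(\<lambda>k. \<nu> (D i \<inter> A k)) sums \<nu> (\<Union>k. D i \<inter> A k)"
      proof (rule finite_vmeasure_sums[OF \<nu>])
        show "range (\<lambda>k. D i \<inter> A k) \<subseteq> borel_of \<Omega>"
          using D(1) A(1) by (auto intro!: sets.Int)
        show "disjoint_family (\<lambda>k. D i \<inter> A k)"
          using A(2) by (auto simp: disjoint_family_on_def)
      qed
      ultimately show ?thesis using norm_suminf_le_ennreal by metis
    qed
    have "(\<Sum>i. ennreal (norm (\<nu> (D i)))) \<le> (\<Sum>i. \<Sum>k. ennreal (norm (\<nu> (D i \<inter> A k))))"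
      by (intro suminf_le 1) auto
    also have "\<dots> = (\<Sum>k. \<Sum>i. ennreal (norm (\<nu> (D i \<inter> A k))))"
      using nn_integral_count_space_nat
      by (simp flip: nn_integral_count_space_nat) (rule pair_sigma_finite.Fubini'; simp add: pair_sigma_finite_def sigma_finite_measure_count_space)
    also have "\<dots> \<le> (\<Sum>k. variation \<Omega> \<nu> (A k))"
    proof (intro suminf_le)
      fix k
      show "(\<Sum>i. ennreal (norm (\<nu> (D i \<inter> A k)))) \<le> variation \<Omega> \<nu> (A k)"
      proof (rule variation_upper)
        show "range (\<lambda>i. D i \<inter> A k) \<subseteq> borel_of \<Omega>" using D(1) A(1) by (auto intro!: sets.Int)
        show "disjoint_family (\<lambda>i. D i \<inter> A k)" using D(2) by (auto simp: disjoint_family_on_def)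
        show "(\<Union>i. D i \<inter> A k) = A k" using D(3) by auto
      qed
    qed auto
    finally show ?thesis .
  qed
  then show ?thesis unfolding variation_def by (intro SUP_least) auto
qed

text \<open>Partitions of the single \<open>A i\<close> are glued into one partition of the union by
  enumerating pairs of indices. Choosing them optimal up to \<open>e / 2 ^ Suc i\<close> costs
  \<open>e\<close> in total.\<close>

lemma variation_superadditive:
  assumes A: "range A \<subseteq> borel_of \<Omega>" "disjoint_family A"
  shows "(\<Sum>i. variation \<Omega> \<nu> (A i)) \<le> variation \<Omega> \<nu> (\<Union>i. A i)"
proof -
  define good where "good i D \<longleftrightarrow> range D \<subseteq> borel_of \<Omega> \<and> disjoint_family D \<and> (\<Union>k. D k) = A i"
    for i and D :: "nat \<Rightarrow> 'a set"
  have comb: "(\<Sum>i. \<Sum>k. ennreal (norm (\<nu> (D i k)))) \<le> variation \<Omega> \<nu> (\<Union>i. A i)"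
    if D: "\<And>i. good i (D i)" for D
  proof -
    have "(\<Sum>i. \<Sum>k. ennreal (norm (\<nu> (D i k)))) =
        (\<Sum>i. ennreal (norm (\<nu> ((\<lambda>(i,k). D i k) (prod_decode i)))))"
      by (rule suminf_ennreal_2dimen[of _ "\<lambda>p. ennreal (norm (\<nu> ((\<lambda>(i,k). D i k) p)))", symmetric]) simp
    also have "\<dots> \<le> variation \<Omega> \<nu> (\<Union>i. A i)"
    proof (rule variation_upper)
      show "range (\<lambda>i. case prod_decode i of (i, k) \<Rightarrow> D i k) \<subseteq> borel_of \<Omega>"
      proof (rule image_subsetI)
        fix m obtain i k where m: "prod_decode m = (i,k)" by force
        show "(case prod_decode m of (i, k) \<Rightarrow> D i k) \<in> borel_of \<Omega>"
          using D[of i] m unfolding good_def by auto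
      qed
      show "disjoint_family (\<lambda>i. case prod_decode i of (i, k) \<Rightarrow> D i k)"
        unfolding disjoint_family_on_def
      proof (intro ballI impI)
        fix m n :: nat assume "m \<noteq> n"
        obtain i k where m: "prod_decode m = (i,k)" by force
        obtain i' k' where n: "prod_decode n = (i',k')" by force
        have ne: "(i,k) \<noteq> (i',k')" using \<open>m \<noteq> n\<close> m n by (metis prod_decode_inverse)
        have s: "D i k \<subseteq> A i" "D i' k' \<subseteq> A i'" using D unfolding good_def by auto
        have "D i k \<inter> D i' k' = {}"
        proof (cases "i = i'")
          case True then show ?thesis using ne D[of i] unfolding good_def disjoint_family_on_def by auto
        next
          case False
          then have "A i \<inter> A i' = {}" using A(2) unfolding disjoint_family_on_def by auto
          then show ?thesis using s by auto
        qed
        then show "(case prod_decode m of (i, k) \<Rightarrow> D i k) \<inter> (case prod_decode n of (i, k) \<Rightarrow> D i k) = {}"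
          using m n by simp
      qed
      show "(\<Union>i. case prod_decode i of (i, k) \<Rightarrow> D i k) = (\<Union>i. A i)"
      proof -
        have "(\<Union>i. case prod_decode i of (i, k) \<Rightarrow> D i k) = (\<Union>p\<in>range prod_decode. case p of (i, k) \<Rightarrow> D i k)"
          by auto
        also have "\<dots> = (\<Union>i. \<Union>k. D i k)"
          using surj_prod_decode by auto
        also have "\<dots> = (\<Union>i. A i)" using D unfolding good_def by auto
        finally show ?thesis .
      qed
    qed
    finally show ?thesis .
  qed
  have triv: "good i (binaryset (A i) {})" for i
    using A(1) unfolding good_def by (auto simp: disjoint_family_on_def binaryset_def split: if_splits)
  show ?thesis
  proof (rule ennreal_le_epsilon)
    fix e :: real assume e: "0 < e" and fin: "variation \<Omega> \<nu> (\<Union>i. A i) < top"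
    have "\<exists>D. good i D \<and> variation \<Omega> \<nu> (A i) \<le> (\<Sum>k. ennreal (norm (\<nu> (D k)))) + ennreal e * ennreal ((1/2)^Suc i)" for i
    proof -
      \<comment> \<open>Finiteness has to pass to \<open>A i\<close> first, because subtracting the
        error from an infinite supremum would not make it smaller. The gluing gives this with
        trivial partitions in all slots but the one with index \<open>i\<close>.\<close>
      have le: "variation \<Omega> \<nu> (A i) \<le> variation \<Omega> \<nu> (\<Union>i. A i)"
        unfolding variation_def[of \<Omega> \<nu> "A i"]
      proof (rule SUP_least)
        fix D :: "nat \<Rightarrow> _" assume D: "D \<in> {D. range D \<subseteq> borel_of \<Omega> \<and> disjoint_family D \<and> \<Union> (range D) = A i}"
        define E where "E j = (if j = i then D else binaryset (A j) {})" for j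
        have gD: "good i D" using D unfolding good_def by simp
        have "good j (E j)" for j using gD triv unfolding E_def by simp
        from comb[OF this] have "(\<Sum>j. \<Sum>k. ennreal (norm (\<nu> (E j k)))) \<le> variation \<Omega> \<nu> (\<Union>i. A i)" .
        moreover define S where "S j = (\<Sum>k. ennreal (norm (\<nu> (E j k))))" for j
        have "sum S {i} \<le> suminf S" by (rule sum_le_suminf) auto
        moreover have "S i = (\<Sum>k. ennreal (norm (\<nu> (D k))))" unfolding S_def E_def by simp
        ultimately show "(\<Sum>k. ennreal (norm (\<nu> (D k)))) \<le> variation \<Omega> \<nu> (\<Union>i. A i)"
          unfolding S_def[abs_def, symmetric] by simp
      qed
      let ?d = "ennreal e * ennreal ((1/2)^Suc i)"
      have d: "?d > 0" using e by (simp add: ennreal_zero_less_mult_iff)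
      have vfin: "variation \<Omega> \<nu> (A i) < top" using le fin by simp
      show ?thesis
      proof (cases "variation \<Omega> \<nu> (A i) = 0")
        case True then show ?thesis using triv[of i] by (intro exI[of _ "binaryset (A i) {}"]) auto
      next
        case False
        have "variation \<Omega> \<nu> (A i) - ?d < variation \<Omega> \<nu> (A i)"
          using False d vfin zero_less_iff_neq_zero by (intro ennreal_between) auto
        then obtain D where "good i D" "variation \<Omega> \<nu> (A i) - ?d < (\<Sum>k. ennreal (norm (\<nu> (D k))))"
          unfolding variation_def less_SUP_iff good_def by auto
        then have "good i D" "variation \<Omega> \<nu> (A i) - ?d \<le> (\<Sum>k. ennreal (norm (\<nu> (D k))))"
          by (simp_all only: less_imp_le)
        then show ?thesis
          by (intro exI[of _ D] conjI) (simp_all only: ennreal_minus_le_iff add.commute[of ?d])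
      qed
    qed
    then have "\<exists>D. \<forall>i. good i (D i) \<and> variation \<Omega> \<nu> (A i)
        \<le> (\<Sum>k. ennreal (norm (\<nu> (D i k)))) + ennreal e * ennreal ((1/2)^Suc i)"
      by (intro choice allI)
    then obtain D where D: "\<And>i. good i (D i)"
      "\<And>i. variation \<Omega> \<nu> (A i) \<le> (\<Sum>k. ennreal (norm (\<nu> (D i k)))) + ennreal e * ennreal ((1/2)^Suc i)"
      by blast
    have "(\<Sum>i. variation \<Omega> \<nu> (A i)) \<le> (\<Sum>i. (\<Sum>k. ennreal (norm (\<nu> (D i k)))) + ennreal e * ennreal ((1/2)^Suc i))"
      by (intro suminf_le D) auto
    also have "\<dots> = (\<Sum>i. \<Sum>k. ennreal (norm (\<nu> (D i k)))) + (\<Sum>i. ennreal e * ennreal ((1/2)^Suc i))"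
      by (rule suminf_add[symmetric]) auto
    also have "(\<Sum>i. ennreal e * ennreal ((1/2)^Suc i)) = ennreal e"
    proof -
      have "(\<Sum>i. ennreal ((1/2)^Suc i)) = ennreal 1"
        by (rule suminf_ennreal_eq[OF _ power_half_series]) simp
      then show ?thesis unfolding ennreal_suminf_cmult by (simp only: ennreal_1 mult_1_right)
    qed
    finally show "(\<Sum>i. variation \<Omega> \<nu> (A i)) \<le> variation \<Omega> \<nu> (\<Union>i. A i) + ennreal e"
      by (rule order_trans[OF _ add_right_mono[OF comb[of D, OF D(1)]]])
  qed
qed

lemma sets_total_variation [simp, measurable_cong]:
    "sets (total_variation \<Omega> \<nu>) = sets (restrict_space borel \<Omega>)"
  and space_total_variation [simp]: "space (total_variation \<Omega> \<nu>) = \<Omega>"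
  unfolding total_variation_def
  by (rule sigma_algebra.sets_measure_of_eq[OF sigma_algebra_borel_of],
      rule sigma_algebra.space_measure_of_eq[OF sigma_algebra_borel_of])

lemma total_variation_eq: "total_variation \<Omega> \<nu> = measure_of \<Omega> (borel_of \<Omega>) (variation \<Omega> \<nu>)"
  by (simp add: total_variation_def variation_def[abs_def])

lemma emeasure_total_variation:
  assumes \<nu>: "finite_vmeasure \<Omega> \<nu>" and "A \<in> borel_of \<Omega>"
  shows "emeasure (total_variation \<Omega> \<nu>) A = variation \<Omega> \<nu> A"
  unfolding total_variation_eq
proof (rule emeasure_measure_of_sigma[OF sigma_algebra_borel_of])
  show "positive (borel_of \<Omega>) (variation \<Omega> \<nu>)"
    using variation_empty[OF \<nu>] unfolding positive_def by simp
  show "countably_additive (borel_of \<Omega>) (variation \<Omega> \<nu>)"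
    unfolding countably_additive_def
    using variation_superadditive[of _ \<Omega> \<nu>] variation_subadditive[OF \<nu>]
    by (intro allI impI antisym) simp_all
qed (use assms in auto)

lemma finite_vmeasure_finite_sum:
  assumes "finite_vmeasure \<Omega> \<nu>" "disjoint_family_on D I" "finite I" "\<And>i. i \<in> I \<Longrightarrow> D i \<in> borel_of \<Omega>"
  shows "\<nu> (\<Union>i\<in>I. D i) = (\<Sum>i\<in>I. \<nu> (D i))"
  using assms(3,2,4)
proof (induction I rule: finite_induct)
  case empty
  then show ?case using finite_vmeasure_empty[OF assms(1)] by simp
next
  case (insert i I)
  have "\<nu> (D i \<union> (\<Union>i\<in>I. D i)) = \<nu> (D i) + \<nu> (\<Union>i\<in>I. D i)"
    using insert.prems insert.hyps
    by (intro finite_vmeasure_Un[OF assms(1)]) (auto simp: disjoint_family_on_def)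
  then show ?case
    using insert by (simp add: disjoint_family_on_def)
qed

text \<open>If \<open>E\<close> has infinite variation, some part of \<open>E\<close> has large measure while the rest still has
  infinite variation; iterating contradicts countable additivity.\<close>

lemma variation_split:
  fixes \<nu> :: "'a::topological_space set \<Rightarrow> real"
  assumes \<nu>: "finite_vmeasure \<Omega> \<nu>" and E: "E \<in> borel_of \<Omega>" "variation \<Omega> \<nu> E = \<infinity>"
  shows "\<exists>B. B \<in> borel_of \<Omega> \<and> B \<subseteq> E \<and> variation \<Omega> \<nu> B = \<infinity> \<and> 1 \<le> \<bar>\<nu> (E - B)\<bar>"
proof -
  \<comment> \<open>The factor 2 is there because the pieces are sorted by sign and only one of the
    two classes is used. The summand \<open>\<bar>\<nu> E\<bar>\<close> ensures that the complement
    of the chosen part in \<open>E\<close> also has measure at least 1 in absolute value.\<close>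
  let ?t = "2 * (1 + \<bar>\<nu> E\<bar>)"
  have "ennreal ?t < variation \<Omega> \<nu> E" using E(2) by simp
  then obtain D where D: "range D \<subseteq> borel_of \<Omega>" "disjoint_family D" "(\<Union>i. D i) = E"
    and *: "ennreal ?t < (\<Sum>i. ennreal \<bar>\<nu> (D i)\<bar>)"
    unfolding variation_def less_SUP_iff by auto
  from * obtain n where n: "ennreal ?t < (\<Sum>i<n. ennreal \<bar>\<nu> (D i)\<bar>)"
    unfolding suminf_eq_SUP less_SUP_iff by auto
  then have n: "?t < (\<Sum>i<n. \<bar>\<nu> (D i)\<bar>)"
    by (subst (asm) sum_ennreal) (simp_all add: ennreal_less_iff del: ennreal_plus)
  let ?P = "{i\<in>{..<n}. 0 \<le> \<nu> (D i)}" and ?N = "{i\<in>{..<n}. \<nu> (D i) < 0}"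
  have "(\<Sum>i<n. \<bar>\<nu> (D i)\<bar>) = (\<Sum>i\<in>?P. \<bar>\<nu> (D i)\<bar>) + (\<Sum>i\<in>?N. \<bar>\<nu> (D i)\<bar>)"
    by (subst sum.union_disjoint[symmetric]) (auto intro!: sum.cong)
  also have "\<dots> = (\<Sum>i\<in>?P. \<nu> (D i)) - (\<Sum>i\<in>?N. \<nu> (D i))"
    by (simp add: sum_negf)
  also have "\<dots> = \<nu> (\<Union>i\<in>?P. D i) - \<nu> (\<Union>i\<in>?N. D i)"
    using D by (subst (1 2) finite_vmeasure_finite_sum[OF \<nu>]) (auto simp: disjoint_family_on_def)
  finally have "?t < \<bar>\<nu> (\<Union>i\<in>?P. D i)\<bar> + \<bar>\<nu> (\<Union>i\<in>?N. D i)\<bar>" using n by linarith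
  moreover have "1 + e < a \<or> 1 + e < b" if "2 * (1 + e) < a + b" for a b e :: real
    using that by auto
  ultimately have "1 + \<bar>\<nu> E\<bar> < \<bar>\<nu> (\<Union>i\<in>?P. D i)\<bar> \<or> 1 + \<bar>\<nu> E\<bar> < \<bar>\<nu> (\<Union>i\<in>?N. D i)\<bar>" by blast
  moreover have "(\<Union>i\<in>?P. D i) \<in> borel_of \<Omega>" "(\<Union>i\<in>?N. D i) \<in> borel_of \<Omega>"
    using D(1) by (auto intro!: sets.finite_UN)
  moreover have "(\<Union>i\<in>?P. D i) \<subseteq> E" "(\<Union>i\<in>?N. D i) \<subseteq> E" using D(3) by auto
  ultimately obtain A where A: "A \<in> borel_of \<Omega>" "A \<subseteq> E" "1 + \<bar>\<nu> E\<bar> < \<bar>\<nu> A\<bar>" by blast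
  have d: "\<nu> (E - A) = \<nu> E - \<nu> A" by (rule finite_vmeasure_Diff[OF \<nu> E(1) A(1,2)])
  have "variation \<Omega> \<nu> E = variation \<Omega> \<nu> A + variation \<Omega> \<nu> (E - A)"
    using A E(1)
    by (subst (1 2 3) emeasure_total_variation[OF \<nu>, symmetric]) (auto simp: plus_emeasure Un_absorb1)
  \<comment> \<open>Both \<open>A\<close> and \<open>E - A\<close> have large measure, so whichever
    of them keeps infinite variation can serve as \<open>B\<close>.\<close>
  then have "variation \<Omega> \<nu> A = \<infinity> \<or> variation \<Omega> \<nu> (E - A) = \<infinity>"
    unfolding E(2) infinity_ennreal_def by (metis ennreal_add_eq_top)
  then show ?thesis
  proof
    assume "variation \<Omega> \<nu> A = \<infinity>"
    then show ?thesis using A d by (intro exI[of _ A]) auto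
  next
    assume "variation \<Omega> \<nu> (E - A) = \<infinity>"
    moreover have "E - (E - A) = A" using A by auto
    ultimately show ?thesis using A E by (intro exI[of _ "E - A"]) auto
  qed
qed

text \<open>The chain produced by \<open>variation_split\<close> has disjoint successive differences
  of measure at least 1 in absolute value, while the terms of a convergent series tend to 0.\<close>

lemma variation_finite_real:
  fixes \<nu> :: "'a::topological_space set \<Rightarrow> real"
  assumes \<nu>: "finite_vmeasure \<Omega> \<nu>"
  shows "variation \<Omega> \<nu> \<Omega> < \<infinity>"
proof (rule ccontr)
  assume "\<not> ?thesis"
  then have top: "variation \<Omega> \<nu> \<Omega> = \<infinity>" by (simp add: not_less top_unique)
  let ?P = "\<lambda>E. E \<in> borel_of \<Omega> \<and> variation \<Omega> \<nu> E = \<infinity>"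
  have "\<exists>B. ?P B \<and> B \<subseteq> E \<and> 1 \<le> \<bar>\<nu> (E - B)\<bar>" if "?P E" for E
    using variation_split[OF \<nu>, of E] that by blast
  moreover have "\<exists>E. ?P E" using top borel_of_top by blast
  ultimately have "\<exists>E. \<forall>k. ?P (E k) \<and> (E (Suc k) \<subseteq> E k \<and> 1 \<le> \<bar>\<nu> (E k - E (Suc k))\<bar>)"
    by (intro dependent_nat_choice[of "\<lambda>_. ?P" "\<lambda>_ E B. B \<subseteq> E \<and> 1 \<le> \<bar>\<nu> (E - B)\<bar>"]) blast+
  then obtain E where E: "\<And>k. ?P (E k)" "\<And>k. E (Suc k) \<subseteq> E k \<and> 1 \<le> \<bar>\<nu> (E k - E (Suc k))\<bar>"
    by blast
  let ?A = "\<lambda>k. E k - E (Suc k)"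
  have dec: "decseq E" using E(2) by (intro decseq_SucI) auto
  have disj: "?A m \<inter> ?A n = {}" if "m < n" for m n
  proof -
    have "E n \<subseteq> E (Suc m)" using that by (intro decseqD[OF dec]) simp
    then show ?thesis by blast
  qed
  have "disjoint_family ?A"
    unfolding disjoint_family_on_def
  proof (intro ballI impI)
    fix m n :: nat assume "m \<noteq> n"
    then consider "m < n" | "n < m" by linarith
    then show "?A m \<inter> ?A n = {}" using disj[of m n] disj[of n m] by cases (simp_all only: Int_commute)
  qed
  then have "(\<lambda>k. \<nu> (?A k)) sums \<nu> (\<Union>k. ?A k)"
    using E(1) by (intro finite_vmeasure_sums[OF \<nu>]) auto
  then have "(\<lambda>k. \<nu> (?A k)) \<longlonglongrightarrow> 0" using sums_summable summable_LIMSEQ_zero by blast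
  then have "eventually (\<lambda>k. \<bar>\<nu> (?A k)\<bar> < 1) sequentially"
    using tendstoD[of "\<lambda>k. \<nu> (?A k)" 0 sequentially 1] by (simp add: dist_real_def)
  then show False using E(2) unfolding eventually_sequentially by (meson le_refl not_le)
qed

lemma finite_vmeasure_inner:
  assumes "finite_vmeasure \<Omega> \<nu>"
  shows "finite_vmeasure \<Omega> (\<lambda>A. \<nu> A \<bullet> (i::'b::real_inner))"
  using assms unfolding finite_vmeasure_def
  by (auto intro: bounded_linear.sums[OF bounded_linear_inner_left])

text \<open>The Euclidean norm is at most the sum of the absolute coordinates. This carries
  finiteness of the variation from real to vector values.\<close>

lemma variation_le_sum_components:
  fixes \<nu> :: "'a::topological_space set \<Rightarrow> 'b::euclidean_space"
  assumes "finite_vmeasure \<Omega> \<nu>"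
  shows "variation \<Omega> \<nu> A \<le> (\<Sum>i\<in>Basis. variation \<Omega> (\<lambda>A. \<nu> A \<bullet> i) A)"
  unfolding variation_def[of \<Omega> \<nu>]
proof (rule SUP_least)
  fix D :: "nat \<Rightarrow> _" assume D: "D \<in> {D. range D \<subseteq> borel_of \<Omega> \<and> disjoint_family D \<and> \<Union> (range D) = A}"
  have "(\<Sum>k. ennreal (norm (\<nu> (D k)))) \<le> (\<Sum>k. \<Sum>i\<in>Basis. ennreal (norm (\<nu> (D k) \<bullet> i)))"
    using norm_le_l1 by (intro suminf_le) (auto simp: sum_ennreal intro!: ennreal_leI)
  also have "\<dots> = (\<Sum>i\<in>Basis. \<Sum>k. ennreal (norm (\<nu> (D k) \<bullet> i)))"
    by (rule suminf_sum) auto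
  also have "\<dots> \<le> (\<Sum>i\<in>Basis. variation \<Omega> (\<lambda>A. \<nu> A \<bullet> i) A)"
    using D by (intro sum_mono variation_upper[of _ _ _ "\<lambda>A. \<nu> A \<bullet> _"]) auto
  finally show "(\<Sum>k. ennreal (norm (\<nu> (D k)))) \<le> (\<Sum>i\<in>Basis. variation \<Omega> (\<lambda>A. \<nu> A \<bullet> i) A)" .
qed

lemma finite_measure_total_variation:
  fixes \<nu> :: "'a::topological_space set \<Rightarrow> 'b::euclidean_space"
  assumes \<nu>: "finite_vmeasure \<Omega> \<nu>"
  shows "finite_measure (total_variation \<Omega> \<nu>)"
proof
  have "variation \<Omega> \<nu> \<Omega> \<le> (\<Sum>i\<in>Basis. variation \<Omega> (\<lambda>A. \<nu> A \<bullet> i) \<Omega>)"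
    by (rule variation_le_sum_components[OF \<nu>])
  also have "\<dots> < \<infinity>"
    using variation_finite_real[OF finite_vmeasure_inner[OF \<nu>]] by simp
  finally show "emeasure (total_variation \<Omega> \<nu>) (space (total_variation \<Omega> \<nu>)) \<noteq> \<infinity>"
    by (simp add: emeasure_total_variation[OF \<nu>])
qed

lemma norm_le_total_variation:
  fixes \<nu> :: "'a::topological_space set \<Rightarrow> 'b::euclidean_space"
  assumes \<nu>: "finite_vmeasure \<Omega> \<nu>" and A: "A \<in> borel_of \<Omega>"
  shows "norm (\<nu> A) \<le> measure (total_variation \<Omega> \<nu>) A"
  using norm_le_variation[OF assms] finite_measure.emeasure_eq_measure[OF finite_measure_total_variation[OF \<nu>]]
  by (simp flip: emeasure_total_variation[OF assms])

section \<open>Operations on finite vector measures and restriction to Borel sets\<close>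

lemma finite_vmeasure_measure:
  assumes "finite_measure M" "sets M = borel_of \<Omega>"
  shows "finite_vmeasure \<Omega> (measure M)"
  unfolding finite_vmeasure_def
  using finite_measure.finite_measure_UNION[OF assms(1)] assms(2) by auto

lemma finite_vmeasure_add:
  assumes "finite_vmeasure \<Omega> \<nu>" "finite_vmeasure \<Omega> \<nu>'"
  shows "finite_vmeasure \<Omega> (\<lambda>A. \<nu> A + \<nu>' A)"
  using assms unfolding finite_vmeasure_def by (auto intro: sums_add)

lemma finite_vmeasure_diff:
  assumes "finite_vmeasure \<Omega> \<nu>" "finite_vmeasure \<Omega> \<nu>'"
  shows "finite_vmeasure \<Omega> (\<lambda>A. \<nu> A - \<nu>' A)"
  using assms unfolding finite_vmeasure_def by (auto intro: sums_diff)

lemma finite_vmeasure_Int: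
  assumes "finite_vmeasure \<Omega> \<nu>" "N \<in> borel_of \<Omega>"
  shows "finite_vmeasure \<Omega> (\<lambda>A. \<nu> (A \<inter> N))"
  unfolding finite_vmeasure_def
proof (intro allI impI)
  fix A :: "nat \<Rightarrow> 'a set" assume A: "range A \<subseteq> borel_of \<Omega> \<and> disjoint_family A"
  have "(\<lambda>i. \<nu> (A i \<inter> N)) sums \<nu> (\<Union>i. A i \<inter> N)"
    using A assms(2) by (intro finite_vmeasure_sums[OF assms(1)]) (auto simp: disjoint_family_on_def)
  then show "(\<lambda>i. \<nu> (A i \<inter> N)) sums \<nu> (\<Union> (range A) \<inter> N)" by simp
qed

lemma finite_vmeasure_cong:
  assumes "finite_vmeasure \<Omega> \<nu>" "\<And>A. A \<in> borel_of \<Omega> \<Longrightarrow> \<nu> A = \<nu>' A"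
  shows "finite_vmeasure \<Omega> \<nu>'"
  unfolding finite_vmeasure_def
proof (intro allI impI)
  fix A :: "nat \<Rightarrow> 'a set" assume A: "range A \<subseteq> borel_of \<Omega> \<and> disjoint_family A"
  then have "(\<Union>i. A i) \<in> borel_of \<Omega>" by (intro sets.countable_UN) auto
  then show "(\<lambda>i. \<nu>' (A i)) sums \<nu>' (\<Union> (range A))"
    using finite_vmeasure_sums[OF assms(1), of A] A assms(2) by (simp add: image_subset_iff)
qed

lemma variation_cong:
  assumes "\<And>B. B \<in> borel_of \<Omega> \<Longrightarrow> B \<subseteq> A \<Longrightarrow> \<nu> B = \<nu>' B"
  shows "variation \<Omega> \<nu> A = variation \<Omega> \<nu>' A"
proof -
  have "\<nu> (D i) = \<nu>' (D i)" if "range D \<subseteq> borel_of \<Omega>" "(\<Union>i. D i) = A" for D :: "nat \<Rightarrow> 'a set" and i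
    using assms[of "D i"] that by auto
  then show ?thesis unfolding variation_def by (intro SUP_cong) auto
qed

lemma total_variation_cong:
  assumes "\<And>A. A \<in> borel_of \<Omega> \<Longrightarrow> \<nu> A = \<nu>' A"
  shows "total_variation \<Omega> \<nu> = total_variation \<Omega> \<nu>'"
  unfolding total_variation_eq
proof (rule measure_of_eq)
  show "borel_of \<Omega> \<subseteq> Pow \<Omega>" using borel_of_subset by auto
  show "variation \<Omega> \<nu> a = variation \<Omega> \<nu>' a" if "a \<in> sigma_sets \<Omega> (borel_of \<Omega>)" for a
    using assms by (intro variation_cong) auto
qed

text \<open>Chosen measures such as \<open>div_measure\<close> are known only on Borel subsets of
  \<open>\<Omega>\<close>. Both parts of the Jordan decomposition see no other values, so agreement
  there is enough to exchange them.\<close>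

lemma signed_integral_cong_measure:
  assumes "\<And>A. A \<in> borel_of \<Omega> \<Longrightarrow> \<nu> A = \<nu>' A"
  shows "signed_integral \<Omega> \<nu> f = signed_integral \<Omega> \<nu>' f"
proof -
  have s: "borel_of \<Omega> \<subseteq> Pow \<Omega>" using borel_of_subset by auto
  have "pos_variation \<Omega> \<nu> = pos_variation \<Omega> \<nu>'" "neg_variation \<Omega> \<nu> = neg_variation \<Omega> \<nu>'"
    unfolding pos_variation_def neg_variation_def
    using assms total_variation_cong[of \<Omega> \<nu> \<nu>', OF assms]
    by (auto intro!: measure_of_eq[OF s] simp: sigma_algebra.sigma_sets_eq[OF sigma_algebra_borel_of])
  then show ?thesis unfolding signed_integral_def by simp
qed

subsection \<open>Positive and negative parts\<close>

lemma sets_pos_variation [simp, measurable_cong]: "sets (pos_variation \<Omega> \<nu>) = borel_of \<Omega>"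
  and space_pos_variation [simp]: "space (pos_variation \<Omega> \<nu>) = \<Omega>"
  and sets_neg_variation [simp, measurable_cong]: "sets (neg_variation \<Omega> \<nu>) = borel_of \<Omega>"
  and space_neg_variation [simp]: "space (neg_variation \<Omega> \<nu>) = \<Omega>"
  unfolding pos_variation_def neg_variation_def
  by (rule sigma_algebra.sets_measure_of_eq[OF sigma_algebra_borel_of]
      sigma_algebra.space_measure_of_eq[OF sigma_algebra_borel_of])+

lemma emeasure_measure_of_finite_vmeasure:
  assumes "finite_vmeasure \<Omega> \<nu>" "\<And>A. A \<in> borel_of \<Omega> \<Longrightarrow> 0 \<le> \<nu> A" "A \<in> borel_of \<Omega>"
  shows "emeasure (measure_of \<Omega> (borel_of \<Omega>) (\<lambda>A. ennreal (\<nu> A))) A = ennreal (\<nu> A)"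
proof (rule emeasure_measure_of_sigma[OF sigma_algebra_borel_of])
  show "positive (borel_of \<Omega>) (\<lambda>A. ennreal (\<nu> A))"
    using finite_vmeasure_empty[OF assms(1)] by (simp add: positive_def)
  show "countably_additive (borel_of \<Omega>) (\<lambda>A. ennreal (\<nu> A))"
    unfolding countably_additive_def
  proof (intro allI impI)
    fix A :: "nat \<Rightarrow> 'a set"
    assume A: "range A \<subseteq> borel_of \<Omega>" "disjoint_family A"
    show "(\<Sum>i. ennreal (\<nu> (A i))) = ennreal (\<nu> (\<Union> (range A)))"
      using finite_vmeasure_sums[OF assms(1) A] assms(2) A(1)
      by (intro suminf_ennreal_eq) (auto simp: image_subset_iff)
  qed
qed fact

context
  fixes \<Omega> :: "'a::topological_space set" and \<nu> :: "'a set \<Rightarrow> real"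
  assumes \<nu>: "finite_vmeasure \<Omega> \<nu>"
begin

interpretation TV: finite_measure "total_variation \<Omega> \<nu>"
  by (rule finite_measure_total_variation[OF \<nu>])

lemma emeasure_pos_variation:
  assumes "A \<in> borel_of \<Omega>"
  shows "emeasure (pos_variation \<Omega> \<nu>) A = ennreal ((measure (total_variation \<Omega> \<nu>) A + \<nu> A) / 2)"
  unfolding pos_variation_def
proof (rule emeasure_measure_of_finite_vmeasure[OF _ _ assms])
  have "finite_vmeasure \<Omega> (\<lambda>A. measure (total_variation \<Omega> \<nu>) A + \<nu> A)"
    by (intro finite_vmeasure_add finite_vmeasure_measure TV.finite_measure_axioms \<nu>) simp
  then show "finite_vmeasure \<Omega> (\<lambda>A. (measure (total_variation \<Omega> \<nu>) A + \<nu> A) / 2)"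
    unfolding finite_vmeasure_def by (auto intro: sums_divide)
  show "0 \<le> (measure (total_variation \<Omega> \<nu>) A + \<nu> A) / 2" if "A \<in> borel_of \<Omega>" for A
    using norm_le_total_variation[OF \<nu> that] by auto
qed

lemma emeasure_neg_variation:
  assumes "A \<in> borel_of \<Omega>"
  shows "emeasure (neg_variation \<Omega> \<nu>) A = ennreal ((measure (total_variation \<Omega> \<nu>) A - \<nu> A) / 2)"
  unfolding neg_variation_def
proof (rule emeasure_measure_of_finite_vmeasure[OF _ _ assms])
  have "finite_vmeasure \<Omega> (\<lambda>A. measure (total_variation \<Omega> \<nu>) A - \<nu> A)"
    by (intro finite_vmeasure_diff finite_vmeasure_measure TV.finite_measure_axioms \<nu>) simp
  then show "finite_vmeasure \<Omega> (\<lambda>A. (measure (total_variation \<Omega> \<nu>) A - \<nu> A) / 2)"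
    unfolding finite_vmeasure_def by (auto intro: sums_divide)
  show "0 \<le> (measure (total_variation \<Omega> \<nu>) A - \<nu> A) / 2" if "A \<in> borel_of \<Omega>" for A
    using norm_le_total_variation[OF \<nu> that] by auto
qed

lemma finite_measure_pos_variation: "finite_measure (pos_variation \<Omega> \<nu>)"
  and finite_measure_neg_variation: "finite_measure (neg_variation \<Omega> \<nu>)"
  by (auto intro!: finite_measureI simp: emeasure_pos_variation emeasure_neg_variation)

lemma emeasure_pos_variation_le:
  "A \<in> borel_of \<Omega> \<Longrightarrow> emeasure (pos_variation \<Omega> \<nu>) A \<le> emeasure (total_variation \<Omega> \<nu>) A"
  using norm_le_total_variation[OF \<nu>, of A]
  by (auto simp: emeasure_pos_variation TV.emeasure_eq_measure intro!: ennreal_leI)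

lemma emeasure_neg_variation_le:
  "A \<in> borel_of \<Omega> \<Longrightarrow> emeasure (neg_variation \<Omega> \<nu>) A \<le> emeasure (total_variation \<Omega> \<nu>) A"
  using norm_le_total_variation[OF \<nu>, of A]
  by (auto simp: emeasure_neg_variation TV.emeasure_eq_measure intro!: ennreal_leI)

end

section \<open>Integrals against finite sums of measures\<close>

lemma nn_integral_sum_measures_cong:
  fixes M1 :: "'i \<Rightarrow> 'a measure" and M2 :: "'j \<Rightarrow> 'a measure"
  assumes sets: "\<And>i. i \<in> I \<Longrightarrow> sets (M1 i) = sets M" "\<And>j. j \<in> J \<Longrightarrow> sets (M2 j) = sets M"
    and eq: "\<And>A. A \<in> sets M \<Longrightarrow> (\<Sum>i\<in>I. emeasure (M1 i) A) = (\<Sum>j\<in>J. emeasure (M2 j) A)"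
    and f: "f \<in> borel_measurable M"
  shows "(\<Sum>i\<in>I. \<integral>\<^sup>+x. f x \<partial>M1 i) = (\<Sum>j\<in>J. \<integral>\<^sup>+x. f x \<partial>M2 j)"
proof -
  note mcong = measurable_cong_sets[OF sets(1) refl] measurable_cong_sets[OF sets(2) refl]
  show ?thesis
    using f
  proof (induction f rule: borel_measurable_induct)
    case (cong f g)
    have *: "(\<integral>\<^sup>+x. f x \<partial>N) = (\<integral>\<^sup>+x. g x \<partial>N)" if "sets N = sets M" for N
      using cong(3) sets_eq_imp_space_eq[OF that] by (intro nn_integral_cong) auto
    show ?case using cong(4) sets * by simp
  next
    case (set A)
    then show ?case using eq sets by simp
  next
    case (mult u c)
    then show ?case by (simp add: nn_integral_cmult mcong flip: sum_distrib_left)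
  next
    case (add u v)
    then show ?case by (simp add: nn_integral_add mcong sum.distrib)
  next
    case (seq U)
    have *: "(\<integral>\<^sup>+x. (SUP i. U i) x \<partial>N) = (SUP i. \<integral>\<^sup>+x. U i x \<partial>N)" if "sets N = sets M" for N
      unfolding SUP_apply
    proof (intro nn_integral_monotone_convergence_SUP)
      show "U i \<in> borel_measurable N" for i
        using seq(1)[of i] by (simp add: measurable_cong_sets[OF that refl])
    qed (use seq in auto)
    have inc: "incseq (\<lambda>i. \<integral>\<^sup>+x. U i x \<partial>N)" for N
      using seq by (intro incseq_SucI nn_integral_mono) (auto simp: incseq_Suc_iff le_fun_def)
    have "(\<Sum>i\<in>I. \<integral>\<^sup>+x. (SUP k. U k) x \<partial>M1 i) = (SUP k. \<Sum>i\<in>I. \<integral>\<^sup>+x. U k x \<partial>M1 i)"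
      using sets by (subst ennreal_SUP_sum) (auto intro!: sum.cong *[symmetric] * inc)
    also have "\<dots> = (SUP k. \<Sum>j\<in>J. \<integral>\<^sup>+x. U k x \<partial>M2 j)"
      using seq.IH by simp
    also have "\<dots> = (\<Sum>j\<in>J. \<integral>\<^sup>+x. (SUP k. U k) x \<partial>M2 j)"
      using sets by (subst ennreal_SUP_sum) (auto intro!: sum.cong *[symmetric] * inc)
    finally show ?case .
  qed
qed

text \<open>An identity between signed measures becomes one between sums of positive measures once
  the negative parts change sides. In this form it extends to integrals without any subtraction of
  infinite quantities.\<close>

lemma integral_sum_measures_cong:
  fixes M1 :: "'i \<Rightarrow> 'a measure" and M2 :: "'j \<Rightarrow> 'a measure" and f :: "'a \<Rightarrow> real"
  assumes sets: "\<And>i. i \<in> I \<Longrightarrow> sets (M1 i) = sets M" "\<And>j. j \<in> J \<Longrightarrow> sets (M2 j) = sets M"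
    and eq: "\<And>A. A \<in> sets M \<Longrightarrow> (\<Sum>i\<in>I. emeasure (M1 i) A) = (\<Sum>j\<in>J. emeasure (M2 j) A)"
    and meas: "f \<in> borel_measurable M"
    and f: "\<And>i. i \<in> I \<Longrightarrow> integrable (M1 i) f" "\<And>j. j \<in> J \<Longrightarrow> integrable (M2 j) f"
  shows "(\<Sum>i\<in>I. LINT x|M1 i. f x) = (\<Sum>j\<in>J. LINT x|M2 j. f x)"
proof -
  have fin: "(\<integral>\<^sup>+x. ennreal (f x) \<partial>N) < top \<and> (\<integral>\<^sup>+x. ennreal (- f x) \<partial>N) < top" if "integrable N f" for N
    using that unfolding real_integrable_def by (simp add: less_top)
  have *: "(\<Sum>i\<in>I. enn2real (\<integral>\<^sup>+x. ennreal (h x) \<partial>M1 i)) = (\<Sum>j\<in>J. enn2real (\<integral>\<^sup>+x. ennreal (h x) \<partial>M2 j))"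
    if "h = f \<or> h = (\<lambda>x. - f x)" for h
  proof -
    have "enn2real (\<Sum>i\<in>I. \<integral>\<^sup>+x. ennreal (h x) \<partial>M1 i) = enn2real (\<Sum>j\<in>J. \<integral>\<^sup>+x. ennreal (h x) \<partial>M2 j)"
      using nn_integral_sum_measures_cong[OF sets eq, of "\<lambda>x. ennreal (h x)"] meas that by auto
    then show ?thesis
      using fin[OF f(1)] fin[OF f(2)] that by (subst (asm) (1 2) enn2real_sum) auto
  qed
  have "(LINT x|N. f x) = enn2real (\<integral>\<^sup>+x. ennreal (f x) \<partial>N) - enn2real (\<integral>\<^sup>+x. ennreal (- f x) \<partial>N)"
    if "integrable N f" for N using real_lebesgue_integral_def[OF that] .
  then show ?thesis using f *[of f] *[of "\<lambda>x. - f x"] by (simp add: sum_subtractf)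
qed

lemma integrable_of_emeasure_le:
  fixes f :: "'a \<Rightarrow> real"
  assumes "sets M = sets N" "\<And>A. A \<in> sets N \<Longrightarrow> emeasure M A \<le> emeasure N A" "integrable N f"
  shows "integrable M f"
proof -
  have "f \<in> borel_measurable M"
    using assms(3) measurable_cong_sets[OF assms(1) refl] by auto
  moreover have "(\<integral>\<^sup>+x. ennreal (norm (f x)) \<partial>M) \<le> (\<integral>\<^sup>+x. ennreal (norm (f x)) \<partial>N)"
    using assms(1,2) by (intro nn_integral_mono_measure) (auto simp: le_measure)
  ultimately show ?thesis using assms(3) unfolding integrable_iff_bounded by auto
qed

lemma emeasure_total_variation_eq_pos_neg:
  "A \<in> borel_of \<Omega> \<Longrightarrow> finite_vmeasure \<Omega> \<nu> \<Longrightarrow>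
    emeasure (total_variation \<Omega> (\<nu> :: _ \<Rightarrow> real)) A = emeasure (pos_variation \<Omega> \<nu>) A + emeasure (neg_variation \<Omega> \<nu>) A"
  using norm_le_total_variation[of \<Omega> \<nu> A] finite_measure.emeasure_eq_measure[OF finite_measure_total_variation[of \<Omega> \<nu>]]
  by (simp add: emeasure_pos_variation emeasure_neg_variation field_simps flip: ennreal_plus)

lemma finite_vmeasure_eq_pos_neg:
  fixes \<nu> :: "'a::topological_space set \<Rightarrow> real"
  assumes \<nu>: "finite_vmeasure \<Omega> \<nu>" and A: "A \<in> borel_of \<Omega>"
  shows "\<nu> A = measure (pos_variation \<Omega> \<nu>) A - measure (neg_variation \<Omega> \<nu>) A"
  using norm_le_total_variation[OF assms]
  by (simp add: measure_def emeasure_pos_variation[OF assms] emeasure_neg_variation[OF assms] field_simps)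

context
  fixes \<Omega> :: "'a::topological_space set" and \<nu> :: "'a set \<Rightarrow> real" and f :: "'a \<Rightarrow> real"
  assumes \<nu>: "finite_vmeasure \<Omega> \<nu>" and f: "integrable (total_variation \<Omega> \<nu>) f"
begin

lemma integrable_pos_variation: "integrable (pos_variation \<Omega> \<nu>) f"
proof (rule integrable_of_emeasure_le[OF _ _ f])
  show "emeasure (pos_variation \<Omega> \<nu>) A \<le> emeasure (total_variation \<Omega> \<nu>) A"
    if "A \<in> sets (total_variation \<Omega> \<nu>)" for A
    using emeasure_pos_variation_le[OF \<nu>, of A] that by simp
qed simp

lemma integrable_neg_variation: "integrable (neg_variation \<Omega> \<nu>) f"
proof (rule integrable_of_emeasure_le[OF _ _ f])
  show "emeasure (neg_variation \<Omega> \<nu>) A \<le> emeasure (total_variation \<Omega> \<nu>) A"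
    if "A \<in> sets (total_variation \<Omega> \<nu>)" for A
    using emeasure_neg_variation_le[OF \<nu>, of A] that by simp
qed simp

text \<open>The Jordan decomposition may be replaced by any representation as a difference of finite
  sums of finite measures. This is how signed integrals are computed below without identifying
  positive and negative variations.\<close>

lemma signed_integral_eq:
  fixes P :: "'i \<Rightarrow> 'a measure" and N :: "'j \<Rightarrow> 'a measure"
  assumes fin: "finite I" "finite J"
    and P: "\<And>i. i \<in> I \<Longrightarrow> finite_measure (P i) \<and> sets (P i) = borel_of \<Omega> \<and> integrable (P i) f"
    and N: "\<And>j. j \<in> J \<Longrightarrow> finite_measure (N j) \<and> sets (N j) = borel_of \<Omega> \<and> integrable (N j) f"
    and eq: "\<And>A. A \<in> borel_of \<Omega> \<Longrightarrow> \<nu> A = (\<Sum>i\<in>I. measure (P i) A) - (\<Sum>j\<in>J. measure (N j) A)"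
  shows "signed_integral \<Omega> \<nu> f = (\<Sum>i\<in>I. LINT x|P i. f x) - (\<Sum>j\<in>J. LINT x|N j. f x)"
proof -
  \<comment> \<open>The index \<open>None\<close> carries the Jordan part of \<open>\<nu>\<close> on
    the opposite side: negative variation plus the given \<open>P\<close> equals positive variation
    plus the given \<open>N\<close>.\<close>
  let ?P = "\<lambda>i. case i of None \<Rightarrow> neg_variation \<Omega> \<nu> | Some i \<Rightarrow> P i"
  let ?N = "\<lambda>i. case i of None \<Rightarrow> pos_variation \<Omega> \<nu> | Some i \<Rightarrow> N i"
  let ?I = "insert None (Some ` I)" and ?J = "insert None (Some ` J)"
  have "(\<Sum>i\<in>?I. LINT x|?P i. f x) = (\<Sum>i\<in>?J. LINT x|?N i. f x)"
  proof (rule integral_sum_measures_cong[where M = "restrict_space borel \<Omega>"])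
    fix A assume A: "A \<in> borel_of \<Omega>"
    have pn: "emeasure (pos_variation \<Omega> \<nu>) A = ennreal (measure (pos_variation \<Omega> \<nu>) A)"
      "emeasure (neg_variation \<Omega> \<nu>) A = ennreal (measure (neg_variation \<Omega> \<nu>) A)"
      using finite_measure.emeasure_eq_measure[OF finite_measure_pos_variation[OF \<nu>]]
        finite_measure.emeasure_eq_measure[OF finite_measure_neg_variation[OF \<nu>]] by auto
    have e: "(\<Sum>i\<in>I. emeasure (P i) A) = ennreal (\<Sum>i\<in>I. measure (P i) A)"
        "(\<Sum>i\<in>J. emeasure (N i) A) = ennreal (\<Sum>i\<in>J. measure (N i) A)"
      using P N by (auto simp: finite_measure.emeasure_eq_measure sum_ennreal)
    have "measure (neg_variation \<Omega> \<nu>) A + (\<Sum>i\<in>I. measure (P i) A) =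
       measure (pos_variation \<Omega> \<nu>) A + (\<Sum>j\<in>J. measure (N j) A)"
      using eq[OF A] finite_vmeasure_eq_pos_neg[OF \<nu> A] by simp
    then show "(\<Sum>i\<in>?I. emeasure (?P i) A) = (\<Sum>i\<in>?J. emeasure (?N i) A)"
      using fin by (simp add: sum.reindex o_def e pn sum_nonneg flip: ennreal_plus)
  next
    show "f \<in> borel_measurable (restrict_space borel \<Omega>)"
      using borel_measurable_integrable[OF f] by (simp cong: measurable_cong_sets)
  qed (use P N integrable_pos_variation integrable_neg_variation in auto)
  then show ?thesis unfolding signed_integral_def
    using fin by (simp add: sum.reindex o_def)
qed

lemma abs_signed_integral_le:
  "\<bar>signed_integral \<Omega> \<nu> f\<bar> \<le> (LINT x|total_variation \<Omega> \<nu>. \<bar>f x\<bar>)"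
proof -
  have "\<bar>LINT x|M. f x\<bar> \<le> (LINT x|M. \<bar>f x\<bar>)" for M
    using integral_norm_bound[of M f] by simp
  from this[of "pos_variation \<Omega> \<nu>"] this[of "neg_variation \<Omega> \<nu>"]
  have "\<bar>signed_integral \<Omega> \<nu> f\<bar> \<le> (LINT x|pos_variation \<Omega> \<nu>. \<bar>f x\<bar>) + (LINT x|neg_variation \<Omega> \<nu>. \<bar>f x\<bar>)"
    unfolding signed_integral_def by linarith
  also have "\<dots> = (LINT x|total_variation \<Omega> \<nu>. \<bar>f x\<bar>)"
    using integral_sum_measures_cong[of "{()}" "\<lambda>_. total_variation \<Omega> \<nu>" "restrict_space borel \<Omega>"
      "UNIV" "\<lambda>b. if b then pos_variation \<Omega> \<nu> else neg_variation \<Omega> \<nu>" "\<lambda>x. \<bar>f x\<bar>"]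
    f integrable_pos_variation integrable_neg_variation emeasure_total_variation_eq_pos_neg[OF _ \<nu>]
    borel_measurable_integrable[OF f]
    by (auto simp: UNIV_bool add.commute cong: measurable_cong_sets)
  finally show ?thesis .
qed

end

text \<open>Summing the setwise bound over a partition gives exactly the measure of the union. This
  minimality of the variation is the source of all its upper bounds below.\<close>

lemma variation_le_measures:
  fixes \<nu> :: "'a::topological_space set \<Rightarrow> 'b::real_normed_vector"
  assumes "\<And>A. A \<in> borel_of \<Omega> \<Longrightarrow> ennreal (norm (\<nu> A)) \<le> emeasure M A" "sets M = borel_of \<Omega>"
  shows "variation \<Omega> \<nu> A \<le> emeasure M A"
  unfolding variation_def
proof (rule SUP_least)
  fix D :: "nat \<Rightarrow> _" assume D: "D \<in> {D. range D \<subseteq> borel_of \<Omega> \<and> disjoint_family D \<and> \<Union> (range D) = A}"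
  have "(\<Sum>k. ennreal (norm (\<nu> (D k)))) \<le> (\<Sum>k. emeasure M (D k))"
    using D assms(1) by (intro suminf_le) auto
  also have "\<dots> = emeasure M A"
    using D assms(2) by (subst suminf_emeasure) auto
  finally show "(\<Sum>k. ennreal (norm (\<nu> (D k)))) \<le> emeasure M A" .
qed

lemma signed_integral_diff:
  assumes "finite_vmeasure \<Omega> \<nu>" "integrable (total_variation \<Omega> \<nu>) f" "integrable (total_variation \<Omega> \<nu>) g"
  shows "signed_integral \<Omega> \<nu> (\<lambda>x. f x - g x) = signed_integral \<Omega> \<nu> f - signed_integral \<Omega> \<nu> g"
  unfolding signed_integral_def
  using integrable_pos_variation[OF assms(1)] integrable_neg_variation[OF assms(1)] assms(2,3) by simp

lemma signed_integral_tendsto: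
  fixes f :: "nat \<Rightarrow> 'a::topological_space \<Rightarrow> real"
  assumes \<nu>: "finite_vmeasure \<Omega> \<nu>"
    and "\<And>k. f k \<in> borel_measurable (restrict_space borel \<Omega>)"
    and "h \<in> borel_measurable (restrict_space borel \<Omega>)"
    and "\<And>x. x \<in> \<Omega> \<Longrightarrow> (\<lambda>k. f k x) \<longlonglongrightarrow> h x"
    and "\<And>k x. x \<in> \<Omega> \<Longrightarrow> \<bar>f k x\<bar> \<le> c"
  shows "(\<lambda>k. signed_integral \<Omega> \<nu> (f k)) \<longlonglongrightarrow> signed_integral \<Omega> \<nu> h"
proof -
  have "(\<lambda>k. LINT x|M. f k x) \<longlonglongrightarrow> (LINT x|M. h x)" if "finite_measure M" "sets M = borel_of \<Omega>" for M
  proof (rule integral_dominated_convergence[where w = "\<lambda>_. c"])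
    interpret finite_measure M by fact
    show "integrable M (\<lambda>_. c)" by simp
    have [simp]: "space M = \<Omega>" using sets_eq_imp_space_eq[OF that(2)] by simp
    show "AE x in M. (\<lambda>k. f k x) \<longlonglongrightarrow> h x" "\<And>k. AE x in M. norm (f k x) \<le> c" using assms by auto
  qed (use assms that in \<open>auto cong: measurable_cong_sets\<close>)
  then show ?thesis unfolding signed_integral_def
    using finite_measure_pos_variation[OF \<nu>] finite_measure_neg_variation[OF \<nu>] by (intro tendsto_diff) auto
qed

lemma signed_integral_indicator:
  fixes \<nu> :: "'a::topological_space set \<Rightarrow> real"
  assumes \<nu>: "finite_vmeasure \<Omega> \<nu>" and A: "A \<in> borel_of \<Omega>"
  shows "signed_integral \<Omega> \<nu> (indicator A) = \<nu> A"
  unfolding signed_integral_def finite_vmeasure_eq_pos_neg[OF assms] using A borel_of_subset[OF A]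
  by (simp add: Int_absorb2)

section \<open>Uniqueness and Lebesgue decomposition\<close>

lemma borel_of_open_eq:
  assumes "open (\<Omega> :: 'a::euclidean_space set)"
  shows "borel_of \<Omega> = {A \<in> sets borel. A \<subseteq> \<Omega>}"
  using assms by (auto simp: sets_restrict_space_iff)

lemma borel_of_compact_sigma:
  assumes "open (\<Omega> :: 'a::euclidean_space set)"
  shows "borel_of \<Omega> = sigma_sets \<Omega> {C. compact C \<and> C \<subseteq> \<Omega>}"
proof
  have "borel_of \<Omega> = sigma_sets \<Omega> ((\<inter>) \<Omega> ` {S. open S})"
    unfolding sets_restrict_space borel_def
    using sigma_sets_Int[of \<Omega> UNIV "Collect open"] assms by (simp add: sigma_sets.Basic)
  also have "\<dots> \<subseteq> sigma_sets \<Omega> {C. compact C \<and> C \<subseteq> \<Omega>}"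
  proof (rule sigma_sets_mono, rule image_subsetI)
    fix S :: "'a set" assume "S \<in> {S. open S}"
    then have "open (\<Omega> \<inter> S)" using assms by auto
    from open_Union_compact_subsets[OF this] obtain C :: "nat \<Rightarrow> 'a set" where
      C: "\<And>n. compact (C n)" "\<And>n. C n \<subseteq> \<Omega> \<inter> S" "(\<Union>n. C n) = \<Omega> \<inter> S" by metis
    have "(\<Union>n. C n) \<in> sigma_sets \<Omega> {C. compact C \<and> C \<subseteq> \<Omega>}"
      using C by (intro sigma_sets.Union sigma_sets.Basic) auto
    then show "\<Omega> \<inter> S \<in> sigma_sets \<Omega> {C. compact C \<and> C \<subseteq> \<Omega>}" using C by simp
  qed
  finally show "borel_of \<Omega> \<subseteq> sigma_sets \<Omega> {C. compact C \<and> C \<subseteq> \<Omega>}" .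
  show "sigma_sets \<Omega> {C. compact C \<and> C \<subseteq> \<Omega>} \<subseteq> borel_of \<Omega>"
    using assms by (intro sigma_algebra.sigma_sets_subset[OF sigma_algebra_borel_of])
      (auto simp: borel_of_open_eq borel_compact)
qed

text \<open>The compact subsets are stable under intersection and generate the Borel sets, so the
  induction over Dynkin systems applies.\<close>

lemma finite_vmeasure_eqI_compact:
  fixes \<nu>1 \<nu>2 :: "'a::euclidean_space set \<Rightarrow> real"
  assumes \<Omega>: "open \<Omega>" and \<nu>: "finite_vmeasure \<Omega> \<nu>1" "finite_vmeasure \<Omega> \<nu>2"
    and eq: "\<And>C. compact C \<Longrightarrow> C \<subseteq> \<Omega> \<Longrightarrow> \<nu>1 C = \<nu>2 C"
    and A: "A \<in> borel_of \<Omega>"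
  shows "\<nu>1 A = \<nu>2 A"
proof -
  obtain C :: "nat \<Rightarrow> 'a set" where C: "\<And>n. compact (C n)" "\<And>n. C n \<subseteq> \<Omega>" "\<And>n. C n \<subseteq> C (Suc n)" "(\<Union>n. C n) = \<Omega>"
    using open_Union_compact_subsets[OF \<Omega>] by (metis interior_subset order_trans)
  have inc: "incseq C" using C(3) by (rule incseq_SucI)
  have Cb: "range C \<subseteq> borel_of \<Omega>" using C \<Omega> by (auto simp: borel_of_open_eq borel_compact)
  have lim: "(\<lambda>n. \<nu> (C n)) \<longlonglongrightarrow> \<nu> \<Omega>" if "finite_vmeasure \<Omega> \<nu>" for \<nu> :: "'a set \<Rightarrow> real"
  proof -
    have *: "(\<lambda>n. measure M (C n)) \<longlonglongrightarrow> measure M \<Omega>" if "finite_measure M" "sets M = borel_of \<Omega>" for M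
      using finite_measure.finite_Lim_measure_incseq[OF that(1) _ inc] Cb C(4) that(2) by auto
    have "(\<lambda>n. measure (pos_variation \<Omega> \<nu>) (C n) - measure (neg_variation \<Omega> \<nu>) (C n)) \<longlonglongrightarrow> \<nu> \<Omega>"
      unfolding finite_vmeasure_eq_pos_neg[OF that borel_of_top]
      using finite_measure_pos_variation[OF that] finite_measure_neg_variation[OF that]
      by (intro tendsto_diff *) auto
    then show ?thesis using Cb by (simp add: finite_vmeasure_eq_pos_neg[OF that] image_subset_iff)
  qed
  \<comment> \<open>The complement step of the induction needs equal values on
    \<open>\<Omega>\<close> itself, which need not be compact; they are limits along a compact
    exhaustion.\<close>
  have top: "\<nu>1 \<Omega> = \<nu>2 \<Omega>"
    using lim[OF \<nu>(1)] lim[OF \<nu>(2)] eq C(1,2) by (simp add: LIMSEQ_unique)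
  have s: "sigma_sets \<Omega> {C. compact C \<and> C \<subseteq> \<Omega>} = borel_of \<Omega>" using borel_of_compact_sigma[OF \<Omega>] by simp
  have "Int_stable {C. compact C \<and> C \<subseteq> \<Omega>}" by (auto simp: Int_stable_def)
  moreover have "{C. compact C \<and> C \<subseteq> \<Omega>} \<subseteq> Pow \<Omega>" by auto
  moreover have "A \<in> sigma_sets \<Omega> {C. compact C \<and> C \<subseteq> \<Omega>}" using A s by simp
  ultimately show ?thesis
  proof (induction rule: sigma_sets_induct_disjoint)
    case (basic A) then show ?case using eq by simp
  next
    case empty then show ?case using \<nu> by (simp add: finite_vmeasure_empty)
  next
    case (compl A)
    then have "A \<in> borel_of \<Omega>" using s by simp
    then show ?case using compl top borel_of_subset[of A \<Omega>] \<nu> by (simp add: finite_vmeasure_Diff)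
  next
    case (union A)
    then have "range A \<subseteq> borel_of \<Omega>" using s by auto
    then have "(\<lambda>i. \<nu>1 (A i)) sums \<nu>1 (\<Union>i. A i)" "(\<lambda>i. \<nu>2 (A i)) sums \<nu>2 (\<Union>i. A i)"
      using union(1) \<nu> by (auto intro!: finite_vmeasure_sums)
    then show ?case using union(3) by (simp add: sums_unique2)
  qed
qed

text \<open>Among the Lebesgue null sets one of maximal \<open>M\<close>-mass exists. Removing it
  leaves an absolutely continuous measure, to which the Radon-Nikodym theorem applies.\<close>

lemma lebesgue_decomposition_measure:
  fixes M :: "'a::euclidean_space measure"
  assumes \<Omega>: "open \<Omega>" and M: "finite_measure M" "sets M = borel_of \<Omega>"
  shows "\<exists>g N. integrable lborel (g :: 'a \<Rightarrow> real) \<and> N \<in> borel_of \<Omega> \<and> emeasure lborel N = 0 \<and>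
    (\<forall>A\<in>borel_of \<Omega>. A \<inter> N = {} \<longrightarrow> measure M A = (LINT x:A|lborel. g x))"
proof -
  interpret M: finite_measure M by fact
  let ?L = "restrict_space lborel \<Omega>"
  have \<Omega>b: "\<Omega> \<in> sets lborel" using \<Omega> by simp
  have spM: "space M = \<Omega>" using sets_eq_imp_space_eq[OF M(2)] by simp
  have setsL: "sets ?L = borel_of \<Omega>" by (simp add: sets_restrict_space)
  have bo: "borel_of \<Omega> = {A \<in> sets borel. A \<subseteq> \<Omega>}" by (rule borel_of_open_eq[OF \<Omega>])
  let ?Z = "{N\<in>borel_of \<Omega>. emeasure lborel N = 0}"
  define s where "s = (SUP N\<in>?Z. measure M N)"
  have bdd: "bdd_above (measure M ` ?Z)"
    using M.bounded_measure spM by (intro bdd_aboveI2[of _ _ "measure M \<Omega>"]) simp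
  have "{} \<in> ?Z" by simp
  then have ne: "?Z \<noteq> {}" by blast
  have "\<exists>N\<in>?Z. s - 1 / real (Suc k) < measure M N" for k
    using less_cSUP_iff[OF ne bdd, of "s - 1 / real (Suc k)"] unfolding s_def by simp
  \<comment> \<open>Null sets whose masses approach the supremum; their countable union is again
    null and attains it.\<close>
  then obtain Z where Z: "\<And>k. Z k \<in> ?Z" "\<And>k. s - 1 / real (Suc k) < measure M (Z k)" by metis
  define N where "N = (\<Union>k. Z k)"
  have N: "N \<in> ?Z"
  proof -
    have "N \<in> borel_of \<Omega>" unfolding N_def using Z(1) by (intro sets.countable_UN) auto
    moreover have "N \<in> null_sets lborel" unfolding N_def
      using Z(1) bo by (intro null_sets_UN) (auto simp: null_sets_def)
    ultimately show ?thesis by auto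
  qed
  have le_s: "measure M B \<le> s" if "B \<in> ?Z" for B
    unfolding s_def by (rule cSUP_upper[OF that bdd])
  have "s \<le> measure M N"
  proof (rule LIMSEQ_le_const2)
    show "(\<lambda>k. s - 1 / real (Suc k)) \<longlonglongrightarrow> s"
      using tendsto_diff[OF tendsto_const LIMSEQ_inverse_real_of_nat, of s] by (simp add: inverse_eq_divide)
    have "measure M (Z k) \<le> measure M N" for k
      using N M(2) by (intro M.finite_measure_mono) (auto simp: N_def)
    then show "\<exists>n. \<forall>k\<ge>n. s - 1 / real (Suc k) \<le> measure M N"
      using Z(2) by (meson less_imp_le order_trans)
  qed
  then have sN: "measure M N = s" using le_s[OF N] by simp
  let ?M = "density M (indicator (\<Omega> - N))"
  have setsM: "sets ?M = sets ?L" using M(2) setsL by simp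
  have emM: "emeasure ?M A = emeasure M (A - N)" if "A \<in> borel_of \<Omega>" for A
  proof -
    have Nb: "N \<in> borel_of \<Omega>" using N by blast
    have s: "\<Omega> - N \<in> sets M" "A \<in> sets M" "A - N \<in> sets M"
      unfolding M(2) by (rule sets.Diff[OF borel_of_top Nb], rule that, rule sets.Diff[OF that Nb])
    have "emeasure ?M A = (\<integral>\<^sup>+x. indicator (\<Omega> - N) x * indicator A x \<partial>M)"
      using s by (intro emeasure_density borel_measurable_indicator)
    also have "(\<integral>\<^sup>+x. indicator (\<Omega> - N) x * indicator A x \<partial>M) = (\<integral>\<^sup>+x. indicator (A - N) x \<partial>M)"
      using borel_of_subset[OF that] by (intro nn_integral_cong) (auto split: split_indicator)
    also have "\<dots> = emeasure M (A - N)" using s(3) by (rule nn_integral_indicator)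
    finally show ?thesis .
  qed
  have "absolutely_continuous ?L ?M"
    unfolding absolutely_continuous_def
  proof
    fix A assume "A \<in> null_sets ?L"
    then have A: "A \<in> borel_of \<Omega>" "emeasure lborel A = 0"
      using null_sets_restrict_space[OF \<Omega>b, of A] bo by (auto simp: null_sets_def)
    \<comment> \<open>If \<open>A - N\<close> carried mass, then adding a null set \<open>A\<close>
      to \<open>N\<close> would exceed the maximal mass \<open>s\<close>.\<close>
    have "A \<union> N \<in> ?Z" using A N emeasure_Un_null_set[of A lborel N] bo by (auto simp: null_sets_def)
    from le_s[OF this] have "measure M (A \<union> N) \<le> s" .
    moreover have "measure M (N \<union> (A - N)) = measure M N + measure M (A - N)"
    proof (rule M.finite_measure_Union)
      show "N \<in> sets M" "A - N \<in> sets M" using N A(1) unfolding M(2) by (blast intro: sets.Diff)+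
    qed blast
    then have "measure M (A \<union> N) = measure M N + measure M (A - N)"
      by (simp add: Un_commute)
    ultimately have "measure M (A - N) \<le> 0" using sN by simp
    then have "emeasure M (A - N) = 0" by (simp add: M.emeasure_eq_measure measure_le_0_iff)
    then show "A \<in> null_sets ?M" using A(1) M(2) emM[OF A(1)] by (intro null_setsI) simp_all
  qed
  moreover have "sigma_finite_measure ?L"
    using sigma_finite_measure_restrict_space[OF sigma_finite_lborel] \<Omega>b by simp
  ultimately obtain h where h: "h \<in> borel_measurable ?L" "density ?L h = ?M"
    using sigma_finite_measure.Radon_Nikodym[of ?L ?M] setsM by auto
  \<comment> \<open>The density \<open>h\<close> may be infinite on a null set and is meaningful
    only on \<open>\<Omega>\<close>. The total mass of \<open>M\<close> is finite, so the real
    version \<open>g\<close> loses nothing almost everywhere.\<close>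
  define g where "g x = (if x \<in> \<Omega> then enn2real (h x) else 0)" for x
  have hm: "(\<lambda>x. if x \<in> \<Omega> then h x else 0) \<in> borel_measurable lborel"
    using h(1) \<Omega> by (subst (asm) measurable_restrict_space_iff[of _ _ 0]) (auto simp: indicator_def if_distrib cong: if_cong)
  have gm [measurable]: "g \<in> borel_measurable lborel"
    unfolding g_def using measurable_compose[OF hm, of enn2real borel] by (simp add: if_distrib cong: if_cong)
  have hA: "(\<integral>\<^sup>+x. (if x \<in> A then h x else 0) \<partial>lborel) = emeasure M (A - N)" if "A \<in> borel_of \<Omega>" for A
  proof -
    have "emeasure M (A - N) = emeasure (density ?L h) A" using emM[OF that] h(2) by simp
    also have "\<dots> = (\<integral>\<^sup>+x. h x * indicator A x \<partial>?L)"
      using h(1) that setsL by (intro emeasure_density) auto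
    also have "\<dots> = (\<integral>\<^sup>+x. h x * indicator A x * indicator \<Omega> x \<partial>lborel)"
      using \<Omega>b by (subst nn_integral_restrict_space) auto
    also have "\<dots> = (\<integral>\<^sup>+x. (if x \<in> A then h x else 0) \<partial>lborel)"
      using borel_of_subset[OF that] by (intro nn_integral_cong) (auto split: split_indicator)
    finally show ?thesis by simp
  qed
  have "(\<integral>\<^sup>+x. (if x \<in> \<Omega> then h x else 0) \<partial>lborel) < top"
    unfolding hA[OF borel_of_top] using M.emeasure_finite by (simp only: less_top)
  then have AEh: "AE x in lborel. (if x \<in> \<Omega> then h x else 0) \<noteq> \<infinity>"
    by (intro nn_integral_PInf_AE[OF hm]) simp
  have gA: "(\<integral>\<^sup>+x. ennreal (indicator A x * g x) \<partial>lborel) = emeasure M (A - N)" if "A \<in> borel_of \<Omega>" for A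
    unfolding hA[OF that, symmetric]
  proof (rule nn_integral_cong_AE)
    show "AE x in lborel. ennreal (indicator A x * g x) = (if x \<in> A then h x else 0)"
      using AEh by eventually_elim (use borel_of_subset[OF that] in \<open>auto simp: g_def less_top split: split_indicator\<close>)
  qed
  have g0: "g x \<ge> 0" for x by (simp add: g_def)
  have gi: "integrable lborel g"
  proof (rule integrableI_nonneg)
    have "(\<integral>\<^sup>+x. ennreal (g x) \<partial>lborel) = (\<integral>\<^sup>+x. ennreal (indicator \<Omega> x * g x) \<partial>lborel)"
      by (intro nn_integral_cong) (auto simp: g_def split: split_indicator)
    then show "(\<integral>\<^sup>+x. ennreal (g x) \<partial>lborel) < \<infinity>"
      unfolding gA[OF borel_of_top] infinity_ennreal_def using M.emeasure_finite by (simp only: less_top)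
  qed (use g0 in auto)
  have "measure M A = (LINT x:A|lborel. g x)" if A: "A \<in> borel_of \<Omega>" "A \<inter> N = {}" for A
  proof -
    have "A - N = A" using A by auto
    then have "(\<integral>\<^sup>+x. ennreal (indicator A x * g x) \<partial>lborel) = emeasure M A" using gA[OF A(1)] by simp
    moreover have "A \<in> sets borel" using A bo by simp
    ultimately show ?thesis
      unfolding set_lebesgue_integral_def measure_def real_scaleR_def using g0
      by (subst integral_eq_nn_integral) simp_all
  qed
  then show ?thesis using gi N by blast
qed

text \<open>The notions are stated with the completed measure on subsets. Translations, reflections
  and product measures are handled with the Borel measure on the whole space, and this lemma is the
  bridge.\<close>

lemma integral_lebesgue_on_eq:
  fixes g :: "'a::euclidean_space \<Rightarrow> 'b::euclidean_space"
  assumes "g \<in> borel_measurable borel" "A \<in> sets borel"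
  shows "(LINT x|lebesgue_on A. g x) = (LINT x:A|lborel. g x)"
proof -
  have "(LINT x|lebesgue_on A. g x) = (LINT x|lebesgue. indicator A x *\<^sub>R g x)"
    using assms by (subst integral_restrict_space) (auto simp: sets_completionI_sets)
  also have "\<dots> = (LINT x|lborel. indicator A x *\<^sub>R g x)"
    using assms by (intro integral_completion) auto
  finally show ?thesis by (simp add: set_lebesgue_integral_def)
qed

lemma integrable_lebesgue_on_of_lborel:
  fixes g :: "'a::euclidean_space \<Rightarrow> 'b::euclidean_space"
  assumes "integrable lborel g" "A \<in> sets borel"
  shows "integrable (lebesgue_on A) g"
proof -
  have "integrable lborel (\<lambda>x. indicator A x *\<^sub>R g x)"
    using assms by (intro integrable_mult_indicator) auto
  then have "integrable lebesgue (\<lambda>x. indicator A x *\<^sub>R g x)"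
    using integrable_completion[of "\<lambda>x. indicator A x *\<^sub>R g x" lborel] by auto
  then show ?thesis
    using assms by (subst integrable_restrict_space) (auto simp: sets_completionI_sets)
qed

lemma lebesgue_decomposition_real:
  fixes \<nu> :: "'a::euclidean_space set \<Rightarrow> real"
  assumes \<Omega>: "open \<Omega>" and \<nu>: "finite_vmeasure \<Omega> \<nu>"
  shows "\<exists>g N. integrable lborel (g :: 'a \<Rightarrow> real) \<and> N \<in> borel_of \<Omega> \<and> emeasure lborel N = 0 \<and>
    (\<forall>A\<in>borel_of \<Omega>. A \<inter> N = {} \<longrightarrow> \<nu> A = (LINT x:A|lborel. g x))"
proof -
  obtain g1 N1 where 1: "integrable lborel (g1 :: 'a \<Rightarrow> real)" "N1 \<in> borel_of \<Omega>" "emeasure lborel N1 = 0"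
    "\<And>A. A \<in> borel_of \<Omega> \<Longrightarrow> A \<inter> N1 = {} \<Longrightarrow> measure (pos_variation \<Omega> \<nu>) A = (LINT x:A|lborel. g1 x)"
    using lebesgue_decomposition_measure[OF \<Omega> finite_measure_pos_variation[OF \<nu>]] by auto
  obtain g2 N2 where 2: "integrable lborel (g2 :: 'a \<Rightarrow> real)" "N2 \<in> borel_of \<Omega>" "emeasure lborel N2 = 0"
    "\<And>A. A \<in> borel_of \<Omega> \<Longrightarrow> A \<inter> N2 = {} \<Longrightarrow> measure (neg_variation \<Omega> \<nu>) A = (LINT x:A|lborel. g2 x)"
    using lebesgue_decomposition_measure[OF \<Omega> finite_measure_neg_variation[OF \<nu>]] by auto
  have bo: "\<And>A. A \<in> borel_of \<Omega> \<Longrightarrow> A \<in> sets lborel" using borel_of_open_eq[OF \<Omega>] by auto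
  show ?thesis
  proof (intro exI[of _ "\<lambda>x. g1 x - g2 x"] exI[of _ "N1 \<union> N2"] conjI ballI impI)
    show "integrable lborel (\<lambda>x. g1 x - g2 x)" using 1 2 by simp
    show "N1 \<union> N2 \<in> borel_of \<Omega>" using 1 2 by (intro sets.Un)
    have "N1 \<in> null_sets lborel" "N2 \<in> null_sets lborel" using 1(2,3) 2(2,3) bo by (blast intro: null_setsI)+
    then show "emeasure lborel (N1 \<union> N2) = 0" by (intro null_setsD1 null_sets.Un)
    fix A assume A: "A \<in> borel_of \<Omega>" "A \<inter> (N1 \<union> N2) = {}"
    have "set_integrable lborel A g1" "set_integrable lborel A g2"
      unfolding set_integrable_def using 1(1) 2(1) bo[OF A(1)] by (intro integrable_mult_indicator; simp)+
    moreover have "A \<inter> N1 = {}" "A \<inter> N2 = {}" using A(2) by auto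
    ultimately show "\<nu> A = (LINT x:A|lborel. g1 x - g2 x)"
      unfolding finite_vmeasure_eq_pos_neg[OF \<nu> A(1)] by (simp only: set_integral_diff 1(4)[OF A(1)] 2(4)[OF A(1)])
  qed
qed

lemma ex_ac_density:
  fixes \<nu> :: "'a::euclidean_space set \<Rightarrow> 'a"
  assumes \<Omega>: "open \<Omega>" and \<nu>: "finite_vmeasure \<Omega> \<nu>"
  shows "\<exists>g. is_ac_density \<Omega> \<nu> g"
proof -
  have "\<forall>i\<in>Basis. \<exists>g N. integrable lborel (g :: 'a \<Rightarrow> real) \<and> N \<in> borel_of \<Omega> \<and> emeasure lborel N = 0 \<and>
    (\<forall>A\<in>borel_of \<Omega>. A \<inter> N = {} \<longrightarrow> \<nu> A \<bullet> i = (LINT x:A|lborel. g x))"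
    using lebesgue_decomposition_real[OF \<Omega> finite_vmeasure_inner[OF \<nu>]] by simp
  from bchoice[OF this] obtain g where "\<forall>i\<in>Basis. \<exists>N. integrable lborel (g i :: 'a \<Rightarrow> real) \<and> N \<in> borel_of \<Omega> \<and> emeasure lborel N = 0 \<and>
    (\<forall>A\<in>borel_of \<Omega>. A \<inter> N = {} \<longrightarrow> \<nu> A \<bullet> i = (LINT x:A|lborel. g i x))" ..
  from bchoice[OF this] obtain N where gN: "\<forall>i\<in>Basis. integrable lborel (g i :: 'a \<Rightarrow> real) \<and> N i \<in> borel_of \<Omega> \<and> emeasure lborel (N i) = 0 \<and>
    (\<forall>A\<in>borel_of \<Omega>. A \<inter> N i = {} \<longrightarrow> \<nu> A \<bullet> i = (LINT x:A|lborel. g i x))" ..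
  have bo: "\<And>A. A \<in> borel_of \<Omega> \<Longrightarrow> A \<in> sets borel" using borel_of_open_eq[OF \<Omega>] by auto
  define G where "G x = (\<Sum>i\<in>Basis. g i x *\<^sub>R i)" for x
  have gi: "integrable lborel (g i)" and Nb: "N i \<in> borel_of \<Omega>" and N0: "emeasure lborel (N i) = 0"
    and gNA: "\<And>A. A \<in> borel_of \<Omega> \<Longrightarrow> A \<inter> N i = {} \<Longrightarrow> \<nu> A \<bullet> i = (LINT x:A|lborel. g i x)"
    if "i \<in> Basis" for i using bspec[OF gN that] by simp_all
  have Gi: "integrable lborel G"
    unfolding G_def by (intro Bochner_Integration.integrable_sum integrable_scaleR_left) (use gi in blast)
  have Gm: "G \<in> borel_measurable borel" using borel_measurable_integrable[OF Gi] by simp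
  have "is_ac_density \<Omega> \<nu> G"
    unfolding is_ac_density_def
  proof (intro conjI bexI[of _ "\<Union>i\<in>Basis. N i"] ballI impI)
    show "integrable (lebesgue_on \<Omega>) G" using Gi \<Omega> by (intro integrable_lebesgue_on_of_lborel) auto
    show "(\<Union>i\<in>Basis. N i) \<in> borel_of \<Omega>" using Nb by (intro sets.finite_UN) simp_all
    have "N i \<in> null_sets lborel" if "i \<in> Basis" for i
      using N0[OF that] bo[OF Nb[OF that]] by (intro null_setsI) (simp_all only: sets_lborel)
    then have "(\<Union>i\<in>Basis. N i) \<in> null_sets lborel" by (intro null_sets_UN') (auto intro: countable_finite)
    then show "emeasure lborel (\<Union>i\<in>Basis. N i) = 0" by (rule null_setsD1)
    fix A assume A: "A \<in> borel_of \<Omega>" "A \<inter> (\<Union>i\<in>Basis. N i) = {}"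
    have GA: "integrable lborel (\<lambda>x. indicator A x *\<^sub>R G x)"
      using Gi bo[OF A(1)] by (intro integrable_mult_indicator) auto
    have "\<nu> A \<bullet> i = (LINT x:A|lborel. G x) \<bullet> i" if i: "i \<in> Basis" for i
    proof -
      have "A \<inter> N i = {}" using A(2) i by auto
      then have "\<nu> A \<bullet> i = (LINT x:A|lborel. g i x)" using gNA[OF i A(1)] by simp
      also have "\<dots> = (LINT x|lborel. (indicator A x *\<^sub>R G x) \<bullet> i)"
        unfolding set_lebesgue_integral_def G_def using i by (simp add: inner_sum_left inner_Basis if_distrib sum.If_cases cong: if_cong)
      also have "\<dots> = (LINT x:A|lborel. G x) \<bullet> i"
        unfolding set_lebesgue_integral_def using GA by (rule integral_inner_left[rotated])
      finally show ?thesis .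
    qed
    then show "\<nu> A = (LINT x|lebesgue_on A. G x)"
      unfolding integral_lebesgue_on_eq[OF Gm bo[OF A(1)]] by (subst euclidean_eq_iff) (rule ballI)
  qed
  then show ?thesis by blast
qed

text \<open>Existence turns the choices behind \<open>deriv_measure\<close> and
  \<open>ac_grad\<close> into objects with their defining properties.\<close>

lemma is_ac_density_ac_grad:
  assumes "open \<Omega>" "u \<in> BV \<Omega>"
  shows "is_deriv_measure \<Omega> u (deriv_measure \<Omega> u)"
    and "is_ac_density \<Omega> (deriv_measure \<Omega> u) (ac_grad \<Omega> u)"
proof -
  show d: "is_deriv_measure \<Omega> u (deriv_measure \<Omega> u)"
  proof -
    have "\<exists>\<nu>. is_deriv_measure \<Omega> u \<nu>" using assms(2) unfolding BV_def by blast
    then show "is_deriv_measure \<Omega> u (deriv_measure \<Omega> u)" unfolding deriv_measure_def by (rule someI_ex)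
  qed
  show "is_ac_density \<Omega> (deriv_measure \<Omega> u) (ac_grad \<Omega> u)"
    unfolding ac_grad_def using d
    by (intro someI_ex[of "is_ac_density \<Omega> (deriv_measure \<Omega> u)"] ex_ac_density assms(1))
      (simp add: is_deriv_measure_def)
qed

text \<open>Only the positive part of \<open>g\<close> counts: \<^const>\<open>ennreal\<close> maps negative numbers to 0.\<close>

definition pos_density :: "'a::euclidean_space set \<Rightarrow> ('a \<Rightarrow> real) \<Rightarrow> 'a measure" where
  "pos_density \<Omega> g = density (restrict_space lborel \<Omega>) (\<lambda>x. ennreal (g x))"

context
  fixes \<Omega> :: "'a::euclidean_space set" and g :: "'a \<Rightarrow> real"
  assumes \<Omega>: "open \<Omega>" and g: "integrable lborel g"
begin

lemma sets_pos_density [simp]: "sets (pos_density \<Omega> g) = borel_of \<Omega>"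
  by (simp add: pos_density_def sets_restrict_space)

lemma borel_measurable_density_restrict [measurable]: "g \<in> borel_measurable (restrict_space lborel \<Omega>)"
  using borel_measurable_integrable[OF g] by (rule measurable_restrict_space1)

lemma emeasure_pos_density:
  assumes "A \<in> borel_of \<Omega>"
  shows "emeasure (pos_density \<Omega> g) A = ennreal (LINT x:A|lborel. max 0 (g x))"
proof -
  have A: "A \<in> sets lborel" "A \<subseteq> \<Omega>" using assms borel_of_open_eq[OF \<Omega>] by auto
  have "emeasure (pos_density \<Omega> g) A = (\<integral>\<^sup>+x. ennreal (g x) * indicator A x \<partial>restrict_space lborel \<Omega>)"
    unfolding pos_density_def using assms by (intro emeasure_density) (auto simp: sets_restrict_space)
  also have "\<dots> = (\<integral>\<^sup>+x. ennreal (g x) * indicator A x * indicator \<Omega> x \<partial>lborel)"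
    using \<Omega> by (subst nn_integral_restrict_space) auto
  also have "\<dots> = (\<integral>\<^sup>+x. ennreal (indicator A x *\<^sub>R max 0 (g x)) \<partial>lborel)"
    using A by (intro nn_integral_cong) (auto split: split_indicator simp: max_def ennreal_neg)
  also have "\<dots> = ennreal (LINT x:A|lborel. max 0 (g x))"
    unfolding set_lebesgue_integral_def
  proof (rule nn_integral_eq_integral)
    show "integrable lborel (\<lambda>x. indicator A x *\<^sub>R max 0 (g x))"
      using g A by (intro integrable_mult_indicator) auto
  qed (auto split: split_indicator)
  finally show ?thesis .
qed

lemma measure_pos_density:
  "A \<in> borel_of \<Omega> \<Longrightarrow> measure (pos_density \<Omega> g) A = (LINT x:A|lborel. max 0 (g x))"
  unfolding measure_def by (simp add: emeasure_pos_density set_lebesgue_integral_def)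

lemma finite_measure_pos_density: "finite_measure (pos_density \<Omega> g)"
  using sets_eq_imp_space_eq[OF sets_pos_density] by (intro finite_measureI) (simp add: emeasure_pos_density)

lemma pos_density_integral:
  assumes "f \<in> borel_measurable (restrict_space borel \<Omega>)" "integrable lborel (\<lambda>x. indicator \<Omega> x * (g x * f x))"
  shows "integrable (pos_density \<Omega> g) f"
    and "(LINT x|pos_density \<Omega> g. f x) = (LINT x|lborel. indicator \<Omega> x * (max 0 (g x) * f x))"
proof -
  have eq: "pos_density \<Omega> g = density (restrict_space lborel \<Omega>) (\<lambda>x. ennreal (max 0 (g x)))"
    unfolding pos_density_def by (intro density_cong) (auto simp: max_def ennreal_neg)
  have f: "f \<in> borel_measurable (restrict_space lborel \<Omega>)"
    using assms(1) by (simp cong: measurable_cong_sets sets_restrict_space_cong)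
  have i: "integrable lborel (\<lambda>x. indicator \<Omega> x * (max 0 (g x) * f x))"
  proof (rule Bochner_Integration.integrable_bound[OF assms(2)])
    have "(\<lambda>x. indicator \<Omega> x *\<^sub>R (max 0 (g x) * f x)) \<in> borel_measurable lborel"
      using f \<Omega> by (subst borel_measurable_restrict_space_iff[symmetric]) auto
    then show "(\<lambda>x. indicator \<Omega> x * (max 0 (g x) * f x)) \<in> borel_measurable lborel" by simp
    show "AE x in lborel. norm (indicator \<Omega> x * (max 0 (g x) * f x)) \<le> norm (indicator \<Omega> x * (g x * f x))"
      by (auto simp: abs_mult intro!: mult_right_mono split: split_indicator)
  qed
  have r: "integrable (restrict_space lborel \<Omega>) (\<lambda>x. max 0 (g x) *\<^sub>R f x)"
    using i \<Omega> by (subst integrable_restrict_space) auto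
  show "integrable (pos_density \<Omega> g) f"
    unfolding eq using r f by (subst integrable_density) auto
  have "(LINT x|pos_density \<Omega> g. f x) = (LINT x|restrict_space lborel \<Omega>. max 0 (g x) *\<^sub>R f x)"
    unfolding eq using f by (subst integral_density) auto
  also have "\<dots> = (LINT x|lborel. indicator \<Omega> x *\<^sub>R (max 0 (g x) *\<^sub>R f x))"
    using \<Omega> by (subst integral_restrict_space) auto
  finally show "(LINT x|pos_density \<Omega> g. f x) = (LINT x|lborel. indicator \<Omega> x * (max 0 (g x) * f x))" by simp
qed

end

text \<open>The density is split into positive and negative parts, so that \<open>\<nu>\<close> is a
  difference of two sums of two measures each. The Boolean index \<open>True\<close> marks the
  densities and \<open>False\<close> the Jordan parts of \<open>\<nu>s\<close>.\<close>

lemma signed_integral_ac_plus: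
  fixes \<nu> \<nu>s :: "'a::euclidean_space set \<Rightarrow> real"
  assumes \<Omega>: "open \<Omega>" and g: "integrable lborel g"
    and \<nu>: "finite_vmeasure \<Omega> \<nu>" "finite_vmeasure \<Omega> \<nu>s"
    and eq: "\<And>A. A \<in> borel_of \<Omega> \<Longrightarrow> \<nu> A = (LINT x:A|lborel. g x) + \<nu>s A"
    and f: "integrable (total_variation \<Omega> \<nu>) f" "integrable (total_variation \<Omega> \<nu>s) f"
       "integrable lborel (\<lambda>x. indicator \<Omega> x * (g x * f x))"
  shows "signed_integral \<Omega> \<nu> f = (LINT x|lborel. indicator \<Omega> x * (g x * f x)) + signed_integral \<Omega> \<nu>s f"
proof -
  have fm: "f \<in> borel_measurable (restrict_space borel \<Omega>)"
    using borel_measurable_integrable[OF f(1)] by (simp cong: measurable_cong_sets)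
  have g': "integrable lborel (\<lambda>x. - g x)" using g by simp
  have f3': "integrable lborel (\<lambda>x. indicator \<Omega> x * (- g x * f x))"
    using integrable_minus[OF f(3)] by simp
  note p = pos_density_integral[OF \<Omega> g fm f(3)] and n = pos_density_integral[OF \<Omega> g' fm f3']
  let ?P = "\<lambda>b. if b then pos_density \<Omega> g else pos_variation \<Omega> \<nu>s"
  let ?N = "\<lambda>b. if b then pos_density \<Omega> (\<lambda>x. - g x) else neg_variation \<Omega> \<nu>s"
  have "signed_integral \<Omega> \<nu> f = (\<Sum>i\<in>UNIV. LINT x|?P i. f x) - (\<Sum>j\<in>UNIV. LINT x|?N j. f x)"
  proof (rule signed_integral_eq[OF \<nu>(1) f(1)])
    fix A assume A: "A \<in> borel_of \<Omega>"
    have Ab: "A \<in> sets lborel" using A borel_of_open_eq[OF \<Omega>] by auto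
    have si: "set_integrable lborel A (\<lambda>x. max 0 (g x))" "set_integrable lborel A (\<lambda>x. max 0 (- g x))"
      unfolding set_integrable_def using g Ab by (intro integrable_mult_indicator; simp)+
    have "(LINT x:A|lborel. g x) = (LINT x:A|lborel. max 0 (g x) - max 0 (- g x))"
      by (intro arg_cong[where f="\<lambda>h. LINT x:A|lborel. h x"]) auto
    also have "\<dots> = (LINT x:A|lborel. max 0 (g x)) - (LINT x:A|lborel. max 0 (- g x))"
      using si by (rule set_integral_diff)
    finally show "\<nu> A = (\<Sum>i\<in>UNIV. measure (?P i) A) - (\<Sum>j\<in>UNIV. measure (?N j) A)"
      using A eq[OF A] finite_vmeasure_eq_pos_neg[OF \<nu>(2) A]
      by (simp add: UNIV_bool measure_pos_density[OF \<Omega> g] measure_pos_density[OF \<Omega> g'])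
  qed (use p n finite_measure_pos_density[OF \<Omega> g] finite_measure_pos_density[OF \<Omega> g']
      finite_measure_pos_variation[OF \<nu>(2)] finite_measure_neg_variation[OF \<nu>(2)]
      integrable_pos_variation[OF \<nu>(2) f(2)] integrable_neg_variation[OF \<nu>(2) f(2)] in \<open>auto simp: sets_pos_density[OF \<Omega> g] sets_pos_density[OF \<Omega> g']\<close>)
  also have "\<dots> = (LINT x|lborel. indicator \<Omega> x * (max 0 (g x) * f x)) - (LINT x|lborel. indicator \<Omega> x * (max 0 (- g x) * f x))
      + signed_integral \<Omega> \<nu>s f"
    using p n by (simp add: UNIV_bool signed_integral_def)
  also have "(LINT x|lborel. indicator \<Omega> x * (max 0 (g x) * f x)) - (LINT x|lborel. indicator \<Omega> x * (max 0 (- g x) * f x))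
    = (LINT x|lborel. indicator \<Omega> x * (g x * f x))"
  proof (subst Bochner_Integration.integral_diff[symmetric])
    have bd: "integrable lborel (\<lambda>x. indicator \<Omega> x * (max 0 (h x) * f x))" if h: "h = g \<or> h = (\<lambda>x. - g x)" for h
    proof (rule Bochner_Integration.integrable_bound[OF f(3)])
      have "(\<lambda>x. indicator \<Omega> x *\<^sub>R (max 0 (h x) * f x)) \<in> borel_measurable lborel"
      proof -
        have "h \<in> borel_measurable (restrict_space lborel \<Omega>)"
          using h borel_measurable_density_restrict[OF \<Omega> g] by auto
        moreover have "f \<in> borel_measurable (restrict_space lborel \<Omega>)"
          using fm by (simp cong: measurable_cong_sets sets_restrict_space_cong)
        ultimately show ?thesis
          using \<Omega> by (subst borel_measurable_restrict_space_iff[symmetric]) auto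
      qed
      then show "(\<lambda>x. indicator \<Omega> x * (max 0 (h x) * f x)) \<in> borel_measurable lborel" by simp
      show "AE x in lborel. norm (indicator \<Omega> x * (max 0 (h x) * f x)) \<le> norm (indicator \<Omega> x * (g x * f x))"
        using h by (auto simp: abs_mult intro!: mult_right_mono split: split_indicator)
    qed
    show "integrable lborel (\<lambda>x. indicator \<Omega> x * (max 0 (g x) * f x))"
      "integrable lborel (\<lambda>x. indicator \<Omega> x * (max 0 (- g x) * f x))"
      using bd[of g] bd[of "\<lambda>x. - g x"] by auto
  qed (auto intro!: Bochner_Integration.integral_cong simp: max_def algebra_simps split: split_indicator)
  finally show ?thesis .
qed

section \<open>Smooth functions\<close>

text \<open>A class of differentiable functions closed under partial derivatives consists of smooth
  functions. It is used for the algebra containing the bump function and for convolutions, so no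
  formula for higher derivatives is required.\<close>

lemma cont_diff_coinduct:
  assumes "f \<in> S" "\<And>f x. f \<in> S \<Longrightarrow> f differentiable at x"
    "\<And>f i. f \<in> S \<Longrightarrow> i \<in> Basis \<Longrightarrow> (\<lambda>x. frechet_derivative f (at x) i) \<in> S"
  shows "cont_diff k f"
  using assms(1)
proof (induction k arbitrary: f)
  case 0
  then show ?case using assms(2) by (auto simp: continuous_on_eq_continuous_at intro: differentiable_imp_continuous_within)
next
  case (Suc k)
  then show ?case using assms(2,3) by simp
qed

lemma cont_diff_SucD: "cont_diff (Suc k) f \<Longrightarrow> cont_diff k f"
proof (induction k arbitrary: f)
  case 0
  then show ?case by (auto simp: continuous_on_eq_continuous_at intro: differentiable_imp_continuous_within)
qed simp

lemma cont_diff_const: "cont_diff k (\<lambda>x. c)"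
  by (rule cont_diff_coinduct[of _ "range (\<lambda>c x. c)"]) (auto simp: frechet_derivative_const)

lemma cont_diff_add: "cont_diff k f \<Longrightarrow> cont_diff k g \<Longrightarrow> cont_diff k (\<lambda>x. f x + g x)"
proof (induction k arbitrary: f g)
  case 0 then show ?case by (auto intro: continuous_intros)
next
  case (Suc k)
  then have d: "f differentiable at x" "g differentiable at x" for x by auto
  have "frechet_derivative (\<lambda>x. f x + g x) (at x) = (\<lambda>v. frechet_derivative f (at x) v + frechet_derivative g (at x) v)" for x
    using d[of x] by (intro frechet_derivative_at[symmetric] has_derivative_add) (auto simp: frechet_derivative_works)
  then show ?case using Suc d by (auto intro: differentiable_add)
qed

lemma frechet_derivative_mult:
  fixes f g :: "'a::real_normed_vector \<Rightarrow> real"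
  assumes "f differentiable at x" "g differentiable at x"
  shows "frechet_derivative (\<lambda>x. f x * g x) (at x) =
    (\<lambda>v. f x * frechet_derivative g (at x) v + frechet_derivative f (at x) v * g x)"
  using assms by (intro frechet_derivative_at[symmetric] has_derivative_mult) (auto simp: frechet_derivative_works)

lemma cont_diff_mult: "cont_diff k f \<Longrightarrow> cont_diff k g \<Longrightarrow> cont_diff k (\<lambda>x. f x * g x)"
proof (induction k arbitrary: f g)
  case 0 then show ?case by (auto intro: continuous_intros)
next
  case (Suc k)
  then have d: "f differentiable at x" "g differentiable at x" for x by auto
  have "cont_diff k f" "cont_diff k g" using Suc.prems by (auto intro: cont_diff_SucD)
  then show ?case using Suc d by (auto simp: frechet_derivative_mult intro!: cont_diff_add Suc.IH differentiable_mult)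
qed

lemma frechet_derivative_affine_compose:
  fixes f :: "'a::real_normed_vector \<Rightarrow> real"
  assumes "f differentiable at (a + s *\<^sub>R x)"
  shows "frechet_derivative (\<lambda>x. f (a + s *\<^sub>R x)) (at x) = (\<lambda>v. s * frechet_derivative f (at (a + s *\<^sub>R x)) v)"
    and "(\<lambda>x. f (a + s *\<^sub>R x)) differentiable at x"
proof -
  have "((\<lambda>x. a + s *\<^sub>R x) has_derivative (\<lambda>v. s *\<^sub>R v)) (at x)"
    by (auto intro!: derivative_eq_intros)
  moreover have "(f has_derivative frechet_derivative f (at (a + s *\<^sub>R x))) (at (a + s *\<^sub>R x))"
    using assms by (simp add: frechet_derivative_works)
  ultimately have "((\<lambda>x. f (a + s *\<^sub>R x)) has_derivative (\<lambda>v. frechet_derivative f (at (a + s *\<^sub>R x)) (s *\<^sub>R v))) (at x)"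
    by (rule has_derivative_compose)
  moreover have "frechet_derivative f (at (a + s *\<^sub>R x)) (s *\<^sub>R v) = s * frechet_derivative f (at (a + s *\<^sub>R x)) v" for v
    using linear_frechet_derivative[OF assms] by (simp add: linear_scale)
  ultimately have h: "((\<lambda>x. f (a + s *\<^sub>R x)) has_derivative (\<lambda>v. s * frechet_derivative f (at (a + s *\<^sub>R x)) v)) (at x)"
    by simp
  show "frechet_derivative (\<lambda>x. f (a + s *\<^sub>R x)) (at x) = (\<lambda>v. s * frechet_derivative f (at (a + s *\<^sub>R x)) v)"
    using frechet_derivative_at[OF h] by simp
  show "(\<lambda>x. f (a + s *\<^sub>R x)) differentiable at x" using h by (auto simp: differentiable_def)
qed

lemma cont_diff_affine: "cont_diff k f \<Longrightarrow> cont_diff k (\<lambda>x. f (a + s *\<^sub>R x))"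
proof (induction k arbitrary: f)
  case 0 then show ?case by (auto intro!: continuous_on_compose2[of UNIV f] continuous_intros)
next
  case (Suc k)
  then have d: "f differentiable at x" for x by auto
  have "cont_diff k (\<lambda>x. s * frechet_derivative f (at (a + s *\<^sub>R x)) i)" if "i \<in> Basis" for i
    using Suc.prems Suc.IH[of "\<lambda>x. frechet_derivative f (at x) i"] that
    by (intro cont_diff_mult cont_diff_const) auto
  then show ?case using frechet_derivative_affine_compose[OF d] by simp
qed

subsection \<open>Test functions\<close>

lemma test_functionsI:
  assumes "\<And>k. cont_diff k f" "compact K" "K \<subseteq> \<Omega>" "\<And>x. x \<notin> K \<Longrightarrow> f x = 0"
  shows "f \<in> test_functions \<Omega>"
  using assms unfolding test_functions_def by blast

lemma test_functionsE:
  assumes "f \<in> test_functions \<Omega>"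
  obtains K where "compact K" "K \<subseteq> \<Omega>" "\<And>x. x \<notin> K \<Longrightarrow> f x = 0"
  using assms unfolding test_functions_def by blast

lemma test_functions_mono: "\<Omega> \<subseteq> \<Omega>' \<Longrightarrow> f \<in> test_functions \<Omega> \<Longrightarrow> f \<in> test_functions \<Omega>'"
  unfolding test_functions_def by blast

lemma test_functions_cont_diff: "f \<in> test_functions \<Omega> \<Longrightarrow> cont_diff k f"
  unfolding test_functions_def by blast

lemma test_functions_differentiable: "f \<in> test_functions \<Omega> \<Longrightarrow> f differentiable at x"
  using test_functions_cont_diff[of f \<Omega> 1] by simp

lemma test_functions_has_derivative:
  "f \<in> test_functions \<Omega> \<Longrightarrow> (f has_derivative frechet_derivative f (at x)) (at x)"
  using test_functions_differentiable by (simp add: frechet_derivative_works)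

lemma test_functions_continuous: "f \<in> test_functions \<Omega> \<Longrightarrow> continuous_on A f"
  using test_functions_cont_diff[of f \<Omega> 0] by (auto intro: continuous_on_subset)

lemma test_functions_measurable: "f \<in> test_functions \<Omega> \<Longrightarrow> f \<in> borel_measurable borel"
  using test_functions_continuous[of f \<Omega> UNIV] by (rule borel_measurable_continuous_onI)

lemma test_functions_deriv:
  assumes "f \<in> test_functions \<Omega>" "i \<in> Basis"
  shows "(\<lambda>x. frechet_derivative f (at x) i) \<in> test_functions \<Omega>"
proof -
  obtain K where K: "compact K" "K \<subseteq> \<Omega>" "\<And>x. x \<notin> K \<Longrightarrow> f x = 0" by (rule test_functionsE[OF assms(1)]) blast
  show ?thesis
  proof (rule test_functionsI[OF _ K(1,2)])
    show "cont_diff k (\<lambda>x. frechet_derivative f (at x) i)" for k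
      using test_functions_cont_diff[OF assms(1), of "Suc k"] assms(2) by simp
    fix x assume "x \<notin> K"
    \<comment> \<open>The complement of the compact set is open, so near a point outside
      \<open>K\<close> the function is identically 0 and the same \<open>K\<close> works for its
      derivatives.\<close>
    have "open (- K)" using K(1) by (simp add: compact_imp_closed open_Compl)
    then have "(f has_derivative (\<lambda>_. 0)) (at x)"
      using \<open>x \<notin> K\<close> K(3) by (intro has_derivative_transform_within_open[of "\<lambda>_. 0" "\<lambda>_. 0" x UNIV "- K" f]) auto
    then show "frechet_derivative f (at x) i = 0" using frechet_derivative_at by metis
  qed
qed

lemma test_functions_mult_smooth:
  assumes "f \<in> test_functions \<Omega>" "\<And>k. cont_diff k g"
  shows "(\<lambda>x. f x * g x) \<in> test_functions \<Omega>"
proof -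
  obtain K where K: "compact K" "K \<subseteq> \<Omega>" "\<And>x. x \<notin> K \<Longrightarrow> f x = 0" by (rule test_functionsE[OF assms(1)]) blast
  show ?thesis
    by (rule test_functionsI[OF _ K(1,2)]) (use assms K(3) in \<open>auto intro: cont_diff_mult test_functions_cont_diff\<close>)
qed

lemma test_functions_cmult: "f \<in> test_functions \<Omega> \<Longrightarrow> (\<lambda>x. c * f x) \<in> test_functions \<Omega>"
  using test_functions_mult_smooth[OF _ cont_diff_const, of f \<Omega> c] by (simp add: mult.commute)

lemma test_functions_diff:
  assumes "f \<in> test_functions \<Omega>" "g \<in> test_functions \<Omega>"
  shows "(\<lambda>x. f x - g x) \<in> test_functions \<Omega>"
proof -
  obtain K where K: "compact K" "K \<subseteq> \<Omega>" "\<And>x. x \<notin> K \<Longrightarrow> f x = 0" by (rule test_functionsE[OF assms(1)]) blast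
  obtain K' where K': "compact K'" "K' \<subseteq> \<Omega>" "\<And>x. x \<notin> K' \<Longrightarrow> g x = 0" by (rule test_functionsE[OF assms(2)]) blast
  have "cont_diff k (\<lambda>x. f x + (-1) * g x)" for k
    using assms by (intro cont_diff_add test_functions_cont_diff test_functions_cmult)
  then have "cont_diff k (\<lambda>x. f x - g x)" for k by simp
  then show ?thesis
    by (rule test_functionsI[of _ "K \<union> K'"]) (use K K' in auto)
qed

lemma test_functions_reflect:
  assumes "f \<in> test_functions UNIV"
  shows "(\<lambda>y. f (a - y)) \<in> test_functions UNIV"
proof -
  obtain K where K: "compact K" "\<And>x. x \<notin> K \<Longrightarrow> f x = 0" using test_functionsE[OF assms] by metis
  have "cont_diff k (\<lambda>y. f (a + (-1) *\<^sub>R y))" for k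
    using assms by (intro cont_diff_affine test_functions_cont_diff)
  then have "cont_diff k (\<lambda>y. f (a - y))" for k by simp
  then show ?thesis
  proof (rule test_functionsI)
    show "compact ((\<lambda>x. a - x) ` K)" using K(1) by (intro compact_continuous_image continuous_intros)
    fix x assume "x \<notin> (\<lambda>x. a - x) ` K"
    then have "a - x \<notin> K" by (metis add_diff_cancel diff_add_cancel image_eqI diff_diff_eq2 add_diff_cancel_left')
    then show "f (a - x) = 0" by (rule K(2))
  qed simp
qed

lemma test_functions_bounded:
  assumes "f \<in> test_functions \<Omega>"
  obtains B where "B > 0" "\<And>x. \<bar>f x\<bar> \<le> B"
proof -
  obtain K where K: "compact K" "K \<subseteq> \<Omega>" "\<And>x. x \<notin> K \<Longrightarrow> f x = 0" by (rule test_functionsE[OF assms]) blast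
  have "compact (f ` K)" using K(1) test_functions_continuous[OF assms] by (rule compact_continuous_image[rotated])
  then obtain B where B: "\<And>y. y \<in> f ` K \<Longrightarrow> norm y \<le> B" using compact_imp_bounded bounded_iff by metis
  have "\<bar>f x\<bar> \<le> max 1 B" for x using B[of "f x"] K(3)[of x] by (cases "x \<in> K") auto
  then show ?thesis using that[of "max 1 B"] by simp
qed

lemma test_functions_integrable:
  assumes "f \<in> test_functions \<Omega>" shows "integrable lborel f"
proof -
  obtain K where K: "compact K" "K \<subseteq> \<Omega>" "\<And>x. x \<notin> K \<Longrightarrow> f x = 0" by (rule test_functionsE[OF assms]) blast
  have "integrable lborel (\<lambda>x. indicator K x *\<^sub>R f x)"
    using borel_integrable_compact[OF K(1) test_functions_continuous[OF assms]]
    by (simp add: indicator_def if_distrib cong: if_cong)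
  moreover have "(\<lambda>x. indicator K x *\<^sub>R f x) = f" using K(3) by (auto split: split_indicator)
  ultimately show ?thesis by simp
qed

lemma test_functions_uniformly_continuous:
  assumes "f \<in> test_functions \<Omega>" "e > 0"
  obtains d where "d > 0" "\<And>x y. norm (x - y) < d \<Longrightarrow> \<bar>f x - f y\<bar> < e"
proof -
  obtain K where K: "compact K" "K \<subseteq> \<Omega>" "\<And>x. x \<notin> K \<Longrightarrow> f x = 0" by (rule test_functionsE[OF assms(1)]) blast
  obtain R where "\<And>x. x \<in> K \<Longrightarrow> norm x \<le> R" using compact_imp_bounded[OF K(1)] unfolding bounded_iff by blast
  then have R: "K \<subseteq> cball 0 R" by auto
  \<comment> \<open>The radius exceeds \<open>R\<close> by 1, and only pairs at distance less than 1
    are compared. If one of the two points lies outside this ball, then both lie outside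
    \<open>K\<close>.\<close>
  have "uniformly_continuous_on (cball 0 (R + 1)) f"
    using test_functions_continuous[OF assms(1)] by (intro compact_uniformly_continuous) auto
  then obtain d where d: "d > 0" "\<And>x y. x \<in> cball 0 (R+1) \<Longrightarrow> y \<in> cball 0 (R+1) \<Longrightarrow> dist x y < d \<Longrightarrow> dist (f x) (f y) < e"
    unfolding uniformly_continuous_on_def using assms(2) by (metis dist_commute)
  show ?thesis
  proof (rule that[of "min d 1"])
    fix x y :: 'a assume xy: "norm (x - y) < min d 1"
    show "\<bar>f x - f y\<bar> < e"
    proof (cases "x \<in> cball 0 (R+1) \<and> y \<in> cball 0 (R+1)")
      case True then show ?thesis using d(2)[of x y] xy by (auto simp: dist_norm)
    next
      case False
      have "norm x \<le> norm y + norm (x - y)" "norm y \<le> norm x + norm (x - y)"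
        using norm_triangle_ineq[of y "x - y"] norm_triangle_ineq[of x "y - x"] by (auto simp: norm_minus_commute)
      then have "x \<notin> cball 0 R" "y \<notin> cball 0 R" using False xy by auto
      then have "f x = 0" "f y = 0" using K(3) R by blast+
      then show ?thesis using assms(2) by simp
    qed
  qed (use d in auto)
qed

subsection \<open>A smooth bump function\<close>

text \<open>The factor \<open>inverse t ^ m\<close> makes the family closed, up to linear
  combinations, under differentiation; \<open>m = 0\<close> is the classical flat function.\<close>

definition flat_exp :: "nat \<Rightarrow> real \<Rightarrow> real" where
  "flat_exp m t = (if t > 0 then inverse t ^ m * exp (- inverse t) else 0)"

lemma flat_exp_deriv: "(flat_exp m has_real_derivative flat_exp (m + 2) t - real m * flat_exp (m + 1) t) (at t)"
proof -
  consider "t < 0" | "t > 0" | "t = 0" by linarith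
  then show ?thesis
  proof cases
    case 1
    have "(flat_exp m has_real_derivative 0) (at t)"
      by (rule DERIV_cong_ev[THEN iffD1, of t t "\<lambda>_. 0"], simp)
        (use 1 in \<open>auto simp: flat_exp_def intro: eventually_mono[OF eventually_nhds_in_open[of "{..<0}"]]\<close>)
    then show ?thesis using 1 by (simp add: flat_exp_def)
  next
    case 2
    have "((\<lambda>t. inverse t ^ m * exp (- inverse t)) has_real_derivative
        (real m * inverse t ^ (m - 1) * (- (inverse t ^ 2))) * exp (- inverse t)
         + inverse t ^ m * (exp (- inverse t) * inverse t ^ 2)) (at t)"
      using 2 by (auto intro!: derivative_eq_intros simp: power2_eq_square)
    moreover have "(real m * inverse t ^ (m - 1) * (- (inverse t ^ 2))) * exp (- inverse t)
         + inverse t ^ m * (exp (- inverse t) * inverse t ^ 2) = flat_exp (m + 2) t - real m * flat_exp (m + 1) t"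
      using 2 by (cases m) (simp_all add: flat_exp_def power_add algebra_simps power2_eq_square)
    ultimately have "((\<lambda>t. inverse t ^ m * exp (- inverse t)) has_real_derivative
       flat_exp (m + 2) t - real m * flat_exp (m + 1) t) (at t)" by (simp only:)
    moreover have "eventually (\<lambda>x. inverse x ^ m * exp (- inverse x) = flat_exp m x) (nhds t)"
      using 2 by (intro eventually_mono[OF eventually_nhds_in_open[of "{0<..}"]]) (auto simp: flat_exp_def)
    ultimately show ?thesis by (simp add: DERIV_cong_ev)
  next
    case 3
    \<comment> \<open>With \<open>x = inverse t\<close> the difference quotient from the right at 0
      becomes a power divided by an exponential, which tends to 0 at infinity.\<close>
    have "((\<lambda>x::real. x ^ Suc m / exp x) \<longlongrightarrow> 0) at_top" by (rule tendsto_power_div_exp_0)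
    then have "((\<lambda>t. inverse t ^ Suc m / exp (inverse t)) \<longlongrightarrow> 0) (at_right (0::real))"
      using filterlim_compose filterlim_inverse_at_top_right by blast
    then have "((\<lambda>t. (flat_exp m t - flat_exp m 0) / (t - 0)) \<longlongrightarrow> 0) (at_right (0::real))"
      by (rule Lim_transform_eventually)
         (auto simp: eventually_at_right_field flat_exp_def exp_minus divide_inverse intro!: exI[of _ 1])
    moreover have "((\<lambda>t. (flat_exp m t - flat_exp m 0) / (t - 0)) \<longlongrightarrow> 0) (at_left (0::real))"
      by (rule Lim_transform_eventually[OF tendsto_const])
         (auto simp: eventually_at_left_field flat_exp_def intro!: exI[of _ "-1"])
    ultimately have "(flat_exp m has_real_derivative 0) (at 0)"
      unfolding has_field_derivative_iff by (simp add: filterlim_split_at)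
    then show ?thesis using 3 by (simp add: flat_exp_def)
  qed
qed

text \<open>By the chain rule the derivative of a generator is a combination of generators with a
  linear factor, so this algebra is closed under differentiation and its members are smooth.\<close>

inductive_set flat_algebra :: "real \<Rightarrow> ('a::euclidean_space \<Rightarrow> real) set" for \<epsilon> where
  const: "(\<lambda>_. c) \<in> flat_algebra \<epsilon>"
| coord: "(\<lambda>x. x \<bullet> i) \<in> flat_algebra \<epsilon>"
| flat: "(\<lambda>x. flat_exp m (1 - (x \<bullet> x) / \<epsilon>\<^sup>2)) \<in> flat_algebra \<epsilon>"
| add: "f \<in> flat_algebra \<epsilon> \<Longrightarrow> g \<in> flat_algebra \<epsilon> \<Longrightarrow> (\<lambda>x. f x + g x) \<in> flat_algebra \<epsilon>"
| mult: "f \<in> flat_algebra \<epsilon> \<Longrightarrow> g \<in> flat_algebra \<epsilon> \<Longrightarrow> (\<lambda>x. f x * g x) \<in> flat_algebra \<epsilon>"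

lemma flat_algebra_deriv:
  assumes "f \<in> flat_algebra \<epsilon>"
  shows "\<exists>f'. (\<forall>x. (f has_derivative f' x) (at x)) \<and> (\<forall>v. (\<lambda>x. f' x v) \<in> flat_algebra \<epsilon>)"
  using assms
proof induction
  case (const c)
  show ?case by (intro exI[of _ "\<lambda>_ _. 0"]) (auto intro: flat_algebra.const)
next
  case (coord i)
  show ?case by (intro exI[of _ "\<lambda>_ v. v \<bullet> i"]) (auto intro!: flat_algebra.const derivative_eq_intros)
next
  case (flat m)
  let ?s = "\<lambda>x::'a. 1 - (x \<bullet> x) / \<epsilon>\<^sup>2"
  have ds: "(?s has_derivative (\<lambda>v. - (2 / \<epsilon>\<^sup>2) * (x \<bullet> v))) (at x)" for x
    by (auto intro!: derivative_eq_intros ext simp: inner_commute divide_inverse algebra_simps)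
  have "((\<lambda>x. flat_exp m (?s x)) has_derivative
     (\<lambda>v. (flat_exp (m + 2) (?s x) - real m * flat_exp (m + 1) (?s x)) * (- (2 / \<epsilon>\<^sup>2) * (x \<bullet> v)))) (at x)" for x
    by (rule has_derivative_compose[OF ds flat_exp_deriv[unfolded has_field_derivative_def]])
  moreover have "(\<lambda>x. (flat_exp (m + 2) (?s x) + (- real m) * flat_exp (m + 1) (?s x)) * (- (2 / \<epsilon>\<^sup>2) * (x \<bullet> v))) \<in> flat_algebra \<epsilon>" for v
    by (intro flat_algebra.intros)
  ultimately show ?case by (intro exI[of _ "\<lambda>x v. (flat_exp (m + 2) (?s x) - real m * flat_exp (m + 1) (?s x)) * (- (2 / \<epsilon>\<^sup>2) * (x \<bullet> v))"]) simp
next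
  case (add f g)
  then obtain f' g' where "\<forall>x. (f has_derivative f' x) (at x)" "\<forall>v. (\<lambda>x. f' x v) \<in> flat_algebra \<epsilon>"
    "\<forall>x. (g has_derivative g' x) (at x)" "\<forall>v. (\<lambda>x. g' x v) \<in> flat_algebra \<epsilon>" by blast
  then show ?case by (intro exI[of _ "\<lambda>x v. f' x v + g' x v"]) (auto intro: has_derivative_add flat_algebra.add)
next
  case (mult f g)
  then obtain f' g' where *: "\<forall>x. (f has_derivative f' x) (at x)" "\<forall>v. (\<lambda>x. f' x v) \<in> flat_algebra \<epsilon>"
    "\<forall>x. (g has_derivative g' x) (at x)" "\<forall>v. (\<lambda>x. g' x v) \<in> flat_algebra \<epsilon>" by blast
  then show ?case using mult(1,2)
    by (intro exI[of _ "\<lambda>x v. f x * g' x v + f' x v * g x"]) (auto intro!: has_derivative_mult flat_algebra.add flat_algebra.mult)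
qed

lemma flat_algebra_cont_diff: "f \<in> flat_algebra \<epsilon> \<Longrightarrow> cont_diff k f"
proof (rule cont_diff_coinduct[of f "flat_algebra \<epsilon>"])
  fix f :: "'a \<Rightarrow> real" assume "f \<in> flat_algebra \<epsilon>"
  then obtain f' where f': "\<And>x. (f has_derivative f' x) (at x)" "\<And>v. (\<lambda>x. f' x v) \<in> flat_algebra \<epsilon>"
    using flat_algebra_deriv by blast
  show "f differentiable at x" for x using f' by (auto simp: differentiable_def)
  have "frechet_derivative f (at x) = f' x" for x using frechet_derivative_at[OF f'(1)] by simp
  then show "(\<lambda>x. frechet_derivative f (at x) i) \<in> flat_algebra \<epsilon>" for i using f' by simp
qed

definition bump :: "real \<Rightarrow> 'a::euclidean_space \<Rightarrow> real" where
  "bump \<epsilon> x = flat_exp 0 (1 - (x \<bullet> x) / \<epsilon>\<^sup>2)"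

lemma bump_nonneg: "0 \<le> bump \<epsilon> x" and bump_le_1: "bump \<epsilon> x \<le> 1"
  by (auto simp: bump_def flat_exp_def)

lemma bump_eq_0: "\<epsilon> > 0 \<Longrightarrow> \<epsilon> \<le> norm x \<Longrightarrow> bump \<epsilon> x = 0"
  using power_mono[of \<epsilon> "norm x" 2] by (auto simp: bump_def flat_exp_def field_simps power2_norm_eq_inner)

lemma bump_lower: 
  assumes "\<epsilon> > 0" "norm x \<le> \<epsilon> / 2" shows "exp (- 2) \<le> bump \<epsilon> x"
proof -
  have "x \<bullet> x \<le> (\<epsilon> / 2)\<^sup>2" using power_mono[OF assms(2), of 2] by (simp add: power2_norm_eq_inner)
  then have "(x \<bullet> x) / \<epsilon>\<^sup>2 \<le> 1 / 4" using assms(1) by (simp add: field_simps power2_eq_square)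
  \<comment> \<open>The true lower bound is 3/4; the weaker 1/2 already gives an inverse of at most
    2, hence the constant \<open>exp (- 2)\<close>.\<close>
  then have s: "1 / 2 \<le> 1 - (x \<bullet> x) / \<epsilon>\<^sup>2" by linarith
  then have "inverse (1 - (x \<bullet> x) / \<epsilon>\<^sup>2) \<le> 2" using le_imp_inverse_le[OF s] by simp
  moreover have "0 < 1 - (x \<bullet> x) / \<epsilon>\<^sup>2" using s by linarith
  then have "bump \<epsilon> x = exp (- inverse (1 - (x \<bullet> x) / \<epsilon>\<^sup>2))"
    by (simp only: bump_def flat_exp_def if_True power_0 mult_1_left)
  ultimately show ?thesis by simp
qed

lemma bump_test: "\<epsilon> > 0 \<Longrightarrow> bump \<epsilon> \<in> test_functions UNIV"
  by (rule test_functionsI[of _ "cball 0 \<epsilon>"])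
    (auto simp: bump_def[abs_def] intro!: flat_algebra_cont_diff flat_algebra.flat bump_eq_0[unfolded bump_def])

text \<open>The bump is normalised separately at every scale. Uniformity in
  \<open>\<epsilon>\<close> then comes from comparing its integral with the volume of the
  ball.\<close>

definition mollifier :: "real \<Rightarrow> 'a::euclidean_space \<Rightarrow> real" where
  "mollifier \<epsilon> x = inverse (LINT y|lborel. bump \<epsilon> (y::'a)) * bump \<epsilon> x"

context
  fixes \<epsilon> :: real
  assumes \<epsilon>: "\<epsilon> > 0"
begin

lemma bump_integral_le: "(LINT y|lborel. bump \<epsilon> (y::'a::euclidean_space)) \<le> measure lborel (ball (0::'a) \<epsilon>)"
proof -
  have "(LINT y|lborel. bump \<epsilon> (y::'a)) \<le> (LINT y|lborel. indicator (ball (0::'a) \<epsilon>) y)"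
  proof (rule integral_mono)
    show "integrable lborel (bump \<epsilon> :: 'a \<Rightarrow> real)" by (rule test_functions_integrable[OF bump_test[OF \<epsilon>]])
    show "integrable lborel (indicator (ball (0::'a) \<epsilon>) :: 'a \<Rightarrow> real)"
      by (intro integrable_real_indicator) (use emeasure_bounded_finite[OF bounded_ball] in simp_all)
    show "bump \<epsilon> x \<le> indicator (ball 0 \<epsilon>) x" for x :: 'a
      using bump_le_1[of \<epsilon> x] bump_eq_0[OF \<epsilon>, of x] by (auto split: split_indicator)
  qed
  then show ?thesis by simp
qed

text \<open>On the concentric ball of half the radius the bump is at least \<open>exp (- 2)\<close>,
  and that ball has \<open>(1/2) ^ DIM('a)\<close> of the volume.\<close>

lemma bump_integral_ge:
  "exp (- 2) * (1 / 2) ^ DIM('a) * measure lborel (ball (0::'a) \<epsilon>) \<le> (LINT y|lborel. bump \<epsilon> (y::'a::euclidean_space))"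
proof -
  have "exp (- 2) * measure lborel (ball (0::'a) (\<epsilon>/2)) = (LINT y|lborel. exp (- 2) * indicator (ball (0::'a) (\<epsilon>/2)) y)"
    by simp
  also have "\<dots> \<le> (LINT y|lborel. bump \<epsilon> (y::'a))"
  proof (rule integral_mono)
    show "integrable lborel (bump \<epsilon> :: 'a \<Rightarrow> real)" by (rule test_functions_integrable[OF bump_test[OF \<epsilon>]])
    show "integrable lborel (\<lambda>y::'a. exp (- 2) * indicator (ball (0::'a) (\<epsilon>/2)) y :: real)"
      by (intro integrable_mult_right integrable_real_indicator) (use emeasure_bounded_finite[OF bounded_ball] in simp_all)
    show "exp (- 2) * indicator (ball 0 (\<epsilon>/2)) x \<le> bump \<epsilon> x" for x :: 'a
      using bump_lower[OF \<epsilon>, of x] bump_nonneg[of \<epsilon> x] by (auto split: split_indicator)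
  qed
  finally show ?thesis using \<epsilon> by (simp add: content_ball power_divide mult_ac)
qed

lemma measure_ball_pos: "0 < measure lborel (ball (0::'a::euclidean_space) \<epsilon>)"
  using \<epsilon> by (simp add: content_ball)

lemma bump_integral_pos: "0 < (LINT y|lborel. bump \<epsilon> (y::'a::euclidean_space))"
  by (rule less_le_trans[OF _ bump_integral_ge]) (use measure_ball_pos in auto)

lemma mollifier_nonneg: "0 \<le> mollifier \<epsilon> (x::'a::euclidean_space)"
  unfolding mollifier_def using bump_integral_pos[where ?'a='a]
  by (intro mult_nonneg_nonneg bump_nonneg) (simp add: less_imp_le)

lemma mollifier_eq_0: "\<epsilon> \<le> norm x \<Longrightarrow> mollifier \<epsilon> x = 0"
  by (simp only: mollifier_def bump_eq_0[OF \<epsilon>] mult_zero_right)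

lemma mollifier_test: "mollifier \<epsilon> \<in> test_functions UNIV"
  unfolding mollifier_def[abs_def] by (intro test_functions_cmult bump_test \<epsilon>)

lemma mollifier_integral: "(LINT x|lborel. mollifier \<epsilon> (x::'a::euclidean_space)) = 1"
  unfolding mollifier_def using bump_integral_pos[where ?'a='a] by simp

text \<open>Compared with the normalised indicator of the ball, only a dimensional factor is lost.
  Hence the error of a mollification is controlled by the mean deviation over the ball.\<close>

lemma mollifier_upper: "mollifier \<epsilon> (x::'a::euclidean_space) \<le> exp 2 * 2 ^ DIM('a) / measure lborel (ball (0::'a) \<epsilon>)"
proof -
  have "mollifier \<epsilon> x \<le> inverse (LINT y|lborel. bump \<epsilon> (y::'a)) * 1"
    unfolding mollifier_def using bump_integral_pos[where ?'a='a] bump_le_1 by (intro mult_left_mono) (auto simp: less_imp_le)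
  also have "\<dots> \<le> inverse (exp (- 2) * (1 / 2) ^ DIM('a) * measure lborel (ball (0::'a) \<epsilon>)) * 1"
    using measure_ball_pos[where ?'a='a] by (intro mult_right_mono le_imp_inverse_le bump_integral_ge) auto
  also have "\<dots> = exp 2 * 2 ^ DIM('a) / measure lborel (ball (0::'a) \<epsilon>)"
    by (simp add: exp_minus power_divide field_simps)
  finally show ?thesis .
qed

text \<open>The counterpart to the upper bound: the mollification of a nonnegative function
  dominates a fixed fraction of its average over the ball of half the radius. This feeds the lower
  bound at trace points.\<close>

lemma mollifier_lower:
  "norm x \<le> \<epsilon> / 2 \<Longrightarrow> exp (- 2) / measure lborel (ball (0::'a) \<epsilon>) \<le> mollifier \<epsilon> (x::'a::euclidean_space)"
  unfolding mollifier_def divide_inverse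
  by (subst mult.commute, rule mult_mono) (use bump_integral_pos[where ?'a='a] bump_integral_le[where ?'a='a] bump_lower[OF \<epsilon>] in
     \<open>auto intro: le_imp_inverse_le simp: less_imp_le\<close>)

end

lemma mollifier_minus: "mollifier \<epsilon> (- x) = mollifier \<epsilon> x"
  by (simp add: mollifier_def bump_def)

section \<open>Convolution\<close>

lemma distr_lborel_reflect: "distr lborel borel (\<lambda>y. a - y) = (lborel :: 'a::euclidean_space measure)"
proof -
  have "lborel = density (distr lborel borel (\<lambda>x::'a. a + (\<Sum>j\<in>Basis. ((-1::real) * (x \<bullet> j)) *\<^sub>R j))) (\<lambda>_. ennreal (\<Prod>j\<in>(Basis::'a set). \<bar>-1::real\<bar>))"
    using lborel_affine_euclidean[of "\<lambda>_. -1" a] by simp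
  moreover have "(\<Sum>j\<in>Basis. ((-1::real) * (x \<bullet> j)) *\<^sub>R j) = - x" for x :: 'a
    using euclidean_representation[of x] by (simp add: sum_negf)
  ultimately show ?thesis by (simp add: density_1)
qed

lemma distr_lborel_translate: "distr lborel borel (\<lambda>y. a + y) = (lborel :: 'a::euclidean_space measure)"
  using lborel_distr_plus[of a] by simp

lemma lborel_integral_reflect:
  fixes f :: "'a::euclidean_space \<Rightarrow> 'b::{banach, second_countable_topology}"
  assumes [measurable]: "f \<in> borel_measurable borel"
  shows "(LINT y|lborel. f (a - y)) = (LINT y|lborel. f y)"
    and "integrable lborel (\<lambda>y. f (a - y)) \<longleftrightarrow> integrable lborel f"
proof -
  have "(LINT y|distr lborel borel (\<lambda>y. a - y). f y) = (LINT y|lborel. f (a - y))"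
    by (rule integral_distr) auto
  then show "(LINT y|lborel. f (a - y)) = (LINT y|lborel. f y)" by (simp add: distr_lborel_reflect)
  have "integrable (distr lborel borel (\<lambda>y. a - y)) f \<longleftrightarrow> integrable lborel (\<lambda>y. f (a - y))"
    by (rule integrable_distr_eq) auto
  then show "integrable lborel (\<lambda>y. f (a - y)) \<longleftrightarrow> integrable lborel f" by (simp add: distr_lborel_reflect)
qed

lemma lborel_integral_translate:
  fixes f :: "'a::euclidean_space \<Rightarrow> 'b::{banach, second_countable_topology}"
  assumes [measurable]: "f \<in> borel_measurable borel"
  shows "(LINT y|lborel. f (a + y)) = (LINT y|lborel. f y)"
    and "integrable lborel (\<lambda>y. f (a + y)) \<longleftrightarrow> integrable lborel f"
proof -
  have "(LINT y|distr lborel borel (\<lambda>y. a + y). f y) = (LINT y|lborel. f (a + y))"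
    by (rule integral_distr) auto
  then show "(LINT y|lborel. f (a + y)) = (LINT y|lborel. f y)" by (simp add: distr_lborel_translate)
  have "integrable (distr lborel borel (\<lambda>y. a + y)) f \<longleftrightarrow> integrable lborel (\<lambda>y. f (a + y))"
    by (rule integrable_distr_eq) auto
  then show "integrable lborel (\<lambda>y. f (a + y)) \<longleftrightarrow> integrable lborel f" by (simp add: distr_lborel_translate)
qed

definition conv :: "('a::euclidean_space \<Rightarrow> real) \<Rightarrow> ('a \<Rightarrow> real) \<Rightarrow> 'a \<Rightarrow> real" where
  "conv f u x = (LINT y|lborel. f (x - y) * u y)"

lemma conv_integrable:
  assumes f: "f \<in> test_functions UNIV" and u: "integrable lborel u"
  shows "integrable lborel (\<lambda>y. f (x - y) * u y)"
proof -
  obtain B where B: "B > 0" "\<And>x. \<bar>f x\<bar> \<le> B" by (rule test_functions_bounded[OF f]) blast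
  have [measurable]: "f \<in> borel_measurable borel" "u \<in> borel_measurable borel"
    using test_functions_measurable[OF f] borel_measurable_integrable[OF u] by auto
  show ?thesis
  proof (rule Bochner_Integration.integrable_bound[of lborel "\<lambda>y. B * u y"])
    show "AE y in lborel. norm (f (x - y) * u y) \<le> norm (B * u y)"
      using B by (auto simp: abs_mult intro!: mult_right_mono)
  qed (use u in auto)
qed

lemma frechet_derivative_basis_sum:
  fixes f :: "'a::euclidean_space \<Rightarrow> real"
  assumes "f differentiable at x"
  shows "frechet_derivative f (at x) v = (\<Sum>i\<in>Basis. (v \<bullet> i) * frechet_derivative f (at x) i)"
proof -
  have "frechet_derivative f (at x) (\<Sum>i\<in>Basis. (v \<bullet> i) *\<^sub>R i) = (\<Sum>i\<in>Basis. (v \<bullet> i) * frechet_derivative f (at x) i)"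
    using linear_frechet_derivative[OF assms] by (simp add: linear_sum linear_scale)
  then show ?thesis by (simp add: euclidean_representation)
qed

text \<open>The partial derivatives are uniformly continuous, so \<open>d\<close> does not depend on
  \<open>z\<close>. That uniformity allows differentiation under the integral against a merely
  integrable function. Each partial derivative may vary by \<open>e / DIM('a)\<close>, since the
  coordinates are summed.\<close>

lemma test_functions_linearization:
  fixes f :: "'a::euclidean_space \<Rightarrow> real"
  assumes f: "f \<in> test_functions \<Omega>" and "e > 0"
  obtains d where "d > 0"
    "\<And>z h. norm h < d \<Longrightarrow> \<bar>f (z + h) - f z - frechet_derivative f (at z) h\<bar> \<le> e * norm h"
proof -
  let ?D = "\<lambda>i x. frechet_derivative f (at x) i"
  let ?n = "real DIM('a)"
  have n: "?n > 0" by simp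
  have "\<exists>d>0. \<forall>x y. norm (x - y) < d \<longrightarrow> \<bar>?D i x - ?D i y\<bar> < e / ?n" if "i \<in> Basis" for i
    using test_functions_uniformly_continuous[OF test_functions_deriv[OF f that], of "e / ?n"] assms(2) n
    by (metis divide_pos_pos)
  then obtain d where d: "\<And>i. i \<in> Basis \<Longrightarrow> d i > 0"
    "\<And>i x y. i \<in> Basis \<Longrightarrow> norm (x - y) < d i \<Longrightarrow> \<bar>?D i x - ?D i y\<bar> < e / ?n" by metis
  define d0 where "d0 = Min (d ` Basis)"
  have d0: "d0 > 0" "\<And>i. i \<in> Basis \<Longrightarrow> d0 \<le> d i" unfolding d0_def using d(1) by (auto simp: Min_gr_iff)
  show ?thesis
  proof (rule that[OF d0(1)])
    fix z h :: 'a assume h: "norm h < d0"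
    have "norm (f (z + h) - f z - frechet_derivative f (at z) (z + h - z)) \<le> norm (z + h - z) * e"
    proof (rule differentiable_bound_linearization[where S = "cball z (norm h)" and f' = "\<lambda>x. frechet_derivative f (at x)"])
      fix t :: real assume "t \<in> {0..1}"
      then show "z + t *\<^sub>R (z + h - z) \<in> cball z (norm h)"
        by (auto simp: dist_norm mult_left_le_one_le)
    next
      fix x assume "x \<in> cball z (norm h)"
      show "(f has_derivative frechet_derivative f (at x)) (at x within cball z (norm h))"
        using test_functions_has_derivative[OF f] by (rule has_derivative_at_withinI)
    next
      fix x assume x: "x \<in> cball z (norm h)"
      have nx: "norm (x - z) < d0" using x h by (auto simp: dist_norm norm_minus_commute)
      show "onorm (frechet_derivative f (at x) - frechet_derivative f (at z)) \<le> e"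
        unfolding fun_diff_def
      proof (rule onorm_le)
        fix v :: 'a
        have e1: "norm (frechet_derivative f (at x) v - frechet_derivative f (at z) v)
           = \<bar>\<Sum>i\<in>Basis. (v \<bullet> i) * (?D i x - ?D i z)\<bar>"
          using frechet_derivative_basis_sum[OF test_functions_differentiable[OF f], of _ v]
          by (simp add: sum_subtractf algebra_simps)
        have e2: "\<bar>\<Sum>i\<in>Basis. (v \<bullet> i) * (?D i x - ?D i z)\<bar> \<le> (\<Sum>i\<in>Basis. \<bar>v \<bullet> i\<bar> * \<bar>?D i x - ?D i z\<bar>)"
          using sum_abs[of "\<lambda>i. (v \<bullet> i) * (?D i x - ?D i z)" Basis] by (simp add: abs_mult)
        have e3: "(\<Sum>i\<in>Basis. \<bar>v \<bullet> i\<bar> * \<bar>?D i x - ?D i z\<bar>) \<le> (\<Sum>i\<in>(Basis::'a set). norm v * (e / ?n))"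
          using d(2) d0(2) nx by (intro sum_mono mult_mono Basis_le_norm less_imp_le[OF d(2)]) (auto intro: less_le_trans)
        have e4: "(\<Sum>i\<in>(Basis::'a set). norm v * (e / ?n)) = e * norm v" using n by simp
        show "norm (frechet_derivative f (at x) v - frechet_derivative f (at z) v) \<le> e * norm v"
          using order_trans[OF e2 e3] unfolding e1 e4 .
      qed
    qed auto
    then show "\<bar>f (z + h) - f z - frechet_derivative f (at z) h\<bar> \<le> e * norm h" by (simp add: mult.commute)
  qed
qed

text \<open>The linearisation error of \<open>f\<close> is uniformly small relative to the
  increment, and after integration against \<open>u\<close> it picks up the factor
  \<open>LINT y|lborel. \<bar>u y\<bar>\<close>.\<close>

lemma conv_has_derivative:
  fixes f u :: "'a::euclidean_space \<Rightarrow> real"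
  assumes f: "f \<in> test_functions UNIV" and u: "integrable lborel u"
  shows "(conv f u has_derivative
     (\<lambda>v. \<Sum>i\<in>Basis. (v \<bullet> i) * conv (\<lambda>z. frechet_derivative f (at z) i) u x)) (at x)"
  unfolding has_derivative_at_alt
proof (intro conjI allI impI)
  let ?D = "\<lambda>i z. frechet_derivative f (at z) i"
  show "bounded_linear (\<lambda>v. \<Sum>i\<in>Basis. (v \<bullet> i) * conv (?D i) u x)"
    by (intro bounded_linear_sum bounded_linear_mult_const bounded_linear_inner_left)
  fix e :: real assume e: "e > 0"
  have [measurable]: "f \<in> borel_measurable borel" "u \<in> borel_measurable borel"
    using test_functions_measurable[OF f] borel_measurable_integrable[OF u] by auto
  define U where "U = (LINT y|lborel. \<bar>u y\<bar>)"
  have U: "U \<ge> 0" by (simp add: U_def)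
  \<comment> \<open>The divisor is \<open>U + 1\<close> because the integral \<open>U\<close> may be
    0.\<close>
  obtain d where d: "d > 0"
    "\<And>z h. norm h < d \<Longrightarrow> \<bar>f (z + h) - f z - frechet_derivative f (at z) h\<bar> \<le> (e / (U + 1)) * norm h"
    using test_functions_linearization[OF f, of "e / (U + 1)"] e U by (metis add_nonneg_pos divide_pos_pos zero_less_one)
  have Di: "integrable lborel (\<lambda>y. ?D i (x - y) * u y)" if "i \<in> Basis" for i
    by (intro conv_integrable test_functions_deriv f u that)
  show "\<exists>d>0. \<forall>y. norm (y - x) < d \<longrightarrow>
      norm (conv f u y - conv f u x - (\<Sum>i\<in>Basis. ((y - x) \<bullet> i) * conv (?D i) u x)) \<le> e * norm (y - x)"
  proof (intro exI[of _ d] conjI allI impI d(1))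
    fix x' assume x': "norm (x' - x) < d"
    let ?h = "x' - x"
    let ?r = "\<lambda>y. f (x' - y) - f (x - y) - frechet_derivative f (at (x - y)) ?h"
    have r: "\<bar>?r y\<bar> \<le> (e / (U + 1)) * norm ?h" for y
      using d(2)[OF x', of "x - y"] by simp
    have fd: "frechet_derivative f (at (x - y)) ?h = (\<Sum>i\<in>Basis. (?h \<bullet> i) * ?D i (x - y))" for y
      by (rule frechet_derivative_basis_sum[OF test_functions_differentiable[OF f]])
    have req: "?r y * u y = f (x' - y) * u y - f (x - y) * u y - (\<Sum>i\<in>Basis. (?h \<bullet> i) * (?D i (x - y) * u y))" for y
      unfolding fd by (simp add: algebra_simps sum_distrib_left sum_distrib_right)
    have ir: "integrable lborel (\<lambda>y. ?r y * u y)"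
      unfolding req using conv_integrable[OF f u] Di by (intro Bochner_Integration.integrable_diff Bochner_Integration.integrable_sum integrable_mult_right) auto
    have e1: "conv f u x' - conv f u x - (\<Sum>i\<in>Basis. (?h \<bullet> i) * conv (?D i) u x) = (LINT y|lborel. ?r y * u y)"
      unfolding req conv_def using conv_integrable[OF f u] Di by (simp add: integral_sum)
    have "norm (LINT y|lborel. ?r y * u y) \<le> (LINT y|lborel. \<bar>?r y * u y\<bar>)"
      using integral_norm_bound[of lborel "\<lambda>y. ?r y * u y"] by simp
    also have "\<dots> \<le> (LINT y|lborel. (e / (U + 1)) * norm ?h * \<bar>u y\<bar>)"
    proof (rule integral_mono)
      show "\<bar>?r y * u y\<bar> \<le> (e / (U + 1)) * norm ?h * \<bar>u y\<bar>" for y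
        unfolding abs_mult by (rule mult_right_mono[OF r]) simp
    qed (use ir u in auto)
    also have "\<dots> = (e * norm ?h) * (U / (U + 1))" by (simp add: U_def)
    also have "\<dots> \<le> (e * norm ?h) * 1"
      using U e by (intro mult_left_mono) (auto simp: field_simps)
    finally show "norm (conv f u x' - conv f u x - (\<Sum>i\<in>Basis. (?h \<bullet> i) * conv (?D i) u x)) \<le> e * norm ?h"
      unfolding e1 by simp
  qed
qed

lemma conv_frechet_derivative:
  assumes f: "f \<in> test_functions UNIV" and u: "integrable lborel u" and i: "i \<in> Basis"
  shows "frechet_derivative (conv f u) (at x) i = conv (\<lambda>z. frechet_derivative f (at z) i) u x"
  using frechet_derivative_at[OF conv_has_derivative[OF f u], symmetric] i
  by (simp add: inner_Basis if_distrib[of "\<lambda>c. c * _"] sum.If_cases cong: if_cong) 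

text \<open>All derivatives fall on the test function, so the convolutions with one fixed
  \<open>u\<close> form a class closed under partial derivatives.\<close>

lemma conv_cont_diff:
  assumes f: "f \<in> test_functions UNIV" and u: "integrable lborel u"
  shows "cont_diff k (conv f u)"
proof (rule cont_diff_coinduct[of _ "{conv g u |g. g \<in> test_functions UNIV}"])
  show "conv f u \<in> {conv g u |g. g \<in> test_functions UNIV}" using f by blast
  fix h x assume "h \<in> {conv g u |g. g \<in> test_functions UNIV}"
  then obtain g where g: "g \<in> test_functions UNIV" "h = conv g u" by blast
  show "h differentiable at x" using conv_has_derivative[OF g(1) u] g(2) by (auto simp: differentiable_def)
next
  fix h i assume "h \<in> {conv g u |g. g \<in> test_functions UNIV}" "(i::'a) \<in> Basis"
  then obtain g where g: "g \<in> test_functions UNIV" "h = conv g u" by blast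
  have "(\<lambda>x. frechet_derivative h (at x) i) = conv (\<lambda>z. frechet_derivative g (at z) i) u"
    using conv_frechet_derivative[OF g(1) u \<open>i \<in> Basis\<close>] g(2) by auto
  then show "(\<lambda>x. frechet_derivative h (at x) i) \<in> {conv g u |g. g \<in> test_functions UNIV}"
    using test_functions_deriv[OF g(1) \<open>i \<in> Basis\<close>] by blast
qed

lemma mollifier_integrable_reflect:
  assumes "\<epsilon> > 0"
  shows "integrable lborel (\<lambda>y. mollifier \<epsilon> (x - y))" "(LINT y|lborel. mollifier \<epsilon> (x - y)) = 1"
  by (simp_all add: lborel_integral_reflect[of "mollifier \<epsilon>" x] test_functions_measurable[OF mollifier_test[OF assms]]
    test_functions_integrable[OF mollifier_test[OF assms]] mollifier_integral[OF assms])

lemma conv_mollifier_nonneg: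
  assumes "\<epsilon> > 0" "\<And>y. 0 \<le> u y"
  shows "0 \<le> conv (mollifier \<epsilon>) u x"
  unfolding conv_def by (intro Bochner_Integration.integral_nonneg mult_nonneg_nonneg mollifier_nonneg assms)

lemma conv_abs_le:
  assumes "\<epsilon> > 0"
  shows "\<bar>conv (mollifier \<epsilon>) u x\<bar> \<le> conv (mollifier \<epsilon>) (\<lambda>y. \<bar>u y\<bar>) x"
proof -
  have "\<bar>LINT y|lborel. mollifier \<epsilon> (x - y) * u y\<bar> \<le> (LINT y|lborel. norm (mollifier \<epsilon> (x - y) * u y))"
    using integral_norm_bound[of lborel "\<lambda>y. mollifier \<epsilon> (x - y) * u y"] by simp
  then show ?thesis by (simp add: conv_def abs_mult mollifier_nonneg[OF assms])
qed

lemma conv_mollifier_bounded: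
  assumes "\<epsilon> > 0" "integrable lborel u" "\<And>y. \<bar>u y\<bar> \<le> c"
  shows "\<bar>conv (mollifier \<epsilon>) u x\<bar> \<le> c"
proof -
  have "\<bar>conv (mollifier \<epsilon>) u x\<bar> \<le> (LINT y|lborel. mollifier \<epsilon> (x - y) * \<bar>u y\<bar>)"
    using conv_abs_le[OF assms(1)] by (simp add: conv_def)
  also have "\<dots> \<le> (LINT y|lborel. mollifier \<epsilon> (x - y) * c)"
    by (intro integral_mono conv_integrable mollifier_test mult_left_mono mollifier_nonneg assms
        integrable_mult_left mollifier_integrable_reflect integrable_abs)
  finally show ?thesis by (simp add: mollifier_integrable_reflect[OF assms(1)])
qed

lemma conv_mollifier_eq_0:
  assumes "\<epsilon> > 0" "\<And>y. norm (x - y) < \<epsilon> \<Longrightarrow> u y = 0"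
  shows "conv (mollifier \<epsilon>) u x = 0"
proof -
  have "mollifier \<epsilon> (x - y) * u y = 0" for y
    using assms mollifier_eq_0[OF assms(1), of "x - y"] by (cases "norm (x - y) < \<epsilon>") auto
  then have "(\<lambda>y. mollifier \<epsilon> (x - y) * u y) = (\<lambda>_. 0)" by blast
  then show ?thesis unfolding conv_def by (simp only: Bochner_Integration.integral_zero)
qed

subsection \<open>Cutoff functions and consequences\<close>

text \<open>The neighbourhood of radius \<open>\<delta>/2\<close> is mollified at scale
  \<open>\<delta>/4\<close>. Within \<open>\<delta>/4\<close> of \<open>C\<close> the average meets
  only the value 1, and beyond distance \<open>3\<delta>/4\<close> only the value 0.\<close>

lemma ex_cutoff:
  fixes C :: "'a::euclidean_space set"
  assumes C: "compact C" and \<delta>: "\<delta> > 0"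
  shows "\<exists>\<phi>\<in>test_functions UNIV. (\<forall>x. 0 \<le> \<phi> x \<and> \<phi> x \<le> 1) \<and> (\<forall>x. (\<exists>c\<in>C. dist c x < \<delta>/4) \<longrightarrow> \<phi> x = 1) \<and>
     (\<forall>x. (\<forall>c\<in>C. \<delta> \<le> dist c x) \<longrightarrow> \<phi> x = 0)"
proof -
  define A where "A = (\<Union>c\<in>C. cball c (\<delta>/2))"
  have "A = {c + b |c b. c \<in> C \<and> b \<in> cball 0 (\<delta>/2)}"
  proof (intro set_eqI iffI)
    fix x assume "x \<in> A"
    then obtain c where "c \<in> C" "dist c x \<le> \<delta>/2" unfolding A_def by auto
    then have "x = c + (x - c)" "c \<in> C" "x - c \<in> cball 0 (\<delta>/2)" by (auto simp: dist_norm norm_minus_commute)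
    then show "x \<in> {c + b |c b. c \<in> C \<and> b \<in> cball 0 (\<delta>/2)}" by blast
    next
    fix x assume "x \<in> {c + b |c b. c \<in> C \<and> b \<in> cball 0 (\<delta>/2)}"
    then obtain c b where "x = c + b" "c \<in> C" "b \<in> cball 0 (\<delta>/2)" by blast
    then show "x \<in> A" unfolding A_def by (intro UN_I[of c]) (auto simp: dist_norm)
  qed
  then have cA: "compact A" by (simp only: compact_sums[OF C compact_cball])
  let ?e = "\<delta>/4"
  have e: "?e > 0" using \<delta> by simp
  let ?f = "indicator A :: 'a \<Rightarrow> real"
  have f: "integrable lborel ?f"
    using emeasure_compact_finite[OF cA] by (intro integrable_real_indicator) (simp_all add: borel_compact cA)
  let ?\<phi> = "conv (mollifier ?e) ?f"
  have b: "0 \<le> ?\<phi> x" "?\<phi> x \<le> 1" for x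
    using conv_mollifier_nonneg[OF e, of ?f x] conv_mollifier_bounded[OF e f, of 1 x] by auto
  have z: "?\<phi> x = 0" if "\<forall>c\<in>C. \<delta> \<le> dist c x" for x
  proof (rule conv_mollifier_eq_0[OF e])
    fix y assume y: "norm (x - y) < ?e"
    have "y \<notin> A"
    proof
      assume "y \<in> A" then obtain c where c: "c \<in> C" "dist c y \<le> \<delta>/2" unfolding A_def by auto
      have "dist c x \<le> dist c y + dist y x" by (rule dist_triangle)
      then show False using c y that \<delta> by (auto simp: dist_norm norm_minus_commute)
    qed
    then show "?f y = 0" by simp
  qed
  have o: "?\<phi> x = 1" if "c \<in> C" "dist c x < \<delta>/4" for x c
  proof -
    have "mollifier ?e (x - y) * ?f y = mollifier ?e (x - y)" for y
    proof (cases "norm (x - y) < ?e")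
      case True
      have "dist c y \<le> dist c x + dist x y" by (rule dist_triangle)
      then have "y \<in> A" unfolding A_def using that True by (auto simp: dist_norm intro!: bexI[of _ c])
      then show ?thesis by simp
    next
      case False then show ?thesis using mollifier_eq_0[OF e, of "x - y"] by simp
    qed
    then have "(\<lambda>y. mollifier ?e (x - y) * ?f y) = (\<lambda>y. mollifier ?e (x - y))" by blast
    then show ?thesis unfolding conv_def by (simp only: mollifier_integrable_reflect[OF e])
  qed
  have "?\<phi> \<in> test_functions UNIV"
  proof (rule test_functionsI[of _ "{c + b |c b. c \<in> C \<and> b \<in> cball 0 \<delta>}"])
    show "cont_diff k ?\<phi>" for k by (intro conv_cont_diff mollifier_test e f)
    show "compact {c + b |c b. c \<in> C \<and> b \<in> cball 0 \<delta>}" by (rule compact_sums[OF C compact_cball])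
    fix x assume x: "x \<notin> {c + b |c b. c \<in> C \<and> b \<in> cball 0 \<delta>}"
    have "\<delta> \<le> dist c x" if "c \<in> C" for c
    proof (rule ccontr)
      assume "\<not> \<delta> \<le> dist c x"
      then have "x - c \<in> cball 0 \<delta>" by (simp add: dist_norm norm_minus_commute)
      then show False using x that by (auto dest!: spec[of _ c] spec[of _ "x - c"])
    qed
    then show "?\<phi> x = 0" using z by blast
  qed simp
  then show ?thesis using b z o by (intro bexI[of _ ?\<phi>]) blast+
qed

lemma ex_cutoff_open:
  fixes C :: "'a::euclidean_space set"
  assumes C: "compact C" "C \<subseteq> U" and U: "open U"
  obtains \<phi> V where "\<phi> \<in> test_functions U" "\<And>x. 0 \<le> \<phi> x" "\<And>x. \<phi> x \<le> 1" "open V" "C \<subseteq> V" "V \<subseteq> U"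
    "\<And>x. x \<in> V \<Longrightarrow> \<phi> x = 1"
proof -
  obtain d where d: "d > 0" "{x + e |x e. x \<in> C \<and> e \<in> cball 0 d} \<subseteq> U"
  proof -
    have "\<exists>d>0. (\<Union>x\<in>C. cball x d) \<subseteq> U"
      by (rule compact_subset_open_imp_cball_epsilon_subset[OF C(1) U C(2)]) blast
    then show ?thesis using that by (force simp: dist_norm)
  qed
  obtain \<phi> where \<phi>: "\<phi> \<in> test_functions UNIV" "\<And>x. 0 \<le> \<phi> x \<and> \<phi> x \<le> 1"
    "\<And>x. (\<exists>c\<in>C. dist c x < d/4) \<Longrightarrow> \<phi> x = 1" "\<And>x. (\<forall>c\<in>C. d \<le> dist c x) \<Longrightarrow> \<phi> x = 0"
    using ex_cutoff[OF C(1) d(1)] by blast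
  show ?thesis
  proof (rule that[of \<phi> "\<Union>c\<in>C. ball c (d/4)"])
    show "\<phi> \<in> test_functions U"
    proof (rule test_functionsI[OF _ _ d(2)])
      show "cont_diff k \<phi>" for k by (rule test_functions_cont_diff[OF \<phi>(1)])
      show "compact {x + e |x e. x \<in> C \<and> e \<in> cball 0 d}" by (rule compact_sums[OF C(1) compact_cball])
      fix x assume x: "x \<notin> {x + e |x e. x \<in> C \<and> e \<in> cball 0 d}"
      have "d \<le> dist c x" if "c \<in> C" for c
      proof (rule ccontr)
        assume "\<not> d \<le> dist c x"
        then have "x - c \<in> cball 0 d" by (simp add: dist_norm norm_minus_commute)
        then show False using x that by (auto dest!: spec[of _ c] spec[of _ "x - c"])
      qed
      then show "\<phi> x = 0" using \<phi>(4) by blast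
    qed
    show "(\<Union>c\<in>C. ball c (d/4)) \<subseteq> U"
    proof
      fix x assume "x \<in> (\<Union>c\<in>C. ball c (d/4))"
      then obtain c where c: "c \<in> C" "dist c x < d / 4" by auto
      then have "x = c + (x - c) \<and> x - c \<in> cball 0 d" using d(1) by (simp add: dist_norm norm_minus_commute)
      then show "x \<in> U" using d(2) c(1) by blast
    qed
    show "C \<subseteq> (\<Union>c\<in>C. ball c (d/4))" using d(1) by auto
  qed (use \<phi> in auto)
qed

text \<open>The cut-offs live in the neighbourhoods of radius \<open>1 / Suc k\<close>. A point off
  the closed set \<open>C\<close> leaves these neighbourhoods from some index on.\<close>

lemma cutoff_sequence:
  fixes C :: "'a::euclidean_space set"
  assumes C: "compact C" "C \<subseteq> U" and U: "open U"
  obtains \<phi> :: "nat \<Rightarrow> 'a \<Rightarrow> real" where "\<And>k. \<phi> k \<in> test_functions U" "\<And>k x. 0 \<le> \<phi> k x" "\<And>k x. \<phi> k x \<le> 1"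
    "\<And>x. (\<lambda>k. \<phi> k x) \<longlonglongrightarrow> indicator C x"
proof -
  let ?V = "\<lambda>k. U \<inter> (\<Union>c\<in>C. ball c (1 / real (Suc k)))"
  have "\<exists>\<phi>. \<phi> \<in> test_functions (?V k) \<and> (\<forall>x. 0 \<le> \<phi> x) \<and> (\<forall>x. \<phi> x \<le> 1) \<and> (\<forall>x\<in>C. \<phi> x = 1)" for k
  proof -
    have "open (?V k)" "C \<subseteq> ?V k" using U C(2) by auto
    then show ?thesis using ex_cutoff_open[OF C(1), of "?V k"] by (metis subsetD)
  qed
  then obtain \<phi> where \<phi>: "\<And>k. \<phi> k \<in> test_functions (?V k)" "\<And>k x. 0 \<le> \<phi> k x" "\<And>k x. \<phi> k x \<le> 1"
    "\<And>k x. x \<in> C \<Longrightarrow> \<phi> k x = 1" by metis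
  show ?thesis
  proof (rule that[of \<phi>])
    show "\<phi> k \<in> test_functions U" for k using \<phi>(1)[of k] test_functions_mono[of "?V k" U] by auto
    show "(\<lambda>k. \<phi> k x) \<longlonglongrightarrow> indicator C x" for x
    proof (cases "x \<in> C")
      case True then show ?thesis using \<phi>(4) by simp
    next
      case False
      then have "open (- C)" "x \<in> - C" using C(1) by (auto simp: compact_imp_closed open_Compl)
      then obtain r where r: "r > 0" "ball x r \<subseteq> - C" using open_contains_ball by blast
      obtain N where N: "1 / real (Suc N) < r" using nat_approx_posE[OF r(1)] by blast
      have "\<phi> k x = 0" if "k \<ge> N" for k
      proof -
        have "x \<notin> ?V k"
        proof
          assume "x \<in> ?V k"
          then obtain c where c: "c \<in> C" "dist c x < 1 / real (Suc k)" by auto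
          have "1 / real (Suc k) \<le> 1 / real (Suc N)" using that by (simp add: field_simps)
          then have "c \<in> ball x r" using c N by (auto simp: dist_commute)
          then show False using r c by auto
        qed
        then show ?thesis using test_functionsE[OF \<phi>(1)[of k]] by (metis subsetD)
      qed
      then show ?thesis using False by (intro tendsto_eventually) (auto simp: eventually_sequentially)
    qed
  qed (use \<phi> in auto)
qed

text \<open>Cut-offs approximate the indicator of a compact set boundedly and pointwise, so the
  values on compact sets are limits of tested values. This identifies a chosen derivative measure
  with an explicit one.\<close>

lemma finite_vmeasure_eqI_test:
  fixes \<nu>1 \<nu>2 :: "'a::euclidean_space set \<Rightarrow> real"
  assumes \<Omega>: "open \<Omega>" and \<nu>: "finite_vmeasure \<Omega> \<nu>1" "finite_vmeasure \<Omega> \<nu>2"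
    and eq: "\<And>\<phi>. \<phi> \<in> test_functions \<Omega> \<Longrightarrow> signed_integral \<Omega> \<nu>1 \<phi> = signed_integral \<Omega> \<nu>2 \<phi>"
    and A: "A \<in> borel_of \<Omega>"
  shows "\<nu>1 A = \<nu>2 A"
proof (rule finite_vmeasure_eqI_compact[OF \<Omega> \<nu> _ A])
  fix C assume C: "compact C" "C \<subseteq> \<Omega>"
  obtain \<phi> :: "nat \<Rightarrow> 'a \<Rightarrow> real" where \<phi>: "\<And>k. \<phi> k \<in> test_functions \<Omega>" "\<And>k x. 0 \<le> \<phi> k x" "\<And>k x. \<phi> k x \<le> 1"
    "\<And>x. (\<lambda>k. \<phi> k x) \<longlonglongrightarrow> indicator C x" by (rule cutoff_sequence[OF C \<Omega>]) blast
  have Cb: "C \<in> borel_of \<Omega>" using C \<Omega> by (simp add: borel_of_open_eq borel_compact)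
  have lim: "(\<lambda>k. signed_integral \<Omega> \<nu> (\<phi> k)) \<longlonglongrightarrow> \<nu> C" if "finite_vmeasure \<Omega> \<nu>" for \<nu> :: "'a set \<Rightarrow> real"
  proof -
    have "(\<lambda>k. signed_integral \<Omega> \<nu> (\<phi> k)) \<longlonglongrightarrow> signed_integral \<Omega> \<nu> (indicator C)"
    proof (rule signed_integral_tendsto[OF that, where c = 1])
      show "\<phi> k \<in> borel_measurable (restrict_space borel \<Omega>)" for k
        using test_functions_measurable[OF \<phi>(1)] by (rule measurable_restrict_space1)
      show "(indicator C :: 'a \<Rightarrow> real) \<in> borel_measurable (restrict_space borel \<Omega>)"
        using Cb by (rule borel_measurable_indicator)
      show "\<bar>\<phi> k x\<bar> \<le> 1" for k x using \<phi>(2,3)[of k x] by simp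
    qed (rule \<phi>(4))
    then show ?thesis using signed_integral_indicator[OF that Cb] by simp
  qed
  show "\<nu>1 C = \<nu>2 C"
    using lim[OF \<nu>(1)] lim[OF \<nu>(2)] eq[OF \<phi>(1)] by (simp add: LIMSEQ_unique)
qed

section \<open>Lebesgue points and convergence of mollifications\<close>

definition sign_flip :: "('a::euclidean_space \<Rightarrow> real) \<Rightarrow> 'a \<Rightarrow> 'a" where
  "sign_flip s x = (\<Sum>j\<in>Basis. (s j * (x \<bullet> j)) *\<^sub>R j)"

abbreviation signs :: "('a::euclidean_space \<Rightarrow> real) set" where
  "signs \<equiv> Basis \<rightarrow>\<^sub>E {- 1, 1}"

lemma sign_flip_inner: "j \<in> Basis \<Longrightarrow> sign_flip s x \<bullet> j = s j * (x \<bullet> j)"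
  by (simp add: sign_flip_def)

lemma sign_flip_measurable [measurable]: "sign_flip s \<in> borel_measurable borel"
  unfolding sign_flip_def[abs_def] by measurable

context
  fixes s :: "'a::euclidean_space \<Rightarrow> real"
  assumes s: "s \<in> signs"
begin

lemma sign_cases: "j \<in> Basis \<Longrightarrow> s j = -1 \<or> s j = 1"
  using s by (auto simp: PiE_iff)

lemma sign_flip_flip: "sign_flip s (sign_flip s x) = x"
proof (rule euclidean_eqI)
  fix j :: 'a assume j: "j \<in> Basis"
  then show "sign_flip s (sign_flip s x) \<bullet> j = x \<bullet> j"
    using sign_cases[OF j] by (auto simp: sign_flip_inner)
qed

lemma distr_sign_flip: "distr lborel borel (sign_flip s) = (lborel :: 'a measure)"
proof -
  have "(lborel :: 'a measure) = density (distr lborel borel (\<lambda>x. 0 + (\<Sum>j\<in>Basis. (s j * (x \<bullet> j)) *\<^sub>R j))) (\<lambda>_. ennreal (\<Prod>j\<in>Basis. \<bar>s j\<bar>))"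
    using sign_cases by (intro lborel_affine_euclidean) force
  moreover have "(\<Prod>j\<in>Basis. \<bar>s j\<bar>) = 1"
    using sign_cases by (intro prod.neutral) force
  ultimately show ?thesis by (simp add: sign_flip_def[abs_def] density_1)
qed

end

text \<open>Differentiation for cubes having \<open>x\<close> as lower corner. Such a cube sees only
  one orthant around \<open>x\<close>; the coordinate reflections supply the others.\<close>

definition corner_avg_lim :: "('a::euclidean_space \<Rightarrow> real) \<Rightarrow> 'a \<Rightarrow> bool" where
  "corner_avg_lim f x \<longleftrightarrow> (\<forall>e>0. \<exists>d>0. \<forall>h. 0 < h \<and> h < d \<longrightarrow>
     \<bar>integral (cbox x (x + h *\<^sub>R One)) f / h ^ DIM('a) - f x\<bar> < e)"

lemma set_integrable_bounded:
  fixes u :: "'a::euclidean_space \<Rightarrow> real"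
  assumes u: "integrable lborel u" and A: "A \<in> sets borel" "bounded A"
  shows "set_integrable lborel A (\<lambda>y. \<bar>u y - q\<bar>)"
proof -
  have "set_integrable lborel A u" unfolding set_integrable_def using u A by (intro integrable_mult_indicator) auto
  moreover have "set_integrable lborel A (\<lambda>_. q)"
    unfolding set_integrable_def using A emeasure_bounded_finite[OF A(2)]
    by (intro integrable_scaleR_left integrable_real_indicator) auto
  ultimately have "set_integrable lborel A (\<lambda>y. u y - q)" by (rule set_integral_diff)
  then show ?thesis by (rule set_integrable_abs)
qed

lemma AE_corner_avg_lim:
  assumes u: "integrable lborel u" and s: "s \<in> signs"
  shows "AE x in lborel. corner_avg_lim (\<lambda>y. \<bar>u (sign_flip s y) - q\<bar>) (sign_flip s x)"
proof -
  let ?f = "\<lambda>y. \<bar>u (sign_flip s y) - q\<bar>"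
  have [measurable]: "u \<in> borel_measurable borel" using borel_measurable_integrable[OF u] by simp
  have us: "integrable lborel (\<lambda>y. u (sign_flip s y))"
    using u by (subst integrable_distr_eq[symmetric, of _ _ borel]) (auto simp: distr_sign_flip[OF s])
  have "?f integrable_on cbox a b" for a b
    using set_integrable_bounded[OF us, of "cbox a b" q] by (intro set_borel_integral_eq_integral) auto
  then obtain N where N: "negligible N" "\<And>x e. x \<notin> N \<Longrightarrow> 0 < e \<Longrightarrow> \<exists>d>0. \<forall>h. 0 < h \<and> h < d \<longrightarrow>
         norm (integral (cbox x (x + h *\<^sub>R One)) ?f /\<^sub>R h ^ DIM('a) - ?f x) < e"
    using integrable_ccontinuous_explicit[of ?f] by blast
  have c: "corner_avg_lim ?f x" if "x \<notin> N" for x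
    using N(2)[OF that] unfolding corner_avg_lim_def by (simp add: divide_inverse mult.commute)
  have "N \<in> null_sets (completion lborel)" using N(1) by (simp add: negligible_iff_null_sets)
  then obtain N' where N': "N' \<in> null_sets lborel" "N \<subseteq> N'" by (auto simp: null_sets_completion_iff2)
  \<comment> \<open>The exceptional set belongs to the reflected function. Since reflections
    preserve Lebesgue measure, its preimage is null as well.\<close>
  have "AE x in distr lborel borel (sign_flip s). x \<notin> N'"
    unfolding distr_sign_flip[OF s] using N'(1) by (rule AE_not_in)
  then have "AE x in lborel. sign_flip s x \<notin> N'"
    using N'(1) by (subst (asm) AE_distr_iff) auto
  then show ?thesis by eventually_elim (use c N'(2) in blast)
qed

text \<open>A point \<open>y\<close> of the ball is carried into a corner cube by the reflection
  whose signs are those of the coordinates of \<open>y - x\<close>, so the reflected cubes cover the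
  ball.\<close>

lemma set_integral_ball_le_corners:
  fixes u :: "'a::euclidean_space \<Rightarrow> real"
  assumes u: "integrable lborel u" and r: "r > 0"
  shows "(LINT y:ball x r|lborel. \<bar>u y - q\<bar>)
     \<le> (\<Sum>s\<in>signs. integral (cbox (sign_flip s x) (sign_flip s x + r *\<^sub>R One)) (\<lambda>y. \<bar>u (sign_flip s y) - q\<bar>))"
proof -
  have [measurable]: "u \<in> borel_measurable borel" using borel_measurable_integrable[OF u] by simp
  have fin: "finite (signs :: ('a \<Rightarrow> real) set)" by (intro finite_PiE) auto
  let ?C = "\<lambda>s. cbox (sign_flip s x) (sign_flip s x + r *\<^sub>R One)"
  let ?f = "\<lambda>s y. \<bar>u (sign_flip s y) - q\<bar>"
  have us: "integrable lborel (\<lambda>y. u (sign_flip s y))" if s: "s \<in> signs" for s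
    using u by (subst integrable_distr_eq[symmetric, of _ _ borel]) (auto simp: distr_sign_flip[OF s])
  have si: "set_integrable lborel (?C s) (?f s)" if "s \<in> signs" for s
    by (rule set_integrable_bounded[OF us[OF that]]) auto
  let ?g = "\<lambda>s y. indicator (?C s) (sign_flip s y) * \<bar>u y - q\<bar>"
  have gi: "integrable lborel (?g s)" "(LINT y|lborel. ?g s y) = integral (?C s) (?f s)" if s: "s \<in> signs" for s
  proof -
    have e: "?g s y = (\<lambda>y. indicator (?C s) y * ?f s y) (sign_flip s y)" for y
      by (simp add: sign_flip_flip[OF s])
    have i: "integrable lborel (\<lambda>y. indicator (?C s) y * ?f s y)"
      using si[OF s] by (simp add: set_integrable_def)
    show "integrable lborel (?g s)" unfolding e
      by (subst integrable_distr_eq[symmetric, of _ _ borel]) (use i in \<open>auto simp: distr_sign_flip[OF s]\<close>)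
    have "(LINT y|lborel. ?g s y) = (LINT y|distr lborel borel (sign_flip s). indicator (?C s) y * ?f s y)"
      unfolding e by (rule integral_distr[symmetric]) auto
    also have "\<dots> = (LINT y:?C s|lborel. ?f s y)" by (simp add: distr_sign_flip[OF s] set_lebesgue_integral_def)
    also have "\<dots> = integral (?C s) (?f s)" by (rule set_borel_integral_eq_integral(2)[OF si[OF s]])
    finally show "(LINT y|lborel. ?g s y) = integral (?C s) (?f s)" .
  qed
  have "(LINT y:ball x r|lborel. \<bar>u y - q\<bar>) \<le> (LINT y|lborel. (\<Sum>s\<in>signs. ?g s y))"
    unfolding set_lebesgue_integral_def real_scaleR_def
  proof (rule integral_mono)
    show "integrable lborel (\<lambda>y. indicator (ball x r) y * \<bar>u y - q\<bar>)"
      using set_integrable_bounded[OF u, of "ball x r" q] by (simp add: set_integrable_def)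
    show "integrable lborel (\<lambda>y. \<Sum>s\<in>signs. ?g s y)" using gi by (intro Bochner_Integration.integrable_sum) auto
    fix y
    show "indicator (ball x r) y * \<bar>u y - q\<bar> \<le> (\<Sum>s\<in>signs. ?g s y)"
    proof (cases "y \<in> ball x r")
      case True
      define s where "s = (\<lambda>j\<in>(Basis::'a set). if 0 \<le> (y - x) \<bullet> j then 1 else - 1 :: real)"
      have s: "s \<in> signs" unfolding s_def by (auto simp: PiE_iff)
      have "sign_flip s y \<in> ?C s"
        unfolding mem_box
      proof (intro ballI conjI)
        fix j :: 'a assume j: "j \<in> Basis"
        have "\<bar>(y - x) \<bullet> j\<bar> \<le> norm (y - x)" using j by (rule Basis_le_norm)
        then have "\<bar>(y - x) \<bullet> j\<bar> \<le> r" using True by (auto simp: dist_norm norm_minus_commute)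
        moreover have "s j * (y \<bullet> j) - s j * (x \<bullet> j) = \<bar>(y - x) \<bullet> j\<bar>"
          using j by (simp add: s_def inner_diff_left)
        ultimately show "sign_flip s x \<bullet> j \<le> sign_flip s y \<bullet> j"
          "sign_flip s y \<bullet> j \<le> (sign_flip s x + r *\<^sub>R One) \<bullet> j"
          using j by (auto simp: sign_flip_inner inner_add_left)
      qed
      then have "indicator (ball x r) y * \<bar>u y - q\<bar> = ?g s y" using True by simp
      also have "\<dots> \<le> (\<Sum>s\<in>signs. ?g s y)" using s fin by (intro member_le_sum) auto
      finally show ?thesis .
    qed (auto intro: sum_nonneg)
  qed
  also have "\<dots> = (\<Sum>s\<in>signs. integral (?C s) (?f s))"
    using gi by (subst Bochner_Integration.integral_sum) auto
  finally show ?thesis .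
qed

text \<open>The counterpart of \<open>mean_dev\<close> for the Borel measure; both agree on Borel
  subsets of \<open>\<Omega>\<close> when the functions agree almost everywhere.\<close>

definition mdev :: "('a::euclidean_space \<Rightarrow> real) \<Rightarrow> 'a set \<Rightarrow> real \<Rightarrow> real" where
  "mdev u E z = (LINT y:E|lborel. \<bar>u y - z\<bar>) / measure lborel E"

lemma mdev_nonneg: "0 \<le> mdev u E z"
  unfolding mdev_def set_lebesgue_integral_def by (intro divide_nonneg_nonneg Bochner_Integration.integral_nonneg) auto

lemma measure_ball_eq: "r \<ge> 0 \<Longrightarrow> measure lborel (ball (x::'a::euclidean_space) r) = unit_ball_vol (real DIM('a)) * r ^ DIM('a)"
  by (simp add: content_ball)

lemma mdev_triangle:
  assumes u: "integrable lborel u" and r: "r > 0"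
  shows "mdev u (ball x r) z \<le> mdev u (ball x r) q + \<bar>q - z\<bar>"
proof -
  have p: "measure lborel (ball x r) > 0" using r by (simp add: content_ball)
  have "(LINT y:ball x r|lborel. \<bar>u y - z\<bar>) \<le> (LINT y:ball x r|lborel. \<bar>u y - q\<bar> + \<bar>q - z\<bar>)"
    using set_integrable_bounded[OF u, of "ball x r"] set_integrable_bounded[of "\<lambda>_. 0" "ball x r" "\<bar>q - z\<bar>"]
    by (intro set_integral_mono set_integral_add) auto
  also have "\<dots> = (LINT y:ball x r|lborel. \<bar>u y - q\<bar>) + (LINT y:ball x r|lborel. \<bar>q - z\<bar>)"
    using set_integrable_bounded[OF u, of "ball x r"] set_integrable_bounded[of "\<lambda>_. 0" "ball x r" "\<bar>q - z\<bar>"]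
    by (intro set_integral_add) auto
  also have "(LINT y:ball x r|lborel. \<bar>q - z\<bar>) = \<bar>q - z\<bar> * measure lborel (ball x r)"
    by (simp add: set_lebesgue_integral_def mult.commute)
  finally show ?thesis using p by (simp add: mdev_def field_simps)
qed

text \<open>The differentiation theorem is applied to \<open>\<bar>u - q\<bar>\<close> for rational
  \<open>q\<close>, which keeps the union of the exceptional sets countable; then \<open>q\<close>
  is chosen close to \<open>u x\<close>.\<close>

theorem lebesgue_points:
  fixes u :: "'a::euclidean_space \<Rightarrow> real"
  assumes u: "integrable lborel u"
  shows "AE x in lborel. ((\<lambda>r. mdev u (ball x r) (u x)) \<longlongrightarrow> 0) (at_right 0)"
proof -
  have fin: "finite (signs :: ('a \<Rightarrow> real) set)" by (intro finite_PiE) auto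
  have "AE x in lborel. \<forall>s\<in>(signs :: ('a \<Rightarrow> real) set). \<forall>q\<in>\<rat>. corner_avg_lim (\<lambda>y. \<bar>u (sign_flip s y) - q\<bar>) (sign_flip s x)"
    using AE_corner_avg_lim[OF u] fin countable_rat
    by (intro AE_ball_countable[THEN iffD2] ballI) (auto intro: countable_finite)
  then show ?thesis
  proof eventually_elim
    case (elim x)
    let ?n = "DIM('a)" and ?v = "unit_ball_vol (real DIM('a))"
    \<comment> \<open>Each of the corner averages is below \<open>2 * c\<close>, their number
      divided by the volume of the unit ball passes from cubes to the ball, and the final 1 pays for
      replacing \<open>q\<close> by \<open>u x\<close>.\<close>
    let ?K = "2 * (real (card (signs :: ('a \<Rightarrow> real) set)) / ?v) + 1"
    have v: "?v > 0" by simp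
    have vne: "?v \<noteq> 0" by (rule less_imp_neq[OF v, symmetric])
    have K: "?K > 0" using v by (intro add_nonneg_pos) auto
    show ?case
    proof (rule tendstoI)
      fix e :: real assume e: "e > 0"
      obtain q where q: "q \<in> \<rat>" "\<bar>u x - q\<bar> < e / (2 * ?K)"
        using Rats_dense_in_real[of "u x" "u x + e / (2 * ?K)"] e K by (auto simp: abs_if)
      define c where "c = e / (2 * ?K)"
      have c: "c > 0" using e K by (simp add: c_def)
      have "\<exists>d>0. \<forall>h. 0 < h \<and> h < d \<longrightarrow>
         \<bar>integral (cbox (sign_flip s x) (sign_flip s x + h *\<^sub>R One)) (\<lambda>y. \<bar>u (sign_flip s y) - q\<bar>) / h ^ ?n - \<bar>u x - q\<bar>\<bar> < c"
        if "s \<in> signs" for s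
      proof -
        have "corner_avg_lim (\<lambda>y. \<bar>u (sign_flip s y) - q\<bar>) (sign_flip s x)" using elim that q(1) by blast
        from this[unfolded corner_avg_lim_def, rule_format, OF c] show ?thesis by (simp only: sign_flip_flip[OF that])
      qed
      then obtain d where d: "\<And>s. s \<in> signs \<Longrightarrow> d s > 0"
        "\<And>s h. s \<in> signs \<Longrightarrow> 0 < h \<Longrightarrow> h < d s \<Longrightarrow>
         \<bar>integral (cbox (sign_flip s x) (sign_flip s x + h *\<^sub>R One)) (\<lambda>y. \<bar>u (sign_flip s y) - q\<bar>) / h ^ ?n - \<bar>u x - q\<bar>\<bar> < c"
        by metis
      define d0 where "d0 = Min (insert 1 (d ` signs))"
      have d0: "d0 > 0" "\<And>s. s \<in> signs \<Longrightarrow> d0 \<le> d s"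
        unfolding d0_def using d(1) fin by (auto simp: Min_gr_iff)
      show "\<forall>\<^sub>F r in at_right 0. dist (mdev u (ball x r) (u x)) 0 < e"
        unfolding eventually_at_right_field
      proof (intro exI[of _ d0] conjI allI impI d0(1))
        fix r assume r: "0 < r" "r < d0"
        have "integral (cbox (sign_flip s x) (sign_flip s x + r *\<^sub>R One)) (\<lambda>y. \<bar>u (sign_flip s y) - q\<bar>) \<le> 2 * c * r ^ ?n"
          if s: "s \<in> signs" for s
        proof -
          have "integral (cbox (sign_flip s x) (sign_flip s x + r *\<^sub>R One)) (\<lambda>y. \<bar>u (sign_flip s y) - q\<bar>) / r ^ ?n \<le> 2 * c"
            using d(2)[OF s r(1)] d0(2)[OF s] r(2) q(2) unfolding c_def by linarith
          then show ?thesis using r by (simp add: field_simps)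
        qed
        then have "(LINT y:ball x r|lborel. \<bar>u y - q\<bar>) \<le> (\<Sum>s\<in>(signs :: ('a \<Rightarrow> real) set). 2 * c * r ^ ?n)"
          by (intro order_trans[OF set_integral_ball_le_corners[OF u r(1)]] sum_mono)
        also have "\<dots> = (2 * c * (real (card (signs :: ('a \<Rightarrow> real) set)) / ?v)) * (?v * r ^ ?n)"
          using vne by simp
        finally have "mdev u (ball x r) q \<le> 2 * c * (real (card (signs :: ('a \<Rightarrow> real) set)) / ?v)"
          unfolding mdev_def using r v vne by (subst measure_ball_eq) (auto simp: pos_divide_le_eq)
        then have "mdev u (ball x r) (u x) \<le> 2 * c * (real (card (signs :: ('a \<Rightarrow> real) set)) / ?v) + \<bar>q - u x\<bar>"
          using mdev_triangle[OF u r(1), of x "u x" q] by linarith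
        also have "\<dots> \<le> c * ?K" using q(2) unfolding c_def[symmetric] by (simp add: algebra_simps abs_minus_commute)
        also have "\<dots> < e"
        proof -
          have "e / (2 * k) * k < e" if "k > 0" for k using e that by (simp add: field_simps)
          then show ?thesis unfolding c_def using K by blast
        qed
        finally show "dist (mdev u (ball x r) (u x)) 0 < e" using mdev_nonneg[of u "ball x r" "u x"] by simp
      qed
    qed
  qed
qed

text \<open>The mollifier has integral 1, so the error is an average of \<open>u - z\<close>, and
  \<open>mollifier_upper\<close> bounds it by a multiple of the mean deviation. Convergence thus
  holds wherever an approximate limit exists.\<close>

lemma conv_mollifier_tendsto:
  fixes u :: "'a::euclidean_space \<Rightarrow> real"
  assumes u: "integrable lborel u" and lim: "((\<lambda>r. mdev u (ball x r) z) \<longlongrightarrow> 0) (at_right 0)"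
  shows "((\<lambda>\<epsilon>. conv (mollifier \<epsilon>) u x) \<longlongrightarrow> z) (at_right 0)"
proof -
  let ?C = "exp 2 * 2 ^ DIM('a) :: real"
  have "norm (conv (mollifier \<epsilon>) u x - z) \<le> ?C * mdev u (ball x \<epsilon>) z" if e: "\<epsilon> > 0" for \<epsilon>
  proof -
    have ir: "integrable lborel (\<lambda>y. mollifier \<epsilon> (x - y) * z)"
      using mollifier_integrable_reflect[OF e] by (intro integrable_mult_left)
    have i: "integrable lborel (\<lambda>y. mollifier \<epsilon> (x - y) * (u y - z))"
      unfolding right_diff_distrib by (intro Bochner_Integration.integrable_diff conv_integrable mollifier_test e u ir)
    have "conv (mollifier \<epsilon>) u x - z = (LINT y|lborel. mollifier \<epsilon> (x - y) * u y) - (LINT y|lborel. mollifier \<epsilon> (x - y) * z)"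
      by (simp add: conv_def mollifier_integrable_reflect[OF e])
    also have "\<dots> = (LINT y|lborel. mollifier \<epsilon> (x - y) * (u y - z))"
      unfolding right_diff_distrib by (rule Bochner_Integration.integral_diff[symmetric, OF conv_integrable[OF mollifier_test[OF e] u] ir])
    finally have "norm (conv (mollifier \<epsilon>) u x - z) \<le> (LINT y|lborel. norm (mollifier \<epsilon> (x - y) * (u y - z)))"
      by (simp only: integral_norm_bound)
    also have "\<dots> \<le> (LINT y|lborel. (?C / measure lborel (ball (0::'a) \<epsilon>)) * (indicator (ball x \<epsilon>) y * \<bar>u y - z\<bar>))"
    proof (rule integral_mono)
      show "integrable lborel (\<lambda>y. norm (mollifier \<epsilon> (x - y) * (u y - z)))" using i by (rule integrable_norm)
      show "integrable lborel (\<lambda>y. (?C / measure lborel (ball (0::'a) \<epsilon>)) * (indicator (ball x \<epsilon>) y * \<bar>u y - z\<bar>))"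
        using set_integrable_bounded[OF u, of "ball x \<epsilon>" z] by (intro integrable_mult_right) (simp add: set_integrable_def)
      fix y
      show "norm (mollifier \<epsilon> (x - y) * (u y - z)) \<le> (?C / measure lborel (ball (0::'a) \<epsilon>)) * (indicator (ball x \<epsilon>) y * \<bar>u y - z\<bar>)"
      proof (cases "y \<in> ball x \<epsilon>")
        case True
        have "\<bar>mollifier \<epsilon> (x - y)\<bar> * \<bar>u y - z\<bar> \<le> (?C / measure lborel (ball (0::'a) \<epsilon>)) * \<bar>u y - z\<bar>"
          by (intro mult_right_mono) (simp_all add: mollifier_nonneg[OF e] mollifier_upper[OF e])
        then show ?thesis using True by (simp add: abs_mult)
      next
        case False
        then show ?thesis by (simp add: mollifier_eq_0[OF e] dist_norm)
      qed
    qed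
    also have "\<dots> = ?C * mdev u (ball x \<epsilon>) z"
      using e by (simp add: mdev_def set_lebesgue_integral_def content_ball)
    finally show ?thesis .
  qed
  then have "\<forall>\<^sub>F \<epsilon> in at_right 0. norm (conv (mollifier \<epsilon>) u x - z) \<le> ?C * mdev u (ball x \<epsilon>) z"
    by (auto simp: eventually_at_right_field intro!: exI[of _ 1])
  moreover have "((\<lambda>\<epsilon>. ?C * mdev u (ball x \<epsilon>) z) \<longlongrightarrow> 0) (at_right 0)"
    using tendsto_mult[OF tendsto_const[of ?C] lim] by simp
  ultimately have "((\<lambda>\<epsilon>. conv (mollifier \<epsilon>) u x - z) \<longlongrightarrow> 0) (at_right 0)"
    by (rule Lim_null_comparison)
  then show ?thesis by (rule LIM_zero_cancel)
qed

lemma AE_conv_mollifier_tendsto: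
  assumes "integrable lborel u"
  shows "AE x in lborel. ((\<lambda>\<epsilon>. conv (mollifier \<epsilon>) u x) \<longlongrightarrow> u x) (at_right 0)"
  using lebesgue_points[OF assms] by eventually_elim (rule conv_mollifier_tendsto[OF assms])

lemma conv_measurable:
  "f \<in> test_functions UNIV \<Longrightarrow> integrable lborel u \<Longrightarrow> conv f u \<in> borel_measurable borel"
  using conv_cont_diff[of f u 0] by (intro borel_measurable_continuous_onI) simp

text \<open>The mollifier is even, hence also has integral 1 in its other variable, and the order of
  integration can be exchanged.\<close>

lemma conv_mollifier_integral:
  fixes u :: "'a::euclidean_space \<Rightarrow> real"
  assumes e: "\<epsilon> > 0" and u: "integrable lborel u"
  shows "integrable lborel (conv (mollifier \<epsilon>) u)" "(LINT x|lborel. conv (mollifier \<epsilon>) u x) = (LINT x|lborel. u x)"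
proof -
  have [measurable]: "(mollifier \<epsilon> :: 'a \<Rightarrow> real) \<in> borel_measurable borel" "u \<in> borel_measurable borel"
    using test_functions_measurable[OF mollifier_test[OF e]] borel_measurable_integrable[OF u] by auto
  have m: "(LINT x|lborel. mollifier \<epsilon> (x - y)) = 1" "integrable lborel (\<lambda>x. mollifier \<epsilon> (x - y))" for y :: 'a
  proof -
    have eq: "mollifier \<epsilon> (x - y) = mollifier \<epsilon> (y - x)" for x
      using mollifier_minus[of \<epsilon> "x - y"] by simp
    show "(LINT x|lborel. mollifier \<epsilon> (x - y)) = 1" "integrable lborel (\<lambda>x. mollifier \<epsilon> (x - y))"
      unfolding eq using mollifier_integrable_reflect[OF e, of y] by auto
  qed
  have i: "integrable (lborel \<Otimes>\<^sub>M lborel) (\<lambda>(y, x). mollifier \<epsilon> (x - y) * u y)"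
  proof (rule lborel_pair.Fubini_integrable)
    show "(\<lambda>(y, x). mollifier \<epsilon> (x - y) * u y) \<in> borel_measurable (lborel \<Otimes>\<^sub>M (lborel :: 'a measure))" by measurable
    have "(LINT x|lborel. norm (case (y, x) of (y, x) \<Rightarrow> mollifier \<epsilon> (x - y) * u y)) = \<bar>u y\<bar>" for y
      by (simp add: abs_mult mollifier_nonneg[OF e] m)
    then show "integrable lborel (\<lambda>y. LINT x|lborel. norm (case (y, x) of (y, x) \<Rightarrow> mollifier \<epsilon> (x - y) * u y))"
      using u by simp
    show "AE y in lborel. integrable lborel (\<lambda>x. case (y, x) of (y, x) \<Rightarrow> mollifier \<epsilon> (x - y) * u y)"
      by (simp add: m)
  qed
  have "integrable lborel (\<lambda>x. LINT y|lborel. mollifier \<epsilon> (x - y) * u y)"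
    using lborel_pair.integrable_snd[OF i] by simp
  then show "integrable lborel (conv (mollifier \<epsilon>) u)" by (simp add: conv_def[abs_def])
  have "(LINT x|lborel. conv (mollifier \<epsilon>) u x) = (LINT y|lborel. LINT x|lborel. mollifier \<epsilon> (x - y) * u y)"
    unfolding conv_def by (rule lborel_pair.Fubini_integral[OF i])
  also have "\<dots> = (LINT y|lborel. u y)" by (simp add: m)
  finally show "(LINT x|lborel. conv (mollifier \<epsilon>) u x) = (LINT x|lborel. u x)" .
qed

lemma conv_mollifier_diff:
  assumes "\<epsilon> > 0" "integrable lborel u" "integrable lborel v"
  shows "conv (mollifier \<epsilon>) (\<lambda>y. u y - v y) x = conv (mollifier \<epsilon>) u x - conv (mollifier \<epsilon>) v x"
  unfolding conv_def right_diff_distrib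
  by (intro Bochner_Integration.integral_diff conv_integrable mollifier_test assms)

text \<open>Scheffe's argument: for \<open>u \<ge> 0\<close> the mollifications keep the integral, so it suffices that
  the negative part of \<open>u\<^sub>\<epsilon> - u\<close>, which is dominated by \<open>u\<close>, tends to 0.\<close>

lemma conv_mollifier_L1_nonneg:
  fixes u :: "'a::euclidean_space \<Rightarrow> real"
  assumes u: "integrable lborel u" "\<And>x. 0 \<le> u x" and e: "\<And>k. \<epsilon> k > 0" "\<epsilon> \<longlonglongrightarrow> 0"
  shows "(\<lambda>k. LINT x|lborel. \<bar>conv (mollifier (\<epsilon> k)) u x - u x\<bar>) \<longlonglongrightarrow> 0"
proof -
  let ?c = "\<lambda>k. conv (mollifier (\<epsilon> k)) u"
  have "\<epsilon> k \<noteq> 0" for k using e(1)[of k] by simp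
  then have fl: "filterlim \<epsilon> (at_right 0) sequentially"
    using e by (auto simp: filterlim_at)
  have um [measurable]: "u \<in> borel_measurable borel" using borel_measurable_integrable[OF u(1)] by simp
  have cm [measurable]: "?c k \<in> borel_measurable borel" for k by (intro conv_measurable mollifier_test e u)
  have lim: "(\<lambda>k. LINT x|lborel. max 0 (u x - ?c k x)) \<longlonglongrightarrow> (LINT x|(lborel::'a measure). 0)"
  proof (rule integral_dominated_convergence[where w = u])
    show "AE x in lborel. (\<lambda>k. max 0 (u x - ?c k x)) \<longlonglongrightarrow> 0"
      using AE_conv_mollifier_tendsto[OF u(1)]
    proof eventually_elim
      case (elim x)
      have "(\<lambda>k. ?c k x) \<longlonglongrightarrow> u x" by (rule filterlim_compose[OF elim fl])
      then have "(\<lambda>k. max 0 (u x - ?c k x)) \<longlonglongrightarrow> max 0 (u x - u x)" by (intro tendsto_intros)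
      then show ?case by simp
    qed
    show "AE x in lborel. norm (max 0 (u x - ?c k x)) \<le> u x" for k
      using conv_mollifier_nonneg[OF e(1), of u] u(2) by (intro always_eventually allI) (auto simp: max_def)
  qed (use u in auto)
  have "(LINT x|lborel. \<bar>?c k x - u x\<bar>) = 2 * (LINT x|lborel. max 0 (u x - ?c k x))" for k
  proof -
    have i: "integrable lborel (?c k)" by (rule conv_mollifier_integral[OF e(1) u(1)])
    have "(LINT x|lborel. \<bar>?c k x - u x\<bar>) = (LINT x|lborel. (?c k x - u x) + 2 * max 0 (u x - ?c k x))"
      by (intro Bochner_Integration.integral_cong) (auto simp: max_def abs_if)
    also have "\<dots> = (LINT x|lborel. ?c k x - u x) + (LINT x|lborel. 2 * max 0 (u x - ?c k x))"
      using i u(1) by (intro Bochner_Integration.integral_add) auto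
    also have "(LINT x|lborel. ?c k x - u x) = 0"
      using i u(1) conv_mollifier_integral(2)[OF e(1) u(1)] by simp
    finally show ?thesis by simp
  qed
  then show ?thesis using tendsto_mult[OF tendsto_const[of 2] lim] by simp
qed

lemma conv_mollifier_L1:
  fixes u :: "'a::euclidean_space \<Rightarrow> real"
  assumes u: "integrable lborel u" and e: "\<And>k. \<epsilon> k > 0" "\<epsilon> \<longlonglongrightarrow> 0"
  shows "(\<lambda>k. LINT x|lborel. \<bar>conv (mollifier (\<epsilon> k)) u x - u x\<bar>) \<longlonglongrightarrow> 0"
proof -
  let ?p = "\<lambda>x. max 0 (u x)" and ?n = "\<lambda>x. max 0 (- u x)"
  have p: "integrable lborel ?p" "integrable lborel ?n" using u by auto
  have c: "integrable lborel (conv (mollifier (\<epsilon> k)) v)" if "integrable lborel v" for v k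
    by (rule conv_mollifier_integral[OF e(1) that])
  let ?d = "\<lambda>k v x. \<bar>conv (mollifier (\<epsilon> k)) v x - v x\<bar>"
  have le: "?d k u x \<le> ?d k ?p x + ?d k ?n x" for k x
  proof -
    have "u = (\<lambda>x. ?p x - ?n x)" by auto
    then have "conv (mollifier (\<epsilon> k)) u x = conv (mollifier (\<epsilon> k)) ?p x - conv (mollifier (\<epsilon> k)) ?n x"
      using conv_mollifier_diff[OF e(1) p, of k x] by simp
    then show ?thesis by linarith
  qed
  have i: "integrable lborel (?d k v)" if "integrable lborel v" for k v
    using c[OF that] that by (intro integrable_abs Bochner_Integration.integrable_diff)
  show ?thesis
  proof (rule tendsto_sandwich)
    show "\<forall>\<^sub>F k in sequentially. 0 \<le> (LINT x|lborel. ?d k u x)" by simp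
    show "\<forall>\<^sub>F k in sequentially. (LINT x|lborel. ?d k u x) \<le> (LINT x|lborel. ?d k ?p x) + (LINT x|lborel. ?d k ?n x)"
    proof (intro always_eventually allI)
      fix k
      have "(LINT x|lborel. ?d k u x) \<le> (LINT x|lborel. ?d k ?p x + ?d k ?n x)"
        by (intro integral_mono Bochner_Integration.integrable_add i p u le)
      also have "\<dots> = (LINT x|lborel. ?d k ?p x) + (LINT x|lborel. ?d k ?n x)"
        by (intro Bochner_Integration.integral_add i p)
      finally show "(LINT x|lborel. ?d k u x) \<le> (LINT x|lborel. ?d k ?p x) + (LINT x|lborel. ?d k ?n x)" .
    qed
    show "(\<lambda>k. (LINT x|lborel. ?d k ?p x) + (LINT x|lborel. ?d k ?n x)) \<longlonglongrightarrow> 0"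
      using tendsto_add[OF conv_mollifier_L1_nonneg[OF p(1) _ e] conv_mollifier_L1_nonneg[OF p(2) _ e]] by simp
  qed simp
qed

section \<open>Traces\<close>

lemma unit_ball_vol_nonzero [simp]: "unit_ball_vol (real n) \<noteq> 0"
  by (rule less_imp_neq[symmetric]) simp

lemma ball_pred [measurable]: "Measurable.pred borel (\<lambda>y. y \<in> ball (x::'a::euclidean_space) r)"
  and indicator_ball_measurable [measurable]:
    "(indicator (ball (x::'a) r) :: 'a \<Rightarrow> real) \<in> borel_measurable borel"
  and half_space_pred [measurable]: "Measurable.pred borel (\<lambda>y::'a. 0 < (y - x) \<bullet> e)"
proof -
  have "ball x r \<in> sets borel" by simp
  then show "Measurable.pred borel (\<lambda>y. y \<in> ball x r)" by (simp add: pred_def)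
  show "(indicator (ball x r) :: 'a \<Rightarrow> real) \<in> borel_measurable borel" by (rule borel_measurable_indicator) simp
  have "open {y::'a. 0 < (y - x) \<bullet> e}" by (intro open_Collect_less continuous_intros)
  then show "Measurable.pred borel (\<lambda>y::'a. 0 < (y - x) \<bullet> e)" by (simp add: pred_def)
qed

lemma pred_open_pair:
  assumes "open {p :: 'a::euclidean_space \<times> 'a. P p}"
  shows "Measurable.pred (borel \<Otimes>\<^sub>M borel) P"
  using assms by (simp add: pred_def borel_prod space_pair_measure)

text \<open>Distance of the blow-ups of \<open>v\<close> at \<open>x\<close> from the function equal to \<open>a\<close> on the side of \<open>e\<close> and to
  \<open>b\<close> on the other side; it unifies approximate limits (\<open>a = b\<close>) and approximate jumps.\<close>

definition jdev :: "('a::euclidean_space \<Rightarrow> real) \<Rightarrow> 'a \<Rightarrow> 'a \<Rightarrow> real \<Rightarrow> real \<Rightarrow> real \<Rightarrow> real" where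
  "jdev v x e a b r = (LINT y:ball x r|lborel. if 0 < (y - x) \<bullet> e then \<bar>v y - a\<bar> else \<bar>v y - b\<bar>) / measure lborel (ball x r)"

definition trace_pair :: "('a::euclidean_space \<Rightarrow> real) \<Rightarrow> 'a \<Rightarrow> real \<Rightarrow> real \<Rightarrow> 'a \<Rightarrow> bool" where
  "trace_pair v x a b e \<longleftrightarrow> norm e = 1 \<and> (jdev v x e a b \<longlongrightarrow> 0) (at_right 0)"

lemma jdev_same: "jdev v x e z z r = mdev v (ball x r) z"
  by (simp add: jdev_def mdev_def)

lemma sets_half_ball [measurable, simp]: "half_ball x r (e::'a::euclidean_space) \<in> sets borel"
proof -
  have "half_ball x r e = ball x r \<inter> {y. 0 < (y - x) \<bullet> e}" by (auto simp: half_ball_def)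
  moreover have "open {y. 0 < (y - x) \<bullet> e}" by (intro open_Collect_less continuous_intros)
  ultimately show ?thesis by auto
qed

lemma integrable_indicator_in_ball:
  assumes "A \<in> sets borel" "A \<subseteq> ball (x::'a::euclidean_space) r"
  shows "integrable lborel (indicator A :: 'a \<Rightarrow> real)"
  using emeasure_bounded_finite[OF bounded_subset[OF bounded_ball assms(2)]] assms(1)
  by (intro integrable_real_indicator) simp_all

lemma integrable_half_ball: "integrable lborel (indicator (half_ball x r (e::'a::euclidean_space)) :: 'a \<Rightarrow> real)"
  by (rule integrable_indicator_in_ball[of _ x r]) (simp, auto simp: half_ball_def)

lemma hyperplane_null: "norm (e::'a::euclidean_space) = 1 \<Longrightarrow> {y. (y - x) \<bullet> e = 0} \<in> null_sets lborel"
proof -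
  assume "norm e = 1"
  then have "e \<noteq> 0" by auto
  then have "negligible {y. e \<bullet> y = e \<bullet> x}" by (intro negligible_hyperplane) auto
  moreover have "{y. e \<bullet> y = e \<bullet> x} = {y. (y - x) \<bullet> e = 0}" by (auto simp: inner_diff_left inner_diff_right inner_commute)
  moreover have "closed {y. (y - x) \<bullet> e = 0}" by (intro closed_Collect_eq continuous_intros)
  ultimately show ?thesis by (simp add: negligible_iff_null_sets null_sets_completion_iff)
qed

text \<open>Reflection through the centre exchanges the two open half balls, and the hyperplane
  between them is null.\<close>

lemma measure_half_ball:
  assumes "norm (e::'a::euclidean_space) = 1"
  shows "measure lborel (half_ball x r e) = measure lborel (ball x r) / 2"
proof -
  have m: "measure lborel A = (LINT y|lborel. indicator A y)" for A :: "'a set"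
    by simp
  have "(LINT y|lborel. indicator (half_ball x r e) (2 *\<^sub>R x - y)) = (LINT y|lborel. indicator (half_ball x r e) y :: real)"
    by (rule lborel_integral_reflect) auto
  moreover have "indicator (half_ball x r e) (2 *\<^sub>R x - y) = (indicator (half_ball x r (- e)) y :: real)" for y
  proof -
    have "dist x (2 *\<^sub>R x - y) = dist x y" by (simp add: dist_norm scaleR_2 norm_minus_commute)
    moreover have "(2 *\<^sub>R x - y - x) \<bullet> e = (y - x) \<bullet> (- e)" by (simp add: scaleR_2 inner_diff_left)
    ultimately show ?thesis by (auto simp: half_ball_def split: split_indicator)
  qed
  ultimately have eq: "measure lborel (half_ball x r (- e)) = measure lborel (half_ball x r e)" by simp
  have i: "integrable lborel (indicator A :: 'a \<Rightarrow> real)" if "A \<in> sets borel" "A \<subseteq> ball x r" for A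
    using emeasure_bounded_finite[OF bounded_subset[OF bounded_ball that(2)]] that(1)
    by (intro integrable_real_indicator) simp_all
  have "(LINT y|lborel. indicator (ball x r) y :: real) = (LINT y|lborel. indicator (half_ball x r e) y + indicator (half_ball x r (- e)) y)"
  proof (rule Bochner_Integration.integral_cong_AE)
    show "AE y in lborel. (indicator (ball x r) y :: real) = indicator (half_ball x r e) y + indicator (half_ball x r (- e)) y"
      using AE_not_in[OF hyperplane_null[OF assms, of x]]
      by eventually_elim (auto simp: half_ball_def inner_commute split: split_indicator)
  qed auto
  also have "\<dots> = (LINT y|lborel. indicator (half_ball x r e) y) + (LINT y|lborel. indicator (half_ball x r (- e)) y)"
    by (intro Bochner_Integration.integral_add i) (auto simp: half_ball_def)
  finally show ?thesis using eq by simp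
qed

context
  fixes v :: "'a::euclidean_space \<Rightarrow> real"
  assumes v: "integrable lborel v"
begin

lemma trace_meas [measurable]: "v \<in> borel_measurable borel"
  using borel_measurable_integrable[OF v] by simp

lemma jdev_integrable:
  assumes "A \<in> sets borel" "bounded A"
  shows "set_integrable lborel A (\<lambda>y. if 0 < (y - x) \<bullet> e then \<bar>v y - a\<bar> else \<bar>v y - b\<bar>)"
proof (rule set_integrable_bound[OF set_integral_add(1)[OF set_integrable_bounded[OF v assms, of a] set_integrable_bounded[OF v assms, of b]]])
  show "set_borel_measurable lborel A (\<lambda>y. if 0 < (y - x) \<bullet> e then \<bar>v y - a\<bar> else \<bar>v y - b\<bar>)"
    using assms(1) unfolding set_borel_measurable_def by measurable
qed auto

lemma jdev_nonneg: "0 \<le> jdev v x e a b r"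
  unfolding jdev_def set_lebesgue_integral_def by (intro divide_nonneg_nonneg Bochner_Integration.integral_nonneg) auto

lemma jdev_eq_halves:
  assumes e: "norm e = 1" and r: "r > 0"
  shows "jdev v x e a b r = (mdev v (half_ball x r e) a + mdev v (half_ball x r (- e)) b) / 2"
proof -
  have p: "measure lborel (ball x r) > 0" using r by (simp add: content_ball)
  have b: "bounded (half_ball x r e)" "bounded (half_ball x r (- e))"
    by (rule bounded_subset[OF bounded_ball]; auto simp: half_ball_def)+
  have "(LINT y:ball x r|lborel. if 0 < (y - x) \<bullet> e then \<bar>v y - a\<bar> else \<bar>v y - b\<bar>)
    = (LINT y|lborel. indicator (half_ball x r e) y * \<bar>v y - a\<bar> + indicator (half_ball x r (- e)) y * \<bar>v y - b\<bar>)"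
    unfolding set_lebesgue_integral_def
  proof (rule Bochner_Integration.integral_cong_AE)
    show "AE y in lborel. indicator (ball x r) y *\<^sub>R (if 0 < (y - x) \<bullet> e then \<bar>v y - a\<bar> else \<bar>v y - b\<bar>)
      = indicator (half_ball x r e) y * \<bar>v y - a\<bar> + indicator (half_ball x r (- e)) y * \<bar>v y - b\<bar>"
      using AE_not_in[OF hyperplane_null[OF e, of x]]
      by eventually_elim (auto simp: half_ball_def split: split_indicator)
  qed auto
  also have "\<dots> = (LINT y:half_ball x r e|lborel. \<bar>v y - a\<bar>) + (LINT y:half_ball x r (- e)|lborel. \<bar>v y - b\<bar>)"
    using set_integrable_bounded[OF v _ b(1), of a] set_integrable_bounded[OF v _ b(2), of b]
    unfolding set_lebesgue_integral_def set_integrable_def real_scaleR_def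
    by (intro Bochner_Integration.integral_add) auto
  finally show ?thesis
    using p e by (simp add: jdev_def mdev_def measure_half_ball add_divide_distrib)
qed

text \<open>The deviation over the ball is the mean of two nonnegative half-ball deviations, so it
  tends to 0 exactly if both do. This connects \<open>trace_pair\<close> with the half balls in
  \<open>approx_jump\<close>.\<close>

lemma trace_pair_iff_halves:
  assumes e: "norm e = 1"
  shows "trace_pair v x a b e \<longleftrightarrow> ((\<lambda>r. mdev v (half_ball x r e) a) \<longlongrightarrow> 0) (at_right 0) \<and>
     ((\<lambda>r. mdev v (half_ball x r (- e)) b) \<longlongrightarrow> 0) (at_right 0)" (is "_ \<longleftrightarrow> ?R")
proof
  have ev: "\<forall>\<^sub>F r in at_right 0. jdev v x e a b r = (mdev v (half_ball x r e) a + mdev v (half_ball x r (- e)) b) / 2"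
    using jdev_eq_halves[OF e] by (auto simp: eventually_at_right_field intro!: exI[of _ 1])
  { assume R: ?R
    have "((\<lambda>r. (mdev v (half_ball x r e) a + mdev v (half_ball x r (- e)) b) / 2) \<longlongrightarrow> (0 + 0) / 2) (at_right 0)"
      using R by (intro tendsto_intros) auto
    then show "trace_pair v x a b e" unfolding trace_pair_def using e tendsto_cong[OF ev] by simp }
  assume t: "trace_pair v x a b e"
  then have t2: "((\<lambda>r. 2 * jdev v x e a b r) \<longlongrightarrow> 0) (at_right 0)"
    unfolding trace_pair_def using tendsto_mult_right_zero by blast
  have ev2: "\<forall>\<^sub>F r in at_right 0. norm (mdev v (half_ball x r e) a) \<le> 2 * jdev v x e a b r"
    "\<forall>\<^sub>F r in at_right 0. norm (mdev v (half_ball x r (- e)) b) \<le> 2 * jdev v x e a b r"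
  proof (safe intro!: eventually_mono[OF ev])
    fix r assume h: "jdev v x e a b r = (mdev v (half_ball x r e) a + mdev v (half_ball x r (- e)) b) / 2"
    have "0 \<le> mdev v (half_ball x r e) a" "0 \<le> mdev v (half_ball x r (- e)) b" by (rule mdev_nonneg)+
    then show "norm (mdev v (half_ball x r e) a) \<le> 2 * jdev v x e a b r"
      "norm (mdev v (half_ball x r (- e)) b) \<le> 2 * jdev v x e a b r" unfolding h by simp_all
  qed
  then show ?R using Lim_null_comparison[OF ev2(1) t2] Lim_null_comparison[OF ev2(2) t2] by blast
qed

text \<open>Replacing \<open>v\<close> by its two-valued blow-up costs at most \<open>jdev\<close>,
  and each value occupies half of the ball. The limit does not involve the direction
  \<open>e\<close>, so the traces can be read off from full balls.\<close>

lemma trace_pair_mdev_lim: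
  assumes t: "trace_pair v x a b e"
  shows "((\<lambda>r. mdev v (ball x r) q) \<longlongrightarrow> (\<bar>a - q\<bar> + \<bar>b - q\<bar>) / 2) (at_right 0)"
proof -
  have e: "norm e = 1" using t by (simp add: trace_pair_def)
  have "\<bar>mdev v (ball x r) q - (\<bar>a - q\<bar> + \<bar>b - q\<bar>) / 2\<bar> \<le> jdev v x e a b r" if r: "r > 0" for r
  proof -
    have p: "measure lborel (ball x r) > 0" using r by (simp add: content_ball)
    let ?L = "\<lambda>y. if 0 < (y - x) \<bullet> e then \<bar>a - q\<bar> else \<bar>b - q\<bar>"
    have i1: "set_integrable lborel (ball x r) (\<lambda>y. \<bar>v y - q\<bar>)" by (rule set_integrable_bounded[OF v]) auto
    have i2: "set_integrable lborel (ball x r) ?L"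
    proof (rule set_integrable_bound[OF set_integrable_bounded[of "\<lambda>_. 0" _ "\<bar>a - q\<bar> + \<bar>b - q\<bar>"]])
      show "set_borel_measurable lborel (ball x r) ?L" unfolding set_borel_measurable_def by measurable
    qed auto
    have i3: "set_integrable lborel (ball x r) (\<lambda>y. if 0 < (y - x) \<bullet> e then \<bar>v y - a\<bar> else \<bar>v y - b\<bar>)"
      by (rule jdev_integrable) auto
    have L: "(LINT y:ball x r|lborel. ?L y) = (\<bar>a - q\<bar> + \<bar>b - q\<bar>) / 2 * measure lborel (ball x r)"
    proof -
      have "(LINT y:ball x r|lborel. ?L y) = (LINT y|lborel. indicator (half_ball x r e) y * \<bar>a - q\<bar> + indicator (half_ball x r (- e)) y * \<bar>b - q\<bar>)"
        unfolding set_lebesgue_integral_def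
      proof (rule Bochner_Integration.integral_cong_AE)
        show "AE y in lborel. indicator (ball x r) y *\<^sub>R ?L y = indicator (half_ball x r e) y * \<bar>a - q\<bar> + indicator (half_ball x r (- e)) y * \<bar>b - q\<bar>"
          using AE_not_in[OF hyperplane_null[OF e, of x]]
          by eventually_elim (auto simp: half_ball_def split: split_indicator)
      qed auto
      also have "\<dots> = (LINT y|lborel. indicator (half_ball x r e) y * \<bar>a - q\<bar>) + (LINT y|lborel. indicator (half_ball x r (- e)) y * \<bar>b - q\<bar>)"
      proof (rule Bochner_Integration.integral_add)
        show "integrable lborel (\<lambda>y. indicator (half_ball x r e) y * \<bar>a - q\<bar>)" "integrable lborel (\<lambda>y. indicator (half_ball x r (- e)) y * \<bar>b - q\<bar>)"
          by (intro integrable_mult_left integrable_half_ball)+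
      qed
      finally show ?thesis using e by (simp add: measure_half_ball field_simps)
    qed
    have "\<bar>(LINT y:ball x r|lborel. \<bar>v y - q\<bar>) - (LINT y:ball x r|lborel. ?L y)\<bar> = \<bar>LINT y:ball x r|lborel. \<bar>v y - q\<bar> - ?L y\<bar>"
      using i1 i2 by (simp add: set_integral_diff)
    also have "\<dots> \<le> (LINT y:ball x r|lborel. \<bar>\<bar>v y - q\<bar> - ?L y\<bar>)"
      using set_integral_norm_bound[OF set_integral_diff(1)[OF i1 i2]] by simp
    also have "\<dots> \<le> (LINT y:ball x r|lborel. if 0 < (y - x) \<bullet> e then \<bar>v y - a\<bar> else \<bar>v y - b\<bar>)"
      by (rule set_integral_mono[OF set_integrable_abs[OF set_integral_diff(1)[OF i1 i2]] i3]) auto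
    finally have "\<bar>(LINT y:ball x r|lborel. \<bar>v y - q\<bar>) - (\<bar>a - q\<bar> + \<bar>b - q\<bar>) / 2 * measure lborel (ball x r)\<bar>
       \<le> jdev v x e a b r * measure lborel (ball x r)"
      unfolding L using p by (simp add: jdev_def)
    then have "\<bar>(LINT y:ball x r|lborel. \<bar>v y - q\<bar>) - (\<bar>a - q\<bar> + \<bar>b - q\<bar>) / 2 * measure lborel (ball x r)\<bar> / measure lborel (ball x r)
       \<le> jdev v x e a b r" using p by (simp add: pos_divide_le_eq)
    moreover have "\<bar>(LINT y:ball x r|lborel. \<bar>v y - q\<bar>) - (\<bar>a - q\<bar> + \<bar>b - q\<bar>) / 2 * measure lborel (ball x r)\<bar> / measure lborel (ball x r)
      = \<bar>mdev v (ball x r) q - (\<bar>a - q\<bar> + \<bar>b - q\<bar>) / 2\<bar>"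
    proof -
      have "\<bar>I - c * m\<bar> / m = \<bar>I / m - c\<bar>" if "m > 0" for I c m :: real
      proof -
        have "I / m - c = (I - c * m) / m" using that by (simp add: field_simps)
        then show ?thesis using that by simp
      qed
      then show ?thesis unfolding mdev_def using p by blast
    qed
    ultimately show ?thesis by linarith
  qed
  then have ev: "\<forall>\<^sub>F r in at_right 0. norm (mdev v (ball x r) q - (\<bar>a - q\<bar> + \<bar>b - q\<bar>) / 2) \<le> jdev v x e a b r"
    by (auto simp: eventually_at_right_field intro!: exI[of _ 1])
  have "((\<lambda>r. mdev v (ball x r) q - (\<bar>a - q\<bar> + \<bar>b - q\<bar>) / 2) \<longlongrightarrow> 0) (at_right 0)"
    using t unfolding trace_pair_def by (intro Lim_null_comparison[OF ev]) auto
  then show ?thesis by (rule LIM_zero_cancel)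
qed

lemma trace_pair_unique:
  assumes "trace_pair v x a b e" "trace_pair v x a' b' e'" "b \<le> a" "b' \<le> a'"
  shows "a = a'" "b = b'"
proof -
  have *: "\<bar>a - q\<bar> + \<bar>b - q\<bar> = \<bar>a' - q\<bar> + \<bar>b' - q\<bar>" for q
    using tendsto_unique[OF _ trace_pair_mdev_lim[OF assms(1), of q] trace_pair_mdev_lim[OF assms(2), of q]] by simp
  \<comment> \<open>For \<open>q\<close> below all four values the absolute values disappear and the
    sums are compared; taking \<open>q\<close> at the common midpoint afterwards compares the
    differences.\<close>
  have 1: "a + b = a' + b'" using *[of "min b b'"] assms(3,4) by (auto simp: min_def abs_if split: if_splits)
  have "\<bar>p - (p + q) / 2\<bar> + \<bar>q - (p + q) / 2\<bar> = p - q" if "q \<le> p" for p q :: real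
    using that by (simp add: abs_if field_simps)
  note m = this
  have "a - b = \<bar>a - (a + b) / 2\<bar> + \<bar>b - (a + b) / 2\<bar>" by (rule m[OF assms(3), symmetric])
  also have "\<dots> = \<bar>a' - (a' + b') / 2\<bar> + \<bar>b' - (a' + b') / 2\<bar>" unfolding * 1 ..
  also have "\<dots> = a' - b'" by (rule m[OF assms(4)])
  finally have "a - b = a' - b'" .
  then show "a = a'" "b = b'" using 1 by linarith+
qed

text \<open>With traces \<open>a\<close> and \<open>b\<close> the inner limit is \<open>(|a + k| + |b + k|) / 2\<close>, so for large \<open>k\<close> the
  difference is \<open>(a + b) / 2\<close>.\<close>

definition mid_trace :: "'a \<Rightarrow> real" where
  "mid_trace x = lim (\<lambda>k. lim (\<lambda>j. mdev v (ball x (1 / real (Suc j))) (- real k)) - real k)"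

definition gap_trace :: "'a \<Rightarrow> real" where
  "gap_trace x = lim (\<lambda>j. mdev v (ball x (1 / real (Suc j))) (mid_trace x))"

lemma filterlim_inverse_Suc: "filterlim (\<lambda>j. 1 / real (Suc j)) (at_right 0) sequentially"
  using LIMSEQ_inverse_real_of_nat by (auto simp: filterlim_at inverse_eq_divide)

lemma trace_pair_mid_gap:
  assumes t: "trace_pair v x a b e"
  shows "mid_trace x = (a + b) / 2" "gap_trace x = \<bar>a - b\<bar> / 2"
proof -
  have L: "lim (\<lambda>j. mdev v (ball x (1 / real (Suc j))) q) = (\<bar>a - q\<bar> + \<bar>b - q\<bar>) / 2" for q
    using filterlim_compose[OF trace_pair_mdev_lim[OF t, of q] filterlim_inverse_Suc] by (rule limI)
  obtain K :: nat where K: "\<bar>a\<bar> + \<bar>b\<bar> \<le> real K" using real_arch_simple by blast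
  have "(\<bar>a - - real k\<bar> + \<bar>b - - real k\<bar>) / 2 - real k = (a + b) / 2" if "k \<ge> K" for k
  proof -
    have "real K \<le> real k" using that by simp
    then have "a + real k \<ge> 0" "b + real k \<ge> 0" using K by linarith+
    then show ?thesis by (simp add: field_simps)
  qed
  then have "(\<lambda>k. (\<bar>a - - real k\<bar> + \<bar>b - - real k\<bar>) / 2 - real k) \<longlonglongrightarrow> (a + b) / 2"
    by (intro tendsto_eventually) (auto simp: eventually_sequentially)
  then show m: "mid_trace x = (a + b) / 2" unfolding mid_trace_def L by (rule limI)
  show "gap_trace x = \<bar>a - b\<bar> / 2" unfolding gap_trace_def L m by (simp add: abs_if field_simps)
qed

lemma measurable_ball_integral:
  assumes [measurable]: "z \<in> borel_measurable borel"
  shows "(\<lambda>x. mdev v (ball x r) (z x)) \<in> borel_measurable borel"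
proof -
  have [measurable]: "Measurable.pred (borel \<Otimes>\<^sub>M borel) (\<lambda>p::'a\<times>'a. dist (fst p) (snd p) < r)"
    by (intro pred_open_pair open_Collect_less continuous_intros)
  have "(\<lambda>x. LINT y|lborel. (\<lambda>p. if dist (fst p) (snd p) < r then \<bar>v (snd p) - z (fst p)\<bar> else 0) (x, y)) \<in> borel_measurable borel"
    by (rule lborel.borel_measurable_lebesgue_integral) measurable
  then have m: "(\<lambda>x. LINT y|lborel. (if dist x y < r then \<bar>v y - z x\<bar> else 0)) \<in> borel_measurable borel"
    by simp
  have e1: "(LINT y:ball x r|lborel. \<bar>v y - z x\<bar>) = (LINT y|lborel. (if dist x y < r then \<bar>v y - z x\<bar> else 0))" for x
    unfolding set_lebesgue_integral_def by (intro Bochner_Integration.integral_cong) (auto split: split_indicator)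
  have e2: "measure lborel (ball x r) = measure lborel (ball (0::'a) r)" for x :: 'a
    by (cases "r \<ge> 0") (auto simp: content_ball not_le ball_empty)
  have "mdev v (ball x r) (z x) = (LINT y|lborel. (if dist x y < r then \<bar>v y - z x\<bar> else 0)) / measure lborel (ball (0::'a) r)" for x
    unfolding mdev_def e1[of x] e2[of x] ..
  then show ?thesis using borel_measurable_divide[OF m borel_measurable_const, of "measure lborel (ball (0::'a) r)"] by (simp only:)
qed

lemma mid_trace_measurable [measurable]: "mid_trace \<in> borel_measurable borel"
  unfolding mid_trace_def[abs_def]
  by (intro borel_measurable_lim_metric borel_measurable_diff measurable_ball_integral) auto

lemma gap_trace_measurable [measurable]: "gap_trace \<in> borel_measurable borel"
  unfolding gap_trace_def[abs_def]
  by (intro borel_measurable_lim_metric measurable_ball_integral mid_trace_measurable)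

lemma jdev_measurable:
  assumes [measurable]: "a \<in> borel_measurable borel" "b \<in> borel_measurable borel"
  shows "(\<lambda>x. jdev v x e (a x) (b x) r) \<in> borel_measurable borel"
proof -
  have [measurable]: "Measurable.pred (borel \<Otimes>\<^sub>M borel) (\<lambda>p::'a\<times>'a. dist (fst p) (snd p) < r)"
    "Measurable.pred (borel \<Otimes>\<^sub>M borel) (\<lambda>p::'a\<times>'a. 0 < (snd p - fst p) \<bullet> e)"
    by (intro pred_open_pair open_Collect_less continuous_intros)+
  have "(\<lambda>x. LINT y|lborel. (\<lambda>p. if dist (fst p) (snd p) < r then if 0 < (snd p - fst p) \<bullet> e
      then \<bar>v (snd p) - a (fst p)\<bar> else \<bar>v (snd p) - b (fst p)\<bar> else 0) (x, y)) \<in> borel_measurable borel"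
    by (rule lborel.borel_measurable_lebesgue_integral) measurable
  then have m: "(\<lambda>x. LINT y|lborel. (if dist x y < r then if 0 < (y - x) \<bullet> e then \<bar>v y - a x\<bar> else \<bar>v y - b x\<bar> else 0)) \<in> borel_measurable borel"
    by simp
  have e1: "(LINT y:ball x r|lborel. if 0 < (y - x) \<bullet> e then \<bar>v y - a x\<bar> else \<bar>v y - b x\<bar>)
     = (LINT y|lborel. (if dist x y < r then if 0 < (y - x) \<bullet> e then \<bar>v y - a x\<bar> else \<bar>v y - b x\<bar> else 0))" for x
    unfolding set_lebesgue_integral_def by (intro Bochner_Integration.integral_cong) (auto split: split_indicator)
  have e2: "measure lborel (ball x r) = measure lborel (ball (0::'a) r)" for x :: 'a
    by (cases "r \<ge> 0") (auto simp: content_ball not_le ball_empty)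
  have "jdev v x e (a x) (b x) r = (LINT y|lborel. (if dist x y < r then if 0 < (y - x) \<bullet> e then \<bar>v y - a x\<bar> else \<bar>v y - b x\<bar> else 0)) / measure lborel (ball (0::'a) r)" for x
    unfolding jdev_def e1[of x] e2[of x] ..
  then show ?thesis using borel_measurable_divide[OF m borel_measurable_const, of "measure lborel (ball (0::'a) r)"] by (simp only:)
qed

section \<open>Borel measurability of the set of trace points\<close>

definition slab :: "'a \<Rightarrow> real \<Rightarrow> 'a set" where
  "slab e \<eta> = {z \<in> ball 0 1. \<bar>z \<bullet> e\<bar> \<le> \<eta>}"

lemma sets_slab [measurable]: "slab e \<eta> \<in> sets borel"
proof -
  have "slab e \<eta> = ball 0 1 \<inter> {z. \<bar>z \<bullet> e\<bar> \<le> \<eta>}" by (auto simp: slab_def)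
  moreover have "closed {z. \<bar>z \<bullet> e\<bar> \<le> \<eta>}" by (intro closed_Collect_le continuous_intros)
  ultimately show ?thesis by auto
qed

text \<open>The slabs shrink to the intersection of the ball with a hyperplane, which is
  null.\<close>

lemma slab_tendsto:
  assumes "norm e = 1" "\<eta> \<longlonglongrightarrow> 0"
  shows "(\<lambda>k. measure lborel (slab e (\<eta> k))) \<longlonglongrightarrow> 0"
proof -
  have "(\<lambda>k. LINT z|lborel. indicator (slab e (\<eta> k)) z) \<longlonglongrightarrow> (LINT z|(lborel :: 'a measure). 0 :: real)"
  proof (rule integral_dominated_convergence[where w = "indicator (ball 0 1)"])
    show "integrable lborel (indicator (ball (0::'a) 1) :: 'a \<Rightarrow> real)"
      using emeasure_bounded_finite[OF bounded_ball] by (intro integrable_real_indicator) simp_all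
    have null: "{z. z \<bullet> e = 0} \<in> null_sets lborel" using hyperplane_null[OF assms(1), of 0] by simp
    show "AE z in lborel. (\<lambda>k. indicator (slab e (\<eta> k)) z :: real) \<longlonglongrightarrow> 0"
      using AE_not_in[OF null]
    proof eventually_elim
      case (elim z)
      then have "\<bar>z \<bullet> e\<bar> > 0" by simp
      then have "\<forall>\<^sub>F k in sequentially. \<eta> k < \<bar>z \<bullet> e\<bar>" by (rule order_tendstoD(2)[OF assms(2)])
      then have "\<forall>\<^sub>F k in sequentially. (indicator (slab e (\<eta> k)) z :: real) = 0"
        by eventually_elim (auto simp: slab_def split: split_indicator)
      then show ?case by (rule tendsto_eventually)
    qed
  qed (auto simp: slab_def split: split_indicator)
  then show ?thesis by simp
qed

lemma measure_scaled_slab: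
  assumes "r > 0"
  shows "measure lborel {y \<in> ball x r. \<bar>(y - x) \<bullet> e\<bar> \<le> r * \<eta>} = r ^ DIM('a) * measure lborel (slab e \<eta>)"
proof -
  have "(\<lambda>z. r *\<^sub>R z + x) ` slab e \<eta> = {y \<in> ball x r. \<bar>(y - x) \<bullet> e\<bar> \<le> r * \<eta>}"
  proof (intro set_eqI iffI)
    fix y assume "y \<in> (\<lambda>z. r *\<^sub>R z + x) ` slab e \<eta>"
    then show "y \<in> {y \<in> ball x r. \<bar>(y - x) \<bullet> e\<bar> \<le> r * \<eta>}"
      using assms by (auto simp: slab_def dist_norm abs_mult)
  next
    fix y assume y: "y \<in> {y \<in> ball x r. \<bar>(y - x) \<bullet> e\<bar> \<le> r * \<eta>}"
    have "y = r *\<^sub>R ((y - x) /\<^sub>R r) + x" using assms by simp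
    moreover have "norm ((y - x) /\<^sub>R r) = norm (y - x) / r" "((y - x) /\<^sub>R r) \<bullet> e = ((y - x) \<bullet> e) / r"
      using assms by (simp_all add: divide_inverse mult.commute)
    then have "(y - x) /\<^sub>R r \<in> slab e \<eta>"
      using y assms by (simp add: slab_def dist_norm norm_minus_commute pos_divide_le_eq mult.commute)
    ultimately show "y \<in> (\<lambda>z. r *\<^sub>R z + x) ` slab e \<eta>" by blast
  qed
  then have "measure lebesgue {y \<in> ball x r. \<bar>(y - x) \<bullet> e\<bar> \<le> r * \<eta>} = \<bar>r\<bar> ^ DIM('a) * measure lebesgue (slab e \<eta>)"
    using measure_lebesgue_affine[of r x "slab e \<eta>"] by simp
  moreover have "{y \<in> ball x r. \<bar>(y - x) \<bullet> e\<bar> \<le> r * \<eta>} \<in> sets borel"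
  proof -
    have "{y \<in> ball x r. \<bar>(y - x) \<bullet> e\<bar> \<le> r * \<eta>} = ball x r \<inter> {y. \<bar>(y - x) \<bullet> e\<bar> \<le> r * \<eta>}" by auto
    moreover have "closed {y. \<bar>(y - x) \<bullet> e\<bar> \<le> r * \<eta>}" by (intro closed_Collect_le continuous_intros)
    ultimately show ?thesis by auto
  qed
  ultimately show ?thesis using assms by (simp add: measure_completion)
qed

text \<open>Where the half spaces of \<open>e\<close> and \<open>e'\<close> differ, \<open>(y - x) \<bullet> e\<close> is small.\<close>

lemma jdev_change_direction:
  assumes r: "r > 0" and e: "norm (e - e') \<le> \<eta>" and slab: "f = e \<or> f = e'"
  shows "jdev v x e a b r \<le> jdev v x e' a b r + \<bar>a - b\<bar> * (measure lborel (slab f \<eta>) / unit_ball_vol (real DIM('a)))"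
proof -
  have p: "measure lborel (ball x r) > 0" using r by (simp add: content_ball)
  let ?S = "{y \<in> ball x r. \<bar>(y - x) \<bullet> f\<bar> \<le> r * \<eta>}"
  let ?j = "\<lambda>e y. if 0 < (y - x) \<bullet> e then \<bar>v y - a\<bar> else \<bar>v y - b\<bar>"
  have Sb: "?S \<in> sets borel"
  proof -
    have "?S = ball x r \<inter> {y. \<bar>(y - x) \<bullet> f\<bar> \<le> r * \<eta>}" by auto
    moreover have "closed {y. \<bar>(y - x) \<bullet> f\<bar> \<le> r * \<eta>}" by (intro closed_Collect_le continuous_intros)
    ultimately show ?thesis by auto
  qed
  have Si: "integrable lborel (indicator ?S :: 'a \<Rightarrow> real)"
    by (rule integrable_indicator_in_ball[OF Sb, of x r]) auto
  have ji: "integrable lborel (\<lambda>y. indicator (ball x r) y * ?j e y)" for e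
    using jdev_integrable[of "ball x r" x e a b] by (simp add: set_integrable_def)
  have "(LINT y:ball x r|lborel. ?j e y) \<le> (LINT y|lborel. indicator (ball x r) y * ?j e' y + \<bar>a - b\<bar> * indicator ?S y)"
    unfolding set_lebesgue_integral_def real_scaleR_def
  proof (rule integral_mono)
    fix y
    show "indicator (ball x r) y * ?j e y \<le> indicator (ball x r) y * ?j e' y + \<bar>a - b\<bar> * indicator ?S y"
    proof (cases "y \<in> ball x r \<and> (0 < (y - x) \<bullet> e) \<noteq> (0 < (y - x) \<bullet> e')")
      case True
      have "\<bar>(y - x) \<bullet> (e - e')\<bar> \<le> norm (y - x) * norm (e - e')" by (rule Cauchy_Schwarz_ineq2)
      also have "\<dots> \<le> r * \<eta>" using True e r by (intro mult_mono) (auto simp: dist_norm norm_minus_commute)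
      finally have "\<bar>(y - x) \<bullet> e - (y - x) \<bullet> e'\<bar> \<le> r * \<eta>" by (simp add: inner_diff_right)
      then have "\<bar>(y - x) \<bullet> f\<bar> \<le> r * \<eta>" using True slab by (cases "0 < (y - x) \<bullet> e"; elim disjE) simp_all
      then have "y \<in> ?S" using True by simp
      then show ?thesis using True by (auto split: split_indicator)
    next
      case False
      then show ?thesis by (auto split: split_indicator)
    qed
  qed (use ji Si in auto)
  also have "\<dots> = (LINT y:ball x r|lborel. ?j e' y) + \<bar>a - b\<bar> * (r ^ DIM('a) * measure lborel (slab f \<eta>))"
    unfolding set_lebesgue_integral_def real_scaleR_def
    using ji Si measure_scaled_slab[OF r, of x f \<eta>] by (subst Bochner_Integration.integral_add) auto
  finally have "jdev v x e a b r \<le> ((LINT y:ball x r|lborel. ?j e' y) + \<bar>a - b\<bar> * (r ^ DIM('a) * measure lborel (slab f \<eta>))) / measure lborel (ball x r)"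
    unfolding jdev_def using p by (intro divide_right_mono) auto
  also have "\<dots> = jdev v x e' a b r + \<bar>a - b\<bar> * (measure lborel (slab f \<eta>) / unit_ball_vol (real DIM('a)))"
    using r by (simp add: jdev_def add_divide_distrib measure_ball_eq)
  finally show ?thesis .
qed

text \<open>Any small radius lies below a dyadic one at most twice as large. Enlarging the ball to
  that radius costs the factor \<open>2 ^ DIM('a)\<close>.\<close>

lemma jdev_dyadic:
  assumes lim: "(\<lambda>j. jdev v x e a b ((1/2) ^ j)) \<longlonglongrightarrow> 0"
  shows "(jdev v x e a b \<longlongrightarrow> 0) (at_right 0)"
proof (rule tendstoI)
  fix \<eta> :: real assume \<eta>: "\<eta> > 0"
  let ?c = "2 ^ DIM('a) :: real"
  have "\<forall>\<^sub>F j in sequentially. jdev v x e a b ((1/2) ^ j) < \<eta> / ?c"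
    using \<eta> by (intro order_tendstoD(2)[OF lim]) simp
  then obtain J where J: "\<And>j. j \<ge> J \<Longrightarrow> jdev v x e a b ((1/2) ^ j) < \<eta> / ?c" unfolding eventually_sequentially by blast
  show "\<forall>\<^sub>F r in at_right 0. dist (jdev v x e a b r) 0 < \<eta>"
    unfolding eventually_at_right_field
  proof (intro exI[of _ "(1/2)^J"] conjI allI impI)
    fix r :: real assume r: "0 < r" "r < (1/2)^J"
    obtain k0 where k0: "(1/2::real) ^ k0 < r" using real_arch_pow_inv[OF r(1), of "1/2"] by auto
    \<comment> \<open>The first dyadic radius below \<open>r\<close>; its predecessor
      \<open>j\<close> is at least \<open>r\<close> and at most \<open>2 * r\<close>.\<close>
    define k where "k = (LEAST k. (1/2::real) ^ k < r)"
    have k: "(1/2::real) ^ k < r" unfolding k_def by (rule LeastI[of "\<lambda>k. (1/2::real) ^ k < r", OF k0])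
    have "k > J"
    proof (rule ccontr)
      assume "\<not> k > J" then have "(1/2::real) ^ J \<le> (1/2) ^ k" by (intro power_decreasing) auto
      then show False using k r by linarith
    qed
    then obtain j where j: "k = Suc j" "j \<ge> J" by (cases k) auto
    have "\<not> (1/2::real) ^ j < r" using not_less_Least[of j "\<lambda>k. (1/2::real) ^ k < r"] j(1) unfolding k_def by auto
    then have rj: "r \<le> (1/2) ^ j" "(1/2) ^ j \<le> 2 * r" using k j(1) by auto
    let ?R = "(1/2::real) ^ j"
    have R: "?R > 0" by simp
    have "(LINT y:ball x r|lborel. if 0 < (y - x) \<bullet> e then \<bar>v y - a\<bar> else \<bar>v y - b\<bar>)
       \<le> (LINT y:ball x ?R|lborel. if 0 < (y - x) \<bullet> e then \<bar>v y - a\<bar> else \<bar>v y - b\<bar>)"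
      unfolding set_lebesgue_integral_def
      using jdev_integrable[of "ball x r" x e a b] jdev_integrable[of "ball x ?R" x e a b] rj(1)
      by (intro integral_mono) (auto simp: set_integrable_def split: split_indicator)
    also have "\<dots> = jdev v x e a b ?R * measure lborel (ball x ?R)"
      using R by (simp add: jdev_def content_ball)
    also have "\<dots> \<le> jdev v x e a b ?R * (?c * measure lborel (ball x r))"
    proof (rule mult_left_mono[OF _ jdev_nonneg])
      have "?R ^ DIM('a) \<le> (2 * r) ^ DIM('a)" using rj(2) by (intro power_mono) auto
      then show "measure lborel (ball x ?R) \<le> ?c * measure lborel (ball x r)"
        using r(1) R by (simp add: measure_ball_eq power_mult_distrib mult_ac mult_left_mono del: power_one_over)
    qed
    finally have "jdev v x e a b r \<le> jdev v x e a b ?R * ?c"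
      using r(1) unfolding jdev_def[of v x e a b r] by (subst pos_divide_le_eq) (auto simp: content_ball mult_ac)
    also have "\<dots> < \<eta>" using J[OF j(2)] by (simp add: pos_less_divide_eq)
    finally show "dist (jdev v x e a b r) 0 < \<eta>" using jdev_nonneg[of x e a b r] by simp
  qed simp
qed

lemma sets_eventually_ex:
  fixes P :: "'b::topological_space \<Rightarrow> 'c \<Rightarrow> nat \<Rightarrow> nat \<Rightarrow> bool"
  assumes P: "\<And>e k j. {x. P x e k j} \<in> sets borel" and E: "countable E"
  shows "{x. \<forall>k. \<exists>e\<in>E. \<exists>m. \<forall>j\<ge>m. P x e k j} \<in> sets borel"
proof -
  have 0: "{x. m \<le> j \<longrightarrow> P x e k j} \<in> sets borel" for m j k e using P by (cases "m \<le> j") auto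
  have 1: "(\<Inter>j. {x. m \<le> j \<longrightarrow> P x e k j}) \<in> sets borel" for k e m by (intro sets.countable_INT image_subsetI 0) simp
  have 2: "(\<Union>m. \<Inter>j. {x. m \<le> j \<longrightarrow> P x e k j}) \<in> sets borel" for k e by (intro sets.countable_UN image_subsetI 1)
  have 3: "(\<Union>e\<in>E. \<Union>m. \<Inter>j. {x. m \<le> j \<longrightarrow> P x e k j}) \<in> sets borel" for k
    by (intro sets.countable_UN' image_subsetI 2 E)
  have "(\<Inter>k. \<Union>e\<in>E. \<Union>m. \<Inter>j. {x. m \<le> j \<longrightarrow> P x e k j}) \<in> sets borel"
    by (intro sets.countable_INT image_subsetI 3) simp
  also have "(\<Inter>k. \<Union>e\<in>E. \<Union>m. \<Inter>j. {x. m \<le> j \<longrightarrow> P x e k j}) = {x. \<forall>k. \<exists>e\<in>E. \<exists>m. \<forall>j\<ge>m. P x e k j}"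
    by auto
  finally show ?thesis .
qed

text \<open>The three existential quantifiers are uncountable. Any admissible pair of traces is, up
  to order, \<open>mid_trace\<close> plus and minus \<open>gap_trace\<close>, which are Borel
  functions. The direction is replaced by approximate directions from a countable dense subset of
  the sphere, one for each tolerance, and compactness of the sphere recovers an exact
  direction.\<close>

lemma sets_trace_points: "{x. \<exists>a b e. trace_pair v x a b e} \<in> sets borel"
proof -
  obtain E :: "'a set" where E: "countable E" "E \<subseteq> sphere 0 1" "sphere 0 1 \<subseteq> closure E"
    using separable by blast
  let ?a = "\<lambda>x. mid_trace x + gap_trace x" and ?b = "\<lambda>x. mid_trace x - gap_trace x"
  let ?J = "\<lambda>x e r. jdev v x e (?a x) (?b x) r"
  have "{x. \<exists>a b e. trace_pair v x a b e} = {x. \<forall>k. \<exists>e\<in>E. \<exists>m. \<forall>j\<ge>m. ?J x e ((1/2) ^ j) < 1 / real (Suc k)}" (is "?L = ?R")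
  proof (intro set_eqI iffI)
    fix x assume "x \<in> ?L"
    then obtain a0 b0 e0 where t0: "trace_pair v x a0 b0 e0" by blast
    \<comment> \<open>The formula with \<open>gap_trace\<close> yields the larger trace as
      \<open>?a\<close>, so the pair is sorted first; swapping the traces reverses the
      direction.\<close>
    have "\<exists>a b e. b \<le> a \<and> trace_pair v x a b e"
    proof (cases "b0 \<le> a0")
      case False
      have "norm (- e0) = 1" using t0 by (simp add: trace_pair_def)
      then have "trace_pair v x b0 a0 (- e0)"
        using t0 trace_pair_iff_halves[of e0 x a0 b0] trace_pair_iff_halves[of "- e0" x b0 a0] by (auto simp: trace_pair_def)
      then show ?thesis using False by (intro exI[of _ b0] exI[of _ a0] exI[of _ "- e0"]) auto
    qed (use t0 in blast)
    then obtain a b e where ba: "b \<le> a" and t: "trace_pair v x a b e" by blast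
    have ab: "?a x = a" "?b x = b" using trace_pair_mid_gap[OF t] ba by (auto simp: field_simps)
    have e: "norm e = 1" using t by (simp add: trace_pair_def)
    have tl: "(jdev v x e a b \<longlongrightarrow> 0) (at_right 0)" using t by (simp add: trace_pair_def)
    have "filterlim (\<lambda>j. (1/2::real) ^ j) (at_right 0) sequentially"
      by (auto simp: filterlim_at intro: LIMSEQ_realpow_zero)
    then have jl: "(\<lambda>j. jdev v x e a b ((1/2) ^ j)) \<longlonglongrightarrow> 0" by (rule filterlim_compose[OF tl])
    show "x \<in> ?R"
    proof (rule CollectI, rule allI)
      fix k
      let ?d = "1 / real (Suc k)"
      let ?V = "unit_ball_vol (real DIM('a))"
      have V: "?V > 0" by simp
      have "(\<lambda>m. \<bar>a - b\<bar> * (measure lborel (slab e (1 / real (Suc m))) / ?V)) \<longlonglongrightarrow> \<bar>a - b\<bar> * (0 / ?V)"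
        using V LIMSEQ_inverse_real_of_nat by (intro tendsto_intros slab_tendsto e) (auto simp: inverse_eq_divide)
      then have "\<forall>\<^sub>F m in sequentially. \<bar>a - b\<bar> * (measure lborel (slab e (1 / real (Suc m))) / ?V) < ?d / 2"
        by (intro order_tendstoD(2)[of _ "\<bar>a - b\<bar> * (0 / ?V)"]) auto
      then obtain m where m: "\<bar>a - b\<bar> * (measure lborel (slab e (1 / real (Suc m))) / ?V) < ?d / 2"
        unfolding eventually_sequentially by blast
      have "e \<in> closure E" using e E(3) by auto
      then obtain e' where e': "e' \<in> E" "dist e' e < 1 / real (Suc m)"
        unfolding closure_approachable by (meson of_nat_0_less_iff zero_less_Suc zero_less_divide_1_iff)
      have "\<forall>\<^sub>F j in sequentially. jdev v x e a b ((1/2) ^ j) < ?d / 2"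
        by (intro order_tendstoD(2)[OF jl]) simp
      then obtain M where M: "\<And>j. j \<ge> M \<Longrightarrow> jdev v x e a b ((1/2) ^ j) < ?d / 2" unfolding eventually_sequentially by blast
      have "jdev v x e' a b ((1/2) ^ j) < ?d" if "j \<ge> M" for j
      proof -
        have "jdev v x e' a b ((1/2) ^ j) \<le> jdev v x e a b ((1/2) ^ j) + \<bar>a - b\<bar> * (measure lborel (slab e (1 / real (Suc m))) / ?V)"
          using e'(2) by (intro jdev_change_direction) (auto simp: dist_norm)
        then show ?thesis using M[OF that] m by linarith
      qed
      then show "\<exists>e\<in>E. \<exists>m. \<forall>j\<ge>m. ?J x e ((1/2) ^ j) < ?d" unfolding ab using e'(1) by blast
    qed
  next
    fix x assume "x \<in> ?R"
    then have "\<forall>k. \<exists>e. e \<in> E \<and> (\<exists>m. \<forall>j\<ge>m. ?J x e ((1/2) ^ j) < 1 / real (Suc k))" by blast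
    from choice[OF this] obtain e where e: "\<And>k. e k \<in> E" "\<And>k. \<exists>m. \<forall>j\<ge>m. ?J x (e k) ((1/2) ^ j) < 1 / real (Suc k)" by blast
    have "\<forall>k. e k \<in> sphere 0 1" using e(1) E(2) by blast
    \<comment> \<open>A limit direction of the approximate ones. In the estimate below the slab is
      taken orthogonal to the fixed \<open>l\<close>, so that its measure tends to 0 along the
      subsequence.\<close>
    then obtain l s where l: "l \<in> sphere 0 1" "strict_mono s" "(e \<circ> s) \<longlonglongrightarrow> l"
      using compact_sphere[of "0::'a" 1] unfolding compact_def by blast
    let ?V = "unit_ball_vol (real DIM('a))"
    let ?g = "\<bar>?a x - ?b x\<bar>"
    have nl: "norm l = 1" using l(1) by simp
    have d0: "(\<lambda>i. norm (l - e (s i))) \<longlonglongrightarrow> 0"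
      using tendsto_norm[OF tendsto_diff[OF tendsto_const[of l] l(3)]] by (simp add: o_def)
    have sl: "(\<lambda>i. ?g * (measure lborel (slab l (norm (l - e (s i)))) / ?V)) \<longlonglongrightarrow> ?g * (0 / ?V)"
      by (intro tendsto_intros slab_tendsto nl d0) (simp add: less_imp_neq[symmetric])
    have "(\<lambda>j. ?J x l ((1/2) ^ j)) \<longlonglongrightarrow> 0"
    proof (rule tendstoI)
      fix d :: real assume d: "d > 0"
      have "\<forall>\<^sub>F i in sequentially. ?g * (measure lborel (slab l (norm (l - e (s i)))) / ?V) < d / 2"
        using d by (intro order_tendstoD(2)[OF sl]) auto
      moreover have "\<forall>\<^sub>F i in sequentially. 1 / real (Suc (s i)) < d / 2"
      proof -
        obtain N where N: "1 / real (Suc N) < d / 2" using nat_approx_posE[of "d/2"] d by auto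
        have "1 / real (Suc (s i)) < d / 2" if "i \<ge> N" for i
        proof -
          have "N \<le> s i" using that seq_suble[OF l(2), of i] by simp
          then have "1 / real (Suc (s i)) \<le> 1 / real (Suc N)" by (simp add: field_simps)
          then show ?thesis using N by linarith
        qed
        then show ?thesis by (auto simp: eventually_sequentially)
      qed
      ultimately have "\<forall>\<^sub>F i in sequentially. ?g * (measure lborel (slab l (norm (l - e (s i)))) / ?V) < d / 2 \<and> 1 / real (Suc (s i)) < d / 2"
        by (rule eventually_conj)
      then obtain i where i: "?g * (measure lborel (slab l (norm (l - e (s i)))) / ?V) < d / 2" "1 / real (Suc (s i)) < d / 2"
        unfolding eventually_sequentially by blast
      obtain m where m: "\<And>j. j \<ge> m \<Longrightarrow> ?J x (e (s i)) ((1/2) ^ j) < 1 / real (Suc (s i))" using e(2) by blast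
      have "dist (?J x l ((1/2) ^ j)) 0 < d" if "j \<ge> m" for j
      proof -
        have "?J x l ((1/2) ^ j) \<le> ?J x (e (s i)) ((1/2) ^ j) + ?g * (measure lborel (slab l (norm (l - e (s i)))) / ?V)"
          by (intro jdev_change_direction) auto
        then show ?thesis using m[OF that] i jdev_nonneg[of x l "?a x" "?b x" "(1/2)^j"] by (simp del: power_one_over)
      qed
      then show "\<forall>\<^sub>F j in sequentially. dist (?J x l ((1/2) ^ j)) 0 < d" by (auto simp: eventually_sequentially)
    qed
    then have "trace_pair v x (?a x) (?b x) l" unfolding trace_pair_def using nl jdev_dyadic by blast
    then show "x \<in> ?L" by blast
  qed
  moreover have "?R \<in> sets borel"
  proof -
    have m: "(\<lambda>x. ?J x e r) \<in> borel_measurable borel" for e r by (intro jdev_measurable) measurable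
    have "{x. ?J x e ((1/2) ^ j) < 1 / real (Suc k)} \<in> sets borel" for e j k
      using borel_measurable_less[OF m borel_measurable_const] by simp
    then show ?thesis by (rule sets_eventually_ex[OF _ E(1)])
  qed
  ultimately show ?thesis by simp
qed

text \<open>As \<open>g\<close> is 1-Lipschitz, \<open>g (v y)\<close> is at least
  \<open>g a\<close> or \<open>g b\<close> minus the deviation of \<open>v\<close> on the respective
  side. Averaging over the ball of radius \<open>\<epsilon> / 2\<close> gives the bracket;
  \<open>mollifier_lower\<close> and the volume ratio of the two balls give the factor.\<close>

lemma trace_pair_conv_lower:
  assumes t: "trace_pair v x a b e" and \<epsilon>: "\<epsilon> > 0"
    and g: "\<And>s. 0 \<le> g s" "\<And>s t. \<bar>g s - g t\<bar> \<le> \<bar>s - t\<bar>" "integrable lborel (\<lambda>y. g (v y))"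
  shows "exp (- 2) * (1/2) ^ DIM('a) * ((g a + g b) / 2 - jdev v x e a b (\<epsilon> / 2)) \<le> conv (mollifier \<epsilon>) (\<lambda>y. g (v y)) x"
proof -
  let ?r = "\<epsilon> / 2"
  have r: "?r > 0" using \<epsilon> by simp
  have e: "norm e = 1" using t by (simp add: trace_pair_def)
  have p: "measure lborel (ball x ?r) > 0" "measure lborel (ball (0::'a) \<epsilon>) > 0" using \<epsilon> by (simp_all add: content_ball)
  let ?L = "\<lambda>y. indicator (half_ball x ?r e) y * g a + indicator (half_ball x ?r (- e)) y * g b"
  let ?j = "\<lambda>y. if 0 < (y - x) \<bullet> e then \<bar>v y - a\<bar> else \<bar>v y - b\<bar>"
  have hi: "integrable lborel (indicator (half_ball x ?r e') :: 'a \<Rightarrow> real)" for e'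
    by (rule integrable_half_ball)
  have Li: "integrable lborel ?L" using hi by (intro Bochner_Integration.integrable_add integrable_mult_left)
  have ji: "integrable lborel (\<lambda>y. indicator (ball x ?r) y * ?j y)"
    using jdev_integrable[of "ball x ?r" x e a b] by (simp add: set_integrable_def)
  have L: "(LINT y|lborel. ?L y) = (g a + g b) / 2 * measure lborel (ball x ?r)"
    using hi e by (simp add: measure_half_ball field_simps)
  have gi: "integrable lborel (\<lambda>y. indicator (ball x ?r) y * g (v y))"
    using integrable_mult_indicator[OF _ g(3), of "ball x ?r"] by simp
  let ?c = "exp (- 2) / measure lborel (ball (0::'a) \<epsilon>)"
  have c: "?c \<ge> 0" using p by simp
  have "((g a + g b) / 2 - jdev v x e a b ?r) * measure lborel (ball x ?r) = (LINT y|lborel. ?L y - indicator (ball x ?r) y * ?j y)"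
  proof -
    have "jdev v x e a b ?r * measure lborel (ball x ?r) = (LINT y|lborel. indicator (ball x ?r) y * ?j y)"
      using p by (simp add: jdev_def set_lebesgue_integral_def)
    then show ?thesis using L Bochner_Integration.integral_diff[OF Li ji] by (simp add: left_diff_distrib)
  qed
  also have "\<dots> \<le> (LINT y|lborel. indicator (ball x ?r) y * g (v y))"
  proof (rule integral_mono[OF Bochner_Integration.integrable_diff[OF Li ji] gi])
    fix y
    show "?L y - indicator (ball x ?r) y * ?j y \<le> indicator (ball x ?r) y * g (v y)"
      using g(2)[of a "v y"] g(2)[of b "v y"] g(1)[of "v y"] g(1)[of b] g(1)[of a]
      by (auto simp: half_ball_def abs_minus_commute split: split_indicator)
  qed
  finally have 1: "((g a + g b) / 2 - jdev v x e a b ?r) * measure lborel (ball x ?r) \<le> (LINT y|lborel. indicator (ball x ?r) y * g (v y))" .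
  have "?c * (LINT y|lborel. indicator (ball x ?r) y * g (v y)) = (LINT y|lborel. ?c * (indicator (ball x ?r) y * g (v y)))" by simp
  also have "\<dots> \<le> conv (mollifier \<epsilon>) (\<lambda>y. g (v y)) x"
    unfolding conv_def
  proof (rule integral_mono)
    show "integrable lborel (\<lambda>y. mollifier \<epsilon> (x - y) * g (v y))" by (rule conv_integrable[OF mollifier_test[OF \<epsilon>] g(3)])
    fix y
    show "?c * (indicator (ball x ?r) y * g (v y)) \<le> mollifier \<epsilon> (x - y) * g (v y)"
    proof (cases "y \<in> ball x ?r")
      case True
      then have "norm (x - y) \<le> \<epsilon> / 2" by (simp add: dist_norm)
      then have "?c * g (v y) \<le> mollifier \<epsilon> (x - y) * g (v y)"
        by (intro mult_right_mono mollifier_lower[OF \<epsilon>] g(1))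
      then show ?thesis using True by simp
    next
      case False
      then show ?thesis using mollifier_nonneg[OF \<epsilon>, of "x - y"] g(1) by simp
    qed
  qed (use gi in auto)
  finally have 2: "?c * (LINT y|lborel. indicator (ball x ?r) y * g (v y)) \<le> conv (mollifier \<epsilon>) (\<lambda>y. g (v y)) x" .
  have "exp (- 2) * (1/2) ^ DIM('a) * ((g a + g b) / 2 - jdev v x e a b (\<epsilon> / 2))
     = ?c * (((g a + g b) / 2 - jdev v x e a b ?r) * measure lborel (ball x ?r))"
    using \<epsilon> p by (simp add: measure_ball_eq power_divide)
  also have "\<dots> \<le> ?c * (LINT y|lborel. indicator (ball x ?r) y * g (v y))" by (rule mult_left_mono[OF 1 c])
  finally show ?thesis using 2 by linarith
qed

end

section \<open>Precise representatives\<close>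

lemma trace_pair_swap:
  assumes "integrable lborel v" "trace_pair v x a b e"
  shows "trace_pair v x b a (- e)"
proof -
  have "norm e = 1" "norm (- e) = 1" using assms(2) by (auto simp: trace_pair_def)
  then show ?thesis
    using assms(2) trace_pair_iff_halves[OF assms(1), of e x a b] trace_pair_iff_halves[OF assms(1), of "- e" x b a] by simp
qed

lemma trace_pair_sorted:
  assumes "integrable lborel v" "trace_pair v x a b e"
  obtains a' b' e' where "b' \<le> a'" "trace_pair v x a' b' e'"
proof (cases "b \<le> a")
  case True then show ?thesis using that assms(2) by blast
next
  case False
  then have "a \<le> b" by simp
  then show ?thesis using that trace_pair_swap[OF assms] by blast
qed

lemma trace_pair_same: "norm e = 1 \<Longrightarrow> trace_pair v x z z e \<longleftrightarrow> ((\<lambda>r. mdev v (ball x r) z) \<longlongrightarrow> 0) (at_right 0)"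
proof -
  have "jdev v x e z z = (\<lambda>r. mdev v (ball x r) z)" by (rule ext) (rule jdev_same)
  then show "norm e = 1 \<Longrightarrow> ?thesis" unfolding trace_pair_def by simp
qed

text \<open>The function \<open>u\<close> is only Lebesgue measurable, and only on
  \<open>\<Omega>\<close>; \<open>v\<close> is a Borel version on the whole space. Approximate
  limits and jumps at points of \<open>\<Omega>\<close> are determined by small balls, hence can be
  computed from \<open>v\<close>.\<close>

locale borel_version =
  fixes \<Omega> :: "'a::euclidean_space set" and u v :: "'a \<Rightarrow> real"
  assumes open_dom: "open \<Omega>" and v_int: "integrable lborel v"
    and u_meas: "u \<in> borel_measurable (lebesgue_on \<Omega>)"
    and uv: "AE x in lebesgue_on \<Omega>. u x = v x"
begin

lemma v_meas [measurable]: "v \<in> borel_measurable borel"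
  using borel_measurable_integrable[OF v_int] by simp

lemma mean_dev_eq:
  assumes "E \<in> sets borel" "E \<subseteq> \<Omega>"
  shows "mean_dev u E z = mdev v E z"
proof -
  have s\<Omega>: "\<Omega> \<in> sets lebesgue" "E \<in> sets lebesgue" using open_dom assms(1) by (auto simp: sets_completionI_sets)
  have sub: "lebesgue_on E = restrict_space (lebesgue_on \<Omega>) E"
    using restrict_restrict_space[of \<Omega> lebesgue E] s\<Omega> assms(2) by (simp add: inf.absorb2)
  from s\<Omega> have sE: "E \<inter> space (lebesgue_on \<Omega>) \<in> sets (lebesgue_on \<Omega>)"
    using assms(2) by (simp add: sets_restrict_space_iff inf.absorb1)
  have "(LINT y|lebesgue_on E. \<bar>u y - z\<bar>) = (LINT y|lebesgue_on E. \<bar>v y - z\<bar>)"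
  proof (rule Bochner_Integration.integral_cong_AE)
    show "(\<lambda>y. \<bar>u y - z\<bar>) \<in> borel_measurable (lebesgue_on E)"
      unfolding sub by (intro borel_measurable_abs borel_measurable_diff measurable_restrict_space1[OF u_meas] measurable_const) simp
    have "v \<in> borel_measurable lebesgue" using v_meas by (intro measurable_completion) simp
    then have [measurable]: "v \<in> borel_measurable (lebesgue_on E)" by (rule measurable_restrict_space1)
    show "(\<lambda>y. \<bar>v y - z\<bar>) \<in> borel_measurable (lebesgue_on E)" by measurable
    have "AE y in lebesgue_on E. u y = v y"
      unfolding sub AE_restrict_space_iff[OF sE] using uv by eventually_elim auto
    then show "AE y in lebesgue_on E. \<bar>u y - z\<bar> = \<bar>v y - z\<bar>" by eventually_elim simp
  qed
  also have "\<dots> = (LINT y:E|lborel. \<bar>v y - z\<bar>)"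
    by (rule integral_lebesgue_on_eq[OF _ assms(1)]) simp
  finally show ?thesis using assms(1) by (simp add: mean_dev_def mdev_def measure_completion)
qed

lemma eventually_ball_subset:
  assumes "x \<in> \<Omega>" shows "\<forall>\<^sub>F r in at_right 0. ball x r \<subseteq> \<Omega>"
proof -
  obtain r0 where "r0 > 0" "ball x r0 \<subseteq> \<Omega>" using open_dom assms open_contains_ball by blast
  then show ?thesis unfolding eventually_at_right_field
    by (intro exI[of _ r0]) (auto intro: order_trans[OF subset_ball])
qed

lemma approx_lim_iff:
  assumes x: "x \<in> \<Omega>" and e: "norm e = 1"
  shows "approx_lim u x z \<longleftrightarrow> trace_pair v x z z e"
proof -
  have "\<forall>\<^sub>F r in at_right 0. mean_dev u (ball x r) z = mdev v (ball x r) z"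
    using eventually_ball_subset[OF x] by eventually_elim (simp add: mean_dev_eq)
  then show ?thesis unfolding approx_lim_def trace_pair_same[OF e] by (rule tendsto_cong)
qed

lemma approx_jump_iff:
  assumes x: "x \<in> \<Omega>"
  shows "approx_jump u x a b e \<longleftrightarrow> b < a \<and> trace_pair v x a b e"
proof (cases "norm e = 1")
  case True
  have "half_ball x r d \<subseteq> ball x r" for r and d :: 'a by (auto simp: half_ball_def)
  then have ev: "\<forall>\<^sub>F r in at_right 0. mean_dev u (half_ball x r d) z = mdev v (half_ball x r d) z" for d z
    using eventually_ball_subset[OF x] by (auto elim!: eventually_mono intro!: mean_dev_eq intro: order_trans)
  show ?thesis
    unfolding approx_jump_def trace_pair_iff_halves[OF v_int True]
    using True tendsto_cong[OF ev[of e a]] tendsto_cong[OF ev[of "- e" b]] by simp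
qed (auto simp: approx_jump_def trace_pair_def)

text \<open>Equal traces give an approximate limit and distinct ones a jump. Uniqueness of sorted
  trace pairs makes the two cases exclusive and each definite description well defined.\<close>

lemma traces_eq:
  assumes x: "x \<in> \<Omega>" and t: "trace_pair v x a b e" and ba: "b \<le> a"
  shows "upper_trace \<Omega> u x = a" "lower_trace \<Omega> u x = b"
proof -
  have e: "norm e = 1" using t by (simp add: trace_pair_def)
  have lim: "approx_lim u x z \<Longrightarrow> a = z \<and> b = z" for z
    using trace_pair_unique[OF v_int t _ ba] approx_lim_iff[OF x e] by auto
  have "upper_trace \<Omega> u x = a \<and> lower_trace \<Omega> u x = b"
  proof (cases "a = b")
    case True
    then have al: "approx_lim u x a" using approx_lim_iff[OF x e] t by simp
    then have "(THE z. approx_lim u x z) = a"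
    proof (rule the_equality)
      show "z = a" if "approx_lim u x z" for z using lim[OF that] by simp
    qed
    moreover have "x \<in> \<Omega> - disc_set \<Omega> u" using al x by (auto simp: disc_set_def)
    ultimately show ?thesis using True by (simp add: upper_trace_def lower_trace_def)
  next
    case False
    then have nl: "\<not> approx_lim u x z" for z using lim by auto
    have j: "approx_jump u x a b e" using approx_jump_iff[OF x] t False ba by simp
    have uniq: "a' = a \<and> b' = b" if "approx_jump u x a' b' e'" for a' b' e'
      using that trace_pair_unique[OF v_int _ t _ ba] approx_jump_iff[OF x] by (auto simp: less_imp_le)
    have "(THE a'. \<exists>b' e'. approx_jump u x a' b' e') = a" "(THE b'. \<exists>a' e'. approx_jump u x a' b' e') = b"
      using j uniq by (blast intro: the_equality)+
    moreover have "x \<in> disc_set \<Omega> u" "x \<in> jump_set \<Omega> u" using nl j x by (auto simp: disc_set_def jump_set_def)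
    ultimately show ?thesis by (simp add: upper_trace_def lower_trace_def)
  qed
  then show "upper_trace \<Omega> u x = a" "lower_trace \<Omega> u x = b" by auto
qed

text \<open>An approximate limit would be a trace pair for any unit direction, so here neither a
  limit nor a jump exists and the default value applies.\<close>

lemma traces_eq_0:
  assumes x: "x \<in> \<Omega>" and no: "\<And>a b e. \<not> trace_pair v x a b e"
  shows "upper_trace \<Omega> u x = 0" "lower_trace \<Omega> u x = 0"
proof -
  obtain e :: 'a where e: "e \<in> Basis" using nonempty_Basis by blast
  then have "norm e = 1" by simp
  then have "x \<in> disc_set \<Omega> u" using no x approx_lim_iff[OF x] by (auto simp: disc_set_def)
  moreover have "x \<notin> jump_set \<Omega> u" using no approx_jump_iff[OF x] by (auto simp: jump_set_def)
  ultimately show "upper_trace \<Omega> u x = 0" "lower_trace \<Omega> u x = 0" by (auto simp: upper_trace_def lower_trace_def)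
qed

text \<open>On the Borel set of trace points the traces are \<open>mid_trace\<close> plus and minus
  \<open>gap_trace\<close>, and elsewhere they are 0.\<close>

lemma traces_measurable:
  "upper_trace \<Omega> u \<in> borel_measurable (restrict_space borel \<Omega>)"
  "lower_trace \<Omega> u \<in> borel_measurable (restrict_space borel \<Omega>)"
proof -
  let ?G = "{x. \<exists>a b e. trace_pair v x a b e}"
  have G: "?G \<in> sets borel" by (rule sets_trace_points[OF v_int])
  have m: "mid_trace v \<in> borel_measurable borel" "gap_trace v \<in> borel_measurable borel"
    using mid_trace_measurable[OF v_int] gap_trace_measurable[OF v_int] .
  have eq: "upper_trace \<Omega> u x = (if x \<in> ?G then mid_trace v x + gap_trace v x else 0) \<and>
     lower_trace \<Omega> u x = (if x \<in> ?G then mid_trace v x - gap_trace v x else 0)" if x: "x \<in> \<Omega>" for x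
  proof (cases "x \<in> ?G")
    case True
    then obtain a b e where "trace_pair v x a b e" by blast
    then obtain a b e where t: "b \<le> a" "trace_pair v x a b e" by (rule trace_pair_sorted[OF v_int])
    have "mid_trace v x = (a + b) / 2" "gap_trace v x = (a - b) / 2"
      using trace_pair_mid_gap[OF v_int t(2)] t(1) by auto
    then show ?thesis using True traces_eq[OF x t(2,1)] by (simp add: field_simps)
  next
    case False
    then have no: "\<not> trace_pair v x a b e" for a b e by blast
    show ?thesis unfolding if_not_P[OF False] using traces_eq_0[OF x no] by simp
  qed
  have "(\<lambda>x. if x \<in> ?G then mid_trace v x + gap_trace v x else 0) \<in> borel_measurable borel"
    "(\<lambda>x. if x \<in> ?G then mid_trace v x - gap_trace v x else 0) \<in> borel_measurable borel"
    by (intro measurable_If_set borel_measurable_add borel_measurable_diff m measurable_const; use G in simp)+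
  note m' = this[THEN measurable_restrict_space1, of \<Omega>]
  show "upper_trace \<Omega> u \<in> borel_measurable (restrict_space borel \<Omega>)"
    by (rule measurable_cong[THEN iffD2, OF _ m'(1)]) (use eq in \<open>simp only: space_borel_of\<close>)
  show "lower_trace \<Omega> u \<in> borel_measurable (restrict_space borel \<Omega>)"
    by (rule measurable_cong[THEN iffD2, OF _ m'(2)]) (use eq in \<open>simp only: space_borel_of\<close>)
qed

text \<open>At a Lebesgue point both traces equal \<open>v x\<close>, and so does every combination
  with weights \<open>lam x\<close> and \<open>1 - lam x\<close>.\<close>

lemma AE_lam_rep: "AE x in lborel. x \<in> \<Omega> \<longrightarrow> lam_rep \<Omega> lam u x = v x"
  using lebesgue_points[OF v_int]
proof eventually_elim
  case (elim x)
  obtain e :: 'a where e: "e \<in> Basis" using nonempty_Basis by blast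
  then have "trace_pair v x (v x) (v x) e" using elim trace_pair_same[of e v x "v x"] by simp
  then show ?case using traces_eq[of x "v x" "v x" e] by (auto simp: lam_rep_def algebra_simps)
qed

end

lemma continuous_mdev_tendsto:
  assumes "w \<in> test_functions UNIV"
  shows "((\<lambda>r. mdev w (ball x r) (w x)) \<longlongrightarrow> 0) (at_right 0)"
proof (rule tendstoI)
  fix \<eta> :: real assume \<eta>: "\<eta> > 0"
  obtain d where d: "d > 0" "\<And>x y. norm (x - y) < d \<Longrightarrow> \<bar>w x - w y\<bar> < \<eta> / 2"
    by (rule test_functions_uniformly_continuous[OF assms, of "\<eta> / 2"]) (use \<eta> in auto)
  show "\<forall>\<^sub>F r in at_right 0. dist (mdev w (ball x r) (w x)) 0 < \<eta>"
    unfolding eventually_at_right_field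
  proof (intro exI[of _ d] conjI allI impI d(1))
    fix r assume r: "0 < r" "r < d"
    have p: "measure lborel (ball x r) > 0" using r by (simp add: content_ball)
    have wi: "integrable lborel w" by (rule test_functions_integrable[OF assms])
    have "(LINT y:ball x r|lborel. \<bar>w y - w x\<bar>) \<le> (LINT y:ball x r|lborel. \<bar>0 - \<eta> / 2\<bar>)"
    proof (rule set_integral_mono)
      show "set_integrable lborel (ball x r) (\<lambda>y. \<bar>w y - w x\<bar>)" by (rule set_integrable_bounded[OF wi]) auto
      show "set_integrable lborel (ball x r) (\<lambda>y. \<bar>0 - \<eta> / 2\<bar>)" by (rule set_integrable_bounded) auto
      fix y assume "y \<in> ball x r"
      then show "\<bar>w y - w x\<bar> \<le> \<bar>0 - \<eta> / 2\<bar>" using d(2)[of y x] r by (auto simp: dist_norm norm_minus_commute)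
    qed
    also have "\<dots> = \<eta> / 2 * measure lborel (ball x r)" using \<eta> by (simp add: set_lebesgue_integral_def)
    finally have "mdev w (ball x r) (w x) \<le> \<eta> / 2" unfolding mdev_def using p by (simp add: pos_divide_le_eq)
    then show "dist (mdev w (ball x r) (w x)) 0 < \<eta>" using \<eta> mdev_nonneg[of w "ball x r" "w x"] by simp
  qed
qed

text \<open>A continuous function is its own approximate limit everywhere. Thus admissibility speaks
  about the plain integral of a test function.\<close>

lemma star_rep_test:
  assumes \<Omega>: "open \<Omega>" and w: "w \<in> test_functions \<Omega>" and x: "x \<in> \<Omega>"
  shows "star_rep \<Omega> w x = w x"
proof -
  have w': "w \<in> test_functions UNIV" by (rule test_functions_mono[OF _ w]) simp
  interpret borel_version \<Omega> w w
  proof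
    show "w \<in> borel_measurable (lebesgue_on \<Omega>)"
      using test_functions_measurable[OF w]
      by (intro measurable_restrict_space1 measurable_completion) simp
  qed (use \<Omega> test_functions_integrable[OF w] in auto)
  obtain e :: 'a where e: "e \<in> Basis" using nonempty_Basis by blast
  then have "trace_pair w x (w x) (w x) e"
    using continuous_mdev_tendsto[OF w'] trace_pair_same[of e w x "w x"] by simp
  then show ?thesis using traces_eq[OF x] by (auto simp: star_rep_def)
qed

section \<open>Test functions as BV functions\<close>

lemma test_integrable_finite:
  assumes \<phi>: "\<phi> \<in> test_functions \<Omega>" and M: "finite_measure M" "sets M = borel_of \<Omega>'"
  shows "integrable M \<phi>"
proof -
  obtain B where B: "B > 0" "\<And>x. \<bar>\<phi> x\<bar> \<le> B" by (rule test_functions_bounded[OF \<phi>]) blast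
  have "\<phi> \<in> borel_measurable (restrict_space borel \<Omega>')"
    using test_functions_measurable[OF \<phi>] by (rule measurable_restrict_space1)
  then have "\<phi> \<in> borel_measurable M" using M(2) by (simp cong: measurable_cong_sets)
  then show ?thesis using B by (intro finite_measure.integrable_const_bound[OF M(1), of _ B]) auto
qed

text \<open>Convolution of \<open>f\<close> with the indicator of a large ball is constant near 0,
  because there it equals the full integral of \<open>f\<close>. Its derivative at 0 vanishes, and
  it is also the integral of the reflected partial derivative.\<close>

lemma integral_partial_test_0:
  fixes f :: "'a::euclidean_space \<Rightarrow> real"
  assumes f: "f \<in> test_functions UNIV" and i: "i \<in> Basis"
  shows "(LINT x|lborel. frechet_derivative f (at x) i) = 0"
proof -
  obtain K where K: "compact K" "\<And>x. x \<notin> K \<Longrightarrow> f x = 0" by (rule test_functionsE[OF f]) blast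
  obtain R where "\<And>x. x \<in> K \<Longrightarrow> norm x \<le> R" using compact_imp_bounded[OF K(1)] unfolding bounded_iff by blast
  then have R: "f x = 0" if "norm x > R" for x using K(2)[of x] that by fastforce
  let ?D = "\<lambda>x. frechet_derivative f (at x) i"
  have D: "?D \<in> test_functions UNIV" by (rule test_functions_deriv[OF f i])
  \<comment> \<open>A margin of 2 beyond the support radius: for \<open>x\<close> in the unit ball
    and \<open>y\<close> outside \<open>?B\<close>, the point \<open>x - y\<close> still lies
    outside the support.\<close>
  let ?B = "ball (0::'a) (R + 2)"
  have B: "integrable lborel (indicator ?B :: 'a \<Rightarrow> real)" by (rule integrable_indicator_in_ball[of _ 0 "R + 2"]) auto
  have c: "conv f (indicator ?B) x = (LINT y|lborel. f y)" if "x \<in> ball 0 1" for x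
  proof -
    have "f (x - y) * indicator ?B y = f (x - y)" for y
    proof (cases "y \<in> ?B")
      case False
      have "norm y \<le> norm x + norm (x - y)" using norm_triangle_ineq4[of x "x - y"] by simp
      then have "norm (x - y) > R" using False that by simp
      then show ?thesis using R by simp
    qed simp
    then have "conv f (indicator ?B) x = (LINT y|lborel. f (x - y))" unfolding conv_def by (simp only:)
    then show ?thesis using lborel_integral_reflect(1)[OF test_functions_measurable[OF f]] by simp
  qed
  have D0: "?D x = 0" if "norm x > R + 1" for x
  proof -
    have "(f has_derivative (\<lambda>_. 0)) (at x)"
      using that R by (intro has_derivative_transform_within_open[of "\<lambda>_. 0" "\<lambda>_. 0" x UNIV "{x. norm x > R}" f])
        (auto intro!: open_Collect_less continuous_intros)
    then show ?thesis using frechet_derivative_at by metis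
  qed
  have "(conv f (indicator ?B) has_derivative (\<lambda>_. 0)) (at 0)"
    by (rule has_derivative_transform_within_open[of "\<lambda>_. LINT y|lborel. f y" "\<lambda>_. 0" 0 UNIV "ball 0 1"]) (auto simp: c)
  then have "frechet_derivative (conv f (indicator ?B)) (at 0) i = 0" using frechet_derivative_at by metis
  then have "conv ?D (indicator ?B) 0 = 0" using conv_frechet_derivative[OF f B i] by simp
  moreover have "?D (0 - y) * indicator ?B y = ?D (0 - y)" for y
    using D0[of "0 - y"] by (cases "y \<in> ?B") auto
  ultimately have "(LINT y|lborel. ?D (0 - y)) = 0" unfolding conv_def by (simp only:)
  then show ?thesis using lborel_integral_reflect(1)[OF test_functions_measurable[OF D], of 0] by simp
qed

lemma integration_by_parts:
  fixes w \<phi> :: "'a::euclidean_space \<Rightarrow> real"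
  assumes w: "w \<in> test_functions UNIV" and \<phi>: "\<phi> \<in> test_functions UNIV" and i: "i \<in> Basis"
  shows "(LINT x|lborel. w x * frechet_derivative \<phi> (at x) i) = - (LINT x|lborel. frechet_derivative w (at x) i * \<phi> x)"
proof -
  have D: "frechet_derivative (\<lambda>x. w x * \<phi> x) (at x) i = w x * frechet_derivative \<phi> (at x) i + frechet_derivative w (at x) i * \<phi> x" for x
    using frechet_derivative_mult[OF test_functions_differentiable[OF w] test_functions_differentiable[OF \<phi>]] by simp
  have "(\<lambda>x. w x * \<phi> x) \<in> test_functions UNIV"
    by (intro test_functions_mult_smooth w test_functions_cont_diff[OF \<phi>])
  from integral_partial_test_0[OF this i]
  have "(LINT x|lborel. w x * frechet_derivative \<phi> (at x) i + frechet_derivative w (at x) i * \<phi> x) = 0" unfolding D .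
  moreover have "integrable lborel (\<lambda>x. w x * frechet_derivative \<phi> (at x) i)" "integrable lborel (\<lambda>x. frechet_derivative w (at x) i * \<phi> x)"
    by (intro test_functions_integrable[of _ UNIV] test_functions_mult_smooth w test_functions_deriv i \<phi> test_functions_cont_diff[OF \<phi>]
        test_functions_cont_diff[OF test_functions_deriv[OF \<phi> i]])+
  ultimately show ?thesis by simp
qed

lemma finite_vmeasure_density:
  fixes f :: "'a::euclidean_space \<Rightarrow> 'b::euclidean_space"
  assumes \<Omega>: "open \<Omega>" and f: "integrable lborel f"
  shows "finite_vmeasure \<Omega> (\<lambda>A. LINT x:A|lborel. f x)"
  unfolding finite_vmeasure_def
proof (intro allI impI)
  fix A :: "nat \<Rightarrow> 'a set" assume A: "range A \<subseteq> borel_of \<Omega> \<and> disjoint_family A"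
  have Ab: "A i \<in> sets borel" for i using A borel_of_open_eq[OF \<Omega>] by auto
  have UA: "(\<Union>i. A i) \<in> sets borel" using Ab by (intro sets.countable_UN image_subsetI)
  have i: "integrable lborel (\<lambda>x. indicator (A i) x *\<^sub>R f x)" for i
    using Ab f by (intro integrable_mult_indicator) auto
  have "(\<lambda>n. LINT x|lborel. (\<Sum>i<n. indicator (A i) x *\<^sub>R f x)) \<longlonglongrightarrow> (LINT x|lborel. indicator (\<Union>i. A i) x *\<^sub>R f x)"
  proof (rule integral_dominated_convergence[where w = "\<lambda>x. norm (f x)"])
    have s: "(\<lambda>i. indicator (A i) x *\<^sub>R f x) sums (indicator (\<Union>i. A i) x *\<^sub>R f x)"
       and b: "norm (\<Sum>i<n. indicator (A i) x *\<^sub>R f x) \<le> norm (f x)" for x n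
    proof -
      consider k where "x \<in> A k" | "x \<notin> (\<Union>i. A i)" by auto
      then have "(\<lambda>i. indicator (A i) x *\<^sub>R f x) sums (indicator (\<Union>i. A i) x *\<^sub>R f x) \<and>
         norm (\<Sum>i<n. indicator (A i) x *\<^sub>R f x) \<le> norm (f x)"
      proof cases
        case 1
        then have *: "indicator (A i) x *\<^sub>R f x = (if i = k then f x else 0)" for i
          using A by (auto simp: disjoint_family_on_def split: split_indicator)
        have "x \<in> (\<Union>i. A i)" using 1 by blast
        then have "indicator (\<Union>i. A i) x *\<^sub>R f x = f x" by (simp only: indicator_simps(1) scaleR_one)
        moreover have "(\<lambda>i. if i = k then f x else 0) sums f x" using sums_single[of k "\<lambda>_. f x"] by simp
        moreover have "norm (\<Sum>i<n. if i = k then f x else 0) \<le> norm (f x)" by simp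
        ultimately show ?thesis unfolding * by simp
      qed (auto)
      then show "(\<lambda>i. indicator (A i) x *\<^sub>R f x) sums (indicator (\<Union>i. A i) x *\<^sub>R f x)"
        "norm (\<Sum>i<n. indicator (A i) x *\<^sub>R f x) \<le> norm (f x)" by auto
    qed
    show "AE x in lborel. (\<lambda>n. \<Sum>i<n. indicator (A i) x *\<^sub>R f x) \<longlonglongrightarrow> indicator (\<Union>i. A i) x *\<^sub>R f x"
      using s by (simp add: sums_def)
    show "AE x in lborel. norm (\<Sum>i<n. indicator (A i) x *\<^sub>R f x) \<le> norm (f x)" for n using b by simp
    show "(\<lambda>x. \<Sum>i<n. indicator (A i) x *\<^sub>R f x) \<in> borel_measurable lborel" for n
      using i by (intro borel_measurable_sum borel_measurable_integrable)
    show "(\<lambda>x. indicator (\<Union>i. A i) x *\<^sub>R f x) \<in> borel_measurable lborel"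
      using UA borel_measurable_integrable[OF f] by (intro borel_measurable_scaleR borel_measurable_indicator) auto
  qed (use f in simp)
  then show "(\<lambda>i. LINT x:A i|lborel. f x) sums (LINT x:\<Union> (range A)|lborel. f x)"
    unfolding sums_def set_lebesgue_integral_def by (simp only: Bochner_Integration.integral_sum[OF i])
qed

lemma signed_integral_zero_measure: "signed_integral \<Omega> (\<lambda>_. 0) f = 0"
  by (simp add: signed_integral_def pos_variation_def neg_variation_def)

lemma finite_vmeasure_zero: "finite_vmeasure \<Omega> (\<lambda>_. 0)"
  by (simp add: finite_vmeasure_def)

lemma signed_integral_density:
  fixes g :: "'a::euclidean_space \<Rightarrow> real"
  assumes \<Omega>: "open \<Omega>" and g: "integrable lborel g" and \<phi>: "\<phi> \<in> test_functions \<Omega>"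
    and eq: "\<And>A. A \<in> borel_of \<Omega> \<Longrightarrow> \<nu> A = (LINT x:A|lborel. g x)"
  shows "signed_integral \<Omega> \<nu> \<phi> = (LINT x|lborel. g x * \<phi> x)"
proof -
  have \<nu>: "finite_vmeasure \<Omega> \<nu>"
    by (rule finite_vmeasure_cong[OF finite_vmeasure_density[OF \<Omega> g]]) (simp add: eq)
  obtain B where B: "B > 0" "\<And>x. \<bar>\<phi> x\<bar> \<le> B" by (rule test_functions_bounded[OF \<phi>]) blast
  have supp: "indicator \<Omega> x * (g x * \<phi> x) = g x * \<phi> x" for x
  proof -
    obtain K where K: "K \<subseteq> \<Omega>" "\<And>x. x \<notin> K \<Longrightarrow> \<phi> x = 0" by (rule test_functionsE[OF \<phi>]) blast
    show ?thesis using K by (cases "x \<in> \<Omega>") auto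
  qed
  have i: "integrable lborel (\<lambda>x. g x * \<phi> x)"
  proof (rule Bochner_Integration.integrable_bound[of lborel "\<lambda>x. B * g x"])
    show "(\<lambda>x. g x * \<phi> x) \<in> borel_measurable lborel"
      using borel_measurable_integrable[OF g] test_functions_measurable[OF \<phi>] by simp
    show "AE x in lborel. norm (g x * \<phi> x) \<le> norm (B * g x)"
      using B by (auto simp: abs_mult mult.commute intro!: mult_right_mono)
  qed (use g in simp)
  have "signed_integral \<Omega> \<nu> \<phi> = (LINT x|lborel. indicator \<Omega> x * (g x * \<phi> x)) + signed_integral \<Omega> (\<lambda>_. 0) \<phi>"
    using \<nu> i by (intro signed_integral_ac_plus[OF \<Omega> g]) (auto intro!: test_integrable_finite[OF \<phi>]
        finite_measure_total_variation finite_vmeasure_zero simp: eq supp)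
  then show ?thesis by (simp add: supp signed_integral_zero_measure)
qed

text \<open>The classical gradient is the density of a derivative measure by integration by parts.
  The norm, however, is formed with the chosen derivative measure, so uniqueness must identify the
  two before the variation is bounded by coordinates.\<close>

lemma test_function_BV:
  fixes w :: "'a::euclidean_space \<Rightarrow> real"
  assumes \<Omega>: "open \<Omega>" and w: "w \<in> test_functions \<Omega>"
  shows "w \<in> BV \<Omega>" "w \<in> Linf \<Omega>"
    and "BV_norm \<Omega> w \<le> (LINT x|lborel. \<bar>w x\<bar>) + (\<Sum>i\<in>Basis. LINT x|lborel. \<bar>frechet_derivative w (at x) i\<bar>)"
proof -
  have w': "w \<in> test_functions UNIV" by (rule test_functions_mono[OF _ w]) simp
  let ?D = "\<lambda>i x. frechet_derivative w (at x) i"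
  define G where "G x = (\<Sum>i\<in>Basis. ?D i x *\<^sub>R i)" for x
  have Di: "integrable lborel (?D i)" if "i \<in> Basis" for i
    by (rule test_functions_integrable[OF test_functions_deriv[OF w that]])
  have G: "integrable lborel G" unfolding G_def using Di by (intro Bochner_Integration.integrable_sum integrable_scaleR_left)
  have Gi: "G x \<bullet> i = ?D i x" if "i \<in> Basis" for x i
    unfolding G_def using that by (simp add: inner_sum_left inner_Basis if_distrib sum.If_cases cong: if_cong)
  define \<nu> where "\<nu> A = (LINT x:A|lborel. G x)" for A
  have \<nu>: "finite_vmeasure \<Omega> \<nu>" unfolding \<nu>_def[abs_def] by (rule finite_vmeasure_density[OF \<Omega> G])
  have \<nu>i: "\<nu> A \<bullet> i = (LINT x:A|lborel. ?D i x)" if i: "i \<in> Basis" and A: "A \<in> borel_of \<Omega>" for A i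
  proof -
    have "integrable lborel (\<lambda>x. indicator A x *\<^sub>R G x)"
      using G A borel_of_open_eq[OF \<Omega>] by (intro integrable_mult_indicator) auto
    then have "\<nu> A \<bullet> i = (LINT x|lborel. (indicator A x *\<^sub>R G x) \<bullet> i)"
      unfolding \<nu>_def set_lebesgue_integral_def by (rule integral_inner_left[symmetric, rotated])
    then show ?thesis using Gi[OF i] by (simp add: set_lebesgue_integral_def)
  qed
  have int_on: "(LINT x|lebesgue_on \<Omega>. w x * f x) = (LINT x|lborel. w x * f x)" if "f \<in> borel_measurable borel" for f
  proof -
    obtain K where K: "K \<subseteq> \<Omega>" "\<And>x. x \<notin> K \<Longrightarrow> w x = 0" by (rule test_functionsE[OF w]) blast
    have "(LINT x|lebesgue_on \<Omega>. w x * f x) = (LINT x:\<Omega>|lborel. w x * f x)"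
      using that test_functions_measurable[OF w] \<Omega> by (intro integral_lebesgue_on_eq) auto
    also have "\<dots> = (LINT x|lborel. w x * f x)"
      unfolding set_lebesgue_integral_def using K by (intro Bochner_Integration.integral_cong) (auto split: split_indicator)
    finally show ?thesis .
  qed
  have dm: "is_deriv_measure \<Omega> w \<nu>"
    unfolding is_deriv_measure_def
  proof (intro conjI ballI \<nu>)
    fix \<phi> and i :: 'a assume \<phi>: "\<phi> \<in> test_functions \<Omega>" and i: "i \<in> Basis"
    have \<phi>': "\<phi> \<in> test_functions UNIV" by (rule test_functions_mono[OF _ \<phi>]) simp
    have "signed_integral \<Omega> (\<lambda>A. \<nu> A \<bullet> i) \<phi> = (LINT x|lborel. ?D i x * \<phi> x)"
      by (rule signed_integral_density[OF \<Omega> Di[OF i] \<phi>]) (rule \<nu>i[OF i])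
    then show "(LINT x|lebesgue_on \<Omega>. w x * frechet_derivative \<phi> (at x) i) = - signed_integral \<Omega> (\<lambda>A. \<nu> A \<bullet> i) \<phi>"
      using integration_by_parts[OF w' \<phi>' i] int_on[OF test_functions_measurable[OF test_functions_deriv[OF \<phi> i]]] by simp
  qed
  have wi: "integrable lborel w" by (rule test_functions_integrable[OF w])
  show BV: "w \<in> BV \<Omega>"
    unfolding BV_def using dm integrable_lebesgue_on_of_lborel[OF wi] \<Omega> by auto
  obtain B where B: "B > 0" "\<And>x. \<bar>w x\<bar> \<le> B" by (rule test_functions_bounded[OF w]) blast
  have wm: "w \<in> borel_measurable (lebesgue_on \<Omega>)"
    using test_functions_measurable[OF w] by (intro measurable_restrict_space1 measurable_completion) simp
  have "Linf_norm \<Omega> w \<le> ereal B"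
    unfolding Linf_norm_def using B(2) wm by (intro esssup_I) auto
  then show "w \<in> Linf \<Omega>" unfolding Linf_def using wm by auto
  let ?d = "deriv_measure \<Omega> w"
  have d: "is_deriv_measure \<Omega> w ?d" by (rule is_ac_density_ac_grad(1)[OF \<Omega> BV])
  then have dv: "finite_vmeasure \<Omega> ?d" by (simp add: is_deriv_measure_def)
  \<comment> \<open>Both measures satisfy the same tested identities, hence agree on Borel
    sets.\<close>
  have deq: "?d A \<bullet> i = (LINT x:A|lborel. ?D i x)" if i: "i \<in> Basis" and A: "A \<in> borel_of \<Omega>" for A i
  proof -
    have "?d A \<bullet> i = \<nu> A \<bullet> i"
    proof (rule finite_vmeasure_eqI_test[OF \<Omega> finite_vmeasure_inner[OF dv] finite_vmeasure_inner[OF \<nu>] _ A])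
      fix \<phi> assume \<phi>: "\<phi> \<in> test_functions \<Omega>"
      show "signed_integral \<Omega> (\<lambda>A. ?d A \<bullet> i) \<phi> = signed_integral \<Omega> (\<lambda>A. \<nu> A \<bullet> i) \<phi>"
        using d[unfolded is_deriv_measure_def, THEN conjunct2, rule_format, OF \<phi> i]
          dm[unfolded is_deriv_measure_def, THEN conjunct2, rule_format, OF \<phi> i] by simp
    qed
    then show ?thesis using \<nu>i[OF i A] by simp
  qed
  have "variation \<Omega> (\<lambda>A. ?d A \<bullet> i) \<Omega> \<le> ennreal (LINT x|lborel. \<bar>?D i x\<bar>)" if i: "i \<in> Basis" for i
  proof -
    have ai: "integrable lborel (\<lambda>x. \<bar>?D i x\<bar>)" using Di[OF i] by simp
    have "variation \<Omega> (\<lambda>A. ?d A \<bullet> i) \<Omega> \<le> emeasure (pos_density \<Omega> (\<lambda>x. \<bar>?D i x\<bar>)) \<Omega>"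
    proof (rule variation_le_measures)
      fix A assume A: "A \<in> borel_of \<Omega>"
      have "\<bar>LINT x:A|lborel. ?D i x\<bar> \<le> (LINT x:A|lborel. \<bar>?D i x\<bar>)"
        using integral_norm_bound[of lborel "\<lambda>x. indicator A x * ?D i x"]
        by (simp add: set_lebesgue_integral_def abs_mult)
      then show "ennreal (norm (?d A \<bullet> i)) \<le> emeasure (pos_density \<Omega> (\<lambda>x. \<bar>?D i x\<bar>)) A"
        by (simp add: emeasure_pos_density[OF \<Omega> ai A] deq[OF i A] max_absorb2 ennreal_leI)
    qed (rule sets_pos_density[OF \<Omega> ai])
    also have "\<dots> = ennreal (LINT x:\<Omega>|lborel. \<bar>?D i x\<bar>)"
      by (simp add: emeasure_pos_density[OF \<Omega> ai] max_absorb2)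
    also have "\<dots> \<le> ennreal (LINT x|lborel. \<bar>?D i x\<bar>)"
      unfolding set_lebesgue_integral_def using ai \<Omega>
      by (intro ennreal_leI integral_mono integrable_mult_indicator) (auto split: split_indicator)
    finally show ?thesis .
  qed
  then have "variation \<Omega> ?d \<Omega> \<le> (\<Sum>i\<in>Basis. ennreal (LINT x|lborel. \<bar>?D i x\<bar>))"
    by (intro order_trans[OF variation_le_sum_components[OF dv]] sum_mono)
  also have "\<dots> = ennreal (\<Sum>i\<in>Basis. LINT x|lborel. \<bar>?D i x\<bar>)" by (simp add: sum_ennreal)
  finally have "ennreal (measure (total_variation \<Omega> ?d) \<Omega>) \<le> ennreal (\<Sum>i\<in>Basis. LINT x|lborel. \<bar>?D i x\<bar>)"
    unfolding emeasure_total_variation[OF dv borel_of_top, symmetric]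
      finite_measure.emeasure_eq_measure[OF finite_measure_total_variation[OF dv]] .
  then have "measure (total_variation \<Omega> ?d) \<Omega> \<le> (\<Sum>i\<in>Basis. LINT x|lborel. \<bar>?D i x\<bar>)"
    by (subst (asm) ennreal_le_iff) (auto intro!: sum_nonneg)
  moreover have "(LINT x|lebesgue_on \<Omega>. \<bar>w x\<bar>) = (LINT x|lborel. \<bar>w x\<bar>)"
  proof -
    have "(LINT x|lebesgue_on \<Omega>. w x * sgn (w x)) = (LINT x|lborel. w x * sgn (w x))"
      using test_functions_measurable[OF w] by (intro int_on) simp
    then show ?thesis by (simp add: abs_sgn)
  qed
  ultimately show "BV_norm \<Omega> w \<le> (LINT x|lborel. \<bar>w x\<bar>) + (\<Sum>i\<in>Basis. LINT x|lborel. \<bar>?D i x\<bar>)"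
    unfolding BV_norm_def by simp
qed

text \<open>Here admissibility enters: continuity of the functional, evaluated on test functions,
  bounds integrals against the total variation of \<open>\<mu>\<close> by a Sobolev norm with one
  constant.\<close>

lemma admissible_bound:
  fixes \<mu> :: "'a::euclidean_space set \<Rightarrow> real"
  assumes \<Omega>: "open \<Omega>" and adm: "admissible \<Omega> \<mu>"
  obtains C where "C \<ge> 0" "\<And>w. w \<in> test_functions \<Omega> \<Longrightarrow> (LINT x|total_variation \<Omega> \<mu>. w x)
     \<le> C * ((LINT x|lborel. \<bar>w x\<bar>) + (\<Sum>i\<in>Basis. LINT x|lborel. \<bar>frechet_derivative w (at x) i\<bar>))"
proof -
  obtain \<Lambda> C where C: "\<And>u. u \<in> BV \<Omega> \<Longrightarrow> \<bar>\<Lambda> u\<bar> \<le> C * BV_norm \<Omega> u"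
    and \<Lambda>: "\<And>u. u \<in> BV \<Omega> \<inter> Linf \<Omega> \<Longrightarrow> \<Lambda> u = (LINT x|total_variation \<Omega> \<mu>. star_rep \<Omega> u x)"
    using adm unfolding admissible_def BV_dual_def by blast
  have "(LINT x|total_variation \<Omega> \<mu>. w x)
     \<le> \<bar>C\<bar> * ((LINT x|lborel. \<bar>w x\<bar>) + (\<Sum>i\<in>Basis. LINT x|lborel. \<bar>frechet_derivative w (at x) i\<bar>))"
    if w: "w \<in> test_functions \<Omega>" for w
  proof -
    note b = test_function_BV[OF \<Omega> w]
    have "(LINT x|total_variation \<Omega> \<mu>. w x) = (LINT x|total_variation \<Omega> \<mu>. star_rep \<Omega> w x)"
      using star_rep_test[OF \<Omega> w] by (intro Bochner_Integration.integral_cong) auto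
    also have "\<dots> = \<Lambda> w" using \<Lambda> b by simp
    also have "\<dots> \<le> C * BV_norm \<Omega> w" using C[OF b(1)] by linarith
    \<comment> \<open>The constant of continuity carries no sign, whereas the bounds that follow
      multiply inequalities by it.\<close>
    also have "\<dots> \<le> \<bar>C\<bar> * BV_norm \<Omega> w"
      unfolding BV_norm_def by (intro mult_right_mono add_nonneg_nonneg) (auto intro!: Bochner_Integration.integral_nonneg)
    also have "\<dots> \<le> \<bar>C\<bar> * ((LINT x|lborel. \<bar>w x\<bar>) + (\<Sum>i\<in>Basis. LINT x|lborel. \<bar>frechet_derivative w (at x) i\<bar>))"
      by (intro mult_left_mono b) auto
    finally show ?thesis .
  qed
  then show ?thesis using that[of "\<bar>C\<bar>"] by simp
qed

section \<open>Difference quotients\<close>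

lemma compact_inner_approx:
  fixes W :: "'a::euclidean_space \<Rightarrow> real"
  assumes W: "integrable lborel W" and S: "S \<in> sets borel" and \<delta>: "\<delta> > 0"
  obtains C where "compact C" "C \<subseteq> S" "(LINT x:S|lborel. max 0 (W x)) \<le> (LINT x:C|lborel. max 0 (W x)) + \<delta>"
proof -
  let ?M = "pos_density UNIV W"
  have sM: "sets ?M = sets borel" using sets_pos_density[OF open_UNIV W] by (simp add: sets_restrict_space)
  have Sb: "S \<in> borel_of UNIV" using S by (simp add: borel_of_open_eq)
  have e: "emeasure ?M A = ennreal (LINT x:A|lborel. max 0 (W x))" if "A \<in> sets borel" for A
    using emeasure_pos_density[OF open_UNIV W, of A] that by (simp add: borel_of_open_eq)
  have fin: "emeasure ?M (space ?M) \<noteq> \<infinity>"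
    using finite_measure.emeasure_finite[OF finite_measure_pos_density[OF open_UNIV W]] by simp
  have ir: "emeasure ?M S = (SUP K\<in>{K. K \<subseteq> S \<and> compact K}. emeasure ?M K)"
    by (rule inner_regular[OF sM fin S])
  let ?I = "LINT x:S|lborel. max 0 (W x)"
  show ?thesis
  proof (cases "?I \<le> \<delta>")
    case True
    then show ?thesis using that[of "{}"] by (simp add: set_lebesgue_integral_def)
  next
    case False
    then have "ennreal (?I - \<delta>) < emeasure ?M S" unfolding e[OF S] using \<delta> by (intro ennreal_lessI) auto
    then obtain K where K: "K \<subseteq> S" "compact K" "ennreal (?I - \<delta>) < emeasure ?M K"
      unfolding ir less_SUP_iff by auto
    then have "?I - \<delta> < (LINT x:K|lborel. max 0 (W x))"
      using False by (subst (asm) e) (auto simp: borel_compact ennreal_less_iff)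
    then show ?thesis using that[OF K(2,1)] by simp
  qed
qed

lemma cutoff_integral_tendsto:
  fixes W :: "'a::euclidean_space \<Rightarrow> real"
  assumes W: "integrable lborel W" and C: "compact C"
    and \<phi>: "\<And>k. \<phi> k \<in> borel_measurable borel" "\<And>k x. 0 \<le> \<phi> k x" "\<And>k x. \<phi> k x \<le> 1"
    "\<And>x. (\<lambda>k. \<phi> k x) \<longlonglongrightarrow> (indicator C x :: real)"
  shows "(\<lambda>k. LINT x|lborel. W x * \<phi> k x) \<longlonglongrightarrow> (LINT x:C|lborel. W x)"
proof -
  have Wm [measurable]: "W \<in> borel_measurable borel" using borel_measurable_integrable[OF W] by simp
  have [measurable]: "C \<in> sets borel" using C by (rule borel_compact)
  have "(\<lambda>k. LINT x|lborel. W x * \<phi> k x) \<longlonglongrightarrow> (LINT x|lborel. W x * indicator C x)"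
  proof (rule integral_dominated_convergence[where w = "\<lambda>x. norm (W x)"])
    show "AE x in lborel. (\<lambda>k. W x * \<phi> k x) \<longlonglongrightarrow> W x * indicator C x"
      by (intro always_eventually allI tendsto_mult tendsto_const \<phi>(4))
    have "\<bar>\<phi> k x\<bar> \<le> 1" for k x using \<phi>(2,3)[of k x] by simp
    then show "AE x in lborel. norm (W x * \<phi> k x) \<le> norm (W x)" for k
      by (auto simp: abs_mult intro!: mult_left_le)
  qed (use W \<phi>(1) in auto)
  then show ?thesis by (simp add: set_lebesgue_integral_def mult.commute)
qed

text \<open>The sign of \<open>W\<close> is approximated from inside: compact subsets of the sets
  where \<open>W\<close> is positive or negative are taken up to \<open>\<delta> / 2\<close>, and
  the difference of cut-offs for them is an admissible test function.\<close>

lemma L1_norm_le_by_duality: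
  fixes W :: "'a::euclidean_space \<Rightarrow> real"
  assumes W: "integrable lborel W"
    and le: "\<And>\<phi>. \<phi> \<in> test_functions UNIV \<Longrightarrow> (\<And>x. \<bar>\<phi> x\<bar> \<le> 1) \<Longrightarrow> (LINT x|lborel. W x * \<phi> x) \<le> c"
  shows "(LINT x|lborel. \<bar>W x\<bar>) \<le> c"
proof (rule field_le_epsilon)
  fix \<delta> :: real assume \<delta>: "\<delta> > 0"
  have Wm [measurable]: "W \<in> borel_measurable borel" using borel_measurable_integrable[OF W] by simp
  have W': "integrable lborel (\<lambda>x. - W x)" using W by simp
  have P: "{x. 0 < W x} \<in> sets borel" "{x. 0 < - W x} \<in> sets borel" by measurable
  obtain C where C: "compact C" "C \<subseteq> {x. 0 < W x}" "(LINT x:{x. 0 < W x}|lborel. max 0 (W x)) \<le> (LINT x:C|lborel. max 0 (W x)) + \<delta> / 2"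
    using compact_inner_approx[OF W P(1), of "\<delta> / 2"] \<delta> by auto
  obtain D where D: "compact D" "D \<subseteq> {x. 0 < - W x}" "(LINT x:{x. 0 < - W x}|lborel. max 0 (- W x)) \<le> (LINT x:D|lborel. max 0 (- W x)) + \<delta> / 2"
    using compact_inner_approx[OF W' P(2), of "\<delta> / 2"] \<delta> by auto
  have CD: "(LINT x:C|lborel. max 0 (W x)) = (LINT x:C|lborel. W x)" "(LINT x:D|lborel. max 0 (- W x)) = - (LINT x:D|lborel. W x)"
  proof -
    show "(LINT x:C|lborel. max 0 (W x)) = (LINT x:C|lborel. W x)"
      unfolding set_lebesgue_integral_def using C(2) by (intro Bochner_Integration.integral_cong) (auto split: split_indicator)
    have "(LINT x:D|lborel. max 0 (- W x)) = (LINT x|lborel. - (indicator D x *\<^sub>R W x))"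
      unfolding set_lebesgue_integral_def using D(2) by (intro Bochner_Integration.integral_cong) (auto split: split_indicator)
    then show "(LINT x:D|lborel. max 0 (- W x)) = - (LINT x:D|lborel. W x)"
      by (simp add: set_lebesgue_integral_def)
  qed
  obtain \<phi> :: "nat \<Rightarrow> 'a \<Rightarrow> real" where \<phi>: "\<And>k. \<phi> k \<in> test_functions UNIV" "\<And>k x. 0 \<le> \<phi> k x" "\<And>k x. \<phi> k x \<le> 1"
    "\<And>x. (\<lambda>k. \<phi> k x) \<longlonglongrightarrow> indicator C x" by (rule cutoff_sequence[OF C(1) subset_UNIV open_UNIV]) blast
  obtain \<psi> :: "nat \<Rightarrow> 'a \<Rightarrow> real" where \<psi>: "\<And>k. \<psi> k \<in> test_functions UNIV" "\<And>k x. 0 \<le> \<psi> k x" "\<And>k x. \<psi> k x \<le> 1"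
    "\<And>x. (\<lambda>k. \<psi> k x) \<longlonglongrightarrow> indicator D x" by (rule cutoff_sequence[OF D(1) subset_UNIV open_UNIV]) blast
  have l: "(\<lambda>k. (LINT x|lborel. W x * \<phi> k x) - (LINT x|lborel. W x * \<psi> k x)) \<longlonglongrightarrow> (LINT x:C|lborel. W x) - (LINT x:D|lborel. W x)"
    by (intro tendsto_diff cutoff_integral_tendsto W C(1) D(1) \<phi>(2-4) \<psi>(2-4) test_functions_measurable[OF \<phi>(1)] test_functions_measurable[OF \<psi>(1)])
  have b: "(LINT x|lborel. W x * \<phi> k x) - (LINT x|lborel. W x * \<psi> k x) \<le> c" for k
  proof -
    have i: "integrable lborel (\<lambda>x. W x * f x)" if "f \<in> test_functions UNIV" "\<And>x. \<bar>f x\<bar> \<le> 1" for f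
    proof (rule Bochner_Integration.integrable_bound[OF W])
      show "AE x in lborel. norm (W x * f x) \<le> norm (W x)" using that(2) by (auto simp: abs_mult intro!: mult_left_le)
    qed (use test_functions_measurable[OF that(1)] in simp)
    have a: "\<bar>\<phi> k x\<bar> \<le> 1" "\<bar>\<psi> k x\<bar> \<le> 1" "\<bar>\<phi> k x - \<psi> k x\<bar> \<le> 1" for x
      using \<phi>(2,3)[of k x] \<psi>(2,3)[of k x] by auto
    have "(LINT x|lborel. W x * \<phi> k x) - (LINT x|lborel. W x * \<psi> k x) = (LINT x|lborel. W x * (\<phi> k x - \<psi> k x))"
      using i[OF \<phi>(1) a(1)] i[OF \<psi>(1) a(2)] by (simp add: right_diff_distrib)
    also have "\<dots> \<le> c" by (intro le test_functions_diff \<phi>(1) \<psi>(1) a(3))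
    finally show ?thesis .
  qed
  have "(LINT x:C|lborel. W x) - (LINT x:D|lborel. W x) \<le> c"
    by (rule LIMSEQ_le_const2[OF l]) (use b in blast)
  moreover have "(LINT x|lborel. \<bar>W x\<bar>) = (LINT x:{x. 0 < W x}|lborel. max 0 (W x)) + (LINT x:{x. 0 < - W x}|lborel. max 0 (- W x))"
  proof -
    have i: "integrable lborel (\<lambda>x. max 0 (W x))" "integrable lborel (\<lambda>x. max 0 (- W x))" using W by auto
    have eqs: "(LINT x:{x. 0 < W x}|lborel. max 0 (W x)) = (LINT x|lborel. max 0 (W x))"
      "(LINT x:{x. 0 < - W x}|lborel. max 0 (- W x)) = (LINT x|lborel. max 0 (- W x))"
      unfolding set_lebesgue_integral_def by (intro Bochner_Integration.integral_cong; auto split: split_indicator)+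
    have "(LINT x|lborel. \<bar>W x\<bar>) = (LINT x|lborel. max 0 (W x) + max 0 (- W x))"
      by (intro Bochner_Integration.integral_cong) auto
    also have "\<dots> = (LINT x|lborel. max 0 (W x)) + (LINT x|lborel. max 0 (- W x))"
      by (rule Bochner_Integration.integral_add[OF i])
    finally show ?thesis unfolding eqs .
  qed
  ultimately show "(LINT x|lborel. \<bar>W x\<bar>) \<le> c + \<delta>" using C(3) D(3) CD by linarith
qed

lemma frechet_derivative_reflect:
  fixes f :: "'a::euclidean_space \<Rightarrow> real"
  assumes "f \<in> test_functions UNIV"
  shows "frechet_derivative (\<lambda>y. f (x - y)) (at y) i = - frechet_derivative f (at (x - y)) i"
  using frechet_derivative_affine_compose(1)[OF test_functions_differentiable[OF assms], of x "- 1" y] by simp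

lemma conv_deriv_eq:
  fixes f :: "'a::euclidean_space \<Rightarrow> real"
  assumes "f \<in> test_functions UNIV"
  shows "conv (\<lambda>z. frechet_derivative f (at z) i) U x = - (LINT y|lborel. U y * frechet_derivative (\<lambda>y. f (x - y)) (at y) i)"
  unfolding conv_def frechet_derivative_reflect[OF assms] by (simp add: mult.commute)

text \<open>Tested against \<open>\<phi>\<close>, the increment of \<open>U\<close> is the increment
  of a smooth function of the step length. The hypothesis bounds its derivative by \<open>C\<close>,
  the mean value inequality by \<open>C * h\<close>, and duality removes
  \<open>\<phi>\<close>.\<close>

lemma difference_quotient_bound:
  fixes U :: "'a::euclidean_space \<Rightarrow> real"
  assumes U: "integrable lborel U" and i: "i \<in> Basis" and C: "C \<ge> 0" and h: "h \<ge> 0"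
    and bd: "\<And>\<phi> B. \<phi> \<in> test_functions UNIV \<Longrightarrow> (\<And>x. \<bar>\<phi> x\<bar> \<le> B) \<Longrightarrow> \<bar>LINT x|lborel. U x * frechet_derivative \<phi> (at x) i\<bar> \<le> C * B"
  shows "(LINT x|lborel. \<bar>U (x + h *\<^sub>R i) - U x\<bar>) \<le> C * h"
proof (rule L1_norm_le_by_duality)
  have Um [measurable]: "U \<in> borel_measurable borel" using borel_measurable_integrable[OF U] by simp
  have Uh: "integrable lborel (\<lambda>x. U (x + h *\<^sub>R i))"
    using lborel_integral_translate(2)[OF Um, of "h *\<^sub>R i"] U by (simp add: add.commute)
  then show "integrable lborel (\<lambda>x. U (x + h *\<^sub>R i) - U x)" using U by simp
  fix \<phi> :: "'a \<Rightarrow> real" assume \<phi>: "\<phi> \<in> test_functions UNIV" "\<And>x. \<bar>\<phi> x\<bar> \<le> 1"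
  have \<phi>m [measurable]: "\<phi> \<in> borel_measurable borel" by (rule test_functions_measurable[OF \<phi>(1)])
  \<comment> \<open>The reflection turns convolution with \<open>U\<close> into testing:
    \<open>F t\<close> is the integral of \<open>U\<close> against \<open>\<phi>\<close> translated
    by \<open>t\<close> in direction \<open>i\<close>.\<close>
  let ?f = "\<lambda>z. \<phi> (0 - z)"
  have f: "?f \<in> test_functions UNIV" by (rule test_functions_reflect[OF \<phi>(1)])
  define F where "F t = conv ?f U (t *\<^sub>R i)" for t :: real
  have dF: "(F has_real_derivative conv (\<lambda>z. frechet_derivative ?f (at z) i) U (t *\<^sub>R i)) (at t)" for t
  proof -
    have "((\<lambda>t. t *\<^sub>R i) has_derivative (\<lambda>s. s *\<^sub>R i)) (at t)" by (auto intro!: derivative_eq_intros)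
    from has_derivative_compose[OF this conv_has_derivative[OF f U]]
    have "(F has_derivative (\<lambda>s. \<Sum>j\<in>Basis. ((s *\<^sub>R i) \<bullet> j) * conv (\<lambda>z. frechet_derivative ?f (at z) j) U (t *\<^sub>R i))) (at t)"
      by (simp add: F_def[abs_def])
    moreover have "(\<Sum>j\<in>Basis. ((s *\<^sub>R i) \<bullet> j) * conv (\<lambda>z. frechet_derivative ?f (at z) j) U (t *\<^sub>R i))
       = conv (\<lambda>z. frechet_derivative ?f (at z) i) U (t *\<^sub>R i) * s" for s
    proof -
      have "((s *\<^sub>R i) \<bullet> j) * c = (if j = i then s * c else 0)" if "j \<in> Basis" for j c
        using that i by (auto simp: inner_Basis)
      then show ?thesis using i by simp
    qed
    ultimately show ?thesis by (simp add: has_field_derivative_def mult_commute_abs)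
  qed
  have bF: "norm (conv (\<lambda>z. frechet_derivative ?f (at z) i) U (t *\<^sub>R i)) \<le> C" for t
  proof -
    have "(\<lambda>y. ?f (t *\<^sub>R i - y)) \<in> test_functions UNIV" by (rule test_functions_reflect[OF f])
    from bd[OF this, of 1] show ?thesis unfolding conv_deriv_eq[OF f] using \<phi>(2) by simp
  qed
  have "norm (F h - F 0) \<le> C * norm (h - 0)"
    by (rule field_differentiable_bound[of UNIV F _ C h 0]) (use dF bF in auto)
  moreover have "F h - F 0 = (LINT x|lborel. (U (x + h *\<^sub>R i) - U x) * \<phi> x)"
  proof -
    have m: "(\<lambda>y. \<phi> (y - h *\<^sub>R i) * U y) \<in> borel_measurable borel" by measurable
    have "F h = (LINT y|lborel. \<phi> (y - h *\<^sub>R i) * U y)" by (simp add: F_def conv_def)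
    also have "\<dots> = (LINT x|lborel. \<phi> x * U (x + h *\<^sub>R i))"
      using lborel_integral_translate(1)[OF m, of "h *\<^sub>R i"] by (simp add: add.commute)
    finally have "F h = (LINT x|lborel. U (x + h *\<^sub>R i) * \<phi> x)" by (simp add: mult.commute)
    moreover have "F 0 = (LINT x|lborel. U x * \<phi> x)" by (simp add: F_def conv_def mult.commute)
    moreover have ii: "integrable lborel (\<lambda>x. V x * \<phi> x)" if V: "integrable lborel V" for V
    proof (rule Bochner_Integration.integrable_bound[OF V])
      show "AE x in lborel. norm (V x * \<phi> x) \<le> norm (V x)" using \<phi>(2) by (auto simp: abs_mult intro!: mult_left_le)
    qed (use borel_measurable_integrable[OF V] \<phi>m in simp)
    ultimately show ?thesis using ii[OF Uh] ii[OF U] by (simp add: left_diff_distrib)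
  qed
  ultimately show "(LINT x|lborel. (U (x + h *\<^sub>R i) - U x) * \<phi> x) \<le> C * h" using h by simp
qed

section \<open>Layers\<close>

text \<open>The portion of \<open>\<bar>t\<bar>\<close> between the heights \<open>j\<close> and
  \<open>j + 1\<close>.\<close>

definition layer :: "nat \<Rightarrow> real \<Rightarrow> real" where
  "layer j t = min 1 (max 0 (\<bar>t\<bar> - real j))"

lemma layer_bounds: "0 \<le> layer j t" "layer j t \<le> 1" "layer j t \<le> \<bar>t\<bar>" "layer j 0 = 0"
  by (auto simp: layer_def)

lemma layer_measurable [measurable]: "layer j \<in> borel_measurable borel"
  unfolding layer_def[abs_def] by measurable

lemma sum_layer: "(\<Sum>j<J. layer j t) = min (real J) \<bar>t\<bar>"
  by (induction J) (auto simp: layer_def min_def max_def)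

text \<open>All layers are nondecreasing in the absolute value, so their increments share one sign
  and add up to the increment of the truncated absolute value.\<close>

lemma sum_layer_diff: "(\<Sum>j<J. \<bar>layer j s - layer j t\<bar>) \<le> \<bar>s - t\<bar>"
proof -
  have *: "(\<Sum>j<J. \<bar>layer j s - layer j t\<bar>) \<le> \<bar>s - t\<bar>" if "\<bar>t\<bar> \<le> \<bar>s\<bar>" for s t
  proof -
    have "layer j t \<le> layer j s" for j using that by (auto simp: layer_def)
    then have "(\<Sum>j<J. \<bar>layer j s - layer j t\<bar>) = (\<Sum>j<J. layer j s) - (\<Sum>j<J. layer j t)"
      by (simp add: sum_subtractf[symmetric])
    also have "\<dots> \<le> \<bar>s - t\<bar>" unfolding sum_layer using that by (auto simp: min_def)
    finally show ?thesis .
  qed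
  show ?thesis
  proof (cases "\<bar>t\<bar> \<le> \<bar>s\<bar>")
    case False
    then show ?thesis using *[of s t] by (simp add: abs_minus_commute)
  qed (rule *)
qed

lemma integral_abs_le_of_tendsto:
  fixes f :: "nat \<Rightarrow> 'a \<Rightarrow> real"
  assumes f: "\<And>k. integrable M (f k)" and g: "integrable M g"
    and lim: "\<And>x. (\<lambda>k. f k x) \<longlonglongrightarrow> g x" and le: "\<And>k. (LINT x|M. \<bar>f k x\<bar>) \<le> c"
  shows "(LINT x|M. \<bar>g x\<bar>) \<le> c"
proof -
  have c: "0 \<le> c" using le[of 0] by (rule order_trans[rotated]) simp
  have "ennreal (LINT x|M. \<bar>g x\<bar>) = (\<integral>\<^sup>+x. ennreal \<bar>g x\<bar> \<partial>M)"
    using g by (intro nn_integral_eq_integral[symmetric]) auto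
  also have "\<dots> = (\<integral>\<^sup>+x. liminf (\<lambda>k. ennreal \<bar>f k x\<bar>) \<partial>M)"
  proof (intro nn_integral_cong)
    fix x
    have "(\<lambda>k. ennreal \<bar>f k x\<bar>) \<longlonglongrightarrow> ennreal \<bar>g x\<bar>" by (intro tendsto_ennrealI tendsto_rabs lim)
    then show "ennreal \<bar>g x\<bar> = liminf (\<lambda>k. ennreal \<bar>f k x\<bar>)"
      by (rule lim_imp_Liminf[OF trivial_limit_sequentially, symmetric])
  qed
  also have "\<dots> \<le> liminf (\<lambda>k. \<integral>\<^sup>+x. ennreal \<bar>f k x\<bar> \<partial>M)"
    using f by (intro nn_integral_liminf) auto
  also have "\<dots> \<le> liminf (\<lambda>k. ennreal c)"
  proof (intro Liminf_mono always_eventually allI)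
    fix k
    have "(\<integral>\<^sup>+x. ennreal \<bar>f k x\<bar> \<partial>M) = ennreal (LINT x|M. \<bar>f k x\<bar>)"
      using f by (intro nn_integral_eq_integral) auto
    then show "(\<integral>\<^sup>+x. ennreal \<bar>f k x\<bar> \<partial>M) \<le> ennreal c" using le by (simp add: ennreal_leI)
  qed
  also have "\<dots> = ennreal c" by (simp add: Liminf_const)
  finally show ?thesis using c by (simp add: ennreal_le_iff)
qed

section \<open>Directional variations of the layers\<close>

context
  fixes U :: "'a::euclidean_space \<Rightarrow> real" and C :: "'a \<Rightarrow> real"
  assumes U: "integrable lborel U"
    and dq: "\<And>i h. i \<in> Basis \<Longrightarrow> h \<ge> 0 \<Longrightarrow> (LINT x|lborel. \<bar>U (x + h *\<^sub>R i) - U x\<bar>) \<le> C i * h"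
begin

lemma U_meas [measurable]: "U \<in> borel_measurable borel"
  using borel_measurable_integrable[OF U] by simp

lemma layer_integrable: "integrable lborel (\<lambda>x. layer j (U x))"
  by (rule Bochner_Integration.integrable_bound[OF U]) (auto simp: layer_bounds)

lemma layer_shift_integrable: "integrable lborel (\<lambda>x. layer j (U (x + y)))"
  using lborel_integral_translate(2)[of "\<lambda>x. layer j (U x)" y] layer_integrable by (simp add: add.commute)

text \<open>Dyadic difference quotients in the \<open>L1\<close> sense. Their limit
  \<open>layer_tv\<close> plays the role of the variation in direction \<open>i\<close> of the
  layer, obtained without differentiating the layer itself.\<close>

definition layer_var :: "'a \<Rightarrow> nat \<Rightarrow> nat \<Rightarrow> real" where
  "layer_var i j k = (LINT x|lborel. \<bar>layer j (U (x + (1/2)^k *\<^sub>R i)) - layer j (U x)\<bar>) * 2 ^ k"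

lemma layer_var_integrable: "integrable lborel (\<lambda>x. \<bar>layer j (U (x + y)) - layer j (U x)\<bar>)"
  using layer_shift_integrable layer_integrable by simp

lemma layer_var_nonneg: "0 \<le> layer_var i j k"
  by (simp add: layer_var_def)

text \<open>A step is the sum of two half steps, and by translation invariance both half steps
  contribute the same integral.\<close>

lemma layer_var_mono: "layer_var i j k \<le> layer_var i j (Suc k)"
proof -
  let ?y = "(1/2::real) ^ Suc k *\<^sub>R i"
  let ?g = "\<lambda>x. layer j (U x)"
  have y2: "(1/2::real) ^ k *\<^sub>R i = ?y + ?y" by (simp add: scaleR_2[symmetric])
  have m: "(\<lambda>x. \<bar>?g (x + ?y) - ?g x\<bar>) \<in> borel_measurable borel" by measurable
  have i2: "integrable lborel (\<lambda>x. \<bar>?g (x + ?y + ?y) - ?g (x + ?y)\<bar>)"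
    using lborel_integral_translate(2)[OF m, of ?y] layer_var_integrable[of j ?y] by (simp add: add_ac)
  have "(LINT x|lborel. \<bar>?g (x + (?y + ?y)) - ?g x\<bar>) \<le> (LINT x|lborel. \<bar>?g (x + ?y + ?y) - ?g (x + ?y)\<bar> + \<bar>?g (x + ?y) - ?g x\<bar>)"
    by (intro integral_mono Bochner_Integration.integrable_add i2 layer_var_integrable) (auto simp: add.assoc)
  also have "\<dots> = (LINT x|lborel. \<bar>?g (x + ?y + ?y) - ?g (x + ?y)\<bar>) + (LINT x|lborel. \<bar>?g (x + ?y) - ?g x\<bar>)"
    by (intro Bochner_Integration.integral_add i2 layer_var_integrable)
  also have "(LINT x|lborel. \<bar>?g (x + ?y + ?y) - ?g (x + ?y)\<bar>) = (LINT x|lborel. \<bar>?g (x + ?y) - ?g x\<bar>)"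
    using lborel_integral_translate(1)[OF m, of ?y] by (simp add: add_ac)
  finally show ?thesis unfolding layer_var_def y2 by simp
qed

text \<open>At a fixed step the increments of all layers together stay below the increment of
  \<open>U\<close>; the bound therefore holds for every \<open>J\<close> and survives the limit in
  the step.\<close>

lemma sum_layer_var_le: 
  assumes i: "i \<in> Basis" shows "(\<Sum>j<J. layer_var i j k) \<le> C i"
proof -
  let ?y = "(1/2::real) ^ k *\<^sub>R i"
  have Us: "integrable lborel (\<lambda>x. U (x + ?y))"
    using lborel_integral_translate(2)[OF U_meas, of ?y] U by (simp add: add.commute)
  have "(\<Sum>j<J. layer_var i j k) = (LINT x|lborel. (\<Sum>j<J. \<bar>layer j (U (x + ?y)) - layer j (U x)\<bar>)) * 2 ^ k"
    unfolding layer_var_def sum_distrib_right[symmetric] by (subst Bochner_Integration.integral_sum) (auto intro: layer_var_integrable)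
  also have "\<dots> \<le> (LINT x|lborel. \<bar>U (x + ?y) - U x\<bar>) * 2 ^ k"
    using Us U by (intro mult_right_mono integral_mono Bochner_Integration.integrable_sum layer_var_integrable sum_layer_diff) auto
  also have "\<dots> \<le> C i * (1/2)^k * 2 ^ k"
    by (intro mult_right_mono dq i) auto
  finally show ?thesis by (simp add: power_divide)
qed

definition layer_tv :: "'a \<Rightarrow> nat \<Rightarrow> real" where
  "layer_tv i j = lim (layer_var i j)"

lemma layer_var_tendsto:
  assumes i: "i \<in> Basis" shows "layer_var i j \<longlonglongrightarrow> layer_tv i j" "layer_var i j k \<le> layer_tv i j"
proof -
  have inc: "incseq (layer_var i j)" by (intro incseq_SucI layer_var_mono)
  have "layer_var i j k \<le> C i" for k
    using sum_layer_var_le[OF i, of k "Suc j"] sum_nonneg[of "{..<j}" "\<lambda>j. layer_var i j k"] layer_var_nonneg by simp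
  then obtain L where "layer_var i j \<longlonglongrightarrow> L" using incseq_convergent[OF inc] by blast
  then show l: "layer_var i j \<longlonglongrightarrow> layer_tv i j" unfolding layer_tv_def using limI by metis
  show "layer_var i j k \<le> layer_tv i j" by (rule incseq_le[OF inc l])
qed

lemma sum_layer_tv_le: "i \<in> Basis \<Longrightarrow> (\<Sum>j<J. layer_tv i j) \<le> C i"
  by (rule LIMSEQ_le_const2[OF tendsto_sum[OF layer_var_tendsto(1)]]) (auto intro: sum_layer_var_le)

lemma layer_tv_nonneg: "i \<in> Basis \<Longrightarrow> 0 \<le> layer_tv i j"
  using layer_var_tendsto(2)[of i j 0] layer_var_nonneg[of i j 0] by linarith

lemma conv_L1_le:
  assumes "\<epsilon> > 0" "integrable lborel w"
  shows "(LINT x|lborel. \<bar>conv (mollifier \<epsilon>) w x\<bar>) \<le> (LINT x|lborel. \<bar>w x :: real\<bar>)"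
proof -
  have "(LINT x|lborel. \<bar>conv (mollifier \<epsilon>) w x\<bar>) \<le> (LINT x|lborel. conv (mollifier \<epsilon>) (\<lambda>y. \<bar>w y\<bar>) x)"
    using assms by (intro integral_mono conv_abs_le integrable_abs conv_mollifier_integral) auto
  also have "\<dots> = (LINT x|lborel. \<bar>w x\<bar>)" using assms by (intro conv_mollifier_integral) auto
  finally show ?thesis .
qed

text \<open>Difference quotients commute with mollification, which does not increase
  \<open>L1\<close> norms. They converge pointwise to the derivative, and Fatou's lemma transfers
  the bound, which is independent of \<open>\<epsilon>\<close>.\<close>

lemma conv_layer_deriv_L1:
  assumes e: "\<epsilon> > 0" and i: "i \<in> Basis"
    and wt: "conv (mollifier \<epsilon>) (\<lambda>x. layer j (U x)) \<in> test_functions UNIV"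
  shows "(LINT x|lborel. \<bar>frechet_derivative (conv (mollifier \<epsilon>) (\<lambda>x. layer j (U x))) (at x) i\<bar>) \<le> layer_tv i j"
proof -
  let ?g = "\<lambda>x. layer j (U x)"
  let ?w = "conv (mollifier \<epsilon>) ?g"
  let ?f = "\<lambda>k x. (?w (x + (1/2)^k *\<^sub>R i) - ?w x) * 2 ^ k"
  have wi: "integrable lborel ?w" by (rule test_functions_integrable[OF wt])
  have wm: "?w \<in> borel_measurable borel" by (rule test_functions_measurable[OF wt])
  have ws: "integrable lborel (\<lambda>x. ?w (x + y))" for y
    using lborel_integral_translate(2)[OF wm, of y] wi by (simp add: add.commute)
  show ?thesis
  proof (rule integral_abs_le_of_tendsto[of lborel ?f])
    show "integrable lborel (?f k)" for k using ws wi by (intro integrable_mult_left Bochner_Integration.integrable_diff)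
    show "integrable lborel (\<lambda>x. frechet_derivative ?w (at x) i)"
      by (rule test_functions_integrable[OF test_functions_deriv[OF wt i]])
    show "(\<lambda>k. ?f k x) \<longlonglongrightarrow> frechet_derivative ?w (at x) i" for x
    proof -
      have "((\<lambda>t. ?w (x + t *\<^sub>R i)) has_derivative (\<lambda>s. frechet_derivative ?w (at x) (s *\<^sub>R i))) (at 0)"
        using test_functions_has_derivative[OF wt, of x]
        by (intro has_derivative_compose[of "\<lambda>t. x + t *\<^sub>R i" "\<lambda>s. s *\<^sub>R i" 0 UNIV ?w]) (auto intro!: derivative_eq_intros)
      moreover have "frechet_derivative ?w (at x) (s *\<^sub>R i) = frechet_derivative ?w (at x) i * s" for s
        using linear_frechet_derivative[OF test_functions_differentiable[OF wt, of x]] by (simp add: linear_scale)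
      ultimately have "((\<lambda>t. ?w (x + t *\<^sub>R i)) has_real_derivative frechet_derivative ?w (at x) i) (at 0)"
        by (simp add: has_field_derivative_def)
      then have "((\<lambda>t. (?w (x + t *\<^sub>R i) - ?w (x + 0 *\<^sub>R i)) / (t - 0)) \<longlongrightarrow> frechet_derivative ?w (at x) i) (at 0)"
        by (simp add: has_field_derivative_iff)
      moreover have "filterlim (\<lambda>k. (1/2::real) ^ k) (at 0) sequentially"
        by (auto simp: filterlim_at intro: LIMSEQ_realpow_zero)
      ultimately have "(\<lambda>k. (?w (x + (1/2)^k *\<^sub>R i) - ?w (x + 0 *\<^sub>R i)) / ((1/2)^k - 0)) \<longlonglongrightarrow> frechet_derivative ?w (at x) i"
        by (rule filterlim_compose)
      then show ?thesis by (simp add: power_divide)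
    qed
    fix k
    let ?y = "(1/2::real)^k *\<^sub>R i"
    have d: "?w (x + ?y) - ?w x = conv (mollifier \<epsilon>) (\<lambda>x. ?g (x + ?y) - ?g x) x" for x
    proof -
      have m: "(\<lambda>y. mollifier \<epsilon> (x + ?y - y) * ?g y) \<in> borel_measurable borel"
        using test_functions_measurable[OF mollifier_test[OF e, where ?'a='a]] by measurable
      have "?w (x + ?y) = (LINT y|lborel. mollifier \<epsilon> (x + ?y - (?y + y)) * ?g (?y + y))"
        unfolding conv_def using lborel_integral_translate(1)[OF m, of ?y] by simp
      also have "\<dots> = conv (mollifier \<epsilon>) (\<lambda>x. ?g (x + ?y)) x" by (simp add: conv_def algebra_simps)
      finally show ?thesis using conv_mollifier_diff[OF e layer_shift_integrable layer_integrable] by simp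
    qed
    have "(LINT x|lborel. \<bar>?f k x\<bar>) = (LINT x|lborel. \<bar>conv (mollifier \<epsilon>) (\<lambda>x. ?g (x + ?y) - ?g x) x\<bar>) * 2 ^ k"
      unfolding d by (simp add: abs_mult)
    also have "\<dots> \<le> layer_var i j k"
      unfolding layer_var_def
      by (intro mult_right_mono conv_L1_le e Bochner_Integration.integrable_diff layer_shift_integrable layer_integrable) auto
    also have "\<dots> \<le> layer_tv i j" by (rule layer_var_tendsto(2)[OF i])
    finally show "(LINT x|lborel. \<bar>?f k x\<bar>) \<le> layer_tv i j" .
  qed
qed

text \<open>An upper bound, free of the mollification scale, for the Sobolev norm in
  \<open>admissible_bound\<close> of a mollified layer.\<close>

definition layer_mass :: "nat \<Rightarrow> real" where
  "layer_mass j = (LINT x|lborel. layer j (U x)) + (\<Sum>i\<in>Basis. layer_tv i j)"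

lemma layer_mass_nonneg: "0 \<le> layer_mass j"
  unfolding layer_mass_def by (intro add_nonneg_nonneg sum_nonneg layer_tv_nonneg Bochner_Integration.integral_nonneg) (auto simp: layer_bounds)

lemma summable_layer_mass: "summable layer_mass"
proof (rule summableI_nonneg_bounded[OF layer_mass_nonneg])
  fix J
  have "(\<Sum>j<J. (LINT x|lborel. layer j (U x))) = (LINT x|lborel. (\<Sum>j<J. layer j (U x)))"
    by (rule Bochner_Integration.integral_sum[symmetric]) (rule layer_integrable)
  also have "\<dots> \<le> (LINT x|lborel. \<bar>U x\<bar>)"
    using U by (intro integral_mono Bochner_Integration.integrable_sum layer_integrable) (auto simp: sum_layer)
  finally have "(\<Sum>j<J. (LINT x|lborel. layer j (U x))) \<le> (LINT x|lborel. \<bar>U x\<bar>)" .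
  moreover have "(\<Sum>j<J. \<Sum>i\<in>Basis. layer_tv i j) \<le> (\<Sum>i\<in>Basis. C i)"
    by (subst sum.swap) (intro sum_mono sum_layer_tv_le)
  ultimately show "(\<Sum>j<J. layer_mass j) \<le> (LINT x|lborel. \<bar>U x\<bar>) + (\<Sum>i\<in>Basis. C i)"
    unfolding layer_mass_def sum.distrib by linarith
qed

lemma conv_layer_mass:
  assumes e: "\<epsilon> > 0" and wt: "conv (mollifier \<epsilon>) (\<lambda>x. layer j (U x)) \<in> test_functions UNIV"
  shows "(LINT x|lborel. \<bar>conv (mollifier \<epsilon>) (\<lambda>x. layer j (U x)) x\<bar>)
     + (\<Sum>i\<in>Basis. LINT x|lborel. \<bar>frechet_derivative (conv (mollifier \<epsilon>) (\<lambda>x. layer j (U x))) (at x) i\<bar>) \<le> layer_mass j"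
proof -
  have "(LINT x|lborel. \<bar>conv (mollifier \<epsilon>) (\<lambda>x. layer j (U x)) x\<bar>) \<le> (LINT x|lborel. layer j (U x))"
    using conv_L1_le[OF e layer_integrable[of j]] by (simp add: layer_bounds)
  moreover have "(\<Sum>i\<in>Basis. LINT x|lborel. \<bar>frechet_derivative (conv (mollifier \<epsilon>) (\<lambda>x. layer j (U x))) (at x) i\<bar>) \<le> (\<Sum>i\<in>Basis. layer_tv i j)"
    by (intro sum_mono conv_layer_deriv_L1 e wt)
  ultimately show ?thesis unfolding layer_mass_def by linarith
qed

end

section \<open>The absolutely continuous part of the pairing\<close>

lemma inner_grad: "(T::'a::euclidean_space) \<bullet> grad \<phi> x = (\<Sum>i\<in>Basis. (T \<bullet> i) * frechet_derivative \<phi> (at x) i)"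
  by (simp add: grad_def inner_sum_right mult.commute)

lemma test_mult_integrable:
  assumes w: "integrable lborel w" and \<phi>: "\<phi> \<in> test_functions \<Omega>"
  shows "integrable lborel (\<lambda>x. w x * \<phi> x :: real)"
proof -
  obtain B where B: "B > 0" "\<And>x. \<bar>\<phi> x\<bar> \<le> B" by (rule test_functions_bounded[OF \<phi>]) blast
  show ?thesis
  proof (rule Bochner_Integration.integrable_bound[of lborel "\<lambda>x. B * w x"])
    show "(\<lambda>x. w x * \<phi> x) \<in> borel_measurable lborel"
      using borel_measurable_integrable[OF w] test_functions_measurable[OF \<phi>] by simp
    show "AE x in lborel. norm (w x * \<phi> x) \<le> norm (B * w x)"
      using B by (auto simp: abs_mult mult.commute intro!: mult_right_mono)
  qed (use w in simp)
qed

lemma finite_measure_tv: "finite_vmeasure \<Omega> (\<nu> :: _ \<Rightarrow> real) \<Longrightarrow> finite_measure (total_variation \<Omega> \<nu>)"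
  by (rule finite_measure_total_variation)

lemma total_variation_Int_null:
  fixes \<nu> :: "'a::topological_space set \<Rightarrow> 'b::real_normed_vector"
  assumes \<nu>: "finite_vmeasure \<Omega> \<nu>" and N: "N \<in> borel_of \<Omega>"
  shows "emeasure (total_variation \<Omega> (\<lambda>A. \<nu> (A \<inter> N))) (\<Omega> - N) = 0"
proof -
  have O: "\<Omega> - N \<in> borel_of \<Omega>" using N by (intro sets.Diff) auto
  have "\<nu> (D n \<inter> N) = 0" if "\<Union>(range D) = \<Omega> - N" for D :: "nat \<Rightarrow> 'a set" and n
  proof -
    have "D n \<inter> N = {}" using that by blast
    then show ?thesis by (simp add: finite_vmeasure_empty[OF \<nu>])
  qed
  then have "variation \<Omega> (\<lambda>A. \<nu> (A \<inter> N)) (\<Omega> - N) = variation \<Omega> (\<lambda>_. 0 :: real) (\<Omega> - N)"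
    unfolding variation_def
    by (intro SUP_cong refl suminf_cong) auto
  also have "\<dots> \<le> emeasure (null_measure (restrict_space borel \<Omega>)) (\<Omega> - N)"
    by (rule variation_le_measures) auto
  finally show ?thesis by (simp add: emeasure_total_variation[OF finite_vmeasure_Int[OF \<nu> N] O])
qed

text \<open>All data as Borel objects on the whole space. The null set \<open>N\<close> carries
  every singular part: \<open>\<nu>s i\<close> that of the derivative in direction \<open>i\<close>,
  \<open>\<tau>\<close> its total variation in the area measure. The functions \<open>g\<close>,
  \<open>h\<close> and \<open>s\<close> are the densities of the derivative, of \<open>\<mu>\<close>
  and of the right-hand side of the pairing.\<close>

locale pairing_data = borel_version \<Omega> u v for \<Omega> :: "'a::euclidean_space set" and u v +
  fixes lam :: "'a \<Rightarrow> real" and \<mu> :: "'a set \<Rightarrow> real" and h s :: "'a \<Rightarrow> real" and N :: "'a set"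
    and g T :: "'a \<Rightarrow> 'a" and \<nu>s :: "'a \<Rightarrow> 'a set \<Rightarrow> real" and \<tau> :: "'a measure"
  assumes lam_meas: "lam \<in> borel_measurable (restrict_space borel \<Omega>)"
    and lam_01: "\<And>x. x \<in> \<Omega> \<Longrightarrow> 0 \<le> lam x \<and> lam x \<le> 1"
    and T_meas [measurable]: "T \<in> borel_measurable borel" and T_le: "\<And>x. norm (T x) \<le> 1"
    and g_int: "integrable lborel g" and h_int: "integrable lborel h" and s_int: "integrable lborel s"
    and N: "N \<in> borel_of \<Omega>" "emeasure lborel N = 0"
    and \<nu>s: "\<And>i. i \<in> Basis \<Longrightarrow> finite_vmeasure \<Omega> (\<nu>s i)"
      "\<And>i. i \<in> Basis \<Longrightarrow> emeasure (total_variation \<Omega> (\<nu>s i)) (\<Omega> - N) = 0"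
    and v_deriv: "\<And>\<phi> i. \<phi> \<in> test_functions \<Omega> \<Longrightarrow> i \<in> Basis \<Longrightarrow>
       (LINT x|lborel. v x * frechet_derivative \<phi> (at x) i)
         = - ((LINT x|lborel. (g x \<bullet> i) * \<phi> x) + signed_integral \<Omega> (\<nu>s i) \<phi>)"
    and \<mu>: "finite_vmeasure \<Omega> \<mu>" "admissible \<Omega> \<mu>"
    and \<mu>_decomp: "\<And>A. A \<in> borel_of \<Omega> \<Longrightarrow> \<mu> A = (LINT x:A|lborel. h x) + \<mu> (A \<inter> N)"
    and T_div: "\<And>\<phi>. \<phi> \<in> test_functions \<Omega> \<Longrightarrow> - (LINT x|lborel. T x \<bullet> grad \<phi> x) = signed_integral \<Omega> \<mu> \<phi>"
    and \<tau>: "finite_measure \<tau>" "sets \<tau> = borel_of \<Omega>" "emeasure \<tau> (\<Omega> - N) = 0"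
    and pairing: "\<And>\<phi>. \<phi> \<in> test_functions \<Omega> \<Longrightarrow>
       - (LINT x|lborel. v x * (T x \<bullet> grad \<phi> x)) - signed_integral \<Omega> \<mu> (\<lambda>x. \<phi> x * lam_rep \<Omega> lam u x)
         = (LINT x|lborel. s x * \<phi> x) + (LINT x|\<tau>. \<phi> x)"
begin

definition \<mu>s :: "'a set \<Rightarrow> real" where "\<mu>s A = \<mu> (A \<inter> N)"

abbreviation "TV \<equiv> total_variation \<Omega> \<mu>"
abbreviation "L \<equiv> lam_rep \<Omega> lam u"

lemma finite_TV: "finite_measure TV" by (rule finite_measure_tv[OF \<mu>(1)])

lemma \<mu>s: "finite_vmeasure \<Omega> \<mu>s"
  unfolding \<mu>s_def[abs_def] by (rule finite_vmeasure_Int[OF \<mu>(1) N(1)])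

lemma finite_TVs: "finite_measure (total_variation \<Omega> \<mu>s)" by (rule finite_measure_tv[OF \<mu>s])

lemma TVs_le: "A \<in> borel_of \<Omega> \<Longrightarrow> emeasure (total_variation \<Omega> \<mu>s) A \<le> emeasure TV A"
proof -
  assume A: "A \<in> borel_of \<Omega>"
  show ?thesis
    unfolding emeasure_total_variation[OF \<mu>s A]
  proof (rule variation_le_measures)
    fix B assume B: "B \<in> borel_of \<Omega>"
    have "ennreal (norm (\<mu>s B)) \<le> emeasure TV (B \<inter> N)"
      unfolding \<mu>s_def using norm_le_variation[OF \<mu>(1)] B N(1)
      by (simp add: emeasure_total_variation[OF \<mu>(1)] sets.Int)
    also have "\<dots> \<le> emeasure TV B" using B by (intro emeasure_mono) auto
    finally show "ennreal (norm (\<mu>s B)) \<le> emeasure TV B" .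
  qed simp
qed

lemma TVs_null: "emeasure (total_variation \<Omega> \<mu>s) (\<Omega> - N) = 0"
  unfolding \<mu>s_def[abs_def] by (rule total_variation_Int_null[OF \<mu>(1) N(1)])

lemma integrable_TVs:
  assumes "integrable TV f" shows "integrable (total_variation \<Omega> \<mu>s) (f :: 'a \<Rightarrow> real)"
proof (rule integrable_of_emeasure_le[OF _ _ assms])
  show "emeasure (total_variation \<Omega> \<mu>s) A \<le> emeasure TV A" if "A \<in> sets TV" for A
    using TVs_le[of A] that by simp
qed simp

text \<open>Off \<open>N\<close> the measure \<open>\<mu>\<close> has density \<open>h\<close>, so
  cutting \<open>A - N\<close> by the sign of \<open>h\<close> expresses the integral of
  \<open>\<bar>h\<bar>\<close> through values of \<open>\<mu>\<close> on two disjoint sets.\<close>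

lemma h_density_le: 
  assumes A: "A \<in> borel_of \<Omega>"
  shows "emeasure (pos_density \<Omega> (\<lambda>x. \<bar>h x\<bar>)) A \<le> emeasure TV A"
proof -
  interpret TV: finite_measure TV by (rule finite_TV)
  have hm [measurable]: "h \<in> borel_measurable borel" using borel_measurable_integrable[OF h_int] by simp
  have bo: "borel_of \<Omega> = {A \<in> sets borel. A \<subseteq> \<Omega>}" by (rule borel_of_open_eq[OF open_dom])
  have Nn: "N \<in> null_sets lborel" using N bo by auto
  let ?P = "(A - N) \<inter> {x. 0 \<le> h x}" and ?Q = "(A - N) \<inter> {x. h x < 0}"
  have PQ: "?P \<in> borel_of \<Omega>" "?Q \<in> borel_of \<Omega>" using A N bo by auto
  have ai: "integrable lborel (\<lambda>x. \<bar>h x\<bar>)" using h_int by simp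
  have "(LINT x:A|lborel. \<bar>h x\<bar>) = (LINT x|lborel. indicator ?P x * h x - indicator ?Q x * h x)"
    unfolding set_lebesgue_integral_def
  proof (rule Bochner_Integration.integral_cong_AE)
    show "AE x in lborel. indicator A x *\<^sub>R \<bar>h x\<bar> = indicator ?P x * h x - indicator ?Q x * h x"
      using AE_not_in[OF Nn] by eventually_elim (auto split: split_indicator)
    show "(\<lambda>x. indicator A x *\<^sub>R \<bar>h x\<bar>) \<in> borel_measurable lborel" using A bo by auto
    show "(\<lambda>x. indicator ?P x * h x - indicator ?Q x * h x) \<in> borel_measurable lborel" using PQ bo by auto
  qed
  also have "\<dots> = (LINT x:?P|lborel. h x) - (LINT x:?Q|lborel. h x)"
    unfolding set_lebesgue_integral_def real_scaleR_def
  proof (rule Bochner_Integration.integral_diff)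
    have "integrable lborel (\<lambda>x. indicator B x * h x)" if "B \<in> borel_of \<Omega>" for B
      using integrable_mult_indicator[OF _ h_int, of B] that bo by simp
    then show "integrable lborel (\<lambda>x. indicator ?P x * h x)" "integrable lborel (\<lambda>x. indicator ?Q x * h x)" using PQ by blast+
  qed
  also have "\<dots> = \<mu> ?P - \<mu> ?Q"
  proof -
    have e: "?P \<inter> N = {}" "?Q \<inter> N = {}" by auto
    show ?thesis using \<mu>_decomp[OF PQ(1)] \<mu>_decomp[OF PQ(2)] by (simp add: e finite_vmeasure_empty[OF \<mu>(1)])
  qed
  also have "\<dots> \<le> measure TV ?P + measure TV ?Q"
    using norm_le_total_variation[OF \<mu>(1) PQ(1)] norm_le_total_variation[OF \<mu>(1) PQ(2)] by simp
  also have "\<dots> = measure TV (?P \<union> ?Q)" using PQ by (intro TV.finite_measure_Union[symmetric]) auto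
  also have "\<dots> \<le> measure TV A" using A by (intro TV.finite_measure_mono) auto
  finally have "(LINT x:A|lborel. \<bar>h x\<bar>) \<le> measure TV A" .
  then show ?thesis
    by (simp add: emeasure_pos_density[OF open_dom ai A] TV.emeasure_eq_measure max_absorb2 ennreal_leI)
qed

text \<open>Integrability against the total variation of \<open>\<mu>\<close> descends to the
  smaller measure with density \<open>\<bar>h\<bar>\<close>.\<close>

lemma h_integrable:
  assumes f: "integrable TV f"
  shows "integrable lborel (\<lambda>x. indicator \<Omega> x * (h x * f x))"
proof -
  have ai: "integrable lborel (\<lambda>x. \<bar>h x\<bar>)" using h_int by simp
  have hm [measurable]: "h \<in> borel_measurable lborel" using borel_measurable_integrable[OF h_int] .
  have i: "integrable (pos_density \<Omega> (\<lambda>x. \<bar>h x\<bar>)) f"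
  proof (rule integrable_of_emeasure_le[OF _ _ f])
    show "sets (pos_density \<Omega> (\<lambda>x. \<bar>h x\<bar>)) = sets TV" by (simp add: sets_pos_density[OF open_dom ai])
    show "emeasure (pos_density \<Omega> (\<lambda>x. \<bar>h x\<bar>)) A \<le> emeasure TV A" if "A \<in> sets TV" for A
      using h_density_le[of A] that by simp
  qed
  have "f \<in> borel_measurable (restrict_space borel \<Omega>)"
    using borel_measurable_integrable[OF f] by (simp cong: measurable_cong_sets)
  then have fm: "f \<in> borel_measurable (restrict_space lborel \<Omega>)"
    by (simp cong: measurable_cong_sets sets_restrict_space_cong)
  have hm': "(\<lambda>x. \<bar>h x\<bar>) \<in> borel_measurable (restrict_space lborel \<Omega>)" by (intro measurable_restrict_space1) measurable
  have "integrable (restrict_space lborel \<Omega>) (\<lambda>x. \<bar>h x\<bar> *\<^sub>R f x)"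
    using i unfolding pos_density_def by (subst (asm) integrable_density[OF fm hm']) auto
  then have "integrable lborel (\<lambda>x. indicator \<Omega> x *\<^sub>R (\<bar>h x\<bar> *\<^sub>R f x))"
    using open_dom by (subst (asm) integrable_restrict_space) auto
  then show ?thesis
  proof (rule Bochner_Integration.integrable_bound)
    have "(\<lambda>x. h x * f x) \<in> borel_measurable (restrict_space lborel \<Omega>)"
      using fm by (intro borel_measurable_times measurable_restrict_space1[OF hm])
    then have "(\<lambda>x. indicator \<Omega> x *\<^sub>R (h x * f x)) \<in> borel_measurable lborel"
      using open_dom by (subst borel_measurable_restrict_space_iff[symmetric]) auto
    then show "(\<lambda>x. indicator \<Omega> x * (h x * f x)) \<in> borel_measurable lborel" by simp
  qed (auto simp: abs_mult)
qed

lemma signed_integral_\<mu>: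
  assumes f: "integrable TV f"
  shows "signed_integral \<Omega> \<mu> f = (LINT x|lborel. indicator \<Omega> x * (h x * f x)) + signed_integral \<Omega> \<mu>s f"
  by (rule signed_integral_ac_plus[OF open_dom h_int \<mu>(1) \<mu>s _ f integrable_TVs[OF f] h_integrable[OF f]])
    (simp add: \<mu>_decomp[symmetric] \<mu>s_def)

lemma L_meas: "L \<in> borel_measurable (restrict_space borel \<Omega>)"
  unfolding lam_rep_def[abs_def] using lam_meas traces_measurable by measurable

end

text \<open>Localisation near \<open>V\<close>: \<open>\<zeta>\<close> is 1 there and vanishes off
  the compact \<open>S\<close>, and the scales are so small that mollifications of the cut-off
  function keep their support inside \<open>\<Omega>\<close>.\<close>

locale pairing_local = pairing_data +
  fixes V S :: "'a set" and \<zeta> :: "'a \<Rightarrow> real" and \<epsilon> :: "nat \<Rightarrow> real"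
  assumes V: "open V" "V \<subseteq> \<Omega>" and \<zeta>: "\<zeta> \<in> test_functions \<Omega>" "\<And>x. 0 \<le> \<zeta> x" "\<And>x. \<zeta> x \<le> 1"
      "\<And>x. x \<in> V \<Longrightarrow> \<zeta> x = 1"
    and S: "compact S" "\<And>x. x \<notin> S \<Longrightarrow> \<zeta> x = 0"
    and \<epsilon>: "\<And>k. \<epsilon> k > 0" "\<epsilon> \<longlonglongrightarrow> 0" "\<And>k. {x + y |x y. x \<in> S \<and> y \<in> cball 0 (\<epsilon> k)} \<subseteq> \<Omega>"
begin

definition U :: "'a \<Rightarrow> real" where "U x = v x * \<zeta> x"

lemma U_int: "integrable lborel U"
  unfolding U_def[abs_def] by (rule test_mult_integrable[OF v_int \<zeta>(1)])

lemma U_meas [measurable]: "U \<in> borel_measurable borel"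
  using borel_measurable_integrable[OF U_int] by simp

lemma U_V: "x \<in> V \<Longrightarrow> U x = v x" using \<zeta>(4) by (simp add: U_def)

lemma \<epsilon>_right: "filterlim \<epsilon> (at_right 0) sequentially"
proof -
  have "\<epsilon> k \<noteq> 0" for k using \<epsilon>(1)[of k] by simp
  then show ?thesis using \<epsilon>(1,2) by (auto simp: filterlim_at)
qed

text \<open>Requiring \<open>w\<close> to vanish where \<open>U\<close> does covers
  \<open>U\<close>, its layers and its truncations at once.\<close>

lemma conv_test:
  assumes w: "integrable lborel w" "\<And>x. U x = 0 \<Longrightarrow> w x = 0"
  shows "conv (mollifier (\<epsilon> k)) w \<in> test_functions \<Omega>"
proof (rule test_functionsI[OF _ _ \<epsilon>(3)])
  show "cont_diff n (conv (mollifier (\<epsilon> k)) w)" for n by (intro conv_cont_diff mollifier_test \<epsilon> w)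
  show "compact {x + y |x y. x \<in> S \<and> y \<in> cball 0 (\<epsilon> k)}" by (rule compact_sums[OF S(1) compact_cball])
  fix x assume x: "x \<notin> {x + y |x y. x \<in> S \<and> y \<in> cball 0 (\<epsilon> k)}"
  show "conv (mollifier (\<epsilon> k)) w x = 0"
  proof (rule conv_mollifier_eq_0[OF \<epsilon>(1)])
    fix y assume y: "norm (x - y) < \<epsilon> k"
    have "y \<notin> S"
    proof
      assume "y \<in> S"
      moreover have "x = y + (x - y)" "x - y \<in> cball 0 (\<epsilon> k)" using y by auto
      ultimately show False using x by blast
    qed
    then show "w y = 0" using S(2) w(2) by (simp add: U_def)
  qed
qed

text \<open>The summands bound the masses of \<open>\<zeta> D\<^sub>i v\<close> (absolutely continuous and singular part) and of
  \<open>v D\<^sub>i \<zeta>\<close>.\<close>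

definition CU :: "'a \<Rightarrow> real" where
  "CU i = (LINT x|lborel. \<bar>g x \<bullet> i\<bar>) + measure (total_variation \<Omega> (\<nu>s i)) \<Omega>
     + (SOME B. B > 0 \<and> (\<forall>x. \<bar>frechet_derivative \<zeta> (at x) i\<bar> \<le> B)) * (LINT x|lborel. \<bar>v x\<bar>)"

lemma g_comp: "i \<in> Basis \<Longrightarrow> integrable lborel (\<lambda>x. g x \<bullet> i)"
  using g_int by simp

text \<open>By the product rule \<open>\<zeta>\<close> times the derivative of \<open>\<phi>\<close>
  is the derivative of \<open>\<zeta> \<phi>\<close>, a test function on \<open>\<Omega>\<close>,
  minus a term in which the derivative falls on \<open>\<zeta>\<close>. The first part is governed
  by the derivative measure of \<open>v\<close>.\<close>

lemma CU_bound:
  assumes i: "i \<in> Basis" and \<phi>: "\<phi> \<in> test_functions UNIV" and B: "\<And>x. \<bar>\<phi> x\<bar> \<le> B"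
  shows "\<bar>LINT x|lborel. U x * frechet_derivative \<phi> (at x) i\<bar> \<le> CU i * B" "0 \<le> CU i"
proof -
  let ?D = "\<lambda>f x. frechet_derivative f (at x) i"
  define B1 where "B1 = (SOME B. B > 0 \<and> (\<forall>x. \<bar>?D \<zeta> x\<bar> \<le> B))"
  have "\<exists>B. B > 0 \<and> (\<forall>x. \<bar>?D \<zeta> x\<bar> \<le> B)"
    by (rule test_functions_bounded[OF test_functions_deriv[OF \<zeta>(1) i]]) blast
  then have "B1 > 0 \<and> (\<forall>x. \<bar>?D \<zeta> x\<bar> \<le> B1)" unfolding B1_def by (rule someI_ex)
  then have B1: "B1 > 0" "\<And>x. \<bar>?D \<zeta> x\<bar> \<le> B1" by auto
  have B0: "0 \<le> B" using B[of 0] by linarith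
  show "0 \<le> CU i" unfolding CU_def B1_def[symmetric] using B1(1) by simp
  have \<zeta>\<phi>: "(\<lambda>x. \<zeta> x * \<phi> x) \<in> test_functions \<Omega>"
    by (intro test_functions_mult_smooth \<zeta> test_functions_cont_diff[OF \<phi>])
  have b\<zeta>\<phi>: "\<bar>\<zeta> x * \<phi> x\<bar> \<le> B" for x
    using mult_mono[of "\<bar>\<zeta> x\<bar>" 1 "\<bar>\<phi> x\<bar>" B] \<zeta>(2,3)[of x] B[of x] by (simp add: abs_mult)
  have D: "?D (\<lambda>x. \<zeta> x * \<phi> x) x = \<zeta> x * ?D \<phi> x + ?D \<zeta> x * \<phi> x" for x
    using frechet_derivative_mult[OF test_functions_differentiable[OF \<zeta>(1)] test_functions_differentiable[OF \<phi>]] by simp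
  have i1: "integrable lborel (\<lambda>x. v x * ?D (\<lambda>x. \<zeta> x * \<phi> x) x)"
    by (rule test_mult_integrable[OF v_int test_functions_deriv[OF \<zeta>\<phi> i]])
  have "(\<lambda>x. ?D \<zeta> x * \<phi> x) \<in> test_functions \<Omega>"
    by (intro test_functions_mult_smooth test_functions_deriv \<zeta> i test_functions_cont_diff[OF \<phi>])
  then have i2: "integrable lborel (\<lambda>x. v x * (?D \<zeta> x * \<phi> x))" by (rule test_mult_integrable[OF v_int])
  have "(LINT x|lborel. U x * ?D \<phi> x) = (LINT x|lborel. v x * ?D (\<lambda>x. \<zeta> x * \<phi> x) x - v x * (?D \<zeta> x * \<phi> x))"
  proof (intro Bochner_Integration.integral_cong refl)
    show "U x * ?D \<phi> x = v x * ?D (\<lambda>x. \<zeta> x * \<phi> x) x - v x * (?D \<zeta> x * \<phi> x)" for x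
      unfolding U_def D by (simp add: algebra_simps)
  qed
  also have "\<dots> = - ((LINT x|lborel. (g x \<bullet> i) * (\<zeta> x * \<phi> x)) + signed_integral \<Omega> (\<nu>s i) (\<lambda>x. \<zeta> x * \<phi> x))
      - (LINT x|lborel. v x * (?D \<zeta> x * \<phi> x))"
    using v_deriv[OF \<zeta>\<phi> i] i1 i2 by simp
  finally have eq: "(LINT x|lborel. U x * ?D \<phi> x) = \<dots>" .
  have "\<bar>LINT x|lborel. (g x \<bullet> i) * (\<zeta> x * \<phi> x)\<bar> \<le> (LINT x|lborel. \<bar>g x \<bullet> i\<bar> * B)"
  proof -
    have "\<bar>LINT x|lborel. (g x \<bullet> i) * (\<zeta> x * \<phi> x)\<bar> \<le> (LINT x|lborel. \<bar>(g x \<bullet> i) * (\<zeta> x * \<phi> x)\<bar>)"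
      using integral_norm_bound[of lborel "\<lambda>x. (g x \<bullet> i) * (\<zeta> x * \<phi> x)"] by simp
    also have "\<dots> \<le> (LINT x|lborel. \<bar>g x \<bullet> i\<bar> * B)"
    proof (rule integral_mono)
      show "\<bar>(g x \<bullet> i) * (\<zeta> x * \<phi> x)\<bar> \<le> \<bar>g x \<bullet> i\<bar> * B" for x
        unfolding abs_mult[of "g x \<bullet> i"] by (rule mult_left_mono[OF b\<zeta>\<phi>]) simp
      show "integrable lborel (\<lambda>x. \<bar>(g x \<bullet> i) * (\<zeta> x * \<phi> x)\<bar>)"
        by (intro integrable_abs test_mult_integrable[OF g_comp[OF i] \<zeta>\<phi>])
      show "integrable lborel (\<lambda>x. \<bar>g x \<bullet> i\<bar> * B)" by (intro integrable_mult_left integrable_abs g_comp i)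
    qed
    finally show ?thesis .
  qed
  moreover have "\<bar>signed_integral \<Omega> (\<nu>s i) (\<lambda>x. \<zeta> x * \<phi> x)\<bar> \<le> measure (total_variation \<Omega> (\<nu>s i)) \<Omega> * B"
  proof -
    interpret F: finite_measure "total_variation \<Omega> (\<nu>s i)" by (rule finite_measure_tv[OF \<nu>s(1)[OF i]])
    have ti: "integrable (total_variation \<Omega> (\<nu>s i)) (\<lambda>x. \<zeta> x * \<phi> x)"
      by (rule test_integrable_finite[OF \<zeta>\<phi> F.finite_measure_axioms]) simp
    have "\<bar>signed_integral \<Omega> (\<nu>s i) (\<lambda>x. \<zeta> x * \<phi> x)\<bar> \<le> (LINT x|total_variation \<Omega> (\<nu>s i). \<bar>\<zeta> x * \<phi> x\<bar>)"
      by (rule abs_signed_integral_le[OF \<nu>s(1)[OF i] ti])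
    also have "\<dots> \<le> (LINT x|total_variation \<Omega> (\<nu>s i). B)"
      by (intro integral_mono integrable_abs ti b\<zeta>\<phi>) simp
    finally show ?thesis by simp
  qed
  moreover have "\<bar>LINT x|lborel. v x * (?D \<zeta> x * \<phi> x)\<bar> \<le> B1 * (LINT x|lborel. \<bar>v x\<bar>) * B"
  proof -
    have "\<bar>LINT x|lborel. v x * (?D \<zeta> x * \<phi> x)\<bar> \<le> (LINT x|lborel. \<bar>v x * (?D \<zeta> x * \<phi> x)\<bar>)"
      using integral_norm_bound[of lborel "\<lambda>x. v x * (?D \<zeta> x * \<phi> x)"] by simp
    also have "\<dots> \<le> (LINT x|lborel. \<bar>v x\<bar> * (B1 * B))"
    proof (rule integral_mono)
      fix x
      have "\<bar>?D \<zeta> x * \<phi> x\<bar> \<le> B1 * B" unfolding abs_mult using B1 B B0 by (intro mult_mono) auto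
      then show "\<bar>v x * (?D \<zeta> x * \<phi> x)\<bar> \<le> \<bar>v x\<bar> * (B1 * B)" unfolding abs_mult[of "v x"] by (rule mult_left_mono) simp
    qed (use i2 v_int in auto)
    finally show ?thesis by (simp add: mult_ac)
  qed
  moreover have "(LINT x|lborel. \<bar>g x \<bullet> i\<bar> * B) = (LINT x|lborel. \<bar>g x \<bullet> i\<bar>) * B" by simp
  ultimately show "\<bar>LINT x|lborel. U x * ?D \<phi> x\<bar> \<le> CU i * B"
    unfolding eq CU_def B1_def[symmetric] distrib_right by linarith
qed

section \<open>Bounds for mollified layers that are uniform in the scale\<close>

lemma U_dq:
  assumes i: "i \<in> Basis" and r: "r \<ge> 0"
  shows "(LINT x|lborel. \<bar>U (x + r *\<^sub>R i) - U x\<bar>) \<le> CU i * r"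
proof (rule difference_quotient_bound[OF U_int i _ r])
  have "(\<lambda>x. 0 :: real) \<in> test_functions (UNIV :: 'a set)"
    using test_functions_cmult[OF test_functions_mono[OF subset_UNIV \<zeta>(1)], of 0] by simp
  then show "0 \<le> CU i" using CU_bound(2)[OF i, of "\<lambda>_. 0" 0] by simp
qed (rule CU_bound(1)[OF i])

lemma cl_layer_integrable: "integrable lborel (\<lambda>x. layer j (U x))"
  by (rule layer_integrable[OF U_int, of CU]) (rule U_dq, assumption+)

abbreviation "cl j k \<equiv> conv (mollifier (\<epsilon> k)) (\<lambda>x. layer j (U x))"
abbreviation "mass \<equiv> layer_mass U"

lemma cl_test: "cl j k \<in> test_functions \<Omega>"
  by (rule conv_test[OF cl_layer_integrable]) (simp add: layer_bounds)

lemma cl_nonneg: "0 \<le> cl j k x"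
  by (rule conv_mollifier_nonneg[OF \<epsilon>(1)]) (rule layer_bounds)

text \<open>The constant of \<open>admissible_bound\<close> does not depend on the test function,
  and \<open>layer_mass\<close> does not depend on the scale, so one \<open>A\<close> serves all
  \<open>j\<close> and \<open>k\<close>.\<close>

lemma cl_TV_bound:
  obtains A where "A \<ge> 0" "\<And>j k. (LINT x|TV. cl j k x) \<le> A * mass j"
proof -
  obtain A where A: "A \<ge> 0" "\<And>w. w \<in> test_functions \<Omega> \<Longrightarrow> (LINT x|TV. w x)
     \<le> A * ((LINT x|lborel. \<bar>w x\<bar>) + (\<Sum>i\<in>Basis. LINT x|lborel. \<bar>frechet_derivative w (at x) i\<bar>))"
    by (rule admissible_bound[OF open_dom \<mu>(2)]) blast
  have "(LINT x|TV. cl j k x) \<le> A * mass j" for j k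
  proof -
    have t: "cl j k \<in> test_functions UNIV" by (rule test_functions_mono[OF subset_UNIV cl_test])
    have "(LINT x|TV. cl j k x) \<le> A * ((LINT x|lborel. \<bar>cl j k x\<bar>) + (\<Sum>i\<in>Basis. LINT x|lborel. \<bar>frechet_derivative (cl j k) (at x) i\<bar>))"
      by (rule A(2)[OF cl_test])
    also have "\<dots> \<le> A * mass j"
    proof (intro mult_left_mono A(1) conv_layer_mass[OF U_int _ \<epsilon>(1) t])
      show "(LINT x|lborel. \<bar>U (x + r *\<^sub>R i) - U x\<bar>) \<le> CU i * r" if "i \<in> Basis" "0 \<le> r" for i r
        using U_dq that .
    qed
    finally show ?thesis .
  qed
  then show ?thesis using that A(1) by blast
qed

definition A0 :: real where "A0 = (SOME A. A \<ge> 0 \<and> (\<forall>j k. (LINT x|TV. cl j k x) \<le> A * mass j))"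

lemma A0: "A0 \<ge> 0" "(LINT x|TV. cl j k x) \<le> A0 * mass j"
proof -
  have "\<exists>A. A \<ge> 0 \<and> (\<forall>j k. (LINT x|TV. cl j k x) \<le> A * mass j)" by (rule cl_TV_bound) blast
  then have "A0 \<ge> 0 \<and> (\<forall>j k. (LINT x|TV. cl j k x) \<le> A0 * mass j)" unfolding A0_def by (rule someI_ex)
  then show "A0 \<ge> 0" "(LINT x|TV. cl j k x) \<le> A0 * mass j" by auto
qed

lemma cl_TV_integrable: "integrable TV (cl j k)"
  by (rule test_integrable_finite[OF cl_test finite_TV]) simp

lemma cl_TV_nn: "(\<integral>\<^sup>+x. ennreal (cl j k x) \<partial>TV) \<le> ennreal (A0 * mass j)"
  using nn_integral_eq_integral[OF cl_TV_integrable[of k j]] cl_nonneg A0(2)[of k j] by (simp add: ennreal_leI)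

lemma mass_facts: "0 \<le> mass j" "summable mass"
proof -
  have *: "(LINT x|lborel. \<bar>U (x + r *\<^sub>R i) - U x\<bar>) \<le> CU i * r" if "i \<in> Basis" "0 \<le> r" for i r
    using U_dq that .
  show "0 \<le> mass j" by (rule layer_mass_nonneg[OF U_int *])
  show "summable mass" by (rule summable_layer_mass[OF U_int *])
qed

section \<open>Truncation and tails\<close>

definition tail :: "nat \<Rightarrow> real" where "tail m = A0 * (\<Sum>j. mass (j + m))"

lemma tail_tendsto: "tail \<longlonglongrightarrow> 0"
proof -
  have "(\<lambda>m. \<Sum>j. mass (j + m)) \<longlonglongrightarrow> 0"
    by (rule suminf_exist_split2[OF mass_facts(2)])
  then show ?thesis unfolding tail_def[abs_def] using tendsto_mult_right_zero by blast
qed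

definition trunc :: "nat \<Rightarrow> real \<Rightarrow> real" where "trunc m t = max (- real m) (min (real m) t)"

lemma trunc_facts: "\<bar>trunc m t\<bar> \<le> real m" "trunc m 0 = 0" "\<bar>trunc m t\<bar> \<le> \<bar>t\<bar>" "\<bar>t - trunc m t\<bar> \<le> \<bar>t\<bar>"
  by (auto simp: trunc_def)

lemma trunc_meas [measurable]: "trunc m \<in> borel_measurable borel"
  unfolding trunc_def[abs_def] by measurable

lemma trunc_int: "integrable lborel (\<lambda>x. trunc m (U x))"
  by (rule Bochner_Integration.integrable_bound[OF U_int]) (auto simp: trunc_facts)

text \<open>What truncation at height \<open>m\<close> removes is made up of the layers from index
  \<open>m\<close> onwards; hence the shift of the summation index. For each \<open>t\<close> only
  finitely many of them are nonzero.\<close>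

lemma trunc_layers: "(\<lambda>j. layer (j + m) t) sums \<bar>t - trunc m t\<bar>"
proof -
  obtain J :: nat where J: "\<bar>t\<bar> \<le> real J" using real_arch_simple by blast
  have "(\<Sum>j<n. layer (j + m) t) = \<bar>t - trunc m t\<bar>" if "n \<ge> J" for n
  proof -
    have "(\<Sum>j<n. layer (j + m) t) = (\<Sum>j<n + m. layer j t) - (\<Sum>j<m. layer j t)"
      by (induction n) (simp_all add: add.commute)
    also have "\<dots> = \<bar>t\<bar> - min (real m) \<bar>t\<bar>" unfolding sum_layer using that J by simp
    also have "\<dots> = \<bar>t - trunc m t\<bar>"
    proof -
      have "\<bar>t\<bar> - min M \<bar>t\<bar> = \<bar>t - max (- M) (min M t)\<bar>" if "M \<ge> 0" for M :: real
        using that by (cases "t \<ge> 0") (auto simp: min_def max_def)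
      then show ?thesis unfolding trunc_def by simp
    qed
    finally show ?thesis .
  qed
  then show ?thesis unfolding sums_def by (intro tendsto_eventually) (auto simp: eventually_sequentially)
qed

abbreviation "wk k \<equiv> conv (mollifier (\<epsilon> k)) U"
abbreviation "vk m k \<equiv> conv (mollifier (\<epsilon> k)) (\<lambda>x. trunc m (U x))"

text \<open>Mollification passes through the series of layers because all terms are nonnegative. The
  removed part is thereby bounded by mollified layers, whose integrals are summable uniformly in
  \<open>k\<close>.\<close>

lemma tail_bound: "(\<integral>\<^sup>+x. ennreal \<bar>wk k x - vk m k x\<bar> \<partial>TV) \<le> ennreal (tail m)"
proof -
  have mm [measurable]: "(mollifier (\<epsilon> k) :: 'a \<Rightarrow> real) \<in> borel_measurable borel"
    by (rule test_functions_measurable[OF mollifier_test[OF \<epsilon>(1)]])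
  have "ennreal \<bar>wk k x - vk m k x\<bar> \<le> (\<Sum>j. ennreal (cl (j + m) k x))" for x
  proof -
    have di: "integrable lborel (\<lambda>y. U y - trunc m (U y))" using U_int trunc_int by simp
    have "\<bar>wk k x - vk m k x\<bar> \<le> conv (mollifier (\<epsilon> k)) (\<lambda>y. \<bar>U y - trunc m (U y)\<bar>) x"
      using conv_abs_le[OF \<epsilon>(1), of k "\<lambda>y. U y - trunc m (U y)" x] conv_mollifier_diff[OF \<epsilon>(1) U_int trunc_int, of k m x] by simp
    then have "ennreal \<bar>wk k x - vk m k x\<bar> \<le> ennreal (conv (mollifier (\<epsilon> k)) (\<lambda>y. \<bar>U y - trunc m (U y)\<bar>) x)" by (rule ennreal_leI)
    also have "\<dots> = (\<integral>\<^sup>+y. ennreal (mollifier (\<epsilon> k) (x - y) * \<bar>U y - trunc m (U y)\<bar>) \<partial>lborel)"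
      unfolding conv_def using di
      by (intro nn_integral_eq_integral[symmetric] conv_integrable mollifier_test \<epsilon> always_eventually allI mult_nonneg_nonneg mollifier_nonneg) auto
    also have "\<dots> = (\<integral>\<^sup>+y. (\<Sum>j. ennreal (mollifier (\<epsilon> k) (x - y) * layer (j + m) (U y))) \<partial>lborel)"
    proof (intro nn_integral_cong)
      fix y
      show "ennreal (mollifier (\<epsilon> k) (x - y) * \<bar>U y - trunc m (U y)\<bar>) = (\<Sum>j. ennreal (mollifier (\<epsilon> k) (x - y) * layer (j + m) (U y)))"
        by (rule suminf_ennreal_eq[symmetric, OF mult_nonneg_nonneg[OF mollifier_nonneg[OF \<epsilon>(1)] layer_bounds(1)] sums_mult[OF trunc_layers]])
    qed
    also have "\<dots> = (\<Sum>j. \<integral>\<^sup>+y. ennreal (mollifier (\<epsilon> k) (x - y) * layer (j + m) (U y)) \<partial>lborel)"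
      by (rule nn_integral_suminf)
        (intro measurable_compose[OF _ measurable_ennreal] borel_measurable_integrable conv_integrable mollifier_test \<epsilon> cl_layer_integrable)
    also have "\<dots> = (\<Sum>j. ennreal (cl (j + m) k x))"
      unfolding conv_def
      by (intro suminf_cong nn_integral_eq_integral conv_integrable mollifier_test \<epsilon> cl_layer_integrable always_eventually allI
          mult_nonneg_nonneg mollifier_nonneg layer_bounds)
    finally show ?thesis .
  qed
  then have "(\<integral>\<^sup>+x. ennreal \<bar>wk k x - vk m k x\<bar> \<partial>TV) \<le> (\<integral>\<^sup>+x. (\<Sum>j. ennreal (cl (j + m) k x)) \<partial>TV)"
    by (intro nn_integral_mono)
  also have "\<dots> = (\<Sum>j. \<integral>\<^sup>+x. ennreal (cl (j + m) k x) \<partial>TV)"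
    using borel_measurable_integrable[OF cl_TV_integrable] by (intro nn_integral_suminf) simp
  also have "\<dots> \<le> (\<Sum>j. ennreal (A0 * mass (j + m)))" by (intro suminf_le cl_TV_nn) auto
  also have "\<dots> = ennreal (tail m)"
    unfolding tail_def using mass_facts A0(1)
    by (intro suminf_ennreal_eq sums_mult summable_sums) (auto simp: summable_iff_shift)
  finally show ?thesis .
qed

text \<open>Mollifications of \<open>min J |u|\<close> dominate a fixed multiple of the truncated traces in the limit, so
  \<open>P\<close> is integrable by Fatou.\<close>

definition P :: "'a \<Rightarrow> real" where "P x = \<bar>upper_trace \<Omega> u x\<bar> + \<bar>lower_trace \<Omega> u x\<bar>"

text \<open>Traces depend only on small balls, and \<open>U\<close> equals \<open>v\<close> on the
  open set \<open>V\<close>.\<close>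

lemma trace_pair_U:
  assumes x: "x \<in> V" and t: "trace_pair v x a b e"
  shows "trace_pair U x a b e"
proof -
  obtain r0 where r0: "r0 > 0" "ball x r0 \<subseteq> V" using V(1) x open_contains_ball by blast
  have "jdev U x e a b r = jdev v x e a b r" if "r < r0" for r
  proof -
    have "U y = v y" if "y \<in> ball x r" for y using that \<open>r < r0\<close> r0 by (intro U_V) auto
    then show ?thesis unfolding jdev_def set_lebesgue_integral_def
      by (intro arg_cong[where f="\<lambda>I. I / _"] Bochner_Integration.integral_cong) (auto split: split_indicator)
  qed
  then have "\<forall>\<^sub>F r in at_right 0. jdev U x e a b r = jdev v x e a b r"
    unfolding eventually_at_right_field using r0(1) by blast
  then show ?thesis using t unfolding trace_pair_def by (simp add: tendsto_cong)
qed

lemma P_meas: "(\<lambda>x. indicator V x * P x) \<in> borel_measurable (restrict_space borel \<Omega>)"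
proof -
  have "(indicator V :: 'a \<Rightarrow> real) \<in> borel_measurable (restrict_space borel \<Omega>)"
    using V(1) by (intro measurable_restrict_space1 borel_measurable_indicator) auto
  then show ?thesis unfolding P_def using traces_measurable by measurable
qed

lemma P_nn_finite: "(\<integral>\<^sup>+x. ennreal (indicator V x * P x) \<partial>TV) < \<infinity>"
proof -
  let ?c = "exp (- 2) * (1/2) ^ DIM('a) :: real"
  have c: "?c > 0" by simp
  let ?Q = "\<lambda>J x. ?c * ((min (real J) \<bar>upper_trace \<Omega> u x\<bar> + min (real J) \<bar>lower_trace \<Omega> u x\<bar>) / 2)"
  define A1 where "A1 = A0 * suminf mass"
  \<comment> \<open>Finitely many layers recombine to \<open>min J \<bar>U\<bar>\<close>, a
    nonnegative 1-Lipschitz function of \<open>U\<close>, to which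
    \<open>trace_pair_conv_lower\<close> applies.\<close>
  have s: "(\<Sum>j<J. cl j k x) = conv (mollifier (\<epsilon> k)) (\<lambda>y. min (real J) \<bar>U y\<bar>) x" for J k x
  proof -
    have "(\<Sum>j<J. cl j k x) = (LINT y|lborel. (\<Sum>j<J. mollifier (\<epsilon> k) (x - y) * layer j (U y)))"
      unfolding conv_def by (intro Bochner_Integration.integral_sum[symmetric] conv_integrable mollifier_test \<epsilon> cl_layer_integrable)
    then show ?thesis by (simp add: conv_def sum_distrib_left[symmetric] sum_layer)
  qed
  have pw: "ennreal (indicator V x * ?Q J x) \<le> liminf (\<lambda>k. ennreal (\<Sum>j<J. cl j k x))" if "x \<in> \<Omega>" for J x
  proof (cases "x \<in> V \<and> (\<exists>a b e. trace_pair v x a b e)")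
    case True
    then obtain a b e where "trace_pair v x a b e" by blast
    then obtain a b e where t: "b \<le> a" "trace_pair v x a b e" by (rule trace_pair_sorted[OF v_int])
    have tU: "trace_pair U x a b e" using trace_pair_U[OF _ t(2)] True by blast
    have tr: "upper_trace \<Omega> u x = a" "lower_trace \<Omega> u x = b" using traces_eq[OF that t(2,1)] .
    have low: "?c * ((min (real J) \<bar>a\<bar> + min (real J) \<bar>b\<bar>) / 2 - jdev U x e a b (\<epsilon> k / 2)) \<le> (\<Sum>j<J. cl j k x)" for k
      unfolding s
    proof (rule trace_pair_conv_lower[OF U_int tU \<epsilon>(1)])
      show "integrable lborel (\<lambda>y. min (real J) \<bar>U y\<bar>)"
        by (rule Bochner_Integration.integrable_bound[OF U_int]) auto
    qed auto
    have e2: "filterlim (\<lambda>k. \<epsilon> k / 2) (at_right 0) sequentially"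
    proof -
      have "\<epsilon> k \<noteq> 0" for k using \<epsilon>(1)[of k] by simp
      then show ?thesis using \<epsilon>(1) tendsto_divide[OF \<epsilon>(2) tendsto_const[of 2]] by (auto simp: filterlim_at)
    qed
    have "(jdev U x e a b \<longlongrightarrow> 0) (at_right 0)" using tU by (simp add: trace_pair_def)
    from filterlim_compose[OF this e2]
    have "(\<lambda>k. ?c * ((min (real J) \<bar>a\<bar> + min (real J) \<bar>b\<bar>) / 2 - jdev U x e a b (\<epsilon> k / 2))) \<longlonglongrightarrow> ?c * ((min (real J) \<bar>a\<bar> + min (real J) \<bar>b\<bar>) / 2 - 0)"
      by (intro tendsto_intros)
    then have "(\<lambda>k. ennreal (?c * ((min (real J) \<bar>a\<bar> + min (real J) \<bar>b\<bar>) / 2 - jdev U x e a b (\<epsilon> k / 2)))) \<longlonglongrightarrow> ennreal (?c * ((min (real J) \<bar>a\<bar> + min (real J) \<bar>b\<bar>) / 2 - 0))"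
      by (rule tendsto_ennrealI)
    then have "ennreal (?c * ((min (real J) \<bar>a\<bar> + min (real J) \<bar>b\<bar>) / 2 - 0)) = liminf (\<lambda>k. ennreal (?c * ((min (real J) \<bar>a\<bar> + min (real J) \<bar>b\<bar>) / 2 - jdev U x e a b (\<epsilon> k / 2))))"
      by (rule lim_imp_Liminf[OF trivial_limit_sequentially, symmetric])
    also have "\<dots> \<le> liminf (\<lambda>k. ennreal (\<Sum>j<J. cl j k x))"
      by (intro Liminf_mono always_eventually allI ennreal_leI low)
    finally show ?thesis using True tr by simp
  next
    case False
    \<comment> \<open>Where no trace pair exists, both traces have the default value 0 and the bound
      is trivial.\<close>
    then have z: "indicator V x * ?Q J x = 0" using traces_eq_0[OF that] by (cases "x \<in> V") auto
    show ?thesis unfolding z by simp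
  qed
  have clm: "cl j k \<in> borel_measurable TV" for j k by (rule borel_measurable_integrable[OF cl_TV_integrable])
  have QJ: "(\<integral>\<^sup>+x. ennreal (indicator V x * ?Q J x) \<partial>TV) \<le> ennreal A1" for J
  proof -
    have "(\<integral>\<^sup>+x. ennreal (indicator V x * ?Q J x) \<partial>TV) \<le> (\<integral>\<^sup>+x. liminf (\<lambda>k. ennreal (\<Sum>j<J. cl j k x)) \<partial>TV)"
      by (intro nn_integral_mono) (use pw in simp)
    also have "\<dots> \<le> liminf (\<lambda>k. \<integral>\<^sup>+x. ennreal (\<Sum>j<J. cl j k x) \<partial>TV)"
      by (intro nn_integral_liminf measurable_compose[OF _ measurable_ennreal] borel_measurable_sum clm)
    also have "\<dots> \<le> liminf (\<lambda>k. ennreal A1)"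
    proof (intro Liminf_mono always_eventually allI)
      fix k
      have "(\<integral>\<^sup>+x. ennreal (\<Sum>j<J. cl j k x) \<partial>TV) = (\<Sum>j<J. \<integral>\<^sup>+x. ennreal (cl j k x) \<partial>TV)"
      proof -
        have e: "ennreal (\<Sum>j<J. cl j k x) = (\<Sum>j<J. ennreal (cl j k x))" for x
          by (rule sum_ennreal[symmetric]) (rule cl_nonneg)
        show ?thesis unfolding e by (intro nn_integral_sum measurable_compose[OF _ measurable_ennreal] clm)
      qed
      also have "\<dots> \<le> (\<Sum>j<J. ennreal (A0 * mass j))" by (intro sum_mono cl_TV_nn)
      also have "\<dots> = ennreal (\<Sum>j<J. A0 * mass j)" using A0(1) mass_facts(1) by (intro sum_ennreal) auto
      also have "\<dots> \<le> ennreal A1"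
        unfolding A1_def sum_distrib_left[symmetric] using A0(1) mass_facts
        by (intro ennreal_leI mult_left_mono sum_le_suminf) auto
      finally show "(\<integral>\<^sup>+x. ennreal (\<Sum>j<J. cl j k x) \<partial>TV) \<le> ennreal A1" .
    qed
    also have "\<dots> = ennreal A1" by (simp add: Liminf_const)
    finally show ?thesis .
  qed
  have V': "(indicator V :: 'a \<Rightarrow> real) \<in> borel_measurable TV"
  proof -
    have "(indicator V :: 'a \<Rightarrow> real) \<in> borel_measurable (restrict_space borel \<Omega>)"
      using V(1) by (intro measurable_restrict_space1 borel_measurable_indicator) auto
    then show ?thesis by (simp cong: measurable_cong_sets)
  qed
  \<comment> \<open>The traces at \<open>x\<close> are real numbers, so the truncation at
    \<open>J\<close> is inactive from some \<open>J\<close> on. A second use of Fatou's lemma then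
    removes it.\<close>
  have lim: "liminf (\<lambda>J. ennreal (indicator V x * ?Q J x)) = ennreal (?c / 2 * (indicator V x * P x))" for x
  proof -
    obtain K :: nat where K: "\<bar>upper_trace \<Omega> u x\<bar> + \<bar>lower_trace \<Omega> u x\<bar> \<le> real K" using real_arch_simple by blast
    have "ennreal (indicator V x * ?Q J x) = ennreal (?c / 2 * (indicator V x * P x))" if "J \<ge> K" for J
    proof -
      have "real K \<le> real J" using that by simp
      then have "min (real J) \<bar>upper_trace \<Omega> u x\<bar> = \<bar>upper_trace \<Omega> u x\<bar>" "min (real J) \<bar>lower_trace \<Omega> u x\<bar> = \<bar>lower_trace \<Omega> u x\<bar>"
        using K by (auto simp: min_def)
      then show ?thesis by (simp add: P_def)
    qed
    then have "(\<lambda>J. ennreal (indicator V x * ?Q J x)) \<longlonglongrightarrow> ennreal (?c / 2 * (indicator V x * P x))"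
      by (intro tendsto_eventually) (auto simp: eventually_sequentially)
    then show ?thesis by (rule lim_imp_Liminf[OF trivial_limit_sequentially])
  qed
  have trm: "upper_trace \<Omega> u \<in> borel_measurable TV" "lower_trace \<Omega> u \<in> borel_measurable TV"
    using traces_measurable by (simp_all cong: measurable_cong_sets)
  have "(\<integral>\<^sup>+x. ennreal (?c / 2 * (indicator V x * P x)) \<partial>TV) \<le> liminf (\<lambda>J. \<integral>\<^sup>+x. ennreal (indicator V x * ?Q J x) \<partial>TV)"
    unfolding lim[symmetric]
    by (intro nn_integral_liminf measurable_compose[OF _ measurable_ennreal] borel_measurable_times borel_measurable_const
        borel_measurable_divide borel_measurable_add borel_measurable_min borel_measurable_abs V' trm)
  also have "\<dots> \<le> liminf (\<lambda>J. ennreal A1)" by (intro Liminf_mono always_eventually allI QJ)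
  also have "\<dots> = ennreal A1" by (simp add: Liminf_const)
  finally have fin: "(\<integral>\<^sup>+x. ennreal (?c / 2 * (indicator V x * P x)) \<partial>TV) \<le> ennreal A1" .
  have Pm: "(\<lambda>x. indicator V x * P x) \<in> borel_measurable TV" using P_meas by (simp cong: measurable_cong_sets)
  have "(\<integral>\<^sup>+x. ennreal (?c / 2 * (indicator V x * P x)) \<partial>TV) = ennreal (?c / 2) * (\<integral>\<^sup>+x. ennreal (indicator V x * P x) \<partial>TV)"
  proof -
    have Pn: "0 \<le> indicator V x * P x" for x by (simp add: P_def)
    have "(\<integral>\<^sup>+x. ennreal (?c / 2 * (indicator V x * P x)) \<partial>TV) = (\<integral>\<^sup>+x. ennreal (?c / 2) * ennreal (indicator V x * P x) \<partial>TV)"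
      by (intro nn_integral_cong ennreal_mult Pn) simp
    also have "\<dots> = ennreal (?c / 2) * (\<integral>\<^sup>+x. ennreal (indicator V x * P x) \<partial>TV)"
      by (rule nn_integral_cmult) (rule measurable_compose[OF Pm measurable_ennreal])
    finally show ?thesis .
  qed
  then have "ennreal (?c / 2) * (\<integral>\<^sup>+x. ennreal (indicator V x * P x) \<partial>TV) < \<infinity>"
    using fin by (simp add: order_le_less_trans)
  then show ?thesis using c by (auto simp: ennreal_mult_less_top)
qed

lemma P_integrable: "integrable TV (\<lambda>x. indicator V x * P x)"
proof (rule integrableI_nonneg)
  show "(\<lambda>x. indicator V x * P x) \<in> borel_measurable TV" using P_meas by (simp cong: measurable_cong_sets)
  show "AE x in TV. 0 \<le> indicator V x * P x" by (simp add: P_def)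
qed (rule P_nn_finite)

lemma L_le_P: "x \<in> \<Omega> \<Longrightarrow> \<bar>L x\<bar> \<le> P x"
proof -
  assume x: "x \<in> \<Omega>"
  have "\<bar>L x\<bar> \<le> \<bar>lam x * upper_trace \<Omega> u x\<bar> + \<bar>(1 - lam x) * lower_trace \<Omega> u x\<bar>"
    unfolding lam_rep_def by (rule abs_triangle_ineq)
  also have "\<dots> \<le> 1 * \<bar>upper_trace \<Omega> u x\<bar> + 1 * \<bar>lower_trace \<Omega> u x\<bar>"
    unfolding abs_mult using lam_01[OF x] by (intro add_mono mult_right_mono) auto
  finally show ?thesis by (simp add: P_def)
qed

lemma VL_integrable: "integrable TV (\<lambda>x. indicator V x * L x)"
proof (rule Bochner_Integration.integrable_bound[OF P_integrable])
  have "(indicator V :: 'a \<Rightarrow> real) \<in> borel_measurable (restrict_space borel \<Omega>)"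
    using V(1) by (intro measurable_restrict_space1 borel_measurable_indicator) auto
  then have "(\<lambda>x. indicator V x * L x) \<in> borel_measurable (restrict_space borel \<Omega>)" using L_meas by (intro borel_measurable_times)
  then show "(\<lambda>x. indicator V x * L x) \<in> borel_measurable TV" by (simp cong: measurable_cong_sets)
  show "AE x in TV. norm (indicator V x * L x) \<le> norm (indicator V x * P x)"
    using L_le_P by (intro AE_I2) (auto simp: abs_mult P_def split: split_indicator)
qed

end

lemma L1_conv_mult:
  fixes f :: "nat \<Rightarrow> 'a::euclidean_space \<Rightarrow> real"
  assumes f: "\<And>k. integrable lborel (f k)" "integrable lborel f0"
    and lim: "(\<lambda>k. LINT x|lborel. \<bar>f k x - f0 x\<bar>) \<longlonglongrightarrow> 0"
    and b: "b \<in> borel_measurable borel" "\<And>x. \<bar>b x\<bar> \<le> B"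
  shows "(\<lambda>k. LINT x|lborel. f k x * b x) \<longlonglongrightarrow> (LINT x|lborel. f0 x * b x)"
proof -
  have i: "integrable lborel (\<lambda>x. w x * b x)" if w: "integrable lborel w" for w
  proof (rule Bochner_Integration.integrable_bound[of lborel "\<lambda>x. B * w x"])
    show "AE x in lborel. norm (w x * b x) \<le> norm (B * w x)"
    proof (intro always_eventually allI)
      fix x have "\<bar>b x\<bar> \<le> \<bar>B\<bar>" using b(2)[of x] by linarith
      then show "norm (w x * b x) \<le> norm (B * w x)" by (simp add: abs_mult mult.commute mult_right_mono)
    qed
  qed (use w b(1) borel_measurable_integrable[OF w] in auto)
  have "norm ((LINT x|lborel. f k x * b x) - (LINT x|lborel. f0 x * b x)) \<le> B * (LINT x|lborel. \<bar>f k x - f0 x\<bar>)" for k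
  proof -
    have d: "integrable lborel (\<lambda>x. f k x - f0 x)" using f by simp
    have "norm ((LINT x|lborel. f k x * b x) - (LINT x|lborel. f0 x * b x)) = norm (LINT x|lborel. (f k x - f0 x) * b x)"
      using i[OF f(1)] i[OF f(2)] by (simp add: left_diff_distrib)
    also have "\<dots> \<le> (LINT x|lborel. norm ((f k x - f0 x) * b x))" by (rule integral_norm_bound)
    also have "\<dots> \<le> (LINT x|lborel. B * \<bar>f k x - f0 x\<bar>)"
    proof (rule integral_mono)
      show "integrable lborel (\<lambda>x. norm ((f k x - f0 x) * b x))" by (intro integrable_norm i d)
      show "integrable lborel (\<lambda>x. B * \<bar>f k x - f0 x\<bar>)" by (intro integrable_mult_right integrable_abs d)
      show "norm ((f k x - f0 x) * b x) \<le> B * \<bar>f k x - f0 x\<bar>" for x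
        using b(2)[of x] by (simp add: abs_mult mult.commute mult_right_mono)
    qed
    also have "\<dots> = B * (LINT x|lborel. \<bar>f k x - f0 x\<bar>)" by simp
    finally show ?thesis .
  qed
  then have "(\<lambda>k. (LINT x|lborel. f k x * b x) - (LINT x|lborel. f0 x * b x)) \<longlonglongrightarrow> 0"
    by (intro Lim_null_comparison[OF always_eventually tendsto_mult_right_zero[OF lim, of B]]) blast
  then show ?thesis by (rule LIM_zero_cancel)
qed

context pairing_local
begin

text \<open>The product of the integrable functions \<open>h\<close> and \<open>v\<close> need not
  be integrable. It is so on \<open>V\<close> because the trace representative is integrable against
  the total variation of \<open>\<mu>\<close> and equals \<open>v\<close> almost everywhere.\<close>

lemma hV_int: "integrable lborel (\<lambda>x. indicator V x * (h x * v x))"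
proof -
  have hm [measurable]: "h \<in> borel_measurable borel" using borel_measurable_integrable[OF h_int] by simp
  have [measurable]: "V \<in> sets borel" using V(1) by simp
  have i: "integrable lborel (\<lambda>x. indicator \<Omega> x * (h x * (indicator V x * L x)))"
    by (rule h_integrable[OF VL_integrable])
  have ae: "AE x in lborel. indicator \<Omega> x * (h x * (indicator V x * L x)) = indicator V x * (h x * v x)"
    using AE_lam_rep[of lam] by eventually_elim (use V(2) in \<open>auto split: split_indicator\<close>)
  show ?thesis
    by (rule integrable_cong_AE_imp[OF i]) (use ae in \<open>auto elim: eventually_mono\<close>)
qed

text \<open>The part above level \<open>m\<close> of the error carried by the absolutely continuous
  part of \<open>\<mu>\<close>.\<close>

definition R :: "nat \<Rightarrow> real" where
  "R m = (LINT x|lborel. indicator V x * (\<bar>h x\<bar> * \<bar>v x - trunc m (v x)\<bar>))"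

lemma R_int: "integrable lborel (\<lambda>x. indicator V x * (\<bar>h x\<bar> * \<bar>v x - trunc m (v x)\<bar>))"
proof (rule Bochner_Integration.integrable_bound[OF hV_int])
  have hm [measurable]: "h \<in> borel_measurable borel" using borel_measurable_integrable[OF h_int] by simp
  have [measurable]: "V \<in> sets borel" using V(1) by simp
  show "(\<lambda>x. indicator V x * (\<bar>h x\<bar> * \<bar>v x - trunc m (v x)\<bar>)) \<in> borel_measurable lborel" by measurable
  show "AE x in lborel. norm (indicator V x * (\<bar>h x\<bar> * \<bar>v x - trunc m (v x)\<bar>)) \<le> norm (indicator V x * (h x * v x))"
    by (intro always_eventually allI) (simp add: abs_mult mult_left_mono trunc_facts)
qed

lemma R_tendsto: "R \<longlonglongrightarrow> 0"
proof -
  have "R \<longlonglongrightarrow> (LINT x|(lborel :: 'a measure). 0)"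
    unfolding R_def[abs_def]
  proof (rule integral_dominated_convergence[where w = "\<lambda>x. \<bar>indicator V x * (h x * v x)\<bar>"])
    show "AE x in lborel. (\<lambda>m. indicator V x * (\<bar>h x\<bar> * \<bar>v x - trunc m (v x)\<bar>)) \<longlonglongrightarrow> 0"
    proof (intro always_eventually allI)
      fix x
      obtain M :: nat where M: "\<bar>v x\<bar> \<le> real M" using real_arch_simple by blast
      have "trunc m (v x) = v x" if "m \<ge> M" for m
      proof -
        have "real M \<le> real m" using that by simp
        then show ?thesis using M by (simp add: trunc_def)
      qed
      then show "(\<lambda>m. indicator V x * (\<bar>h x\<bar> * \<bar>v x - trunc m (v x)\<bar>)) \<longlonglongrightarrow> 0"
        by (intro tendsto_eventually) (simp add: eventually_sequentially exI[of _ M])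
    qed
    show "AE x in lborel. norm (indicator V x * (\<bar>h x\<bar> * \<bar>v x - trunc m (v x)\<bar>)) \<le> \<bar>indicator V x * (h x * v x)\<bar>" for m
      by (intro always_eventually allI) (simp add: abs_mult mult_left_mono trunc_facts)
  qed (use R_int hV_int in \<open>auto intro: borel_measurable_integrable\<close>)
  then show ?thesis by simp
qed

lemma T_comp_le: "i \<in> Basis \<Longrightarrow> \<bar>T x \<bullet> i\<bar> \<le> 1"
  using Basis_le_norm[of i "T x"] T_le[of x] by linarith

lemma T_mult_integrable:
  assumes i: "i \<in> Basis" and w: "integrable lborel w"
  shows "integrable lborel (\<lambda>x. w x * (T x \<bullet> i))"
proof (rule Bochner_Integration.integrable_bound[OF w])
  show "AE x in lborel. norm (w x * (T x \<bullet> i)) \<le> norm (w x)"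
    using T_comp_le[OF i] by (auto simp: abs_mult intro!: mult_left_le)
qed (use borel_measurable_integrable[OF w] in simp)

lemma wk_test: "wk k \<in> test_functions \<Omega>" by (rule conv_test[OF U_int])

lemma vk_test: "vk m k \<in> test_functions \<Omega>" by (rule conv_test[OF trunc_int]) (simp add: trunc_facts)

section \<open>Estimates with a fixed cut-off\<close>

context
  fixes \<phi> :: "'a \<Rightarrow> real" 
  assumes \<phi>: "\<phi> \<in> test_functions V" "\<And>x. 0 \<le> \<phi> x" "\<And>x. \<phi> x \<le> 1"
begin

lemma \<phi>_test: "\<phi> \<in> test_functions \<Omega>" "\<phi> \<in> test_functions UNIV"
  using test_functions_mono[OF V(2) \<phi>(1)] test_functions_mono[OF subset_UNIV \<phi>(1)] by auto

lemma \<phi>_V: "x \<notin> V \<Longrightarrow> \<phi> x = 0"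
  by (rule test_functionsE[OF \<phi>(1)]) blast

lemma D\<phi>_V: "i \<in> Basis \<Longrightarrow> x \<notin> V \<Longrightarrow> frechet_derivative \<phi> (at x) i = 0"
  by (rule test_functionsE[OF test_functions_deriv[OF \<phi>(1), of i]]) blast+

lemma \<phi>_abs: "\<bar>\<phi> x\<bar> = \<phi> x" using \<phi>(2) by simp

lemma \<phi>_mult_bound: "\<bar>\<phi> x * c\<bar> \<le> \<bar>c\<bar>"
  using mult_right_mono[OF \<phi>(3)[of x], of "\<bar>c\<bar>"] \<phi>(2)[of x] by (simp add: abs_mult)

text \<open>The divergence of \<open>wk k\<close> times \<open>T\<close>, expanded by the Leibniz
  rule for the smooth factor and tested with \<open>\<phi>\<close>.\<close>

definition E :: "nat \<Rightarrow> real" where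
  "E k = signed_integral \<Omega> \<mu> (\<lambda>x. \<phi> x * wk k x) + (LINT x|lborel. \<phi> x * (T x \<bullet> grad (wk k) x))"

lemma integrable_T_grad:
  assumes w: "integrable lborel w" and \<psi>: "\<psi> \<in> test_functions UNIV"
  shows "integrable lborel (\<lambda>x. w x * (T x \<bullet> grad \<psi> x))"
proof -
  have "w x * (T x \<bullet> grad \<psi> x) = (\<Sum>i\<in>Basis. (w x * frechet_derivative \<psi> (at x) i) * (T x \<bullet> i))" for x
    by (simp add: inner_grad sum_distrib_left mult_ac)
  then show ?thesis
    using w \<psi> by (simp only:) (intro Bochner_Integration.integrable_sum T_mult_integrable test_mult_integrable test_functions_deriv)
qed

lemma E_eq: "E k = - (LINT x|lborel. wk k x * (T x \<bullet> grad \<phi> x))"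
proof -
  have wU: "wk k \<in> test_functions UNIV" by (rule test_functions_mono[OF subset_UNIV wk_test])
  have t: "(\<lambda>x. \<phi> x * wk k x) \<in> test_functions \<Omega>"
    by (intro test_functions_mult_smooth \<phi>_test test_functions_cont_diff[OF wk_test])
  have D: "T x \<bullet> grad (\<lambda>x. \<phi> x * wk k x) x = \<phi> x * (T x \<bullet> grad (wk k) x) + wk k x * (T x \<bullet> grad \<phi> x)" for x
    unfolding inner_grad frechet_derivative_mult[OF test_functions_differentiable[OF \<phi>_test(1)] test_functions_differentiable[OF wk_test]]
    by (simp add: sum_distrib_left sum.distrib[symmetric] algebra_simps)
  have i1: "integrable lborel (\<lambda>x. \<phi> x * (T x \<bullet> grad (wk k) x))"
    by (rule integrable_T_grad[OF test_functions_integrable[OF \<phi>_test(1)] wU])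
  have i2: "integrable lborel (\<lambda>x. wk k x * (T x \<bullet> grad \<phi> x))"
    by (rule integrable_T_grad[OF test_functions_integrable[OF wk_test] \<phi>_test(2)])
  show ?thesis using T_div[OF t] i1 i2 unfolding E_def D by simp
qed

text \<open>In the form of \<open>E_eq\<close> no derivative of \<open>wk k\<close> occurs, so
  \<open>L1\<close> convergence to \<open>U\<close> suffices. On the support of
  \<open>\<phi>\<close> the limit \<open>U\<close> is \<open>v\<close>, and the pairing hypothesis
  rewrites the resulting integral.\<close>

lemma E_tendsto:
  "E \<longlonglongrightarrow> (LINT x|lborel. s x * \<phi> x) + (LINT x|\<tau>. \<phi> x) + signed_integral \<Omega> \<mu> (\<lambda>x. \<phi> x * L x)"
proof -
  obtain B where B: "\<And>i x. i \<in> Basis \<Longrightarrow> \<bar>frechet_derivative \<phi> (at x) i\<bar> \<le> B i"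
  proof -
    have "\<forall>i\<in>Basis. \<exists>B. \<forall>x. \<bar>frechet_derivative \<phi> (at x) i\<bar> \<le> B"
      using test_functions_bounded[OF test_functions_deriv[OF \<phi>(1)]] by metis
    from bchoice[OF this] show ?thesis using that by blast
  qed
  have tm: "(\<lambda>x. T x \<bullet> grad \<phi> x) \<in> borel_measurable borel"
    unfolding inner_grad using test_functions_measurable[OF test_functions_deriv[OF \<phi>(1)]]
    by (intro borel_measurable_sum borel_measurable_times borel_measurable_inner T_meas borel_measurable_const)
  have bd: "\<bar>T x \<bullet> grad \<phi> x\<bar> \<le> (\<Sum>i\<in>Basis. 1 * B i)" for x
    unfolding inner_grad
  proof (rule order_trans[OF sum_abs sum_mono])
    fix i :: 'a assume i: "i \<in> Basis"
    show "\<bar>(T x \<bullet> i) * frechet_derivative \<phi> (at x) i\<bar> \<le> 1 * B i"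
      unfolding abs_mult using T_comp_le[OF i] B[OF i] by (intro mult_mono) auto
  qed
  have "(\<lambda>k. LINT x|lborel. wk k x * (T x \<bullet> grad \<phi> x)) \<longlonglongrightarrow> (LINT x|lborel. U x * (T x \<bullet> grad \<phi> x))"
    by (rule L1_conv_mult[OF _ U_int conv_mollifier_L1[OF U_int \<epsilon>(1,2)] tm bd])
      (rule test_functions_integrable[OF wk_test])
  moreover have "U x * (T x \<bullet> grad \<phi> x) = v x * (T x \<bullet> grad \<phi> x)" for x
  proof (cases "x \<in> V")
    case False
    then have "T x \<bullet> grad \<phi> x = 0" unfolding inner_grad using D\<phi>_V by simp
    then show ?thesis by simp
  qed (simp add: U_V)
  ultimately have "(\<lambda>k. LINT x|lborel. wk k x * (T x \<bullet> grad \<phi> x)) \<longlonglongrightarrow> (LINT x|lborel. v x * (T x \<bullet> grad \<phi> x))" by simp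
  then have "E \<longlonglongrightarrow> - (LINT x|lborel. v x * (T x \<bullet> grad \<phi> x))"
    unfolding E_eq[abs_def] by (rule tendsto_minus)
  then show ?thesis using pairing[OF \<phi>_test(1)] by (simp add: algebra_simps)
qed

lemma \<phi>L_integrable: "integrable TV (\<lambda>x. \<phi> x * L x)"
proof (rule Bochner_Integration.integrable_bound[OF VL_integrable])
  have "\<phi> \<in> borel_measurable (restrict_space borel \<Omega>)"
    using test_functions_measurable[OF \<phi>(1)] by (rule measurable_restrict_space1)
  then have "(\<lambda>x. \<phi> x * L x) \<in> borel_measurable (restrict_space borel \<Omega>)" using L_meas by (intro borel_measurable_times)
  then show "(\<lambda>x. \<phi> x * L x) \<in> borel_measurable TV" by (simp cong: measurable_cong_sets)
  show "AE x in TV. norm (\<phi> x * L x) \<le> norm (indicator V x * L x)"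
    using \<phi>_mult_bound \<phi>_V by (intro always_eventually allI) (auto split: split_indicator)
qed

text \<open>On the singular part of \<open>\<mu>\<close> the truncated mollification is bounded by
  \<open>m\<close> and the representative by \<open>P\<close>. For fixed \<open>m\<close> this
  weight is integrable, so the term vanishes once the cut-offs concentrate on a set disjoint from
  \<open>N\<close>.\<close>

definition Sing :: "nat \<Rightarrow> real" where
  "Sing m = (LINT x|total_variation \<Omega> \<mu>s. \<phi> x * (real m + indicator V x * P x))"

lemma mass_weight_integrable: "integrable (total_variation \<Omega> \<mu>s) (\<lambda>x. real m + indicator V x * P x)"
proof -
  interpret F: finite_measure "total_variation \<Omega> \<mu>s" by (rule finite_TVs)
  show ?thesis using integrable_TVs[OF P_integrable] by simp
qed

text \<open>The truncated mollification is inserted between \<open>wk k\<close> and the trace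
  representative. The first difference is the tail; the second splits along the decomposition of
  \<open>\<mu>\<close>, where on the density part the representative may be replaced by
  \<open>v\<close>.\<close>

lemma mu_part:
  "\<bar>signed_integral \<Omega> \<mu> (\<lambda>x. \<phi> x * wk k x) - signed_integral \<Omega> \<mu> (\<lambda>x. \<phi> x * L x)\<bar>
    \<le> tail m + \<bar>LINT x|lborel. (h x * \<phi> x) * (vk m k x - v x)\<bar> + Sing m"
proof -
  interpret TV: finite_measure TV by (rule finite_TV)
  have w: "integrable TV (\<lambda>x. \<phi> x * wk k x)"
    by (rule test_integrable_finite[OF test_functions_mult_smooth[OF \<phi>_test(1) test_functions_cont_diff[OF wk_test]] finite_TV]) simp
  have vv: "integrable TV (\<lambda>x. \<phi> x * vk m k x)"
    by (rule test_integrable_finite[OF test_functions_mult_smooth[OF \<phi>_test(1) test_functions_cont_diff[OF vk_test]] finite_TV]) simp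
  have d1: "integrable TV (\<lambda>x. \<phi> x * wk k x - \<phi> x * vk m k x)" using w vv by simp
  have d2: "integrable TV (\<lambda>x. \<phi> x * vk m k x - \<phi> x * L x)" using vv \<phi>L_integrable by simp
  have "signed_integral \<Omega> \<mu> (\<lambda>x. \<phi> x * wk k x) - signed_integral \<Omega> \<mu> (\<lambda>x. \<phi> x * L x)
     = signed_integral \<Omega> \<mu> (\<lambda>x. \<phi> x * wk k x - \<phi> x * vk m k x) + signed_integral \<Omega> \<mu> (\<lambda>x. \<phi> x * vk m k x - \<phi> x * L x)"
    using signed_integral_diff[OF \<mu>(1) w vv] signed_integral_diff[OF \<mu>(1) vv \<phi>L_integrable] by simp
  moreover have "\<bar>signed_integral \<Omega> \<mu> (\<lambda>x. \<phi> x * wk k x - \<phi> x * vk m k x)\<bar> \<le> tail m"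
  proof -
    have t0: "0 \<le> tail m" unfolding tail_def using A0(1) mass_facts
      by (intro mult_nonneg_nonneg suminf_nonneg) (auto simp: summable_iff_shift)
    have "ennreal (LINT x|TV. \<bar>\<phi> x * wk k x - \<phi> x * vk m k x\<bar>) = (\<integral>\<^sup>+x. ennreal \<bar>\<phi> x * wk k x - \<phi> x * vk m k x\<bar> \<partial>TV)"
      using d1 by (intro nn_integral_eq_integral[symmetric] integrable_abs) auto
    also have "\<dots> \<le> (\<integral>\<^sup>+x. ennreal \<bar>wk k x - vk m k x\<bar> \<partial>TV)"
      using \<phi>_mult_bound by (intro nn_integral_mono ennreal_leI) (simp add: right_diff_distrib[symmetric])
    also have "\<dots> \<le> ennreal (tail m)" by (rule tail_bound)
    finally have "(LINT x|TV. \<bar>\<phi> x * wk k x - \<phi> x * vk m k x\<bar>) \<le> tail m" using t0 by (simp add: ennreal_le_iff)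
    then show ?thesis using abs_signed_integral_le[OF \<mu>(1) d1] by linarith
  qed
  moreover have "signed_integral \<Omega> \<mu> (\<lambda>x. \<phi> x * vk m k x - \<phi> x * L x)
     = (LINT x|lborel. (h x * \<phi> x) * (vk m k x - v x)) + signed_integral \<Omega> \<mu>s (\<lambda>x. \<phi> x * vk m k x - \<phi> x * L x)"
  proof -
    have hm [measurable]: "h \<in> borel_measurable borel" using borel_measurable_integrable[OF h_int] by simp
    have [measurable]: "\<phi> \<in> borel_measurable borel" "vk m k \<in> borel_measurable borel"
      using test_functions_measurable[OF \<phi>(1)] test_functions_measurable[OF vk_test] by auto
    have "(LINT x|lborel. indicator \<Omega> x * (h x * (\<phi> x * vk m k x - \<phi> x * L x))) = (LINT x|lborel. (h x * \<phi> x) * (vk m k x - v x))"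
    proof (rule Bochner_Integration.integral_cong_AE)
      show "(\<lambda>x. indicator \<Omega> x * (h x * (\<phi> x * vk m k x - \<phi> x * L x))) \<in> borel_measurable lborel"
        by (rule borel_measurable_integrable[OF h_integrable[OF d2]])
      show "AE x in lborel. indicator \<Omega> x * (h x * (\<phi> x * vk m k x - \<phi> x * L x)) = (h x * \<phi> x) * (vk m k x - v x)"
        using AE_lam_rep[of lam]
      proof eventually_elim
        case (elim x)
        then show ?case using \<phi>_V[of x] V(2) by (cases "x \<in> \<Omega>") (auto simp: algebra_simps)
      qed
    qed measurable
    then show ?thesis using signed_integral_\<mu>[OF d2] by simp
  qed
  moreover have "\<bar>signed_integral \<Omega> \<mu>s (\<lambda>x. \<phi> x * vk m k x - \<phi> x * L x)\<bar> \<le> Sing m"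
  proof -
    have "\<bar>signed_integral \<Omega> \<mu>s (\<lambda>x. \<phi> x * vk m k x - \<phi> x * L x)\<bar> \<le> (LINT x|total_variation \<Omega> \<mu>s. \<bar>\<phi> x * vk m k x - \<phi> x * L x\<bar>)"
      by (rule abs_signed_integral_le[OF \<mu>s integrable_TVs[OF d2]])
    also have "\<dots> \<le> Sing m"
      unfolding Sing_def
    proof (rule integral_mono_AE)
      show "integrable (total_variation \<Omega> \<mu>s) (\<lambda>x. \<bar>\<phi> x * vk m k x - \<phi> x * L x\<bar>)" by (intro integrable_abs integrable_TVs d2)
      show "integrable (total_variation \<Omega> \<mu>s) (\<lambda>x. \<phi> x * (real m + indicator V x * P x))"
      proof (rule Bochner_Integration.integrable_bound[OF mass_weight_integrable])
        have "\<phi> \<in> borel_measurable (restrict_space borel \<Omega>)"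
          using test_functions_measurable[OF \<phi>(1)] by (rule measurable_restrict_space1)
        then have "\<phi> \<in> borel_measurable (total_variation \<Omega> \<mu>s)" by (simp cong: measurable_cong_sets)
        then show "(\<lambda>x. \<phi> x * (real m + indicator V x * P x)) \<in> borel_measurable (total_variation \<Omega> \<mu>s)"
          using borel_measurable_integrable[OF mass_weight_integrable] by (intro borel_measurable_times)
        show "AE x in total_variation \<Omega> \<mu>s. norm (\<phi> x * (real m + indicator V x * P x)) \<le> norm (real m + indicator V x * P x)"
          using \<phi>_mult_bound by simp
      qed
      show "AE x in total_variation \<Omega> \<mu>s. \<bar>\<phi> x * vk m k x - \<phi> x * L x\<bar> \<le> \<phi> x * (real m + indicator V x * P x)"
      proof (rule AE_I2)
        fix x assume "x \<in> space (total_variation \<Omega> \<mu>s)"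
        then have x: "x \<in> \<Omega>" by simp
        have "\<bar>vk m k x\<bar> \<le> real m" by (rule conv_mollifier_bounded[OF \<epsilon>(1) trunc_int]) (rule trunc_facts)
        then have "\<bar>vk m k x - L x\<bar> \<le> real m + P x" using L_le_P[OF x] by linarith
        then have "\<phi> x * \<bar>vk m k x - L x\<bar> \<le> \<phi> x * (real m + P x)" by (rule mult_left_mono[OF _ \<phi>(2)])
        moreover have "\<bar>\<phi> x * vk m k x - \<phi> x * L x\<bar> = \<phi> x * \<bar>vk m k x - L x\<bar>"
          unfolding right_diff_distrib[symmetric] abs_mult \<phi>_abs ..
        ultimately show "\<bar>\<phi> x * vk m k x - \<phi> x * L x\<bar> \<le> \<phi> x * (real m + indicator V x * P x)"
          using \<phi>_V[of x] by (cases "x \<in> V") auto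
      qed
    qed
    finally show ?thesis .
  qed
  ultimately show ?thesis by linarith
qed

text \<open>Truncation supplies the majorant for dominated convergence: the mollifications stay
  below \<open>m\<close>, and \<open>h v\<close> is integrable on \<open>V\<close>. The remaining
  truncation error is at most \<open>R m\<close>.\<close>

lemma h_part_tendsto:
  "(\<lambda>k. LINT x|lborel. (h x * \<phi> x) * (vk m k x - v x)) \<longlonglongrightarrow> (LINT x|lborel. (h x * \<phi> x) * (trunc m (U x) - v x))"
    and h_part_le: "\<bar>LINT x|lborel. (h x * \<phi> x) * (trunc m (U x) - v x)\<bar> \<le> R m"
proof -
  have hm [measurable]: "h \<in> borel_measurable borel" using borel_measurable_integrable[OF h_int] by simp
  have [measurable]: "\<phi> \<in> borel_measurable borel" by (rule test_functions_measurable[OF \<phi>(1)])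
  have vm [measurable]: "vk m k \<in> borel_measurable borel" for k by (rule test_functions_measurable[OF vk_test])
  have [measurable]: "V \<in> sets borel" using V(1) by simp
  have wi: "integrable lborel (\<lambda>x. real m * \<bar>h x\<bar> + \<bar>indicator V x * (h x * v x)\<bar>)"
    using h_int hV_int by simp
  show "(\<lambda>k. LINT x|lborel. (h x * \<phi> x) * (vk m k x - v x)) \<longlonglongrightarrow> (LINT x|lborel. (h x * \<phi> x) * (trunc m (U x) - v x))"
  proof (rule integral_dominated_convergence[OF _ _ wi])
    show "AE x in lborel. (\<lambda>k. (h x * \<phi> x) * (vk m k x - v x)) \<longlonglongrightarrow> (h x * \<phi> x) * (trunc m (U x) - v x)"
      using AE_conv_mollifier_tendsto[OF trunc_int[of m]]
    proof eventually_elim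
      case (elim x)
      from filterlim_compose[OF elim \<epsilon>_right] show ?case by (intro tendsto_intros)
    qed
    show "AE x in lborel. norm ((h x * \<phi> x) * (vk m k x - v x)) \<le> real m * \<bar>h x\<bar> + \<bar>indicator V x * (h x * v x)\<bar>" for k
    proof (intro always_eventually allI)
      fix x
      have b: "\<bar>vk m k x\<bar> \<le> real m" by (rule conv_mollifier_bounded[OF \<epsilon>(1) trunc_int]) (rule trunc_facts)
      show "norm ((h x * \<phi> x) * (vk m k x - v x)) \<le> real m * \<bar>h x\<bar> + \<bar>indicator V x * (h x * v x)\<bar>"
      proof (cases "x \<in> V")
        case True
        have "norm ((h x * \<phi> x) * (vk m k x - v x)) = \<bar>\<phi> x * (h x * (vk m k x - v x))\<bar>" by (simp add: mult_ac)
        also have "\<dots> \<le> \<bar>h x * (vk m k x - v x)\<bar>" by (rule \<phi>_mult_bound)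
        also have "\<dots> \<le> \<bar>h x\<bar> * (real m + \<bar>v x\<bar>)" unfolding abs_mult using b by (intro mult_left_mono) auto
        finally show ?thesis using True by (simp add: abs_mult algebra_simps)
      qed (simp add: \<phi>_V)
    qed
  qed measurable
  have le: "\<bar>(h x * \<phi> x) * (trunc m (U x) - v x)\<bar> \<le> indicator V x * (\<bar>h x\<bar> * \<bar>v x - trunc m (v x)\<bar>)" for x
  proof (cases "x \<in> V")
    case True
    have "\<bar>(h x * \<phi> x) * (trunc m (U x) - v x)\<bar> = \<bar>\<phi> x * (h x * (trunc m (v x) - v x))\<bar>" by (simp add: U_V[OF True] mult_ac)
    also have "\<dots> \<le> \<bar>h x * (trunc m (v x) - v x)\<bar>" by (rule \<phi>_mult_bound)
    finally show ?thesis using True by (simp add: abs_mult abs_minus_commute)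
  qed (simp add: \<phi>_V)
  have i: "integrable lborel (\<lambda>x. (h x * \<phi> x) * (trunc m (U x) - v x))"
  proof (rule Bochner_Integration.integrable_bound[OF R_int[of m]])
    show "(\<lambda>x. (h x * \<phi> x) * (trunc m (U x) - v x)) \<in> borel_measurable lborel" by measurable
    show "AE x in lborel. norm ((h x * \<phi> x) * (trunc m (U x) - v x)) \<le> norm (indicator V x * (\<bar>h x\<bar> * \<bar>v x - trunc m (v x)\<bar>))"
      using le by (intro always_eventually allI) simp
  qed
  have "\<bar>LINT x|lborel. (h x * \<phi> x) * (trunc m (U x) - v x)\<bar> \<le> (LINT x|lborel. \<bar>(h x * \<phi> x) * (trunc m (U x) - v x)\<bar>)"
    using integral_norm_bound[of lborel "\<lambda>x. (h x * \<phi> x) * (trunc m (U x) - v x)"] by simp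
  also have "\<dots> \<le> R m" unfolding R_def by (intro integral_mono integrable_abs i R_int le)
  finally show "\<bar>LINT x|lborel. (h x * \<phi> x) * (trunc m (U x) - v x)\<bar> \<le> R m" .
qed

abbreviation "\<sigma> i \<equiv> total_variation \<Omega> (\<nu>s i)"

text \<open>The derivative is moved to the reflected mollifier, whose support lies in
  \<open>V\<close>. There \<open>U\<close> agrees with \<open>v\<close>, so the derivative measure
  of \<open>v\<close> applies and only its singular part is left as an error.\<close>

lemma deriv_wk_pointwise:
  assumes i: "i \<in> Basis" and x: "cball x (\<epsilon> k) \<subseteq> V"
  shows "\<bar>frechet_derivative (wk k) (at x) i - conv (mollifier (\<epsilon> k)) (\<lambda>y. g y \<bullet> i) x\<bar>
     \<le> (LINT y|\<sigma> i. mollifier (\<epsilon> k) (x - y))"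
proof -
  let ?\<psi> = "\<lambda>y. mollifier (\<epsilon> k) (x - y)"
  note mt = mollifier_test[OF \<epsilon>(1), of k, where ?'a='a]
  have \<psi>: "?\<psi> \<in> test_functions V"
  proof (rule test_functionsI[OF _ _ x])
    show "cont_diff n ?\<psi>" for n by (rule test_functions_cont_diff[OF test_functions_reflect[OF mt]])
    show "?\<psi> y = 0" if "y \<notin> cball x (\<epsilon> k)" for y
      using that by (intro mollifier_eq_0[OF \<epsilon>(1)]) (simp add: dist_norm)
  qed simp
  have \<psi>\<Omega>: "?\<psi> \<in> test_functions \<Omega>" by (rule test_functions_mono[OF V(2) \<psi>])
  have D0: "frechet_derivative ?\<psi> (at y) i = 0" if "y \<notin> V" for y
    by (rule test_functionsE[OF test_functions_deriv[OF \<psi> i]]) (use that in blast)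
  have "frechet_derivative (wk k) (at x) i = - (LINT y|lborel. U y * frechet_derivative ?\<psi> (at y) i)"
    unfolding conv_frechet_derivative[OF mt U_int i] conv_deriv_eq[OF mt] ..
  also have "(LINT y|lborel. U y * frechet_derivative ?\<psi> (at y) i) = (LINT y|lborel. v y * frechet_derivative ?\<psi> (at y) i)"
  proof (intro Bochner_Integration.integral_cong refl)
    show "U y * frechet_derivative ?\<psi> (at y) i = v y * frechet_derivative ?\<psi> (at y) i" for y
      using D0[of y] U_V[of y] by (cases "y \<in> V") auto
  qed
  also have "- \<dots> = (LINT y|lborel. (g y \<bullet> i) * ?\<psi> y) + signed_integral \<Omega> (\<nu>s i) ?\<psi>"
    using v_deriv[OF \<psi>\<Omega> i] by simp
  also have "(LINT y|lborel. (g y \<bullet> i) * ?\<psi> y) = conv (mollifier (\<epsilon> k)) (\<lambda>y. g y \<bullet> i) x"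
    by (simp add: conv_def mult.commute)
  finally have "\<bar>frechet_derivative (wk k) (at x) i - conv (mollifier (\<epsilon> k)) (\<lambda>y. g y \<bullet> i) x\<bar> = \<bar>signed_integral \<Omega> (\<nu>s i) ?\<psi>\<bar>"
    by simp
  also have "\<dots> \<le> (LINT y|\<sigma> i. \<bar>?\<psi> y\<bar>)"
    by (rule abs_signed_integral_le[OF \<nu>s(1)[OF i] test_integrable_finite[OF \<psi>\<Omega> finite_measure_tv[OF \<nu>s(1)[OF i]]]]) simp
  also have "\<dots> = (LINT y|\<sigma> i. ?\<psi> y)" by (simp add: mollifier_nonneg[OF \<epsilon>(1)])
  finally show ?thesis .
qed

text \<open>Since the mollifier is even, exchanging the integrals moves the mollification from the
  singular measure to \<open>\<phi>\<close>, where its limit is known.\<close>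

lemma sigma_Fubini:
  assumes i: "i \<in> Basis"
  shows "(\<integral>\<^sup>+x. ennreal (\<phi> x) * ennreal (LINT y|\<sigma> i. mollifier (\<epsilon> k) (x - y)) \<partial>lborel) = ennreal (LINT y|\<sigma> i. conv (mollifier (\<epsilon> k)) \<phi> y)"
proof -
  interpret F: finite_measure "\<sigma> i" by (rule finite_measure_tv[OF \<nu>s(1)[OF i]])
  interpret PS: pair_sigma_finite "lborel :: 'a measure" "\<sigma> i"
    by (intro pair_sigma_finite.intro sigma_finite_lborel F.sigma_finite_measure_axioms)
  note mt = mollifier_test[OF \<epsilon>(1), of k, where ?'a='a]
  have [measurable]: "(mollifier (\<epsilon> k) :: 'a \<Rightarrow> real) \<in> borel_measurable borel" "\<phi> \<in> borel_measurable borel"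
    using test_functions_measurable[OF mt] test_functions_measurable[OF \<phi>(1)] .
  have idm: "(\<lambda>y. y) \<in> measurable (\<sigma> i) borel"
  proof -
    have "(\<lambda>y. y) \<in> measurable (restrict_space borel \<Omega>) borel" by (rule measurable_restrict_space1) simp
    then show ?thesis by (simp cong: measurable_cong_sets)
  qed
  have [measurable]: "snd \<in> measurable (lborel \<Otimes>\<^sub>M \<sigma> i) borel" "fst \<in> measurable (lborel \<Otimes>\<^sub>M \<sigma> i) borel"
    using measurable_compose[OF measurable_snd idm] measurable_fst[of "lborel :: 'a measure" "\<sigma> i"] by (simp_all cong: measurable_cong_sets)
  have jm: "(\<lambda>p. ennreal (\<phi> (fst p) * mollifier (\<epsilon> k) (fst p - snd p))) \<in> borel_measurable (lborel \<Otimes>\<^sub>M \<sigma> i)"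
    by measurable
  have \<psi>i: "integrable (\<sigma> i) (\<lambda>y. mollifier (\<epsilon> k) (x - y))" for x
    by (rule test_integrable_finite[OF test_functions_reflect[OF mt] F.finite_measure_axioms]) simp
  have "(\<integral>\<^sup>+x. ennreal (\<phi> x) * ennreal (LINT y|\<sigma> i. mollifier (\<epsilon> k) (x - y)) \<partial>lborel)
     = (\<integral>\<^sup>+x. (\<integral>\<^sup>+y. ennreal (\<phi> x * mollifier (\<epsilon> k) (x - y)) \<partial>\<sigma> i) \<partial>lborel)"
  proof (intro nn_integral_cong)
    fix x
    have "ennreal (\<phi> x) * ennreal (LINT y|\<sigma> i. mollifier (\<epsilon> k) (x - y)) = ennreal (LINT y|\<sigma> i. \<phi> x * mollifier (\<epsilon> k) (x - y))"
      using \<phi>(2) by (simp add: ennreal_mult')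
    also have "\<dots> = (\<integral>\<^sup>+y. ennreal (\<phi> x * mollifier (\<epsilon> k) (x - y)) \<partial>\<sigma> i)"
      by (intro nn_integral_eq_integral[symmetric] integrable_mult_right \<psi>i always_eventually allI mult_nonneg_nonneg \<phi>(2) mollifier_nonneg \<epsilon>(1))
    finally show "ennreal (\<phi> x) * ennreal (LINT y|\<sigma> i. mollifier (\<epsilon> k) (x - y)) = (\<integral>\<^sup>+y. ennreal (\<phi> x * mollifier (\<epsilon> k) (x - y)) \<partial>\<sigma> i)" .
  qed
  also have "\<dots> = (\<integral>\<^sup>+y. (\<integral>\<^sup>+x. ennreal (\<phi> x * mollifier (\<epsilon> k) (x - y)) \<partial>lborel) \<partial>\<sigma> i)"
    using PS.Fubini[OF jm] by simp
  also have "\<dots> = (\<integral>\<^sup>+y. ennreal (conv (mollifier (\<epsilon> k)) \<phi> y) \<partial>\<sigma> i)"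
  proof (intro nn_integral_cong)
    fix y
    have "conv (mollifier (\<epsilon> k)) \<phi> y = (LINT x|lborel. \<phi> x * mollifier (\<epsilon> k) (x - y))"
      unfolding conv_def using mollifier_minus[of "\<epsilon> k" "_ - y"] by (simp add: mult.commute)
    moreover have "integrable lborel (\<lambda>x. mollifier (\<epsilon> k) (y - x) * \<phi> x)"
      by (rule conv_integrable[OF mt test_functions_integrable[OF \<phi>(1)]])
    then have "integrable lborel (\<lambda>x. \<phi> x * mollifier (\<epsilon> k) (x - y))"
      using mollifier_minus[of "\<epsilon> k" "_ - y"] by (simp add: mult.commute)
    then have "(\<integral>\<^sup>+x. ennreal (\<phi> x * mollifier (\<epsilon> k) (x - y)) \<partial>lborel) = ennreal (LINT x|lborel. \<phi> x * mollifier (\<epsilon> k) (x - y))"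
      by (rule nn_integral_eq_integral) (intro always_eventually allI mult_nonneg_nonneg \<phi>(2) mollifier_nonneg \<epsilon>(1))
    ultimately show "(\<integral>\<^sup>+x. ennreal (\<phi> x * mollifier (\<epsilon> k) (x - y)) \<partial>lborel) = ennreal (conv (mollifier (\<epsilon> k)) \<phi> y)"
      by (simp only:)
  qed
  also have "\<dots> = ennreal (LINT y|\<sigma> i. conv (mollifier (\<epsilon> k)) \<phi> y)"
  proof (rule nn_integral_eq_integral)
    show "AE y in \<sigma> i. 0 \<le> conv (mollifier (\<epsilon> k)) \<phi> y"
      by (intro always_eventually allI conv_mollifier_nonneg \<epsilon>(1) \<phi>(2))
    have cm: "conv (mollifier (\<epsilon> k)) \<phi> \<in> borel_measurable (\<sigma> i)"
      by (rule measurable_compose[OF idm conv_measurable[OF mt test_functions_integrable[OF \<phi>(1)]]])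
    have "\<bar>conv (mollifier (\<epsilon> k)) \<phi> y\<bar> \<le> 1" for y
      by (rule conv_mollifier_bounded[OF \<epsilon>(1) test_functions_integrable[OF \<phi>(1)]]) (simp add: \<phi>)
    then show "integrable (\<sigma> i) (conv (mollifier (\<epsilon> k)) \<phi>)" by (intro F.integrable_const_bound[of _ 1] cm) auto
  qed
  finally show ?thesis .
qed

lemma sigma_tendsto:
  assumes i: "i \<in> Basis"
  shows "(\<lambda>k. LINT y|\<sigma> i. conv (mollifier (\<epsilon> k)) \<phi> y) \<longlonglongrightarrow> (LINT y|\<sigma> i. \<phi> y)"
proof (rule integral_dominated_convergence[where w = "\<lambda>_. 1"])
  interpret F: finite_measure "\<sigma> i" by (rule finite_measure_tv[OF \<nu>s(1)[OF i]])
  show "integrable (\<sigma> i) (\<lambda>_. 1 :: real)" by simp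
  have idm: "(\<lambda>y. y) \<in> measurable (\<sigma> i) borel"
  proof -
    have "(\<lambda>y. y) \<in> measurable (restrict_space borel \<Omega>) borel" by (rule measurable_restrict_space1) simp
    then show ?thesis by (simp cong: measurable_cong_sets)
  qed
  show "\<phi> \<in> borel_measurable (\<sigma> i)" by (rule measurable_compose[OF idm test_functions_measurable[OF \<phi>(1)]])
  show "conv (mollifier (\<epsilon> k)) \<phi> \<in> borel_measurable (\<sigma> i)" for k
    by (rule measurable_compose[OF idm conv_measurable[OF mollifier_test[OF \<epsilon>(1)] test_functions_integrable[OF \<phi>(1)]]])
  show "AE y in \<sigma> i. (\<lambda>k. conv (mollifier (\<epsilon> k)) \<phi> y) \<longlonglongrightarrow> \<phi> y"
    by (intro always_eventually allI filterlim_compose[OF conv_mollifier_tendsto[OF test_functions_integrable[OF \<phi>(1)] continuous_mdev_tendsto[OF \<phi>_test(2)]] \<epsilon>_right])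
  have "\<bar>conv (mollifier (\<epsilon> k)) \<phi> y\<bar> \<le> 1" for y k
    by (rule conv_mollifier_bounded[OF \<epsilon>(1) test_functions_integrable[OF \<phi>(1)]]) (simp add: \<phi>)
  then show "AE y in \<sigma> i. norm (conv (mollifier (\<epsilon> k)) \<phi> y) \<le> 1" for k by simp
qed

text \<open>Once the scale is below the margin between the support of \<open>\<phi>\<close> and the
  boundary of \<open>V\<close>, \<open>deriv_wk_pointwise\<close> holds on that support. The
  components of \<open>T\<close> are bounded by 1, so they do not enlarge the two errors.\<close>

lemma grad_part:
  "\<forall>\<^sub>F k in sequentially. \<bar>(LINT x|lborel. \<phi> x * (T x \<bullet> grad (wk k) x)) - (LINT x|lborel. \<phi> x * (T x \<bullet> g x))\<bar>
     \<le> (\<Sum>i\<in>Basis. (LINT y|\<sigma> i. conv (mollifier (\<epsilon> k)) \<phi> y)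
         + (LINT x|lborel. \<bar>conv (mollifier (\<epsilon> k)) (\<lambda>y. g y \<bullet> i) x - g x \<bullet> i\<bar>))"
proof -
  obtain K where K: "compact K" "K \<subseteq> V" "\<And>x. x \<notin> K \<Longrightarrow> \<phi> x = 0" by (rule test_functionsE[OF \<phi>(1)]) blast
  obtain d where d: "d > 0" "(\<Union>x\<in>K. ball x d) \<subseteq> V"
    by (rule compact_subset_open_imp_ball_epsilon_subset[OF K(1) V(1) K(2)])
  have "\<forall>\<^sub>F k in sequentially. \<epsilon> k < d" by (rule order_tendstoD(2)[OF \<epsilon>(2) d(1)])
  then show ?thesis
  proof eventually_elim
    case (elim k)
    have sub: "cball x (\<epsilon> k) \<subseteq> V" if "x \<in> K" for x
    proof -
      have "cball x (\<epsilon> k) \<subseteq> ball x d" using elim by auto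
      then show ?thesis using d(2) that by blast
    qed
    let ?D = "\<lambda>i x. frechet_derivative (wk k) (at x) i"
    let ?c = "\<lambda>i. conv (mollifier (\<epsilon> k)) (\<lambda>y. g y \<bullet> i)"
    have wU: "wk k \<in> test_functions UNIV" by (rule test_functions_mono[OF subset_UNIV wk_test])
    have \<phi>i: "integrable lborel \<phi>" by (rule test_functions_integrable[OF \<phi>(1)])
    have gi: "integrable lborel (\<lambda>x. g x \<bullet> i)" if "i \<in> Basis" for i by (rule g_comp[OF that])
    have ci: "integrable lborel (?c i)" if "i \<in> Basis" for i by (rule conv_mollifier_integral(1)[OF \<epsilon>(1) gi[OF that]])
    have \<phi>w: "integrable lborel (\<lambda>x. \<phi> x * w x)" if "integrable lborel w" for w
      using test_mult_integrable[OF that \<phi>(1)] by (simp add: mult.commute)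
    have Di: "integrable lborel (?D i)" if "i \<in> Basis" for i by (rule test_functions_integrable[OF test_functions_deriv[OF wU that]])
    have comp: "\<bar>(LINT x|lborel. \<phi> x * ?D i x * (T x \<bullet> i)) - (LINT x|lborel. \<phi> x * (g x \<bullet> i) * (T x \<bullet> i))\<bar>
       \<le> (LINT y|\<sigma> i. conv (mollifier (\<epsilon> k)) \<phi> y) + (LINT x|lborel. \<bar>?c i x - g x \<bullet> i\<bar>)" if i: "i \<in> Basis" for i
    proof -
      interpret F: finite_measure "\<sigma> i" by (rule finite_measure_tv[OF \<nu>s(1)[OF i]])
      have d1: "integrable lborel (\<lambda>x. \<phi> x * \<bar>?D i x - ?c i x\<bar>)" using Di[OF i] ci[OF i] by (intro \<phi>w) simp
      have d2: "integrable lborel (\<lambda>x. \<phi> x * \<bar>?c i x - g x \<bullet> i\<bar>)" using gi[OF i] ci[OF i] by (intro \<phi>w) simp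
      have i1: "integrable lborel (\<lambda>x. \<phi> x * ?D i x * (T x \<bullet> i))" by (rule T_mult_integrable[OF i \<phi>w[OF Di[OF i]]])
      have i2: "integrable lborel (\<lambda>x. \<phi> x * (g x \<bullet> i) * (T x \<bullet> i))" by (rule T_mult_integrable[OF i \<phi>w[OF gi[OF i]]])
      have "\<bar>(LINT x|lborel. \<phi> x * ?D i x * (T x \<bullet> i)) - (LINT x|lborel. \<phi> x * (g x \<bullet> i) * (T x \<bullet> i))\<bar>
        = \<bar>LINT x|lborel. \<phi> x * ?D i x * (T x \<bullet> i) - \<phi> x * (g x \<bullet> i) * (T x \<bullet> i)\<bar>"
        using i1 i2 by simp
      also have "\<dots> \<le> (LINT x|lborel. \<bar>\<phi> x * ?D i x * (T x \<bullet> i) - \<phi> x * (g x \<bullet> i) * (T x \<bullet> i)\<bar>)"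
        using integral_norm_bound[of lborel "\<lambda>x. \<phi> x * ?D i x * (T x \<bullet> i) - \<phi> x * (g x \<bullet> i) * (T x \<bullet> i)"] by simp
      also have "\<dots> \<le> (LINT x|lborel. \<phi> x * \<bar>?D i x - ?c i x\<bar> + \<phi> x * \<bar>?c i x - g x \<bullet> i\<bar>)"
      proof (rule integral_mono)
        fix x
        have "\<bar>\<phi> x * ?D i x * (T x \<bullet> i) - \<phi> x * (g x \<bullet> i) * (T x \<bullet> i)\<bar> = \<bar>\<phi> x * (?D i x - g x \<bullet> i) * (T x \<bullet> i)\<bar>"
          by (simp add: algebra_simps)
        also have "\<dots> = \<phi> x * \<bar>?D i x - g x \<bullet> i\<bar> * \<bar>T x \<bullet> i\<bar>" by (simp add: abs_mult \<phi>_abs)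
        also have "\<dots> \<le> \<phi> x * \<bar>?D i x - g x \<bullet> i\<bar> * 1" using T_comp_le[OF i] \<phi>(2) by (intro mult_left_mono) auto
        also have "\<dots> \<le> \<phi> x * (\<bar>?D i x - ?c i x\<bar> + \<bar>?c i x - g x \<bullet> i\<bar>)" 
          unfolding mult_1_right using \<phi>(2) by (intro mult_left_mono) auto
        finally show "\<bar>\<phi> x * ?D i x * (T x \<bullet> i) - \<phi> x * (g x \<bullet> i) * (T x \<bullet> i)\<bar> \<le> \<phi> x * \<bar>?D i x - ?c i x\<bar> + \<phi> x * \<bar>?c i x - g x \<bullet> i\<bar>"
          by (simp add: distrib_left)
      qed (use i1 i2 d1 d2 in auto)
      also have "\<dots> = (LINT x|lborel. \<phi> x * \<bar>?D i x - ?c i x\<bar>) + (LINT x|lborel. \<phi> x * \<bar>?c i x - g x \<bullet> i\<bar>)"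
        using d1 d2 by simp
      also have "(LINT x|lborel. \<phi> x * \<bar>?D i x - ?c i x\<bar>) \<le> (LINT y|\<sigma> i. conv (mollifier (\<epsilon> k)) \<phi> y)"
      proof -
        have "ennreal (LINT x|lborel. \<phi> x * \<bar>?D i x - ?c i x\<bar>) = (\<integral>\<^sup>+x. ennreal (\<phi> x * \<bar>?D i x - ?c i x\<bar>) \<partial>lborel)"
          using d1 \<phi>(2) by (intro nn_integral_eq_integral[symmetric]) auto
        also have "\<dots> \<le> (\<integral>\<^sup>+x. ennreal (\<phi> x) * ennreal (LINT y|\<sigma> i. mollifier (\<epsilon> k) (x - y)) \<partial>lborel)"
        proof (intro nn_integral_mono)
          fix x
          show "ennreal (\<phi> x * \<bar>?D i x - ?c i x\<bar>) \<le> ennreal (\<phi> x) * ennreal (LINT y|\<sigma> i. mollifier (\<epsilon> k) (x - y))"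
          proof (cases "x \<in> K")
            case True
            have "\<phi> x * \<bar>?D i x - ?c i x\<bar> \<le> \<phi> x * (LINT y|\<sigma> i. mollifier (\<epsilon> k) (x - y))"
              by (intro mult_left_mono deriv_wk_pointwise[OF i sub[OF True]] \<phi>(2))
            then show ?thesis using \<phi>(2) by (simp add: ennreal_mult'[symmetric] ennreal_leI)
          next
            case False then show ?thesis using K(3) by simp
          qed
        qed
        also have "\<dots> = ennreal (LINT y|\<sigma> i. conv (mollifier (\<epsilon> k)) \<phi> y)" by (rule sigma_Fubini[OF i])
        finally show ?thesis
          using conv_mollifier_nonneg[OF \<epsilon>(1) \<phi>(2)] by (subst (asm) ennreal_le_iff) (auto intro!: Bochner_Integration.integral_nonneg)
      qed
      also have "(LINT x|lborel. \<phi> x * \<bar>?c i x - g x \<bullet> i\<bar>) \<le> (LINT x|lborel. \<bar>?c i x - g x \<bullet> i\<bar>)"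
        using d2 gi[OF i] ci[OF i] \<phi>(2,3) by (intro integral_mono mult_left_le_one_le) auto
      finally show ?thesis by simp
    qed
    have e1: "(LINT x|lborel. \<phi> x * (T x \<bullet> grad (wk k) x)) = (\<Sum>i\<in>Basis. LINT x|lborel. \<phi> x * ?D i x * (T x \<bullet> i))"
    proof -
      have "\<phi> x * (T x \<bullet> grad (wk k) x) = (\<Sum>i\<in>Basis. \<phi> x * ?D i x * (T x \<bullet> i))" for x
        by (simp add: inner_grad sum_distrib_left mult_ac)
      then show ?thesis
        by (simp only:) (intro Bochner_Integration.integral_sum T_mult_integrable \<phi>w Di)
    qed
    have e2: "(LINT x|lborel. \<phi> x * (T x \<bullet> g x)) = (\<Sum>i\<in>Basis. LINT x|lborel. \<phi> x * (g x \<bullet> i) * (T x \<bullet> i))"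
    proof -
      have "\<phi> x * (T x \<bullet> g x) = (\<Sum>i\<in>Basis. \<phi> x * (g x \<bullet> i) * (T x \<bullet> i))" for x
        unfolding euclidean_inner[of "T x" "g x"] by (simp add: sum_distrib_left mult_ac)
      then show ?thesis
        by (simp only:) (intro Bochner_Integration.integral_sum T_mult_integrable \<phi>w gi)
    qed
    show ?case unfolding e1 e2 sum_subtractf[symmetric]
      by (rule order_trans[OF sum_abs sum_mono]) (rule comp)
  qed
qed

text \<open>The limit \<open>k \<rightarrow> \<infinity>\<close> with \<open>\<phi>\<close> and
  \<open>m\<close> fixed. The signed integral of the trace representative occurs in the limit of
  \<open>E\<close> and in \<open>mu_part\<close>, and cancels.\<close>

lemma main_estimate:
  "\<bar>(LINT x|lborel. s x * \<phi> x) - (LINT x|lborel. \<phi> x * (T x \<bullet> g x))\<bar>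
     \<le> (LINT x|\<tau>. \<phi> x) + (\<Sum>i\<in>Basis. LINT y|\<sigma> i. \<phi> y) + Sing m + tail m + R m"
proof -
  let ?I = "LINT x|lborel. s x * \<phi> x" and ?t = "LINT x|\<tau>. \<phi> x" and ?S = "signed_integral \<Omega> \<mu> (\<lambda>x. \<phi> x * L x)"
  let ?G = "LINT x|lborel. \<phi> x * (T x \<bullet> g x)"
  have 1: "(\<lambda>k. \<bar>E k - ?S - ?G\<bar>) \<longlonglongrightarrow> \<bar>?I + ?t + ?S - ?S - ?G\<bar>"
    by (intro tendsto_rabs tendsto_diff E_tendsto tendsto_const)
  let ?b = "\<lambda>k. tail m + \<bar>LINT x|lborel. (h x * \<phi> x) * (vk m k x - v x)\<bar> + Sing m
     + (\<Sum>i\<in>Basis. (LINT y|\<sigma> i. conv (mollifier (\<epsilon> k)) \<phi> y)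
         + (LINT x|lborel. \<bar>conv (mollifier (\<epsilon> k)) (\<lambda>y. g y \<bullet> i) x - g x \<bullet> i\<bar>))"
  have 2: "?b \<longlonglongrightarrow> tail m + \<bar>LINT x|lborel. (h x * \<phi> x) * (trunc m (U x) - v x)\<bar> + Sing m
     + (\<Sum>i\<in>Basis. (LINT y|\<sigma> i. \<phi> y) + 0)"
    by (intro tendsto_add tendsto_const tendsto_rabs h_part_tendsto tendsto_sum sigma_tendsto conv_mollifier_L1[OF g_comp \<epsilon>(1,2)])
  have 3: "\<forall>\<^sub>F k in sequentially. \<bar>E k - ?S - ?G\<bar> \<le> ?b k"
    using grad_part
  proof eventually_elim
    case (elim k)
    then show ?case using mu_part[of k m] unfolding E_def by linarith
  qed
  have "\<bar>?I + ?t + ?S - ?S - ?G\<bar> \<le> tail m + \<bar>LINT x|lborel. (h x * \<phi> x) * (trunc m (U x) - v x)\<bar> + Sing m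
     + (\<Sum>i\<in>Basis. (LINT y|\<sigma> i. \<phi> y) + 0)"
    by (rule tendsto_le[OF trivial_limit_sequentially 2 1 3])
  moreover have "0 \<le> ?t" using \<phi>(2) by simp
  moreover have "(\<Sum>i\<in>Basis. (LINT y|\<sigma> i. \<phi> y) + 0) = (\<Sum>i\<in>Basis. LINT y|\<sigma> i. \<phi> y)" by simp
  moreover have "\<bar>?I - ?G\<bar> \<le> \<bar>?I + ?t + ?S - ?S - ?G\<bar> + \<bar>?t\<bar>" by linarith
  ultimately show ?thesis using h_part_le[of m] by linarith
qed

end

end

section \<open>Compact sets disjoint from the singular set\<close>

lemma concentrated_integral_tendsto_0:
  fixes w :: "'a::euclidean_space \<Rightarrow> real"
  assumes M: "sets M = borel_of \<Omega>" "emeasure M (\<Omega> - N) = 0" and N: "N \<in> borel_of \<Omega>"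
    and w: "integrable M w" and C: "C \<subseteq> \<Omega> - N"
    and \<phi>: "\<And>k. \<phi> k \<in> borel_measurable borel" "\<And>k x. 0 \<le> \<phi> k x" "\<And>k x. \<phi> k x \<le> 1"
    "\<And>x. (\<lambda>k. \<phi> k x) \<longlonglongrightarrow> (indicator C x :: real)"
  shows "(\<lambda>k. LINT x|M. \<phi> k x * w x) \<longlonglongrightarrow> 0"
proof -
  have "\<Omega> \<in> borel_of \<Omega>" using sets.top[of "restrict_space borel \<Omega>"] by (simp add: space_restrict_space)
  then have "\<Omega> - N \<in> sets M" unfolding M(1) by (rule sets.Diff[OF _ N])
  then have n: "\<Omega> - N \<in> null_sets M" using M(2) by (intro null_setsI)
  have \<phi>M: "\<phi> k \<in> borel_measurable M" for k
    using measurable_restrict_space1[OF \<phi>(1), of k \<Omega>] M(1) by (simp cong: measurable_cong_sets)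
  have "(\<lambda>k. LINT x|M. \<phi> k x * w x) \<longlonglongrightarrow> (LINT x|M. 0)"
  proof (rule integral_dominated_convergence[where w = "\<lambda>x. norm (w x)"])
    show "AE x in M. (\<lambda>k. \<phi> k x * w x) \<longlonglongrightarrow> 0"
      using AE_not_in[OF n]
    proof eventually_elim
      case (elim x)
      then have "x \<notin> C" using C by blast
      then show ?case using tendsto_mult[OF \<phi>(4)[of x] tendsto_const[of "w x"]] by simp
    qed
    show "AE x in M. norm (\<phi> k x * w x) \<le> norm (w x)" for k
      using \<phi>(2,3) by (intro always_eventually allI) (simp add: abs_mult mult_left_le_one_le)
    show "(\<lambda>x. \<phi> k x * w x) \<in> borel_measurable M" for k
      by (intro borel_measurable_times \<phi>M borel_measurable_integrable[OF w])
  qed (use w in simp_all)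
  then show ?thesis by simp
qed

text \<open>The set where \<open>W\<close> is positive is exhausted from inside by compact sets up
  to an arbitrary error, so the integral of the positive part over it is 0.\<close>

lemma AE_nonpos_if_compact_integrals_nonpos:
  fixes W :: "'a::euclidean_space \<Rightarrow> real"
  assumes W: "integrable lborel W" and D: "D \<in> sets borel"
    and C: "\<And>C. compact C \<Longrightarrow> C \<subseteq> D \<Longrightarrow> (LINT x:C|lborel. W x) \<le> 0"
  shows "AE x in lborel. x \<in> D \<longrightarrow> W x \<le> 0"
proof -
  have Wm [measurable]: "W \<in> borel_measurable borel" using borel_measurable_integrable[OF W] by simp
  define S where "S = D \<inter> {x. 0 < W x}"
  have S: "S \<in> sets borel" unfolding S_def using D by measurable
  have i: "integrable lborel (\<lambda>x. indicator S x *\<^sub>R max 0 (W x))"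
    using S W by (intro integrable_mult_indicator integrable_max) auto
  have "(LINT x:S|lborel. max 0 (W x)) \<le> \<delta>" if \<delta>: "\<delta> > 0" for \<delta>
  proof -
    obtain K where K: "compact K" "K \<subseteq> S" "(LINT x:S|lborel. max 0 (W x)) \<le> (LINT x:K|lborel. max 0 (W x)) + \<delta>"
      by (rule compact_inner_approx[OF W S \<delta>])
    have "(LINT x:K|lborel. max 0 (W x)) = (LINT x:K|lborel. W x)"
      using K(2) borel_compact[OF K(1)] by (intro set_lebesgue_integral_cong) (auto simp: S_def)
    also have "\<dots> \<le> 0" using K(1,2) by (intro C) (auto simp: S_def)
    finally show ?thesis using K(3) by simp
  qed
  then have "(LINT x:S|lborel. max 0 (W x)) \<le> 0" by (rule field_le_epsilon) simp
  moreover have "0 \<le> (LINT x:S|lborel. max 0 (W x))"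
    unfolding set_lebesgue_integral_def by (intro Bochner_Integration.integral_nonneg) simp
  ultimately have "(LINT x|lborel. indicator S x *\<^sub>R max 0 (W x)) = 0"
    unfolding set_lebesgue_integral_def by linarith
  then have "AE x in lborel. indicator S x *\<^sub>R max 0 (W x) = 0"
    using integral_nonneg_eq_0_iff_AE[OF i] by simp
  then show ?thesis by eventually_elim (auto simp: S_def split: split_indicator_asm)
qed

lemma (in pairing_data) Tg_int: "integrable lborel (\<lambda>x. T x \<bullet> g x)"
proof (rule Bochner_Integration.integrable_bound[OF g_int])
  have [measurable]: "g \<in> borel_measurable borel" using borel_measurable_integrable[OF g_int] by simp
  show "(\<lambda>x. T x \<bullet> g x) \<in> borel_measurable lborel" by measurable
  have "\<bar>T x \<bullet> g x\<bar> \<le> norm (g x)" for x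
    using order_trans[OF Cauchy_Schwarz_ineq2 mult_right_mono[OF T_le[of x] norm_ge_zero]] by simp
  then show "AE x in lborel. norm (T x \<bullet> g x) \<le> norm (g x)" by simp
qed

text \<open>First the cut-offs tend to the indicator of \<open>C\<close> for fixed \<open>m\<close>;
  afterwards only \<open>tail m + R m\<close> is left, and \<open>m\<close> tends to
  infinity.\<close>

lemma (in pairing_local) compact_integral_eq_0_local:
  assumes C: "compact C" "C \<subseteq> V" "C \<inter> N = {}"
  shows "(LINT x:C|lborel. s x - T x \<bullet> g x) = 0"
proof -
  let ?W = "\<lambda>x. s x - T x \<bullet> g x"
  have W: "integrable lborel ?W" using s_int Tg_int by simp
  obtain \<phi> :: "nat \<Rightarrow> 'a \<Rightarrow> real" where \<phi>: "\<And>k. \<phi> k \<in> test_functions V" "\<And>k x. 0 \<le> \<phi> k x" "\<And>k x. \<phi> k x \<le> 1"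
    "\<And>x. (\<lambda>k. \<phi> k x) \<longlonglongrightarrow> indicator C x"
    by (rule cutoff_sequence[OF C(1,2) V(1)]) blast
  note \<phi>m = test_functions_measurable[OF \<phi>(1)]
  have C': "C \<subseteq> \<Omega> - N" using C V by auto
  have null: "(\<lambda>k. LINT x|M. \<phi> k x) \<longlonglongrightarrow> 0"
    if "sets M = borel_of \<Omega>" "emeasure M (\<Omega> - N) = 0" "finite_measure M" for M
    using concentrated_integral_tendsto_0[OF that(1,2) N(1) finite_measure.integrable_const[OF that(3), of "1::real"] C' \<phi>m \<phi>(2,3,4)]
    by simp
  have l: "(\<lambda>k. LINT x|lborel. ?W x * \<phi> k x) \<longlonglongrightarrow> (LINT x:C|lborel. ?W x)"
    by (rule cutoff_integral_tendsto[OF W C(1) \<phi>m \<phi>(2,3,4)])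
  have bound: "\<bar>LINT x:C|lborel. ?W x\<bar> \<le> tail m + R m" for m
  proof -
    have "Sing (\<phi> k) m = (LINT x|total_variation \<Omega> \<mu>s. \<phi> k x * (real m + indicator V x * P x))" for k
      by (rule Sing_def[OF \<phi>(1,2,3)])
    \<comment> \<open>The weight grows with \<open>m\<close>, which is harmless here because
      \<open>m\<close> stays fixed while the cut-offs vary.\<close>
    then have S0: "(\<lambda>k. Sing (\<phi> k) m) \<longlonglongrightarrow> 0"
      using concentrated_integral_tendsto_0[OF _ TVs_null N(1) mass_weight_integrable[of "\<phi> 0" m, OF \<phi>(1,2,3)] C' \<phi>m \<phi>(2,3,4)] by simp
    have r: "(\<lambda>k. (LINT x|\<tau>. \<phi> k x) + (\<Sum>i\<in>Basis. LINT y|total_variation \<Omega> (\<nu>s i). \<phi> k y) + Sing (\<phi> k) m + tail m + R m)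
       \<longlonglongrightarrow> 0 + (\<Sum>i\<in>(Basis::'a set). 0) + 0 + tail m + R m"
      by (intro tendsto_add tendsto_sum tendsto_const S0 null \<tau> \<nu>s finite_measure_tv) simp_all
    have "\<bar>LINT x|lborel. ?W x * \<phi> k x\<bar>
       \<le> (LINT x|\<tau>. \<phi> k x) + (\<Sum>i\<in>Basis. LINT y|total_variation \<Omega> (\<nu>s i). \<phi> k y) + Sing (\<phi> k) m + tail m + R m" for k
    proof -
      have "(LINT x|lborel. ?W x * \<phi> k x) = (LINT x|lborel. s x * \<phi> k x) - (LINT x|lborel. \<phi> k x * (T x \<bullet> g x))"
        using Bochner_Integration.integral_diff[OF test_mult_integrable[OF s_int \<phi>(1)[of k]] test_mult_integrable[OF Tg_int \<phi>(1)[of k]]]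
        by (simp only: left_diff_distrib mult.commute[of "\<phi> k _" "T _ \<bullet> g _"])
      then show ?thesis using main_estimate[OF \<phi>(1,2,3)] by simp
    qed
    then show ?thesis
      using tendsto_le[OF trivial_limit_sequentially r tendsto_rabs[OF l]] by simp
  qed
  have "(\<lambda>m. tail m + R m) \<longlonglongrightarrow> 0 + 0" by (intro tendsto_add tail_tendsto R_tendsto)
  then have "\<bar>LINT x:C|lborel. ?W x\<bar> \<le> 0 + 0"
    by (rule tendsto_lowerbound) (simp_all add: bound)
  then show ?thesis by simp
qed

context pairing_data
begin

lemma compact_integral_eq_0:
  assumes C: "compact C" "C \<subseteq> \<Omega> - N"
  shows "(LINT x:C|lborel. s x - T x \<bullet> g x) = 0"
proof -
  obtain \<zeta> V where \<zeta>: "\<zeta> \<in> test_functions \<Omega>" "\<And>x. 0 \<le> \<zeta> x" "\<And>x. \<zeta> x \<le> 1" "open V" "C \<subseteq> V" "V \<subseteq> \<Omega>"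
    "\<And>x. x \<in> V \<Longrightarrow> \<zeta> x = 1"
    using ex_cutoff_open[OF C(1) _ open_dom] C(2) by blast
  note CV = \<zeta>(5)
  obtain K where K: "compact K" "K \<subseteq> \<Omega>" "\<And>x. x \<notin> K \<Longrightarrow> \<zeta> x = 0" by (rule test_functionsE[OF \<zeta>(1)]) blast
  obtain e where e: "e > 0" "(\<Union>x\<in>K. cball x e) \<subseteq> \<Omega>"
    by (rule compact_subset_open_imp_cball_epsilon_subset[OF K(1) open_dom K(2)])
  \<comment> \<open>All scales are at most \<open>e\<close>, the margin of the support of
    \<open>\<zeta>\<close> in \<open>\<Omega>\<close>, so the support condition holds for every
    \<open>k\<close> and not only eventually.\<close>
  define \<epsilon> where "\<epsilon> k = e / real (Suc k)" for k
  have \<epsilon>: "\<epsilon> k > 0" "\<epsilon> k \<le> e" for k using e(1) by (simp_all add: \<epsilon>_def field_simps)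
  have "\<epsilon> \<longlonglongrightarrow> 0" unfolding \<epsilon>_def[abs_def] by (rule LIMSEQ_Suc[OF lim_const_over_n])
  moreover have "{x + y |x y. x \<in> K \<and> y \<in> cball (0::'a) (\<epsilon> k)} \<subseteq> \<Omega>" for k
  proof clarify
    fix x y :: 'a assume xy: "x \<in> K" "y \<in> cball 0 (\<epsilon> k)"
    then have "x + y \<in> cball x e" using \<epsilon>(2)[of k] by (simp add: dist_norm)
    then show "x + y \<in> \<Omega>" using e(2) xy(1) by blast
  qed
  ultimately interpret pairing_local \<Omega> u v lam \<mu> h s N g T \<nu>s \<tau> V K \<zeta> \<epsilon>
    by unfold_locales (use \<zeta> K \<epsilon> in auto)
  show ?thesis using C CV by (intro compact_integral_eq_0_local) auto
qed

theorem pairing_density: "AE x in lborel. x \<in> \<Omega> \<longrightarrow> s x = T x \<bullet> g x"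
proof -
  let ?W = "\<lambda>x. s x - T x \<bullet> g x"
  have W: "integrable lborel ?W" using s_int Tg_int by simp
  have b: "N \<in> sets borel" "\<Omega> - N \<in> sets borel" using N(1) open_dom by (auto simp: borel_of_open_eq)
  have n: "N \<in> null_sets lborel" using N(2) b(1) by auto
  have "AE x in lborel. x \<in> \<Omega> - N \<longrightarrow> ?W x \<le> 0"
    by (rule AE_nonpos_if_compact_integrals_nonpos[OF W b(2)]) (simp add: compact_integral_eq_0)
  moreover have "AE x in lborel. x \<in> \<Omega> - N \<longrightarrow> - ?W x \<le> 0"
  proof (rule AE_nonpos_if_compact_integrals_nonpos[OF _ b(2)])
    show "integrable lborel (\<lambda>x. - ?W x)" by (rule Bochner_Integration.integrable_minus[OF W])
    show "(LINT x:C|lborel. - ?W x) \<le> 0" if "compact C" "C \<subseteq> \<Omega> - N" for C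
      using compact_integral_eq_0[OF that] unfolding set_lebesgue_integral_def scaleR_minus_right
        Bochner_Integration.integral_minus by simp
  qed
  ultimately show ?thesis using AE_not_in[OF n] by eventually_elim auto
qed

end

lemma ac_plus_concentrated:
  fixes \<nu> :: "'a::euclidean_space set \<Rightarrow> 'b::euclidean_space"
  assumes \<Omega>: "open \<Omega>" and \<nu>: "finite_vmeasure \<Omega> \<nu>" and G: "integrable lborel G"
    and N: "N \<in> borel_of \<Omega>" "emeasure lborel N = 0"
    and eq: "\<And>B. B \<in> borel_of \<Omega> \<Longrightarrow> B \<inter> N = {} \<Longrightarrow> \<nu> B = (LINT x:B|lborel. G x)"
    and A: "A \<in> borel_of \<Omega>"
  shows "\<nu> A = (LINT x:A|lborel. G x) + \<nu> (A \<inter> N)"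
proof -
  have bo: "\<And>B. B \<in> borel_of \<Omega> \<Longrightarrow> B \<in> sets borel" using borel_of_open_eq[OF \<Omega>] by auto
  have AN: "A - N \<in> borel_of \<Omega>" "A \<inter> N \<in> borel_of \<Omega>" using A N(1) by (rule sets.Diff, rule sets.Int)
  have n: "N \<in> null_sets lborel" using N(2) bo[OF N(1)] by (intro null_setsI) simp_all
  have "\<nu> A = \<nu> ((A - N) \<union> (A \<inter> N))" by (simp add: Un_Diff_Int)
  also have "\<dots> = \<nu> (A - N) + \<nu> (A \<inter> N)" by (rule finite_vmeasure_Un[OF \<nu> AN]) auto
  also have "\<nu> (A - N) = (LINT x:A - N|lborel. G x)" by (rule eq[OF AN(1)]) auto
  also have "\<dots> = (LINT x:A|lborel. G x)"
    unfolding set_lebesgue_integral_def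
  proof (rule integral_cong_AE)
    have [measurable]: "G \<in> borel_measurable borel" using borel_measurable_integrable[OF G] by simp
    show "(\<lambda>x. indicator (A - N) x *\<^sub>R G x) \<in> borel_measurable lborel" "(\<lambda>x. indicator A x *\<^sub>R G x) \<in> borel_measurable lborel"
      using bo[OF A] bo[OF AN(1)] by simp_all
    show "AE x in lborel. indicator (A - N) x *\<^sub>R G x = indicator A x *\<^sub>R G x"
      using AE_not_in[OF n] by eventually_elim (simp add: indicator_def)
  qed
  finally show ?thesis .
qed

section \<open>Passage to Borel versions\<close>

lemma AE_lebesgue_on_iff:
  fixes \<Omega> :: "'a::euclidean_space set"
  assumes "\<Omega> \<in> sets borel"
  shows "(AE x in lebesgue_on \<Omega>. Q x) \<longleftrightarrow> (AE x in lborel. x \<in> \<Omega> \<longrightarrow> Q x)"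
proof -
  have "\<Omega> \<inter> space lebesgue \<in> sets lebesgue" using assms by (simp add: sets_completionI_sets)
  then show ?thesis by (simp only: AE_restrict_space_iff AE_completion_iff)
qed

lemma ex_borel_version:
  fixes f :: "'a::euclidean_space \<Rightarrow> 'b::euclidean_space"
  assumes f: "f \<in> borel_measurable (lebesgue_on \<Omega>)" and \<Omega>: "\<Omega> \<in> sets borel"
  obtains f1 where "f1 \<in> borel_measurable borel" "\<And>x. x \<notin> \<Omega> \<Longrightarrow> f1 x = 0" "AE x in lebesgue_on \<Omega>. f x = f1 x"
proof -
  have fl: "(\<lambda>x. indicator \<Omega> x *\<^sub>R f x) \<in> borel_measurable lebesgue"
    using f \<Omega> by (subst (asm) borel_measurable_restrict_space_iff) (simp_all add: sets_completionI_sets)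
  have "\<exists>h\<in>borel_measurable lborel. AE x in lborel. (indicator \<Omega> x *\<^sub>R f x) \<bullet> i = h x" for i
    using fl by (intro completion_ex_borel_measurable_real borel_measurable_inner borel_measurable_const)
  then obtain h where h: "\<And>i. h i \<in> borel_measurable lborel" "\<And>i. AE x in lborel. (indicator \<Omega> x *\<^sub>R f x) \<bullet> i = h i x"
    by metis
  define f1 where "f1 x = (if x \<in> \<Omega> then \<Sum>i\<in>Basis. h i x *\<^sub>R i else 0)" for x
  have [measurable]: "h i \<in> borel_measurable borel" for i using h(1)[of i] by simp
  show ?thesis
  proof
    show "f1 \<in> borel_measurable borel" unfolding f1_def[abs_def] using \<Omega> by measurable
    have "AE x in lborel. \<forall>i\<in>Basis. (indicator \<Omega> x *\<^sub>R f x) \<bullet> i = h i x"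
      using h(2) by (intro AE_finite_allI) simp_all
    then have "AE x in lborel. x \<in> \<Omega> \<longrightarrow> f x = f1 x"
    proof eventually_elim
      case (elim x)
      show ?case
      proof
        assume "x \<in> \<Omega>"
        then have "f x \<bullet> i = h i x" if "i \<in> Basis" for i using bspec[OF elim that] by simp
        then have "f1 x = (\<Sum>i\<in>Basis. (f x \<bullet> i) *\<^sub>R i)" using \<open>x \<in> \<Omega>\<close> by (simp add: f1_def)
        then show "f x = f1 x" by (simp only: euclidean_representation)
      qed
    qed
    then show "AE x in lebesgue_on \<Omega>. f x = f1 x" by (simp only: AE_lebesgue_on_iff[OF \<Omega>])
  qed (simp add: f1_def)
qed

lemma integral_lebesgue_on_version:
  fixes f f1 :: "'a::euclidean_space \<Rightarrow> 'b::euclidean_space"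
  assumes f: "f \<in> borel_measurable (lebesgue_on \<Omega>)" and f1: "f1 \<in> borel_measurable borel"
    and eq: "AE x in lebesgue_on \<Omega>. f x = f1 x" and \<Omega>: "\<Omega> \<in> sets borel" and A: "A \<in> sets borel" "A \<subseteq> \<Omega>"
  shows "(LINT x|lebesgue_on A. f x) = (LINT x:A|lborel. f1 x)"
proof -
  have "(LINT x|lebesgue_on A. f x) = (LINT x|lebesgue_on A. f1 x)"
  proof (rule integral_cong_AE)
    show "f \<in> borel_measurable (lebesgue_on A)" by (rule measurable_restrict_mono[OF f A(2)])
    show "f1 \<in> borel_measurable (lebesgue_on A)"
      using f1 by (intro measurable_restrict_space1 measurable_completion) simp
    have "AE x in lborel. x \<in> A \<longrightarrow> f x = f1 x"
      using eq[unfolded AE_lebesgue_on_iff[OF \<Omega>]] by eventually_elim (use A(2) in blast)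
    then show "AE x in lebesgue_on A. f x = f1 x" by (simp only: AE_lebesgue_on_iff[OF A(1)])
  qed
  then show ?thesis by (simp only: integral_lebesgue_on_eq[OF f1 A(1)])
qed

lemma integrable_version:
  fixes f f1 :: "'a::euclidean_space \<Rightarrow> 'b::euclidean_space"
  assumes f: "integrable (lebesgue_on \<Omega>) f" and f1: "f1 \<in> borel_measurable borel" "\<And>x. x \<notin> \<Omega> \<Longrightarrow> f1 x = 0"
    and eq: "AE x in lebesgue_on \<Omega>. f x = f1 x" and \<Omega>: "\<Omega> \<in> sets borel"
  shows "integrable lborel f1"
proof -
  have "f1 \<in> borel_measurable (lebesgue_on \<Omega>)"
    using f1(1) by (intro measurable_restrict_space1 measurable_completion) simp
  then have "integrable (lebesgue_on \<Omega>) f1" using integrable_cong_AE[OF borel_measurable_integrable[OF f] _ eq] f by blast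
  then have "integrable lebesgue (\<lambda>x. indicator \<Omega> x *\<^sub>R f1 x)"
    using \<Omega> by (subst (asm) integrable_restrict_space) (simp_all add: sets_completionI_sets)
  moreover have "(\<lambda>x. indicator \<Omega> x *\<^sub>R f1 x) = f1" using f1(2) by (auto simp: indicator_def)
  ultimately show ?thesis using f1(1) by (simp add: integrable_completion)
qed

lemma grad_measurable: "\<phi> \<in> test_functions \<Omega> \<Longrightarrow> grad \<phi> \<in> borel_measurable borel"
  unfolding grad_def[abs_def]
  by (intro borel_measurable_sum borel_measurable_scaleR borel_measurable_const)
    (rule test_functions_measurable[OF test_functions_deriv])

text \<open>Squaring out, \<open>|a t - p|\<^sup>2 = - (a b - 1)\<^sup>2\<close> for the two square roots \<open>a\<close> and \<open>b\<close>.\<close>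

lemma equality_case:
  fixes t p :: "'a::real_inner"
  assumes t: "norm t \<le> 1" and eq: "t \<bullet> p = sqrt (1 + (norm p)\<^sup>2) - sqrt (1 - (norm t)\<^sup>2)"
  shows "t = (1 / sqrt (1 + (norm p)\<^sup>2)) *\<^sub>R p"
proof -
  define a b where "a = sqrt (1 + (norm p)\<^sup>2)" and "b = sqrt (1 - (norm t)\<^sup>2)"
  have "(norm t)\<^sup>2 \<le> 1" using t by (simp add: power_le_one)
  then have sq: "a\<^sup>2 = 1 + p \<bullet> p" "b\<^sup>2 = 1 - t \<bullet> t" by (simp_all add: a_def b_def power2_norm_eq_inner)
  have a: "a > 0" by (simp add: a_def add_pos_nonneg)
  have "(norm (a *\<^sub>R t - p))\<^sup>2 = a\<^sup>2 * (t \<bullet> t) - 2 * a * (t \<bullet> p) + p \<bullet> p"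
    unfolding power2_norm_eq_inner inner_diff_left inner_diff_right inner_scaleR_left inner_scaleR_right
    by (simp add: inner_commute power2_eq_square algebra_simps)
  also have "\<dots> = a\<^sup>2 * (1 - b\<^sup>2) - 2 * a * (a - b) + (a\<^sup>2 - 1)" using sq eq by (simp add: a_def b_def)
  also have "\<dots> = - (a * b - 1)\<^sup>2" by (simp add: power2_eq_square algebra_simps)
  finally have "(norm (a *\<^sub>R t - p))\<^sup>2 \<le> 0" by simp
  then have "p = a *\<^sub>R t" by simp
  then show ?thesis using a unfolding a_def[symmetric] by simp
qed

text \<open>The abstract data are instantiated with Borel versions; the resulting equality almost
  everywhere is the hypothesis of \<open>equality_case\<close> at each point.\<close>

lemma solves_pmc_imp_normalized_gradient:
  fixes \<Omega> :: "'a::euclidean_space set" and T :: "'a \<Rightarrow> 'a"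
  assumes bdd: "bounded \<Omega>" and \<Omega>: "open \<Omega>" and \<mu>: "finite_vmeasure \<Omega> \<mu>" "admissible \<Omega> \<mu>"
    and lam: "lam \<in> borel_measurable (restrict_space borel \<Omega>)" "\<forall>x\<in>\<Omega>. lam x \<in> {0..1}"
    and u: "u \<in> BV \<Omega>" and T: "solves_pmc \<Omega> \<mu> lam u T"
  shows "AE x in lebesgue_on \<Omega>. T x = (1 / sqrt (1 + (norm (ac_grad \<Omega> u x))\<^sup>2)) *\<^sub>R ac_grad \<Omega> u x"
proof -
  have bo: "borel_of \<Omega> = {A \<in> sets borel. A \<subseteq> \<Omega>}" by (rule borel_of_open_eq[OF \<Omega>])
  have \<Omega>b: "\<Omega> \<in> sets borel" using \<Omega> by simp
  let ?D = "deriv_measure \<Omega> u" and ?g = "ac_grad \<Omega> u"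
  have D: "finite_vmeasure \<Omega> ?D" and D_test: "\<And>\<phi> i. \<phi> \<in> test_functions \<Omega> \<Longrightarrow> i \<in> Basis \<Longrightarrow>
      (LINT x|lebesgue_on \<Omega>. u x * frechet_derivative \<phi> (at x) i) = - signed_integral \<Omega> (\<lambda>A. ?D A \<bullet> i) \<phi>"
    using is_ac_density_ac_grad(1)[OF \<Omega> u] unfolding is_deriv_measure_def by blast+
  obtain Nd where g: "integrable (lebesgue_on \<Omega>) ?g" and Nd: "Nd \<in> borel_of \<Omega>" "emeasure lborel Nd = 0"
    and Dg: "\<And>A. A \<in> borel_of \<Omega> \<Longrightarrow> A \<inter> Nd = {} \<Longrightarrow> ?D A = (LINT x|lebesgue_on A. ?g x)"
    using is_ac_density_ac_grad(2)[OF \<Omega> u] unfolding is_ac_density_def by blast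
  obtain h Nm where h: "integrable lborel h" and Nm: "Nm \<in> borel_of \<Omega>" "emeasure lborel Nm = 0"
    and \<mu>h: "\<And>A. A \<in> borel_of \<Omega> \<Longrightarrow> A \<inter> Nm = {} \<Longrightarrow> \<mu> A = (LINT x:A|lborel. h x)"
    using lebesgue_decomposition_real[OF \<Omega> \<mu>(1)] by blast
  \<comment> \<open>One null set for the singular parts of both the derivative and
    \<open>\<mu>\<close>; enlarging either exceptional set by a null set keeps its
    decomposition.\<close>
  define N where "N = Nd \<union> Nm"
  have N: "N \<in> borel_of \<Omega>" unfolding N_def by (rule sets.Un[OF Nd(1) Nm(1)])
  have N0: "emeasure lborel N = 0"
  proof -
    have "Nd \<in> null_sets lborel" "Nm \<in> null_sets lborel" using Nd Nm bo by auto
    then show ?thesis unfolding N_def by (intro null_setsD1 null_sets.Un)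
  qed
  have um: "u \<in> borel_measurable (lebesgue_on \<Omega>)" using u unfolding BV_def by auto
  obtain v where v: "v \<in> borel_measurable borel" "\<And>x. x \<notin> \<Omega> \<Longrightarrow> v x = 0" "AE x in lebesgue_on \<Omega>. u x = v x"
    by (rule ex_borel_version[OF um \<Omega>b]) blast
  have v_int: "integrable lborel v" using u by (intro integrable_version[OF _ v \<Omega>b]) (simp add: BV_def)
  have gm: "?g \<in> borel_measurable (lebesgue_on \<Omega>)" using g by (rule borel_measurable_integrable)
  obtain g1 where g1: "g1 \<in> borel_measurable borel" "\<And>x. x \<notin> \<Omega> \<Longrightarrow> g1 x = 0" "AE x in lebesgue_on \<Omega>. ?g x = g1 x"
    by (rule ex_borel_version[OF gm \<Omega>b]) blast
  have g1_int: "integrable lborel g1" by (rule integrable_version[OF g g1 \<Omega>b])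
  have g1_on: "(LINT x|lebesgue_on A. ?g x) = (LINT x:A|lborel. g1 x)" if "A \<in> borel_of \<Omega>" for A
    using that bo by (intro integral_lebesgue_on_version[OF gm g1(1,3) \<Omega>b]) auto
  have TL: "T \<in> borel_measurable (lebesgue_on \<Omega>)" and T_le: "Linf_norm \<Omega> T \<le> 1"
    and ex: "\<exists>\<nu>. is_div_measure \<Omega> T \<nu>" and div_\<mu>: "\<And>A. A \<in> borel_of \<Omega> \<Longrightarrow> div_measure \<Omega> T A = \<mu> A"
    and pair: "\<And>\<phi>. \<phi> \<in> test_functions \<Omega> \<Longrightarrow> lam_pairing \<Omega> lam T u \<phi> = signed_integral \<Omega>
          (\<lambda>A. area_measure \<Omega> u A - (LINT x|lebesgue_on A. sqrt (1 - (norm (T x))\<^sup>2))) \<phi>"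
    using T unfolding solves_pmc_def DM_inf_def Linf_def by blast+
  have div_T: "is_div_measure \<Omega> T (div_measure \<Omega> T)" unfolding div_measure_def using ex by (rule someI_ex)
  obtain T0 where T0: "T0 \<in> borel_measurable borel" "\<And>x. x \<notin> \<Omega> \<Longrightarrow> T0 x = 0" "AE x in lebesgue_on \<Omega>. T x = T0 x"
    by (rule ex_borel_version[OF TL \<Omega>b]) blast
  \<comment> \<open>The essential bound holds only almost everywhere. Resetting the exceptional
    points to 0 gives a bound at every point without leaving the equivalence class.\<close>
  define T1 where "T1 x = (if norm (T0 x) \<le> 1 then T0 x else 0)" for x
  have T1: "T1 \<in> borel_measurable borel" unfolding T1_def[abs_def] using T0(1) by measurable
  have T1_le: "norm (T1 x) \<le> 1" and T1_0: "x \<notin> \<Omega> \<Longrightarrow> T1 x = 0" for x using T0(2) by (simp_all add: T1_def)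
  have "AE x in lebesgue_on \<Omega>. ereal (norm (T x)) \<le> Linf_norm \<Omega> T" unfolding Linf_norm_def by (rule esssup_AE)
  then have T1_eq: "AE x in lebesgue_on \<Omega>. T x = T1 x"
    using T0(3)
  proof eventually_elim
    case (elim x)
    have "ereal (norm (T x)) \<le> 1" using elim(1) T_le by (rule order_trans)
    then show ?case using elim(2) by (simp add: T1_def)
  qed
  define s1 s2 s where "s1 x = indicator \<Omega> x * sqrt (1 + (norm (g1 x))\<^sup>2)"
    and "s2 x = indicator \<Omega> x * sqrt (1 - (norm (T1 x))\<^sup>2)" and "s x = s1 x - s2 x" for x
  \<comment> \<open>The area integrand is bounded by \<open>1 + norm (g1 x)\<close>, so its
    integrability rests on the finite volume of the bounded set \<open>\<Omega>\<close>.\<close>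
  have fin: "emeasure lborel \<Omega> < \<infinity>" using emeasure_bounded_finite[OF bdd] \<Omega> by simp
  have I_int: "integrable lborel (indicator \<Omega> :: 'a \<Rightarrow> real)" using fin \<Omega> by (simp add: integrable_indicator_iff)
  have s_meas: "s1 \<in> borel_measurable borel" "s2 \<in> borel_measurable borel"
    unfolding s1_def[abs_def] s2_def[abs_def] using g1(1) T1 \<Omega>b by measurable
  have s1_int: "integrable lborel s1"
  proof (rule Bochner_Integration.integrable_bound)
    show "integrable lborel (\<lambda>x. indicator \<Omega> x + norm (g1 x))" using I_int g1_int by simp
    have "norm (s1 x) \<le> norm (indicator \<Omega> x + norm (g1 x))" for x
    proof (cases "x \<in> \<Omega>")
      case True
      have "sqrt (1 + (norm (g1 x))\<^sup>2) \<le> 1 + norm (g1 x)"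
        by (rule real_le_lsqrt) (simp_all add: power2_sum)
      then show ?thesis using True by (simp add: s1_def)
    qed (simp add: s1_def)
    then show "AE x in lborel. norm (s1 x) \<le> norm (indicator \<Omega> x + norm (g1 x))" by simp
  qed (use s_meas in simp)
  have s2_int: "integrable lborel s2"
  proof (rule Bochner_Integration.integrable_bound[OF I_int])
    have "0 \<le> 1 - (norm (T1 x))\<^sup>2" for x using T1_le[of x] by (simp add: power_le_one)
    then have "norm (s2 x) \<le> norm (indicator \<Omega> x :: real)" for x by (simp add: s2_def indicator_def)
    then show "AE x in lborel. norm (s2 x) \<le> norm (indicator \<Omega> x :: real)" by simp
  qed (use s_meas in simp)
  have s_int: "integrable lborel s" unfolding s_def[abs_def] using s1_int s2_int by simp
  let ?Ds = "\<lambda>A. ?D (A \<inter> N)"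
  have Ds: "finite_vmeasure \<Omega> ?Ds" by (rule finite_vmeasure_Int[OF D N])
  have D_decomp: "?D A = (LINT x:A|lborel. g1 x) + ?Ds A" if "A \<in> borel_of \<Omega>" for A
  proof (rule ac_plus_concentrated[OF \<Omega> D g1_int N N0 _ that])
    fix B assume B: "B \<in> borel_of \<Omega>" "B \<inter> N = {}"
    then have "B \<inter> Nd = {}" unfolding N_def by blast
    then show "?D B = (LINT x:B|lborel. g1 x)" by (simp only: Dg[OF B(1)] g1_on[OF B(1)])
  qed
  have \<mu>_decomp: "\<mu> A = (LINT x:A|lborel. h x) + \<mu> (A \<inter> N)" if "A \<in> borel_of \<Omega>" for A
  proof (rule ac_plus_concentrated[OF \<Omega> \<mu>(1) h N N0 _ that])
    fix B assume B: "B \<in> borel_of \<Omega>" "B \<inter> N = {}"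
    then have "B \<inter> Nm = {}" unfolding N_def by blast
    then show "\<mu> B = (LINT x:B|lborel. h x)" by (rule \<mu>h[OF B(1)])
  qed
  define \<tau> where "\<tau> = total_variation \<Omega> ?Ds"
  \<comment> \<open>Subtracting the density part and restricting to \<open>N\<close> describe the
    same singular measure, but only on Borel sets, which is all the total variation uses.\<close>
  have \<tau>_eq: "\<tau> = total_variation \<Omega> (sing_deriv \<Omega> u)"
    unfolding \<tau>_def by (rule total_variation_cong) (simp add: sing_deriv_def g1_on D_decomp)
  have \<tau>: "finite_measure \<tau>" "sets \<tau> = borel_of \<Omega>" "emeasure \<tau> (\<Omega> - N) = 0"
    unfolding \<tau>_def by (simp_all add: finite_measure_total_variation[OF Ds] total_variation_Int_null[OF D N])
  define \<nu>s where "\<nu>s i A = ?Ds A \<bullet> i" for i A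
  have \<nu>s: "finite_vmeasure \<Omega> (\<nu>s i)" for i unfolding \<nu>s_def[abs_def] by (rule finite_vmeasure_inner[OF Ds])
  have \<nu>s0: "emeasure (total_variation \<Omega> (\<nu>s i)) (\<Omega> - N) = 0" for i
    unfolding \<nu>s_def[abs_def] by (rule total_variation_Int_null[OF finite_vmeasure_inner[OF D] N])
  have test_tv: "integrable (total_variation \<Omega> \<nu>) \<phi>" if "finite_vmeasure \<Omega> \<nu>" "\<phi> \<in> test_functions \<Omega>"
    for \<nu> :: "'a set \<Rightarrow> real" and \<phi>
    by (rule test_integrable_finite[OF that(2) finite_measure_total_variation[OF that(1)]]) simp
  have ind: "indicator \<Omega> x * (w x * \<phi> x) = w x * \<phi> x" if \<phi>: "\<phi> \<in> test_functions \<Omega>" for \<phi> w :: "'a \<Rightarrow> real" and x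
  proof -
    obtain K where "compact K" "K \<subseteq> \<Omega>" "\<And>x. x \<notin> K \<Longrightarrow> \<phi> x = 0" by (rule test_functionsE[OF \<phi>]) blast
    then show ?thesis by (auto simp: indicator_def)
  qed
  have ac: "signed_integral \<Omega> \<nu> \<phi> = (LINT x|lborel. w x * \<phi> x) + signed_integral \<Omega> \<nu>' \<phi>"
    if "integrable lborel w" "finite_vmeasure \<Omega> \<nu>" "finite_vmeasure \<Omega> \<nu>'" "\<phi> \<in> test_functions \<Omega>"
      "\<And>A. A \<in> borel_of \<Omega> \<Longrightarrow> \<nu> A = (LINT x:A|lborel. w x) + \<nu>' A" for w \<phi> \<nu> \<nu>'
    using signed_integral_ac_plus[OF \<Omega> that(1,2,3,5) test_tv[OF that(2,4)] test_tv[OF that(3,4)]]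
    unfolding ind[OF that(4)] using test_mult_integrable[OF that(1,4)] by blast
  have on_\<Omega>: "(LINT x|lebesgue_on \<Omega>. w x) = (LINT x|lborel. w1 x)"
    if "w \<in> borel_measurable (lebesgue_on \<Omega>)" "w1 \<in> borel_measurable borel" "AE x in lebesgue_on \<Omega>. w x = w1 x"
      "\<And>x. x \<notin> \<Omega> \<Longrightarrow> w1 x = 0" for w w1 :: "'a \<Rightarrow> real"
  proof -
    have "indicator \<Omega> x *\<^sub>R w1 x = w1 x" for x using that(4) by (cases "x \<in> \<Omega>") simp_all
    then show ?thesis
      using integral_lebesgue_on_version[OF that(1,2,3) \<Omega>b \<Omega>b subset_refl] by (simp only: set_lebesgue_integral_def)
  qed
  have lo_r: "w \<in> borel_measurable (lebesgue_on \<Omega>)" if "w \<in> borel_measurable borel" for w :: "'a \<Rightarrow> real"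
    using that by (intro measurable_restrict_space1 measurable_completion) simp
  have lo_v: "w \<in> borel_measurable (lebesgue_on \<Omega>)" if "w \<in> borel_measurable borel" for w :: "'a \<Rightarrow> 'a"
    using that by (intro measurable_restrict_space1 measurable_completion) simp
  interpret pairing_data \<Omega> u v lam \<mu> h s N g1 T1 \<nu>s \<tau>
  proof (intro pairing_data.intro borel_version.intro pairing_data_axioms.intro)
    show "open \<Omega>" by (rule \<Omega>)
    show "integrable lborel v" by (rule v_int)
    show "u \<in> borel_measurable (lebesgue_on \<Omega>)" by (rule um)
    show "AE x in lebesgue_on \<Omega>. u x = v x" by (rule v(3))
    show "lam \<in> borel_measurable (restrict_space borel \<Omega>)" by (rule lam(1))
    show "T1 \<in> borel_measurable borel" by (rule T1)
    show "norm (T1 x) \<le> 1" for x by (rule T1_le)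
    show "integrable lborel g1" by (rule g1_int)
    show "integrable lborel h" by (rule h)
    show "integrable lborel s" by (rule s_int)
    show "N \<in> borel_of \<Omega>" by (rule N)
    show "emeasure lborel N = 0" by (rule N0)
    show "finite_vmeasure \<Omega> (\<nu>s i)" for i by (rule \<nu>s)
    show "emeasure (total_variation \<Omega> (\<nu>s i)) (\<Omega> - N) = 0" for i by (rule \<nu>s0)
    show "finite_vmeasure \<Omega> \<mu>" by (rule \<mu>(1))
    show "admissible \<Omega> \<mu>" by (rule \<mu>(2))
    show "finite_measure \<tau>" by (rule \<tau>(1))
    show "sets \<tau> = borel_of \<Omega>" by (rule \<tau>(2))
    show "emeasure \<tau> (\<Omega> - N) = 0" by (rule \<tau>(3))
    show "0 \<le> lam x \<and> lam x \<le> 1" if "x \<in> \<Omega>" for x using lam(2) that by auto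
    show "\<mu> A = (LINT x:A|lborel. h x) + \<mu> (A \<inter> N)" if "A \<in> borel_of \<Omega>" for A by (rule \<mu>_decomp[OF that])
    fix \<phi> assume \<phi>: "\<phi> \<in> test_functions \<Omega>"
    note gr = grad_measurable[OF \<phi>]
    show "(LINT x|lborel. v x * frechet_derivative \<phi> (at x) i)
         = - ((LINT x|lborel. (g1 x \<bullet> i) * \<phi> x) + signed_integral \<Omega> (\<nu>s i) \<phi>)" if i: "i \<in> Basis" for i
    proof -
      have d: "(\<lambda>x. frechet_derivative \<phi> (at x) i) \<in> borel_measurable borel"
        by (rule test_functions_measurable[OF test_functions_deriv[OF \<phi> i]])
      have "(LINT x|lebesgue_on \<Omega>. u x * frechet_derivative \<phi> (at x) i) = (LINT x|lborel. v x * frechet_derivative \<phi> (at x) i)"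
      proof (rule on_\<Omega>)
        show "AE x in lebesgue_on \<Omega>. u x * frechet_derivative \<phi> (at x) i = v x * frechet_derivative \<phi> (at x) i"
          using v(3) by eventually_elim (simp only:)
      qed (simp_all add: v(2) borel_measurable_times[OF um lo_r[OF d]] borel_measurable_times[OF v(1) d])
      moreover have "signed_integral \<Omega> (\<lambda>A. ?D A \<bullet> i) \<phi> = (LINT x|lborel. (g1 x \<bullet> i) * \<phi> x) + signed_integral \<Omega> (\<nu>s i) \<phi>"
      proof (rule ac[OF _ finite_vmeasure_inner[OF D] \<nu>s \<phi>])
        show "integrable lborel (\<lambda>x. g1 x \<bullet> i)" using g1_int by simp
        show "?D A \<bullet> i = (LINT x:A|lborel. g1 x \<bullet> i) + \<nu>s i A" if A: "A \<in> borel_of \<Omega>" for A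
        proof -
          have "integrable lborel (\<lambda>x. indicator A x *\<^sub>R g1 x)"
            using A bo by (intro integrable_mult_indicator g1_int) simp
          then have "(LINT x:A|lborel. g1 x) \<bullet> i = (LINT x:A|lborel. g1 x \<bullet> i)"
            unfolding set_lebesgue_integral_def by (subst integral_inner_left[symmetric]) simp_all
          then show ?thesis unfolding D_decomp[OF A] \<nu>s_def by (simp only: inner_add_left)
        qed
      qed
      ultimately show ?thesis using D_test[OF \<phi> i] by simp
    qed
    show "- (LINT x|lborel. T1 x \<bullet> grad \<phi> x) = signed_integral \<Omega> \<mu> \<phi>"
    proof -
      have "(LINT x|lebesgue_on \<Omega>. T x \<bullet> grad \<phi> x) = (LINT x|lborel. T1 x \<bullet> grad \<phi> x)"
      proof (rule on_\<Omega>)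
        show "AE x in lebesgue_on \<Omega>. T x \<bullet> grad \<phi> x = T1 x \<bullet> grad \<phi> x"
          using T1_eq by eventually_elim (simp only:)
      qed (simp_all add: T1_0 borel_measurable_inner[OF TL lo_v[OF gr]] borel_measurable_inner[OF T1 gr])
      moreover have "distr_div \<Omega> T \<phi> = signed_integral \<Omega> (div_measure \<Omega> T) \<phi>"
        using div_T \<phi> unfolding is_div_measure_def by blast
      moreover have "signed_integral \<Omega> (div_measure \<Omega> T) \<phi> = signed_integral \<Omega> \<mu> \<phi>"
        by (rule signed_integral_cong_measure) (rule div_\<mu>)
      ultimately show ?thesis by (simp add: distr_div_def)
    qed
    show "- (LINT x|lborel. v x * (T1 x \<bullet> grad \<phi> x)) - signed_integral \<Omega> \<mu> (\<lambda>x. \<phi> x * lam_rep \<Omega> lam u x)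
         = (LINT x|lborel. s x * \<phi> x) + (LINT x|\<tau>. \<phi> x)"
    proof -
      have "(LINT x|lebesgue_on \<Omega>. (u x *\<^sub>R T x) \<bullet> grad \<phi> x) = (LINT x|lborel. v x * (T1 x \<bullet> grad \<phi> x))"
      proof (rule on_\<Omega>)
        show "AE x in lebesgue_on \<Omega>. (u x *\<^sub>R T x) \<bullet> grad \<phi> x = v x * (T1 x \<bullet> grad \<phi> x)"
          using T1_eq v(3) by eventually_elim simp
        show "(\<lambda>x. (u x *\<^sub>R T x) \<bullet> grad \<phi> x) \<in> borel_measurable (lebesgue_on \<Omega>)"
          by (intro borel_measurable_inner borel_measurable_scaleR um TL lo_v[OF gr])
        show "(\<lambda>x. v x * (T1 x \<bullet> grad \<phi> x)) \<in> borel_measurable borel"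
          by (intro borel_measurable_times borel_measurable_inner v(1) T1 gr)
      qed (simp add: v(2))
      moreover have "signed_integral \<Omega> (div_measure \<Omega> T) f = signed_integral \<Omega> \<mu> f" for f
        by (rule signed_integral_cong_measure) (rule div_\<mu>)
      moreover have "signed_integral \<Omega> (\<lambda>A. area_measure \<Omega> u A - (LINT x|lebesgue_on A. sqrt (1 - (norm (T x))\<^sup>2))) \<phi>
         = (LINT x|lborel. s x * \<phi> x) + (LINT x|\<tau>. \<phi> x)"
      proof -
        let ?\<nu> = "\<lambda>A. area_measure \<Omega> u A - (LINT x|lebesgue_on A. sqrt (1 - (norm (T x))\<^sup>2))"
        have eq: "?\<nu> A = (LINT x:A|lborel. s x) + measure \<tau> A" if A: "A \<in> borel_of \<Omega>" for A
        proof -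
          have A': "A \<in> sets borel" "A \<subseteq> \<Omega>" using A bo by auto
          have "(LINT x|lebesgue_on A. sqrt (1 + (norm (?g x))\<^sup>2)) = (LINT x:A|lborel. s1 x)"
          proof (rule integral_lebesgue_on_version[OF _ s_meas(1) _ \<Omega>b A'])
            show "(\<lambda>x. sqrt (1 + (norm (?g x))\<^sup>2)) \<in> borel_measurable (lebesgue_on \<Omega>)" using gm by measurable
            show "AE x in lebesgue_on \<Omega>. sqrt (1 + (norm (?g x))\<^sup>2) = s1 x"
              using g1(3) AE_space by eventually_elim (simp add: s1_def)
          qed
          moreover have "(LINT x|lebesgue_on A. sqrt (1 - (norm (T x))\<^sup>2)) = (LINT x:A|lborel. s2 x)"
          proof (rule integral_lebesgue_on_version[OF _ s_meas(2) _ \<Omega>b A'])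
            show "(\<lambda>x. sqrt (1 - (norm (T x))\<^sup>2)) \<in> borel_measurable (lebesgue_on \<Omega>)" using TL by measurable
            show "AE x in lebesgue_on \<Omega>. sqrt (1 - (norm (T x))\<^sup>2) = s2 x"
              using T1_eq AE_space by eventually_elim (simp add: s2_def)
          qed
          moreover have "(LINT x:A|lborel. s x) = (LINT x:A|lborel. s1 x) - (LINT x:A|lborel. s2 x)"
            unfolding s_def using A'(1) s1_int s2_int
            by (intro set_integral_diff(2)) (simp_all add: set_integrable_def integrable_mult_indicator del: real_scaleR_def)
          ultimately show ?thesis by (simp add: area_measure_def \<tau>_eq)
        qed
        have m: "finite_vmeasure \<Omega> (measure \<tau>)" by (rule finite_vmeasure_measure[OF \<tau>(1,2)])
        have \<nu>: "finite_vmeasure \<Omega> ?\<nu>"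
          by (rule finite_vmeasure_cong[OF finite_vmeasure_add[OF finite_vmeasure_density[OF \<Omega> s_int] m]]) (simp add: eq)
        \<comment> \<open>The positive measure \<open>\<tau>\<close> is read as a signed one,
          represented by a single positive summand and an empty family of negative ones.\<close>
        have "signed_integral \<Omega> (measure \<tau>) \<phi> = (\<Sum>i\<in>{()}. LINT x|\<tau>. \<phi> x) - (\<Sum>i\<in>({}::unit set). LINT x|\<tau>. \<phi> x)"
          by (rule signed_integral_eq) (simp_all add: \<tau> m test_tv[OF m \<phi>] test_integrable_finite[OF \<phi> \<tau>(1,2)])
        then show ?thesis using ac[OF s_int \<nu> m \<phi> eq] by simp
      qed
      ultimately show ?thesis using pair[OF \<phi>] unfolding lam_pairing_def distr_div_def by simp
    qed
  qed
  have "AE x in lebesgue_on \<Omega>. s x = T1 x \<bullet> g1 x"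
    using pairing_density by (simp only: AE_lebesgue_on_iff[OF \<Omega>b])
  then show ?thesis
    using T1_eq g1(3) AE_space
  proof eventually_elim
    case (elim x)
    then have "x \<in> \<Omega>" by simp
    then have "T1 x \<bullet> g1 x = sqrt (1 + (norm (g1 x))\<^sup>2) - sqrt (1 - (norm (T1 x))\<^sup>2)"
      using elim(1) by (simp add: s_def s1_def s2_def)
    then show ?case unfolding elim(2,3) by (rule equality_case[OF T1_le])
  qed
qed

theorem theorem7p1:
  fixes \<Omega> :: "(real ^ 'n) set"
    and \<mu> :: "(real ^ 'n) set \<Rightarrow> real"
    and lam u :: "real ^ 'n \<Rightarrow> real"
    and T :: "real ^ 'n \<Rightarrow> real ^ 'n"
  assumes "bounded \<Omega>" and "open \<Omega>" and "lipschitz_boundary \<Omega>"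
    and "\<mu> \<in> MH \<Omega>" and "admissible \<Omega> \<mu>"
    and "lam \<in> borel_measurable (restrict_space borel \<Omega>)"
    and "\<forall>x \<in> \<Omega>. lam x \<in> {0..1}"
    and "u \<in> BV \<Omega>"
    and "solves_pmc \<Omega> \<mu> lam u T"
  shows "(\<forall>T'. solves_pmc \<Omega> \<mu> lam u T' \<longrightarrow> (AE x in lebesgue_on \<Omega>. T' x = T x)) \<and>
    (AE x in lebesgue_on \<Omega>.
       T x = (1 / sqrt (1 + (norm (ac_grad \<Omega> u x))\<^sup>2)) *\<^sub>R ac_grad \<Omega> u x)"
proof -
  have \<mu>: "finite_vmeasure \<Omega> \<mu>" using assms(4) by (simp add: MH_def)
  note * = solves_pmc_imp_normalized_gradient[OF assms(1,2) \<mu> assms(5-8)]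
  \<comment> \<open>The formula expresses every solution through \<open>u\<close> alone, so two
    solutions agree almost everywhere.\<close>
  have "AE x in lebesgue_on \<Omega>. T' x = T x" if "solves_pmc \<Omega> \<mu> lam u T'" for T'
    using *[OF that] *[OF assms(9)] by eventually_elim simp
  with *[OF assms(9)] show ?thesis by blast
qed

end
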